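(* Let $\Gamma$ be a metrized graph and let $\mu$ be a real-valued signed Borel measure on $\Gamma$ with $\mu(\Gamma)=1$ and $|\mu|(\Gamma)<\infty$. Given a nonzero function $f\in L^2(\Gamma)$ and a real number $\lambda>0$, the following are equivalent: (A) $f$ is an eigenfunction of $\Delta$ in $\mathrm{Dir}_\mu(\Gamma)$ with eigenvalue $\lambda$; (B) $f$ is an eigenfunction of $\varphi_\mu$ with eigenvalue $\alpha=1/\lambda$; (C) $f$ is an eigenfunction of $\Delta$ in $\mathrm{BDV}_\mu(\Gamma)$ with eigenvalue $\lambda$.
   Context: A metrized graph $\Gamma$ is a compact connected metric space such that for each $p\in\Gamma$ there are a radius $r_p>0$ and an integer $n_p\ge 1$ such that $p$ has a neighborhood isometric to the star $\{te^{2\pi i k/n_p}\in\mathbb{C}: 0\le t<r_p,\ k\in\mathbb{Z}\}$ with the path metric. $\mathrm{Vec}(p)$ is the set of $n_p$ formal unit vectors at $p$ (one for each ray of the star); $p+t\vec v$ is the point at distance $t$ from $p$ in direction $\vec v$ (small $t\ge0$), and $d_{\vec v}f(p)=\lim_{t\to0^+}(f(p+t\vec v)-f(p))/t$. $dx$ is arc-length measure; $L^2(\Gamma)=L^2(\Gamma,dx)$ with $\langle f,g\rangle=\int_\Gamma f\overline{g}\,dx$. A function $f$ is piecewise $\mathcal{C}^k$ if there is a finite set $X_f\subset\Gamma$ such that $\Gamma\setminus X_f$ is a finite union of open intervals and $f$ is $\mathcal{C}^k$ on each of them (in an isometric parametrization). Notion (A): $\mathrm{Zh}(\Gamma)$ is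 the space of continuous $f:\Gamma\to\mathbb{C}$ that are piecewise $\mathcal{C}^2$ with $f''\in L^1(\Gamma,dx)$, and $\mathrm{Zh}_\mu(\Gamma)=\{f\in\mathrm{Zh}(\Gamma):\int_\Gamma f\,d\mu=0\}$. On $\mathrm{Zh}(\Gamma)$, $\langle f,g\rangle_{\mathrm{Dir}}=\int_\Gamma f'\overline{g'}\,dx$; $\|f\|_{\mathrm{Dir}}=\langle f,f\rangle_{\mathrm{Dir}}^{1/2}$ is a norm on $\mathrm{Zh}_\mu(\Gamma)$. $\mathrm{Dir}_\mu(\Gamma)$ is the completion of $\mathrm{Zh}_\mu(\Gamma)$ for this norm; since Dirichlet-Cauchy sequences in $\mathrm{Zh}_\mu(\Gamma)$ converge uniformly, it is identified with a subspace of $\mathcal{C}(\Gamma)$ via uniform limits, and $\langle\cdot,\cdot\rangle_{\mathrm{Dir}}$ extends to it. A nonzero $f\in\mathrm{Dir}_\mu(\Gamma)$ is an eigenfunction of $\Delta$ in $\mathrm{Dir}_\mu(\Gamma)$ with eigenvalue $\lambda$ if $\langle f,g\rangle_{\mathrm{Dir}}=\lambda\langle f,g\rangle$ for all $g\in\mathrm{Dir}_\mu(\Gamma)$. Notion (B): $\mathrm{CPA}(\Gamma)$ is the space of continuous piecewise affine functions $f:\Gamma\to\mathbb{C}$; for such $f$, $\Delta f=-\sum_{p}\big(\sum_{\vec v\in\mathrm{Vec}(p)}d_{\vec v}f(p)\big)\delta_p$. For $\zeta,y\in\Gamma$, $x\mapsto j_\zeta(x,y)$ is the unique function in $\mathrm{CPA}(\Gamma)$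 with $\Delta_x j_\zeta(x,y)=\delta_y-\delta_\zeta$ and $j_\zeta(\zeta,y)=0$; it is jointly continuous in $(\zeta,x,y)$ and symmetric in $x,y$. Put $j_\mu(x,y)=\int_\Gamma j_\zeta(x,y)\,d\mu(\zeta)$; $c_\mu=\int_\Gamma j_\mu(x,y)\,d\mu(x)$ does not depend on $y$, and $g_\mu(x,y)=j_\mu(x,y)-c_\mu$. For $f\in L^2(\Gamma)$, $\varphi_\mu(f)(x)=\int_\Gamma g_\mu(x,y)f(y)\,dy$. A nonzero $f\in L^2(\Gamma)$ is an eigenfunction of $\varphi_\mu$ with eigenvalue $\alpha$ if $\varphi_\mu(f)=\alpha f$. Notion (C): $\mathcal{D}(\Gamma)$ is the set of $f:\Gamma\to\mathbb{C}$ such that $d_{\vec v}f(p)$ exists for all $p$ and all $\vec v\in\mathrm{Vec}(p)$. $\mathcal{A}$ is the Boolean algebra of subsets of $\Gamma$ generated by the connected open sets. For $S\in\mathcal{A}$, $b(S)$ is the (finite) set of points lying in the closures of both $S$ and $\Gamma\setminus S$; for $p\in b(S)$, $\mathrm{In}(p,S)$ is the set of $\vec v\in\mathrm{Vec}(p)$ with $p+t\vec v\in S$ for all sufficiently small $t>0$, and $\mathrm{Out}(p,S)=\mathrm{Vec}(p)\setminus\mathrm{In}(p,S)$. For $f\in\mathcal{D}(\Gamma)$, $m_f(S)=\sum_{b\in b(S),\,b\notin S}\sum_{\vec v\in\mathrm{In}(b,S)}d_{\vec v}f(b)-\sum_{b\in b(S),\,b\in S}\sum_{\vec v\in\mathrm{Out}(b,S)}d_{\vec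 v}f(b)$. $\mathrm{BDV}(\Gamma)$ is the set of $f\in\mathcal{D}(\Gamma)$ for which there is $B>0$ with $\sum_i|m_f(S_i)|\le B$ for every countable family of pairwise disjoint $S_i\in\mathcal{A}$. For $f\in\mathrm{BDV}(\Gamma)$, $m_f$ extends to a (unique) bounded complex Borel measure, denoted $\Delta(f)$. A nonzero $f\in\mathrm{BDV}(\Gamma)$ is an eigenfunction of $\Delta$ in $\mathrm{BDV}_\mu(\Gamma)=\{f\in\mathrm{BDV}(\Gamma):\int_\Gamma f\,d\mu=0\}$ with eigenvalue $\lambda$ if $\int_\Gamma f\,d\mu=0$ and, for some constant $C\in\mathbb{C}$, $\Delta(f)=\lambda\cdot(f(x)\,dx-C\mu)$. *)

theory Defs
  imports "HOL-Analysis.Analysis"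
begin

section \<open>Metrized graphs\<close>

definition star_set :: "nat \<Rightarrow> real \<Rightarrow> complex set" where
  "star_set n r = {of_real t * cis (2 * pi * of_int k / of_nat n) | t k. 0 \<le> t \<and> t < r}"

text \<open>The path metric of a star: points on a common ray are joined by a segment, all other
  pairs are joined through the centre 0.\<close>

definition star_dist :: "complex \<Rightarrow> complex \<Rightarrow> real" where
  "star_dist z w = (if sgn z = sgn w then cmod (z - w) else cmod z + cmod w)"

text \<open>An isometry of a star onto a neighbourhood of \<open>p\<close>; the centre of the star goes to \<open>p\<close>,
  so that \<open>n\<close> is determined by \<open>p\<close>.\<close>

definition (in metric_space) star_chart :: "'a \<Rightarrow> nat \<Rightarrow> real \<Rightarrow> (complex \<Rightarrow> 'a) \<Rightarrow> bool" where
  "star_chart p n r \<phi> \<longleftrightarrow>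
     n \<ge> 1 \<and> r > 0 \<and> \<phi> 0 = p \<and>
     (\<forall>z\<in>star_set n r. \<forall>w\<in>star_set n r. dist (\<phi> z) (\<phi> w) = star_dist z w) \<and>
     (\<exists>W. open W \<and> p \<in> W \<and> W \<subseteq> \<phi> ` star_set n r)"

class metrized_graph = metric_space +
  assumes graph_compact: "compact (UNIV :: 'a set)"
    and graph_connected: "connected (UNIV :: 'a set)"
    and graph_star: "\<exists>n r \<phi>. star_chart p n r \<phi>"

section \<open>Tangent directions and directional derivatives\<close>

definition chart_at :: "'a::metrized_graph \<Rightarrow> nat \<times> real \<times> (complex \<Rightarrow> 'a)" where
  "chart_at p = (SOME (n, r, \<phi>). star_chart p n r \<phi>)"

definition valence :: "'a::metrized_graph \<Rightarrow> nat" where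
  "valence p = fst (chart_at p)"

text \<open>A formal unit vector at \<open>p\<close> is encoded by the unit vector spanning the corresponding ray of
  the chosen star chart. Another chart only permutes these labels of the directions.\<close>

definition Vec :: "'a::metrized_graph \<Rightarrow> complex set" where
  "Vec p = {cis (2 * pi * of_int k / of_nat (valence p)) | k. True}"

definition move :: "'a::metrized_graph \<Rightarrow> complex \<Rightarrow> real \<Rightarrow> 'a" where
  "move p v t = snd (snd (chart_at p)) (of_real t * v)"

definition diff_quot :: "complex \<Rightarrow> ('a::metrized_graph \<Rightarrow> complex) \<Rightarrow> 'a \<Rightarrow> real \<Rightarrow> complex" where
  "diff_quot v f p t = (f (move p v t) - f p) / of_real t"

definition dir_deriv :: "complex \<Rightarrow> ('a::metrized_graph \<Rightarrow> complex) \<Rightarrow> 'a \<Rightarrow> complex" where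
  "dir_deriv v f p = Lim (at_right 0) (diff_quot v f p)"

section \<open>Arc-length measure and \<open>L\<^sup>2\<close>\<close>

text \<open>The unique Borel measure giving every isometrically embedded segment its Lebesgue measure.\<close>

definition arc_length :: "'a::metrized_graph measure" where
  "arc_length = (THE m. sets m = sets borel \<and>
     (\<forall>\<gamma> a b. (\<forall>s\<in>{a..b}. \<forall>t\<in>{a..b}. dist (\<gamma> s) (\<gamma> t) = \<bar>s - t\<bar>) \<longrightarrow>
        (\<forall>A\<in>sets borel. A \<subseteq> {a..b} \<longrightarrow> emeasure m (\<gamma> ` A) = emeasure lborel (A :: real set))))"

text \<open>Elements of \<open>L\<^sup>2\<close> are represented by Borel functions, equality in \<open>L\<^sup>2\<close> being equality almost
  everywhere.\<close>

definition L2 :: "('a::metrized_graph \<Rightarrow> complex) set" where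
  "L2 = {f. f \<in> borel_measurable borel \<and> integrable arc_length (\<lambda>x. (cmod (f x))\<^sup>2)}"

definition L2_inner :: "('a::metrized_graph \<Rightarrow> complex) \<Rightarrow> ('a \<Rightarrow> complex) \<Rightarrow> complex" where
  "L2_inner f g = (LINT x|arc_length. f x * cnj (g x))"

section \<open>Signed and complex Borel measures\<close>

text \<open>Real (\<open>'b = real\<close>) and complex Borel measures are set functions, of which only the values on
  Borel sets matter.\<close>

definition vector_borel_measure ::
    "('a::topological_space set \<Rightarrow> 'b::real_normed_vector) \<Rightarrow> bool" where
  "vector_borel_measure m \<longleftrightarrow>
     (\<forall>A :: nat \<Rightarrow> 'a set. range A \<subseteq> sets borel \<longrightarrow> disjoint_family A \<longrightarrow>
        (\<lambda>i. m (A i)) sums m (\<Union>i. A i))"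

definition total_variation ::
    "('a::topological_space set \<Rightarrow> 'b::real_normed_vector) \<Rightarrow> 'a set \<Rightarrow> ennreal" where
  "total_variation m E =
     (SUP A \<in> {A :: nat \<Rightarrow> 'a set. range A \<subseteq> sets borel \<and> disjoint_family A \<and> (\<Union>i. A i) = E}.
        \<Sum>i. ennreal (norm (m (A i))))"

text \<open>The positive part of the Jordan decomposition; the negative part of \<open>\<mu>\<close> is the positive
  part of \<open>- \<mu>\<close>.\<close>

definition positive_part :: "('a::topological_space set \<Rightarrow> real) \<Rightarrow> 'a measure" where
  "positive_part \<mu> =
     measure_of UNIV (sets borel) (\<lambda>E. SUP A \<in> {A \<in> sets borel. A \<subseteq> E}. ennreal (\<mu> A))"

definition signed_integral ::
    "('a::topological_space set \<Rightarrow> real) \<Rightarrow> ('a \<Rightarrow> complex) \<Rightarrow> complex" where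
  "signed_integral \<mu> f =
     (LINT x|positive_part \<mu>. f x) - (LINT x|positive_part (\<lambda>A. - \<mu> A). f x)"

section \<open>Piecewise conditions\<close>

text \<open>\<open>U\<close> is an open interval with isometric parametrization \<open>\<gamma>\<close>. Isometry is with respect to arc
  length, hence local: the metric of the graph need not restrict to the path metric of \<open>U\<close>
  (for instance on a circle minus a point).\<close>

definition interval_param ::
    "real \<Rightarrow> real \<Rightarrow> (real \<Rightarrow> 'a::metrized_graph) \<Rightarrow> 'a set \<Rightarrow> bool" where
  "interval_param a b \<gamma> U \<longleftrightarrow>
     a < b \<and> open U \<and> (\<exists>\<delta>. homeomorphism {a<..<b} U \<gamma> \<delta>) \<and>
     (\<forall>t\<in>{a<..<b}. \<exists>\<epsilon>>0. \<forall>s\<in>{a<..<b}. \<forall>s'\<in>{a<..<b}.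
        \<bar>s - t\<bar> < \<epsilon> \<longrightarrow> \<bar>s' - t\<bar> < \<epsilon> \<longrightarrow> dist (\<gamma> s) (\<gamma> s') = \<bar>s - s'\<bar>)"

definition piecewise ::
    "(real \<Rightarrow> real \<Rightarrow> (real \<Rightarrow> complex) \<Rightarrow> bool) \<Rightarrow> ('a::metrized_graph \<Rightarrow> complex) \<Rightarrow> bool" where
  "piecewise P f \<longleftrightarrow>
     (\<exists>X \<U>. finite X \<and> finite \<U> \<and> UNIV - X = \<Union>\<U> \<and>
        (\<forall>U\<in>\<U>. \<exists>a b \<gamma>. interval_param a b \<gamma> U \<and> P a b (f \<circ> \<gamma>)))"

definition C2_L1 :: "real \<Rightarrow> real \<Rightarrow> (real \<Rightarrow> complex) \<Rightarrow> bool" where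
  "C2_L1 a b h \<longleftrightarrow>
     (\<exists>h' h''. (\<forall>t\<in>{a<..<b}. (h has_vector_derivative h' t) (at t)) \<and>
        (\<forall>t\<in>{a<..<b}. (h' has_vector_derivative h'' t) (at t)) \<and>
        continuous_on {a<..<b} h'' \<and> set_integrable lborel {a<..<b} h'')"

definition affine_piece :: "real \<Rightarrow> real \<Rightarrow> (real \<Rightarrow> complex) \<Rightarrow> bool" where
  "affine_piece a b h \<longleftrightarrow> (\<exists>c d. \<forall>t\<in>{a<..<b}. h t = c + d * of_real t)"

section \<open>The Dirichlet space\<close>

text \<open>Since \<open>f''\<close> is defined off a finite set consisting of finitely many intervals, its
  integrability is that on each of the intervals.\<close>

definition Zh :: "('a::metrized_graph \<Rightarrow> complex) set" where
  "Zh = {f. continuous_on UNIV f \<and> piecewise C2_L1 f}"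

definition Zh_mu :: "('a::metrized_graph set \<Rightarrow> real) \<Rightarrow> ('a \<Rightarrow> complex) set" where
  "Zh_mu \<mu> = {f \<in> Zh. signed_integral \<mu> f = 0}"

text \<open>The integrand \<open>f' * cnj g'\<close> does not depend on the orientation. Off a finite set there are two
  opposite directions at \<open>p\<close>, both giving this value, which is therefore also the average.\<close>

definition Dir_inner :: "('a::metrized_graph \<Rightarrow> complex) \<Rightarrow> ('a \<Rightarrow> complex) \<Rightarrow> complex" where
  "Dir_inner f g =
     (LINT p|arc_length.
        (\<Sum>v\<in>Vec p. dir_deriv v f p * cnj (dir_deriv v g p)) / of_nat (card (Vec p)))"

definition Dir_norm :: "('a::metrized_graph \<Rightarrow> complex) \<Rightarrow> real" where
  "Dir_norm f = sqrt (Re (Dir_inner f f))"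

definition Dir_approx ::
    "('a::metrized_graph set \<Rightarrow> real) \<Rightarrow> (nat \<Rightarrow> 'a \<Rightarrow> complex) \<Rightarrow> ('a \<Rightarrow> complex) \<Rightarrow> bool" where
  "Dir_approx \<mu> s f \<longleftrightarrow>
     (\<forall>n. s n \<in> Zh_mu \<mu>) \<and>
     (\<forall>e>0. \<exists>N. \<forall>m\<ge>N. \<forall>n\<ge>N. Dir_norm (\<lambda>x. s m x - s n x) < e) \<and>
     uniform_limit UNIV s f sequentially"

text \<open>The completion of \<open>Zh_mu \<mu>\<close> as a space of continuous functions, and the extension of the
  inner product to it.\<close>

definition Dir_mu :: "('a::metrized_graph set \<Rightarrow> real) \<Rightarrow> ('a \<Rightarrow> complex) set" where
  "Dir_mu \<mu> = {f. \<exists>s. Dir_approx \<mu> s f}"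

definition Dir_mu_inner ::
    "('a::metrized_graph set \<Rightarrow> real) \<Rightarrow> ('a \<Rightarrow> complex) \<Rightarrow> ('a \<Rightarrow> complex) \<Rightarrow> complex" where
  "Dir_mu_inner \<mu> f g =
     (THE c. \<forall>s u. Dir_approx \<mu> s f \<longrightarrow> Dir_approx \<mu> u g \<longrightarrow>
        (\<lambda>n. Dir_inner (s n) (u n)) \<longlonglongrightarrow> c)"

definition Dir_eigenfunction ::
    "('a::metrized_graph set \<Rightarrow> real) \<Rightarrow> ('a \<Rightarrow> complex) \<Rightarrow> real \<Rightarrow> bool" where
  "Dir_eigenfunction \<mu> f lam \<longleftrightarrow>
     f \<in> Dir_mu \<mu> \<and> f \<noteq> (\<lambda>x. 0) \<and>
     (\<forall>g\<in>Dir_mu \<mu>. Dir_mu_inner \<mu> f g = of_real lam * L2_inner f g)"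

section \<open>The integral operator\<close>

definition CPA :: "('a::metrized_graph \<Rightarrow> complex) set" where
  "CPA = {f. continuous_on UNIV f \<and> piecewise affine_piece f}"

definition slope_sum :: "('a::metrized_graph \<Rightarrow> complex) \<Rightarrow> 'a \<Rightarrow> complex" where
  "slope_sum f p = (\<Sum>v\<in>Vec p. dir_deriv v f p)"

text \<open>The value on \<open>E\<close> of the discrete measure \<open>\<Delta> f\<close>; for \<open>f \<in> CPA\<close> only finitely many slope sums
  are nonzero.\<close>

definition CPA_laplacian :: "('a::metrized_graph \<Rightarrow> complex) \<Rightarrow> 'a set \<Rightarrow> complex" where
  "CPA_laplacian f E = - (\<Sum>p\<in>{p\<in>E. slope_sum f p \<noteq> 0}. slope_sum f p)"

definition j_fun :: "'a::metrized_graph \<Rightarrow> 'a \<Rightarrow> 'a \<Rightarrow> complex" where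
  "j_fun \<zeta> x y =
     (THE h. h \<in> CPA \<and>
        (\<forall>E\<in>sets borel. CPA_laplacian h E = indicator E y - indicator E \<zeta>) \<and> h \<zeta> = 0) x"

definition j_mu :: "('a::metrized_graph set \<Rightarrow> real) \<Rightarrow> 'a \<Rightarrow> 'a \<Rightarrow> complex" where
  "j_mu \<mu> x y = signed_integral \<mu> (\<lambda>\<zeta>. j_fun \<zeta> x y)"

definition c_mu :: "('a::metrized_graph set \<Rightarrow> real) \<Rightarrow> complex" where
  "c_mu \<mu> = (THE c. \<forall>y. signed_integral \<mu> (\<lambda>x. j_mu \<mu> x y) = c)"

definition g_mu :: "('a::metrized_graph set \<Rightarrow> real) \<Rightarrow> 'a \<Rightarrow> 'a \<Rightarrow> complex" where
  "g_mu \<mu> x y = j_mu \<mu> x y - c_mu \<mu>"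

definition phi_mu :: "('a::metrized_graph set \<Rightarrow> real) \<Rightarrow> ('a \<Rightarrow> complex) \<Rightarrow> 'a \<Rightarrow> complex" where
  "phi_mu \<mu> f x = (LINT y|arc_length. g_mu \<mu> x y * f y)"

definition phi_eigenfunction ::
    "('a::metrized_graph set \<Rightarrow> real) \<Rightarrow> ('a \<Rightarrow> complex) \<Rightarrow> real \<Rightarrow> bool" where
  "phi_eigenfunction \<mu> f \<alpha> \<longleftrightarrow>
     f \<in> L2 \<and> \<not> (AE x in arc_length. f x = 0) \<and>
     (AE x in arc_length. phi_mu \<mu> f x = of_real \<alpha> * f x)"

section \<open>Functions of bounded differential variation\<close>

definition D_fun :: "('a::metrized_graph \<Rightarrow> complex) set" where
  "D_fun = {f. \<forall>p. \<forall>v\<in>Vec p. \<exists>d. (diff_quot v f p \<longlongrightarrow> d) (at_right 0)}"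

definition conn_algebra :: "'a::metrized_graph set set" where
  "conn_algebra = \<Inter>{M. algebra UNIV M \<and> {U. open U \<and> connected U} \<subseteq> M}"

text \<open>The boundary \<open>b(S)\<close> is \<open>frontier S\<close>, cf. \<open>frontier_closures\<close>.\<close>

definition In_dirs :: "'a::metrized_graph \<Rightarrow> 'a set \<Rightarrow> complex set" where
  "In_dirs p S = {v\<in>Vec p. eventually (\<lambda>t. move p v t \<in> S) (at_right 0)}"

definition Out_dirs :: "'a::metrized_graph \<Rightarrow> 'a set \<Rightarrow> complex set" where
  "Out_dirs p S = Vec p - In_dirs p S"

definition m_set :: "('a::metrized_graph \<Rightarrow> complex) \<Rightarrow> 'a set \<Rightarrow> complex" where
  "m_set f S =
     (\<Sum>b\<in>frontier S - S. \<Sum>v\<in>In_dirs b S. dir_deriv v f b) -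
     (\<Sum>b\<in>frontier S \<inter> S. \<Sum>v\<in>Out_dirs b S. dir_deriv v f b)"

text \<open>Finite families are covered by sequences, the remaining members being empty.\<close>

definition BDV :: "('a::metrized_graph \<Rightarrow> complex) set" where
  "BDV = {f\<in>D_fun. \<exists>B>0. \<forall>S :: nat \<Rightarrow> 'a set. range S \<subseteq> conn_algebra \<longrightarrow> disjoint_family S \<longrightarrow>
            (\<Sum>i. ennreal (cmod (m_set f (S i)))) \<le> ennreal B}"

text \<open>\<open>\<Delta>(f) = \<nu>\<close>, where \<open>\<Delta>(f)\<close> is the bounded complex Borel measure extending \<open>m_set f\<close>. It is
  a relation because set functions are compared on Borel sets only; \<open>\<nu>\<close> is unique there.\<close>

definition has_BDV_laplacian ::
    "('a::metrized_graph \<Rightarrow> complex) \<Rightarrow> ('a set \<Rightarrow> complex) \<Rightarrow> bool" where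
  "has_BDV_laplacian f \<nu> \<longleftrightarrow>
     vector_borel_measure \<nu> \<and> total_variation \<nu> UNIV < \<infinity> \<and>
     (\<forall>S\<in>conn_algebra. \<nu> S = m_set f S)"

definition BDV_eigenfunction ::
    "('a::metrized_graph set \<Rightarrow> real) \<Rightarrow> ('a \<Rightarrow> complex) \<Rightarrow> real \<Rightarrow> bool" where
  "BDV_eigenfunction \<mu> f lam \<longleftrightarrow>
     f \<in> BDV \<and> f \<noteq> (\<lambda>x. 0) \<and> signed_integral \<mu> f = 0 \<and>
     (\<exists>C. has_BDV_laplacian f
        (\<lambda>E. of_real lam * ((LINT x:E|arc_length. f x) - C * of_real (\<mu> E))))"

end

theory Submission
  imports Defs "HOL-Real_Asymp.Real_Asymp"
begin

text \<open>
  For \<open>f\<close> and \<open>\<lambda>\<close> as in the theorem let \<open>\<nu> = \<lambda> (f dx - (\<integral>f dx) \<mu>)\<close>, a complex measure of total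
  mass \<open>0\<close>, and \<open>h = \<lambda> \<phi>\<^sub>\<mu>(f)\<close>. Condition (B) says that \<open>h = f\<close> almost everywhere. The proof
  shows that (A) and (C) say the same, because \<open>h\<close> is the solution of the eigenvalue equation
  with \<open>f\<close> inserted on the right-hand side, in the weak sense as well as in the sense of
  measures, and because this solution is unique.

  Let \<open>ker z y\<close> be the Green kernel, the continuous piecewise affine function that vanishes at
  \<open>z\<close> and has Laplacian \<open>\<delta>\<^sub>y - \<delta>\<^sub>z\<close>. By Green's formula it reproduces values: the Dirichlet
  product of \<open>\<phi>\<close> with \<open>ker z y\<close> is \<open>\<phi> y - \<phi> z\<close> (\<open>ker_reproducing\<close>). It is symmetric, and it is
  Lipschitz with constant \<open>1\<close> (\<open>ker_edge_slope\<close>). By the change of base point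
  (\<open>ker_change_base\<close>), \<open>g\<^sub>\<mu>\<close> is this kernel with a correction in each variable separately
  (\<open>g_mu_formula\<close>), so that \<open>h\<close> is the potential \<open>x \<mapsto> \<integral>ker z y x d\<nu>(y)\<close> plus the constant for
  which \<open>\<integral>h d\<mu> = 0\<close> (\<open>h_pot'\<close>).

  (A) and (B). Discretizing \<open>\<nu>\<close> gives piecewise affine functions that converge to \<open>h\<close> uniformly
  and in the Dirichlet norm, and the reproducing property yields \<open>\<langle>h, g\<rangle>\<^sub>D\<^sub>i\<^sub>r = \<lambda> \<langle>f, g\<rangle>\<close> for
  all \<open>g\<close> in \<open>Dir_mu\<close> (\<open>pot_approx\<close>, \<open>h_approx\<close>). If \<open>h = f\<close> almost everywhere this is the
  eigenvalue equation for \<open>h\<close>. Conversely an eigenfunction equal to \<open>f\<close> almost everywhere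
  satisfies the same equation as \<open>h\<close>; the difference has energy \<open>0\<close> and \<open>\<mu>\<close>-integral \<open>0\<close>, so it
  vanishes (\<open>Dir_approx_energy_zero\<close>). That the inner product of the completion is determined by
  uniform limits is the closability of the Dirichlet form (\<open>Dir_approx_null\<close>), a consequence of
  integration by parts.

  (B) and (C). Differentiating under the integral, where the Lipschitz bound justifies dominated
  convergence, one gets \<open>m_set h S = \<nu>(S)\<close> for \<open>S\<close> in the algebra generated by the connected
  open sets (\<open>pot_m_set\<close>, \<open>h_m_set\<close>), because \<open>m_set (ker z y) S\<close> is \<open>1\<close>, \<open>-1\<close> or \<open>0\<close> according
  to how \<open>S\<close> separates \<open>y\<close> from \<open>z\<close> (\<open>m_set_ker\<close>). So \<open>\<Delta>(h) = \<nu>\<close>. Conversely, an eigenfunction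
  equal to \<open>f\<close> almost everywhere has Laplacian \<open>\<nu>\<close> too: the constant \<open>C\<close> must be \<open>\<integral>f dx\<close>, since
  the total mass of a Laplacian is \<open>0\<close>. The difference to \<open>h\<close> has Laplacian \<open>0\<close> and is constant
  by the maximum principle (\<open>harmonic_constant\<close>), and the constant is \<open>0\<close> by integration against
  \<open>\<mu>\<close>.

  Everything is computed on finite subdivisions of the graph into isometric edges
  (\<open>subdivision_exists\<close>). Since connected open sets have finite frontier
  (\<open>connected_open_finite_frontier\<close>), finitely many piecewise functions and sets of the algebra
  can always be described on the edges of a common subdivision.
\<close>

section \<open>Star neighbourhoods\<close>

lemma Vec_unit: "v \<in> Vec p \<Longrightarrow> cmod v = 1"
  by (auto simp: Vec_def)

lemma chart_at_star_chart:
  fixes p :: "'a::metrized_graph"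
  shows "star_chart p (valence p) (fst (snd (chart_at p))) (snd (snd (chart_at p)))"
proof -
  obtain n r \<phi> where "star_chart p n r \<phi>" using graph_star by blast
  then have "\<exists>c. case c of (n, r, \<phi>) \<Rightarrow> star_chart p n r \<phi>" by auto
  then have "case chart_at p of (n, r, \<phi>) \<Rightarrow> star_chart p n r \<phi>"
    unfolding chart_at_def by (rule someI_ex)
  then show ?thesis by (simp add: valence_def case_prod_beta)
qed

lemma valence_pos: "valence (p::'a::metrized_graph) \<ge> 1"
  using chart_at_star_chart[of p] by (simp add: star_chart_def)

lemma finite_Vec: "finite (Vec (p::'a::metrized_graph))"
proof (rule finite_subset)
  have n: "real (valence p) \<noteq> 0" using valence_pos[of p] by simp
  show "Vec p \<subseteq> {z::complex. z ^ valence p = 1}"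
  proof
    fix v assume "v \<in> Vec p"
    then obtain k where k: "v = cis (2 * pi * of_int k / of_nat (valence p))" by (auto simp: Vec_def)
    have "v ^ valence p = cis (real (valence p) * (2 * pi * of_int k / of_nat (valence p)))"
      by (subst k) (rule Complex.DeMoivre)
    also have "real (valence p) * (2 * pi * of_int k / of_nat (valence p)) = 2 * pi * of_int k"
      using n by simp
    also have "cis \<dots> = 1" by simp
    finally show "v \<in> {z. z ^ valence p = 1}" by simp
  qed
  show "finite {z::complex. z ^ valence p = 1}"
    using valence_pos[of p] by (intro finite_roots_unity) auto
qed

text \<open>A radius up to which the chosen chart at \<open>p\<close> is an isometry and its rays fill the metric
  ball. Such balls replace the charts in all later arguments.\<close>

definition star_radius :: "'a::metrized_graph \<Rightarrow> real \<Rightarrow> bool" where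
  "star_radius p \<rho> \<longleftrightarrow> \<rho> > 0 \<and> move p 0 0 = p \<and>
     (\<forall>v\<in>Vec p. \<forall>w\<in>Vec p. \<forall>s\<in>{0..<\<rho>}. \<forall>t\<in>{0..<\<rho>}.
        dist (move p v s) (move p w t) = (if v = w then \<bar>s - t\<bar> else s + t)) \<and>
     ball p \<rho> = {move p v t | v t. v \<in> Vec p \<and> 0 \<le> t \<and> t < \<rho>}"

lemma move_0 [simp]: "move p v 0 = (p::'a::metrized_graph)"
  using chart_at_star_chart[of p] by (simp add: star_chart_def move_def)

lemma star_dist_rays:
  assumes "cmod v = 1" "cmod w = 1" "s \<ge> 0" "t \<ge> 0"
  shows "star_dist (of_real s * v) (of_real t * w) = (if v = w then \<bar>s - t\<bar> else s + t)"
proof -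
  have v: "v \<noteq> 0" and w: "w \<noteq> 0" using assms by auto
  have sv: "sgn (of_real s * v) = (if s = 0 then 0 else v)"
    using assms(1,3) by (auto simp: sgn_mult sgn_eq[of v] sgn_of_real)
  have tw: "sgn (of_real t * w) = (if t = 0 then 0 else w)"
    using assms(2,4) by (auto simp: sgn_mult sgn_eq[of w] sgn_of_real)
  have "cmod (of_real s * v - of_real t * v) = \<bar>s - t\<bar>"
    by (metis assms(1) left_diff_distrib mult.right_neutral norm_mult norm_of_real of_real_diff)
  then show ?thesis
    using assms v w unfolding star_dist_def sv tw by (auto simp: norm_mult)
qed

text \<open>The chart covers a neighbourhood of \<open>p\<close>; inside a ball contained in it, the distance to
  \<open>p\<close> is the parameter along the ray, so that smaller balls are smaller stars.\<close>

lemma star_radius_exists: "\<exists>\<rho>>0. star_radius (p::'a::metrized_graph) \<rho>"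
proof -
  define n where "n = valence p"
  define r where "r = fst (snd (chart_at p))"
  define \<phi> where "\<phi> = snd (snd (chart_at p))"
  have ch: "star_chart p n r \<phi>" using chart_at_star_chart[of p] by (simp add: n_def r_def \<phi>_def)
  have mv: "move p v t = \<phi> (of_real t * v)" for v t by (simp add: move_def \<phi>_def)
  obtain W where W: "open W" "p \<in> W" "W \<subseteq> \<phi> ` star_set n r" using ch by (auto simp: star_chart_def)
  obtain e where e: "e > 0" "ball p e \<subseteq> W" using W open_contains_ball by blast
  define \<rho> where "\<rho> = min e r"
  have \<rho>: "\<rho> > 0" using e ch by (auto simp: \<rho>_def star_chart_def)
  have iso: "dist (\<phi> z) (\<phi> w) = star_dist z w" if "z \<in> star_set n r" "w \<in> star_set n r" for z w
    using that ch by (auto simp: star_chart_def)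
  have in_star: "of_real t * v \<in> star_set n r" if "v \<in> Vec p" "0 \<le> t" "t < r" for v t
    using that by (auto simp: star_set_def Vec_def n_def)
  have d: "dist (move p v s) (move p w t) = (if v = w then \<bar>s - t\<bar> else s + t)"
    if "v \<in> Vec p" "w \<in> Vec p" "s \<in> {0..<r}" "t \<in> {0..<r}" for v w s t
    using that by (simp add: mv iso in_star star_dist_rays Vec_unit)
  have "ball p \<rho> = {move p v t | v t. v \<in> Vec p \<and> 0 \<le> t \<and> t < \<rho>}"
  proof (intro equalityI subsetI)
    fix y assume y: "y \<in> ball p \<rho>"
    then have "y \<in> W" using e by (auto simp: \<rho>_def)
    then obtain z where z: "y = \<phi> z" "z \<in> star_set n r" using W by auto
    then obtain t k where tk: "z = of_real t * cis (2 * pi * of_int k / of_nat n)" "0 \<le> t" "t < r"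
      by (auto simp: star_set_def)
    define v where "v = cis (2 * pi * of_int k / of_nat n)"
    have v: "v \<in> Vec p" by (auto simp: v_def Vec_def n_def)
    have "dist (move p v 0) (move p v t) = t" using d[OF v v, of 0 t] tk by auto
    moreover have "y = move p v t" using z tk by (simp add: mv v_def)
    ultimately show "y \<in> {move p v t | v t. v \<in> Vec p \<and> 0 \<le> t \<and> t < \<rho>}" using y v tk by auto
  next
    fix y assume "y \<in> {move p v t | v t. v \<in> Vec p \<and> 0 \<le> t \<and> t < \<rho>}"
    then obtain v t where vt: "y = move p v t" "v \<in> Vec p" "0 \<le> t" "t < \<rho>" by auto
    then have "dist (move p v 0) (move p v t) = t" using d[of v v 0 t] by (auto simp: \<rho>_def)
    then show "y \<in> ball p \<rho>" using vt by simp
  qed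
  then show ?thesis using \<rho> d by (intro exI[of _ \<rho>]) (auto simp: star_radius_def \<rho>_def)
qed

lemma star_radius_dist:
  assumes "star_radius p \<rho>" "v \<in> Vec p" "w \<in> Vec p" "0 \<le> s" "s < \<rho>" "0 \<le> t" "t < \<rho>"
  shows "dist (move p v s) (move p w t) = (if v = w then \<bar>s - t\<bar> else s + t)"
  using assms by (simp add: star_radius_def)

lemma star_radius_dist0:
  assumes "star_radius p \<rho>" "w \<in> Vec p" "0 \<le> t" "t < \<rho>"
  shows "dist p (move p w t) = t"
  using star_radius_dist[OF assms(1,2,2), of 0 t] assms by auto

lemma star_radius_mono:
  assumes "star_radius p \<rho>" "0 < \<sigma>" "\<sigma> \<le> \<rho>"
  shows "star_radius p \<sigma>"
proof -
  have d: "dist p (move p v t) = t" if "v \<in> Vec p" "0 \<le> t" "t < \<rho>" for v t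
    using star_radius_dist0[OF assms(1) that] .
  have b: "ball p \<rho> = {move p v t | v t. v \<in> Vec p \<and> 0 \<le> t \<and> t < \<rho>}"
    using assms by (simp add: star_radius_def)
  have "ball p \<sigma> = {move p v t | v t. v \<in> Vec p \<and> 0 \<le> t \<and> t < \<sigma>}"
  proof (intro equalityI subsetI)
    fix y assume y: "y \<in> ball p \<sigma>"
    then have "y \<in> ball p \<rho>" using assms by auto
    then obtain v t where "y = move p v t" "v \<in> Vec p" "0 \<le> t" "t < \<rho>" using b by auto
    with y d show "y \<in> {move p v t | v t. v \<in> Vec p \<and> 0 \<le> t \<and> t < \<sigma>}" by auto
  next
    fix y assume "y \<in> {move p v t | v t. v \<in> Vec p \<and> 0 \<le> t \<and> t < \<sigma>}"
    with d assms show "y \<in> ball p \<sigma>" by auto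
  qed
  then show ?thesis using assms unfolding star_radius_def by auto
qed

lemma star_radius_inj:
  assumes "star_radius p \<rho>" "v \<in> Vec p" "w \<in> Vec p" "0 < s" "s < \<rho>" "0 \<le> t" "t < \<rho>"
    "move p v s = move p w t"
  shows "v = w \<and> s = t"
  using star_radius_dist[OF assms(1,2,3), of s t] assms by (auto split: if_splits)

lemma star_radius_ball:
  assumes "star_radius p \<rho>" "y \<in> ball p \<rho>"
  obtains v t where "v \<in> Vec p" "0 \<le> t" "t < \<rho>" "y = move p v t"
  using assms by (auto simp: star_radius_def)

section \<open>Isometric arcs and the directions in which they leave\<close>

definition isom_arc :: "(real \<Rightarrow> 'a::metric_space) \<Rightarrow> real \<Rightarrow> bool" where
  "isom_arc \<gamma> l \<longleftrightarrow> 0 < l \<and> (\<forall>s\<in>{0..l}. \<forall>t\<in>{0..l}. dist (\<gamma> s) (\<gamma> t) = \<bar>s - t\<bar>)"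

lemma isom_arc_dist: "isom_arc \<gamma> l \<Longrightarrow> 0 \<le> s \<Longrightarrow> s \<le> l \<Longrightarrow> 0 \<le> t \<Longrightarrow> t \<le> l \<Longrightarrow> dist (\<gamma> s) (\<gamma> t) = \<bar>s - t\<bar>"
  by (auto simp: isom_arc_def)

lemma isom_arcI:
  "0 < l \<Longrightarrow> (\<And>s t. 0 \<le> s \<Longrightarrow> s \<le> l \<Longrightarrow> 0 \<le> t \<Longrightarrow> t \<le> l \<Longrightarrow> dist (\<gamma> s) (\<gamma> t) = \<bar>s - t\<bar>) \<Longrightarrow> isom_arc \<gamma> l"
  by (auto simp: isom_arc_def)

lemma isom_arc_pos: "isom_arc \<gamma> l \<Longrightarrow> 0 < l" by (auto simp: isom_arc_def)

lemma isom_arc_inj: "isom_arc \<gamma> l \<Longrightarrow> inj_on \<gamma> {0..l}"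
proof (rule inj_onI)
  fix s t assume *: "isom_arc \<gamma> l" "s \<in> {0..l}" "t \<in> {0..l}" "\<gamma> s = \<gamma> t"
  then have "dist (\<gamma> s) (\<gamma> t) = \<bar>s - t\<bar>" unfolding isom_arc_def by blast
  moreover have "dist (\<gamma> s) (\<gamma> t) = 0" using *(4) by simp
  ultimately show "s = t" by linarith
qed

lemma isom_arc_eq_iff: "isom_arc \<gamma> l \<Longrightarrow> 0 \<le> s \<Longrightarrow> s \<le> l \<Longrightarrow> 0 \<le> t \<Longrightarrow> t \<le> l \<Longrightarrow> \<gamma> s = \<gamma> t \<longleftrightarrow> s = t"
  using inj_on_eq_iff[OF isom_arc_inj[of \<gamma> l], of s t] by simp

lemma isom_arc_continuous: "isom_arc \<gamma> l \<Longrightarrow> continuous_on {0..l} \<gamma>"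
  unfolding continuous_on_iff dist_real_def
  by (metis atLeastAtMost_iff isom_arc_dist)

lemma isom_arc_sub: "isom_arc \<gamma> l \<Longrightarrow> 0 \<le> s \<Longrightarrow> 0 < m \<Longrightarrow> s + m \<le> l \<Longrightarrow> isom_arc (\<lambda>t. \<gamma> (s + t)) m"
  by (intro isom_arcI) (auto simp: isom_arc_dist)

lemma isom_arc_rev: "isom_arc \<gamma> l \<Longrightarrow> isom_arc (\<lambda>t. \<gamma> (l - t)) l"
  by (intro isom_arcI) (auto simp: isom_arc_dist isom_arc_pos)

lemma isom_arc_rev_sub: "isom_arc \<gamma> l \<Longrightarrow> s \<le> l \<Longrightarrow> 0 < m \<Longrightarrow> m \<le> s \<Longrightarrow> isom_arc (\<lambda>t. \<gamma> (s - t)) m"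
  by (intro isom_arcI) (auto simp: isom_arc_dist)

lemma star_radius_isom_arc:
  assumes "star_radius p \<rho>" "v \<in> Vec p" "0 < l" "l < \<rho>"
  shows "isom_arc (move p v) l"
  using assms star_radius_dist[OF assms(1,2,2)] by (intro isom_arcI) auto

text \<open>Formal unit vectors are labels of the rays of one chosen chart. An arc gets such a label
  through the ray that it follows near its starting point, which turns \<^const>\<open>dir_deriv\<close> into a
  one-sided derivative along the arc.\<close>

definition leaves :: "(real \<Rightarrow> 'a::metrized_graph) \<Rightarrow> complex \<Rightarrow> bool" where
  "leaves \<gamma> v \<longleftrightarrow> v \<in> Vec (\<gamma> 0) \<and> (\<exists>\<epsilon>>0. \<forall>t. 0 \<le> t \<and> t < \<epsilon> \<longrightarrow> move (\<gamma> 0) v t = \<gamma> t)"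

text \<open>Each point of the arc lies on some ray, at the parameter given by its distance from the
  start. Two points on different rays would be separated by the sum of their parameters, whereas
  on an isometric arc they are separated by the difference; so the ray does not change.\<close>

lemma leaves_exists:
  assumes "isom_arc \<gamma> l"
  shows "\<exists>v. leaves \<gamma> v"
proof -
  obtain \<rho> where \<rho>: "star_radius (\<gamma> 0) \<rho>" "\<rho> > 0" using star_radius_exists by blast
  define \<epsilon> where "\<epsilon> = min \<rho> l"
  have e: "\<epsilon> > 0" using \<rho> isom_arc_pos[OF assms] by (simp add: \<epsilon>_def)
  have *: "\<exists>v\<in>Vec (\<gamma> 0). \<gamma> t = move (\<gamma> 0) v t" if "0 \<le> t" "t < \<epsilon>" for t
  proof -
    have d: "dist (\<gamma> 0) (\<gamma> t) = t" using isom_arc_dist[OF assms, of 0 t] that by (auto simp: \<epsilon>_def)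
    then have "\<gamma> t \<in> ball (\<gamma> 0) \<rho>" using that by (auto simp: \<epsilon>_def)
    then obtain v s where vs: "v \<in> Vec (\<gamma> 0)" "0 \<le> s" "s < \<rho>" "\<gamma> t = move (\<gamma> 0) v s"
      using star_radius_ball[OF \<rho>(1)] by metis
    then have "s = t" using star_radius_dist0[OF \<rho>(1) vs(1-3)] d by simp
    then show ?thesis using vs by auto
  qed
  obtain v where v: "v \<in> Vec (\<gamma> 0)" "\<gamma> (\<epsilon>/2) = move (\<gamma> 0) v (\<epsilon>/2)" using *[of "\<epsilon>/2"] e by auto
  have "move (\<gamma> 0) v t = \<gamma> t" if t: "0 \<le> t" "t < \<epsilon>" for t
  proof (cases "t = 0")
    case False
    then have t0: "t > 0" using t by simp
    obtain w where w: "w \<in> Vec (\<gamma> 0)" "\<gamma> t = move (\<gamma> 0) w t" using *[OF t] by auto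
    have "dist (\<gamma> t) (\<gamma> (\<epsilon>/2)) = \<bar>t - \<epsilon>/2\<bar>" using isom_arc_dist[OF assms, of t "\<epsilon>/2"] t e by (auto simp: \<epsilon>_def)
    moreover have "dist (\<gamma> t) (\<gamma> (\<epsilon>/2)) = (if w = v then \<bar>t - \<epsilon>/2\<bar> else t + \<epsilon>/2)"
      using star_radius_dist[OF \<rho>(1) w(1) v(1), of t "\<epsilon>/2"] w v t e by (auto simp: \<epsilon>_def)
    ultimately have "w = v" using t0 e by (auto split: if_splits)
    then show ?thesis using w by simp
  qed simp
  then show ?thesis using v e unfolding leaves_def by blast
qed

lemma leaves_eventually:
  assumes "leaves \<gamma> v"
  shows "eventually (\<lambda>t. move (\<gamma> 0) v t = \<gamma> t) (at_right 0)"
  using assms unfolding leaves_def eventually_at_right_field by (meson less_eq_real_def)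

lemma leaves_in_Vec: "leaves \<gamma> v \<Longrightarrow> v \<in> Vec (\<gamma> 0)"
  by (simp add: leaves_def)

definition init_dir :: "(real \<Rightarrow> 'a::metrized_graph) \<Rightarrow> complex" where
  "init_dir \<gamma> = (SOME v. leaves \<gamma> v)"

lemma leaves_init_dir: "isom_arc \<gamma> l \<Longrightarrow> leaves \<gamma> (init_dir \<gamma>)"
  unfolding init_dir_def using leaves_exists by (metis someI_ex)

lemma init_dir_in_Vec: "isom_arc \<gamma> l \<Longrightarrow> init_dir \<gamma> \<in> Vec (\<gamma> 0)"
  using leaves_init_dir leaves_in_Vec by blast

lemma diff_quot_along:
  assumes "leaves \<gamma> v"
  shows "(diff_quot v f (\<gamma> 0) \<longlongrightarrow> d) (at_right 0) \<longleftrightarrow>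
         ((\<lambda>t. (f (\<gamma> t) - f (\<gamma> 0)) / of_real t) \<longlongrightarrow> d) (at_right 0)"
  using leaves_eventually[OF assms]
  by (intro tendsto_cong) (auto simp: diff_quot_def elim!: eventually_mono)

lemma dir_deriv_eqI:
  assumes "(diff_quot v f p \<longlongrightarrow> d) (at_right 0)"
  shows "dir_deriv v f p = d"
  unfolding dir_deriv_def using assms by (intro tendsto_Lim) auto

lemma has_vector_derivative_at_right_iff:
  fixes h :: "real \<Rightarrow> complex"
  shows "(h has_vector_derivative d) (at_right x) \<longleftrightarrow>
         ((\<lambda>t. (h (x + t) - h x) / of_real t) \<longlongrightarrow> d) (at_right 0)"
proof -
  have "(h has_vector_derivative d) (at_right x) \<longleftrightarrow>
        ((\<lambda>y. ((h y - h x) - (y - x) *\<^sub>R d) /\<^sub>R norm (y - x)) \<longlongrightarrow> 0) (at_right x)"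
    by (simp add: has_vector_derivative_def has_derivative_at_within bounded_linear_scaleR_left)
  also have "\<dots> \<longleftrightarrow> ((\<lambda>t. ((h (x + t) - h x) - t *\<^sub>R d) /\<^sub>R norm t) \<longlongrightarrow> 0) (at_right 0)"
    by (subst filterlim_at_right_to_0) (simp add: add.commute)
  also have "\<dots> \<longleftrightarrow> ((\<lambda>t. (h (x + t) - h x) / of_real t - d) \<longlongrightarrow> 0) (at_right 0)"
  proof (rule tendsto_cong)
    have "eventually (\<lambda>t::real. 0 < t) (at_right 0)" by (simp add: eventually_at_right_less)
    then show "eventually (\<lambda>t. ((h (x + t) - h x) - t *\<^sub>R d) /\<^sub>R norm t = (h (x + t) - h x) / of_real t - d)
        (at_right 0)"
      by eventually_elim (simp add: scaleR_conv_of_real field_simps)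
  qed
  also have "\<dots> \<longleftrightarrow> ((\<lambda>t. (h (x + t) - h x) / of_real t) \<longlongrightarrow> d) (at_right 0)"
    by (rule Lim_null[symmetric])
  finally show ?thesis .
qed

lemma dir_deriv_init:
  assumes "isom_arc \<gamma> l"
  shows "(diff_quot (init_dir \<gamma>) f (\<gamma> 0) \<longlongrightarrow> d) (at_right 0) \<longleftrightarrow>
         (f \<circ> \<gamma> has_vector_derivative d) (at_right 0)"
  using diff_quot_along[OF leaves_init_dir[OF assms]]
  by (simp add: has_vector_derivative_at_right_iff)

section \<open>Subdivisions into isometric edges\<close>

abbreviation open_edge :: "(real \<Rightarrow> 'a) \<times> real \<Rightarrow> 'a set" where
  "open_edge e \<equiv> fst e ` {0<..<snd e}"

text \<open>Within a star, one gets from a ray to another only through the centre, so the points near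
  a point of an open ray are on the same ray.\<close>

lemma star_radius_open_ray:
  assumes "star_radius p \<rho>" "v \<in> Vec p" "0 \<le> a" "b \<le> \<rho>"
  shows "open (move p v ` {a<..<b})"
  unfolding open_contains_ball
proof safe
  fix t assume t: "t \<in> {a<..<b}"
  define \<delta> where "\<delta> = min (t - a) (b - t)"
  have \<delta>: "\<delta> > 0" "\<delta> \<le> t - a" "\<delta> \<le> b - t" using t by (auto simp: \<delta>_def)
  have "ball (move p v t) \<delta> \<subseteq> move p v ` {a<..<b}"
  proof
    fix y assume y: "y \<in> ball (move p v t) \<delta>"
    have pt: "dist p (move p v t) = t" using star_radius_dist0[OF assms(1,2)] t assms by auto
    have "dist p y \<le> dist p (move p v t) + dist (move p v t) y" by (rule dist_triangle)
    then have "y \<in> ball p \<rho>" using y pt \<delta> assms by auto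
    then obtain w s where ws: "w \<in> Vec p" "0 \<le> s" "s < \<rho>" "y = move p w s"
      using star_radius_ball[OF assms(1)] by metis
    have d: "dist (move p v t) y = (if v = w then \<bar>t - s\<bar> else t + s)"
      using star_radius_dist[OF assms(1,2) ws(1), of t s] ws t assms by auto
    then have "v = w" using y \<delta> t assms ws by (auto split: if_splits)
    with d y \<delta> have "a < s \<and> s < b" by auto
    then show "y \<in> move p v ` {a<..<b}" using ws \<open>v = w\<close> by auto
  qed
  then show "\<exists>e>0. ball (move p v t) e \<subseteq> move p v ` {a<..<b}" using \<delta> by blast
qed

lemma isom_arc_closed_image: "isom_arc \<gamma> l \<Longrightarrow> \<gamma> ` {0..l} = insert (\<gamma> 0) (insert (\<gamma> l) (\<gamma> ` {0<..<l}))"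
proof -
  assume "isom_arc \<gamma> l"
  then have "{0..l} = insert 0 (insert l {0<..<l})" using isom_arc_pos[of \<gamma> l] by auto
  then show ?thesis by simp
qed

lemma isom_arc_compact: "isom_arc \<gamma> l \<Longrightarrow> compact (\<gamma> ` {0..l})"
  by (intro compact_continuous_image isom_arc_continuous) auto

lemma isom_arc_connected_inside: "isom_arc \<gamma> l \<Longrightarrow> connected (\<gamma> ` {0<..<l})"
  by (intro connected_continuous_image continuous_on_subset[OF isom_arc_continuous]) auto

lemma isom_arc_end_in_closure:
  assumes "isom_arc \<gamma> l" shows "\<gamma> 0 \<in> closure (\<gamma> ` {0<..<l})"
  unfolding closure_approachable
proof safe
  fix e :: real assume e: "e > 0"
  define t where "t = min e l / 2"
  have t: "0 < t" "t < l" "t < e" using e isom_arc_pos[OF assms] by (auto simp: t_def)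
  then have "dist (\<gamma> t) (\<gamma> 0) = t" using isom_arc_dist[OF assms, of t 0] by auto
  then show "\<exists>y\<in>\<gamma> ` {0<..<l}. dist y (\<gamma> 0) < e" using t by (intro bexI[of _ "\<gamma> t"]) auto
qed

lemma isom_arc_rev_inside: "(\<lambda>t::real. \<gamma> (l - t)) ` {0<..<l} = \<gamma> ` {0<..<l}"
proof safe
  fix t assume "t \<in> {0<..<l}"
  then show "\<gamma> (l - t) \<in> \<gamma> ` {0<..<l}" by (intro imageI) auto
next
  fix t assume "t \<in> {0<..<l}"
  then show "\<gamma> t \<in> (\<lambda>t. \<gamma> (l - t)) ` {0<..<l}" by (intro image_eqI[of _ _ "l - t"]) auto
qed

lemma isom_arc_closure:
  assumes "isom_arc \<gamma> l" shows "closure (\<gamma> ` {0<..<l}) = \<gamma> ` {0..l}"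
proof
  show "closure (\<gamma> ` {0<..<l}) \<subseteq> \<gamma> ` {0..l}"
    by (intro closure_minimal compact_imp_closed isom_arc_compact assms) auto
  have "\<gamma> l \<in> closure (\<gamma> ` {0<..<l})"
    using isom_arc_end_in_closure[OF isom_arc_rev[OF assms]] by (simp add: isom_arc_rev_inside)
  then show "\<gamma> ` {0..l} \<subseteq> closure (\<gamma> ` {0<..<l})"
    using isom_arc_end_in_closure[OF assms] closure_subset[of "\<gamma> ` {0<..<l}"]
    by (auto simp: isom_arc_closed_image[OF assms])
qed

lemma isom_arc_ends_not_inside:
  assumes "isom_arc \<gamma> l" shows "\<gamma> 0 \<notin> \<gamma> ` {0<..<l}" "\<gamma> l \<notin> \<gamma> ` {0<..<l}" "\<gamma> 0 \<noteq> \<gamma> l"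
proof -
  have "\<gamma> 0 \<noteq> \<gamma> t" if "0 < t" "t \<le> l" for t using isom_arc_eq_iff[OF assms, of 0 t] that by auto
  moreover have "\<gamma> l \<noteq> \<gamma> t" if "0 \<le> t" "t < l" for t using isom_arc_eq_iff[OF assms, of l t] that by auto
  ultimately show "\<gamma> 0 \<notin> \<gamma> ` {0<..<l}" "\<gamma> l \<notin> \<gamma> ` {0<..<l}" "\<gamma> 0 \<noteq> \<gamma> l"
    using isom_arc_pos[OF assms] by (auto simp: image_iff Ball_def less_imp_le)
qed

lemma isom_arc_frontier:
  assumes "isom_arc \<gamma> l" "open (\<gamma> ` {0<..<l})" shows "frontier (\<gamma> ` {0<..<l}) = {\<gamma> 0, \<gamma> l}"
  using isom_arc_ends_not_inside[OF assms(1)] assms(2)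
  by (auto simp: frontier_def interior_open isom_arc_closure[OF assms(1)] isom_arc_closed_image[OF assms(1)])

text \<open>A finite graph structure: \<open>V\<close> are the vertices, and an edge is a pair of an isometric arc
  and its length. Edges are isometric for the metric of the graph itself, so there are no loops
  and an edge carries the Lebesgue measure of its parameter interval.\<close>

definition subdivision :: "'a::metrized_graph set \<Rightarrow> ((real \<Rightarrow> 'a) \<times> real) set \<Rightarrow> bool" where
  "subdivision V E \<longleftrightarrow> finite V \<and> finite E \<and>
     (\<forall>e\<in>E. isom_arc (fst e) (snd e) \<and> open (open_edge e) \<and> fst e 0 \<in> V \<and> fst e (snd e) \<in> V) \<and>
     - V = (\<Union>e\<in>E. open_edge e) \<and> disjoint_family_on open_edge E"

lemma star_cover:
  obtains C :: "'a::metrized_graph set" and \<rho> where "finite C" "\<And>c. star_radius c (2 * \<rho> c)" "(UNIV::'a set) = (\<Union>c\<in>C. ball c (\<rho> c))"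
proof -
  have "\<forall>p::'a. \<exists>\<rho>. star_radius p \<rho>" using star_radius_exists by blast
  then obtain r where r: "\<And>p::'a. star_radius p (r p)" by metis
  have rp: "r p > 0" for p using r[of p] by (simp add: star_radius_def)
  \<comment> \<open>Halving the radii leaves room for the closed rays of length \<open>\<rho> c\<close> inside the stars.\<close>
  have "\<exists>D. D \<subseteq> (UNIV::'a set) \<and> finite D \<and> UNIV \<subseteq> (\<Union>c\<in>D. ball c (r c / 2))"
    by (rule compactE_image[OF graph_compact, of UNIV "\<lambda>c. ball c (r c / 2)"]) (use rp in auto)
  then obtain D where D: "finite D" "(UNIV::'a set) \<subseteq> (\<Union>c\<in>D. ball c (r c / 2))" by blast
  show ?thesis using D r by (intro that[of D "\<lambda>c. r c / 2"]) auto
qed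

lemma finite_gap:
  fixes T :: "real set"
  assumes "finite T" "a \<in> T" "b \<in> T" "a < t" "t < b" "t \<notin> T"
  obtains s s' where "s \<in> T" "s' \<in> T" "s < t" "t < s'" "{s<..<s'} \<inter> T = {}"
proof -
  define s where "s = Max {x\<in>T. x < t}"
  define s' where "s' = Min {x\<in>T. t < x}"
  have s: "s \<in> {x\<in>T. x < t}" unfolding s_def by (rule Max_in) (use assms in auto)
  have s': "s' \<in> {x\<in>T. t < x}" unfolding s'_def by (rule Min_in) (use assms in auto)
  have le: "x \<le> s" if "x \<in> T" "x < t" for x unfolding s_def by (rule Max_ge) (use assms that in auto)
  have ge: "s' \<le> x" if "x \<in> T" "t < x" for x unfolding s'_def by (rule Min_le) (use assms that in auto)
  have "x \<notin> {s<..<s'}" if "x \<in> T" for x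
    using le[OF that] ge[OF that] \<open>t \<notin> T\<close> that by (cases x t rule: linorder_cases) auto
  then show ?thesis using s s' by (intro that[of s s']) auto
qed

text \<open>A connected set avoiding \<open>V\<close> cannot leave an open arc with end points in \<open>V\<close>, as the end
  points are its frontier.\<close>

lemma arcs_disjoint_or_equal:
  assumes "isom_arc \<gamma> l" "open (\<gamma> ` {0<..<l})" "\<gamma> 0 \<in> V" "\<gamma> l \<in> V" "\<gamma> ` {0<..<l} \<inter> V = {}"
    and "isom_arc \<gamma>' l'" "open (\<gamma>' ` {0<..<l'})" "\<gamma>' 0 \<in> V" "\<gamma>' l' \<in> V" "\<gamma>' ` {0<..<l'} \<inter> V = {}"
    and "\<gamma> ` {0<..<l} \<inter> \<gamma>' ` {0<..<l'} \<noteq> {}"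
  shows "\<gamma> ` {0<..<l} = \<gamma>' ` {0<..<l'}"
proof -
  have *: "A \<subseteq> B" if "connected A" "A \<inter> B \<noteq> {}" "frontier B \<subseteq> V" "A \<inter> V = {}" for A B :: "'a set"
  proof (rule ccontr)
    assume "\<not> A \<subseteq> B"
    then have "A - B \<noteq> {}" by auto
    from connected_Int_frontier[OF that(1,2) this] that(3,4) show False by auto
  qed
  have 1: "frontier (\<gamma> ` {0<..<l}) \<subseteq> V" "frontier (\<gamma>' ` {0<..<l'}) \<subseteq> V"
    using assms(3,4,8,9) by (simp_all add: isom_arc_frontier[OF assms(1,2)] isom_arc_frontier[OF assms(6,7)])
  show ?thesis
  proof
    show "\<gamma> ` {0<..<l} \<subseteq> \<gamma>' ` {0<..<l'}"
      by (rule *[OF isom_arc_connected_inside[OF assms(1)] assms(11) 1(2) assms(5)])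
    show "\<gamma>' ` {0<..<l'} \<subseteq> \<gamma> ` {0<..<l}"
      by (rule *[OF isom_arc_connected_inside[OF assms(6)] _ 1(1) assms(10)]) (use assms(11) in \<open>simp add: Int_commute\<close>)
  qed
qed

text \<open>Finitely many stars cover the graph. Their rays, cut at all centres, at all ends of rays
  and at the prescribed points, are the edges. Different stars may yield the same edge, of which
  one parametrization is kept.\<close>

lemma subdivision_exists:
  fixes F :: "'a::metrized_graph set"
  assumes "finite F"
  obtains V E where "subdivision V E" "F \<subseteq> V"
proof -
  obtain C and \<rho> :: "'a \<Rightarrow> real" where C: "finite C" "\<And>c. star_radius c (2 * \<rho> c)" "(UNIV::'a set) = (\<Union>c\<in>C. ball c (\<rho> c))"
    using star_cover by blast
  have \<rho>: "\<rho> c > 0" for c using C(2)[of c] by (simp add: star_radius_def)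
  have sr: "star_radius c (\<rho> c)" for c
    by (rule star_radius_mono[OF C(2)]) (use \<rho>[of c] in auto)
  define V where "V = F \<union> C \<union> (\<Union>c\<in>C. (\<lambda>v. move c v (\<rho> c)) ` Vec c)"
  have V: "finite V" unfolding V_def using assms C finite_Vec by auto
  define T where "T = (\<lambda>c v. {t\<in>{0..\<rho> c}. move c v t \<in> V})"
  have arc: "isom_arc (move c v) (\<rho> c)" if "v \<in> Vec c" for c v
    using star_radius_isom_arc[OF C(2) that] \<rho>[of c] by auto
  have fT: "finite (T c v)" if "v \<in> Vec c" for c v
  proof (rule finite_imageD)
    show "finite (move c v ` T c v)" by (rule finite_subset[OF _ V]) (auto simp: T_def)
    show "inj_on (move c v) (T c v)"
      using isom_arc_inj[OF arc[OF that]] by (rule inj_on_subset) (auto simp: T_def)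
  qed
  \<comment> \<open>The pieces of rays between consecutive points of \<open>V\<close>.\<close>
  define E0 where "E0 = (\<Union>c\<in>C. \<Union>v\<in>Vec c. \<Union>s\<in>T c v. \<Union>s'\<in>T c v.
      if s < s' \<and> {s<..<s'} \<inter> T c v = {} then {(\<lambda>t. move c v (s + t), s' - s)} else {})"
  have fE0: "finite E0" unfolding E0_def by (intro finite_UN_I C fT finite_Vec) auto
  have insideE: "open_edge (\<lambda>t. move c v (s + t), s' - s) = move c v ` {s<..<s'}" for c v and s s' :: real
  proof (intro equalityI subsetI)
    fix y assume "y \<in> move c v ` {s<..<s'}"
    then obtain t where "y = move c v t" "s < t" "t < s'" by auto
    then show "y \<in> open_edge (\<lambda>t. move c v (s + t), s' - s)" by (intro image_eqI[of _ _ "t - s"]) auto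
  qed auto
  have E0: "isom_arc (fst e) (snd e) \<and> open (open_edge e) \<and> fst e 0 \<in> V \<and> fst e (snd e) \<in> V \<and> open_edge e \<inter> V = {}"
    if "e \<in> E0" for e
  proof -
    obtain c v s s' where e: "c \<in> C" "v \<in> Vec c" "s \<in> T c v" "s' \<in> T c v" "s < s'" "{s<..<s'} \<inter> T c v = {}"
      "e = (\<lambda>t. move c v (s + t), s' - s)"
      using \<open>e \<in> E0\<close> unfolding E0_def by (auto split: if_splits)
    have "isom_arc (\<lambda>t. move c v (s + t)) (s' - s)"
      using e by (intro isom_arc_sub[OF arc[OF e(2)]]) (auto simp: T_def)
    moreover have "open (open_edge e)"
      unfolding e(7) insideE by (rule star_radius_open_ray[OF sr e(2)]) (use e in \<open>auto simp: T_def\<close>)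
    moreover have "open_edge e \<inter> V = {}"
      unfolding e(7) insideE using e(3,4,6) by (force simp: T_def)
    ultimately show ?thesis using e by (auto simp: T_def)
  qed
  have cov: "\<exists>e\<in>E0. x \<in> open_edge e" if x: "x \<notin> V" for x
  proof -
    obtain c where c: "c \<in> C" "x \<in> ball c (\<rho> c)" using C(3) by blast
    then obtain v t where vt: "v \<in> Vec c" "0 \<le> t" "t < \<rho> c" "x = move c v t"
      using star_radius_ball[OF sr] by metis
    have tT: "t \<notin> T c v" using x vt by (auto simp: T_def)
    have 0: "0 \<in> T c v" "\<rho> c \<in> T c v" using c vt \<rho>[of c] by (auto simp: T_def V_def)
    have "0 < t" using tT 0 vt by (metis less_eq_real_def)
    obtain s s' where "s \<in> T c v" "s' \<in> T c v" "s < t" "t < s'" "{s<..<s'} \<inter> T c v = {}"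
      using finite_gap[OF fT[OF vt(1)] 0 \<open>0 < t\<close> vt(3) tT] by metis
    then have e: "(\<lambda>t. move c v (s + t), s' - s) \<in> E0" and "x \<in> move c v ` {s<..<s'}"
      using c vt by (force simp: E0_def, auto)
    then show ?thesis using insideE[of c v s s'] by blast
  qed
  \<comment> \<open>Arcs of \<open>E0\<close> with the same open edge are identified.\<close>
  define pick where "pick I = (SOME e. e \<in> E0 \<and> open_edge e = I)" for I
  have pick: "pick (open_edge e) \<in> E0 \<and> open_edge (pick (open_edge e)) = open_edge e" if "e \<in> E0" for e
    unfolding pick_def by (rule someI[of _ e]) (use that in auto)
  define E where "E = (\<lambda>e. pick (open_edge e)) ` E0"
  have EE0: "E \<subseteq> E0" using pick by (auto simp: E_def)
  have "disjoint_family_on open_edge E"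
    unfolding disjoint_family_on_def
  proof (intro ballI impI)
    fix e e' assume ee: "e \<in> E" "e' \<in> E" "e \<noteq> e'"
    show "open_edge e \<inter> open_edge e' = {}"
    proof (rule ccontr)
      assume "open_edge e \<inter> open_edge e' \<noteq> {}"
      then have "open_edge e = open_edge e'"
        using E0[of e] E0[of e'] ee EE0 by (intro arcs_disjoint_or_equal[of "fst e" "snd e" V "fst e'" "snd e'"]) auto
      moreover obtain d d' where "e = pick (open_edge d)" "d \<in> E0" "e' = pick (open_edge d')" "d' \<in> E0"
        using ee by (auto simp: E_def)
      ultimately show False using pick[of d] pick[of d'] ee(3) by metis
    qed
  qed
  moreover have "- V = (\<Union>e\<in>E. open_edge e)"
  proof (intro equalityI subsetI)
    fix x assume "x \<in> - V"
    then obtain e where "e \<in> E0" "x \<in> open_edge e" using cov[of x] by blast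
    then have "x \<in> open_edge (pick (open_edge e))" "pick (open_edge e) \<in> E" using pick[of e] by (auto simp: E_def)
    then show "x \<in> (\<Union>e\<in>E. open_edge e)" by blast
  next
    fix x assume "x \<in> (\<Union>e\<in>E. open_edge e)"
    then show "x \<in> - V" using E0 EE0 by blast
  qed
  moreover have "finite E" using fE0 by (simp add: E_def)
  ultimately have "subdivision V E" unfolding subdivision_def using V E0 EE0 by blast
  then show ?thesis using that by (auto simp: V_def)
qed

lemma subdivisionD:
  assumes "subdivision V E"
  shows "finite V" "finite E" "- V = (\<Union>e\<in>E. open_edge e)" "disjoint_family_on open_edge E"
    and "\<And>e. e \<in> E \<Longrightarrow> isom_arc (fst e) (snd e)" "\<And>e. e \<in> E \<Longrightarrow> open (open_edge e)"
    "\<And>e. e \<in> E \<Longrightarrow> fst e 0 \<in> V" "\<And>e. e \<in> E \<Longrightarrow> fst e (snd e) \<in> V"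
  using assms by (auto simp: subdivision_def)

lemma subdivision_inside_V: "subdivision V E \<Longrightarrow> e \<in> E \<Longrightarrow> open_edge e \<inter> V = {}"
  using subdivisionD(3)[of V E] by blast

section \<open>Directions pointing into the edges\<close>

lemma at_right_0_exists:
  assumes "eventually P (at_right (0::real))" "e > 0"
  obtains t where "0 < t" "t < e" "P t"
proof -
  have "eventually (\<lambda>t. P t \<and> t \<in> {0<..<e}) (at_right 0)"
    using assms eventually_at_right_real[of 0 e] by (auto intro: eventually_conj)
  then have "\<exists>t. P t \<and> t \<in> {0<..<e}" using eventually_happens' trivial_limit_at_right_real by blast
  then show ?thesis using that by auto
qed

lemma In_dirs_subset: "In_dirs b S \<subseteq> Vec b"
  by (auto simp: In_dirs_def)

lemma In_dirs_mono: "S \<subseteq> S' \<Longrightarrow> In_dirs b S \<subseteq> In_dirs b S'"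
  by (auto simp: In_dirs_def elim!: eventually_mono)

lemma finite_In_dirs: "finite (In_dirs b S)"
  by (rule finite_subset[OF In_dirs_subset finite_Vec])

lemma move_tendsto:
  assumes "v \<in> Vec p" shows "(move p v \<longlongrightarrow> p) (at_right 0)"
proof -
  obtain \<rho> where \<rho>: "star_radius p \<rho>" "\<rho> > 0" using star_radius_exists by blast
  have "eventually (\<lambda>t. dist (move p v t) p = t) (at_right 0)"
    using eventually_at_right_real[OF \<rho>(2)]
    by eventually_elim (simp add: star_radius_dist0[OF \<rho>(1) assms] dist_commute)
  moreover have "((\<lambda>t. t) \<longlongrightarrow> (0::real)) (at_right 0)" by (rule tendsto_ident_at)
  ultimately have "((\<lambda>t. dist (move p v t) p) \<longlongrightarrow> 0) (at_right 0)" by (simp add: tendsto_cong)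
  then show ?thesis by (rule iffD2[OF tendsto_dist_iff])
qed

lemma In_dirs_open: "open S \<Longrightarrow> b \<in> S \<Longrightarrow> In_dirs b S = Vec b"
  using move_tendsto unfolding In_dirs_def by (auto dest!: topological_tendstoD)

lemma In_dirs_outside: "b \<notin> closure S \<Longrightarrow> In_dirs b S = {}"
proof (rule ccontr)
  assume b: "b \<notin> closure S" and "In_dirs b S \<noteq> {}"
  then obtain v where v: "v \<in> Vec b" "eventually (\<lambda>t. move b v t \<in> S) (at_right 0)" by (auto simp: In_dirs_def)
  have "eventually (\<lambda>t. move b v t \<in> - closure S) (at_right 0)"
    using topological_tendstoD[OF move_tendsto[OF v(1)], of "- closure S"] b by auto
  with v(2) have "eventually (\<lambda>t. False) (at_right (0::real))"
    by eventually_elim (use closure_subset in auto)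
  then show False using trivial_limit_at_right_real by (simp add: eventually_False)
qed

lemma In_dirs_start:
  assumes "isom_arc \<gamma> l"
  shows "In_dirs (\<gamma> 0) (\<gamma> ` {0<..<l}) = {init_dir \<gamma>}"
proof -
  have lv: "leaves \<gamma> (init_dir \<gamma>)" using leaves_init_dir[OF assms] .
  have ev: "eventually (\<lambda>t. move (\<gamma> 0) (init_dir \<gamma>) t = \<gamma> t \<and> t \<in> {0<..<l}) (at_right 0)"
    using leaves_eventually[OF lv] eventually_at_right_real[OF isom_arc_pos[OF assms]] by (rule eventually_conj)
  have 1: "init_dir \<gamma> \<in> In_dirs (\<gamma> 0) (\<gamma> ` {0<..<l})"
    unfolding In_dirs_def using leaves_in_Vec[OF lv] ev by (auto elim!: eventually_mono)
  have 2: "v = init_dir \<gamma>" if v: "v \<in> In_dirs (\<gamma> 0) (\<gamma> ` {0<..<l})" for v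
  proof -
    have vV: "v \<in> Vec (\<gamma> 0)" and ev2: "eventually (\<lambda>t. move (\<gamma> 0) v t \<in> \<gamma> ` {0<..<l}) (at_right 0)"
      using v by (auto simp: In_dirs_def)
    obtain \<rho> where \<rho>: "star_radius (\<gamma> 0) \<rho>" "\<rho> > 0" using star_radius_exists by blast
    obtain t where t: "0 < t" "t < \<rho>" "(move (\<gamma> 0) (init_dir \<gamma>) t = \<gamma> t \<and> t \<in> {0<..<l}) \<and> move (\<gamma> 0) v t \<in> \<gamma> ` {0<..<l}"
      using at_right_0_exists[OF eventually_conj[OF ev ev2] \<rho>(2)] by metis
    then obtain s where s: "0 < s" "s < l" "move (\<gamma> 0) v t = \<gamma> s" by auto
    have "dist (\<gamma> 0) (move (\<gamma> 0) v t) = t" using star_radius_dist0[OF \<rho>(1) vV, of t] t by simp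
    moreover have "dist (\<gamma> 0) (\<gamma> s) = s" using isom_arc_dist[OF assms, of 0 s] s by simp
    ultimately have "s = t" using s by simp
    then have "move (\<gamma> 0) v t = move (\<gamma> 0) (init_dir \<gamma>) t" using s t by simp
    then show ?thesis using star_radius_inj[OF \<rho>(1) vV leaves_in_Vec[OF lv], of t t] t by simp
  qed
  show ?thesis using 1 2 by blast
qed

definition start_dir :: "(real \<Rightarrow> 'a::metrized_graph) \<times> real \<Rightarrow> complex" where
  "start_dir e = init_dir (fst e)"
definition end_dir :: "(real \<Rightarrow> 'a::metrized_graph) \<times> real \<Rightarrow> complex" where
  "end_dir e = init_dir (\<lambda>t. fst e (snd e - t))"

lemma In_dirs_end:
  assumes "isom_arc \<gamma> l"
  shows "In_dirs (\<gamma> l) (\<gamma> ` {0<..<l}) = {init_dir (\<lambda>t. \<gamma> (l - t))}"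
  using In_dirs_start[OF isom_arc_rev[OF assms]] by (simp add: isom_arc_rev_inside)

text \<open>A short open piece of the ray contains no vertex and is connected, hence it stays in one
  edge.\<close>

lemma In_dirs_edge_exists:
  assumes sub: "subdivision V E" and b: "b \<in> V" and v: "v \<in> Vec b"
  shows "\<exists>e\<in>E. v \<in> In_dirs b (open_edge e)"
proof -
  note S = subdivisionD[OF sub]
  obtain \<rho> where \<rho>: "star_radius b \<rho>" "\<rho> > 0" using star_radius_exists by blast
  have "finite (insert \<rho> (dist b ` (V - {b})))" using S(1) by simp
  moreover have "\<forall>x\<in>insert \<rho> (dist b ` (V - {b})). 0 < x" using \<rho>(2) by auto
  ultimately obtain \<sigma> where \<sigma>: "0 < \<sigma>" "\<forall>x\<in>insert \<rho> (dist b ` (V - {b})). \<sigma> \<le> x"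
    by (metis Min_gr_iff Min_le finite.insertI insert_not_empty)
  define R where "R = move b v ` {0<..<\<sigma>/2}"
  have d: "dist b (move b v t) = t" if "0 \<le> t" "t < \<sigma>" for t
    using star_radius_dist0[OF \<rho>(1) v, of t] that \<sigma> by auto
  have RV: "R \<inter> V = {}"
  proof (rule ccontr)
    assume "R \<inter> V \<noteq> {}"
    then obtain t where t: "move b v t \<in> V" "0 < t" "t < \<sigma>/2" by (auto simp: R_def)
    then have "dist b (move b v t) = t" using d[of t] by simp
    moreover from this t have "move b v t \<noteq> b" by auto
    ultimately have "\<sigma> \<le> dist b (move b v t)" using t \<sigma>(2) by blast
    then show False using \<open>dist b (move b v t) = t\<close> t \<sigma>(1) by linarith
  qed
  have "isom_arc (move b v) (\<sigma>/2)" using star_radius_isom_arc[OF \<rho>(1) v, of "\<sigma>/2"] \<sigma> by auto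
  then have cR: "connected R" unfolding R_def by (rule isom_arc_connected_inside)
  have x: "move b v (\<sigma>/4) \<in> R" using \<sigma>(1) by (auto simp: R_def)
  then obtain e where e: "e \<in> E" "move b v (\<sigma>/4) \<in> open_edge e" using RV S(3) by blast
  have "R \<subseteq> open_edge e"
  proof (rule ccontr)
    assume "\<not> R \<subseteq> open_edge e"
    then have "R - open_edge e \<noteq> {}" by auto
    moreover have "R \<inter> open_edge e \<noteq> {}" using x e(2) by blast
    ultimately have "R \<inter> frontier (open_edge e) \<noteq> {}" by (intro connected_Int_frontier[OF cR])
    then show False using RV S(7,8)[OF e(1)] by (auto simp: isom_arc_frontier[OF S(5,6)[OF e(1)]])
  qed
  moreover have "eventually (\<lambda>t. move b v t \<in> R) (at_right 0)"
    using eventually_at_right_real[of 0 "\<sigma>/2"] \<sigma>(1) unfolding R_def by (auto elim!: eventually_mono)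
  ultimately have "v \<in> In_dirs b (open_edge e)" using v by (auto simp: In_dirs_def elim!: eventually_mono)
  then show ?thesis using e by blast
qed

lemma In_dirs_edge_unique:
  assumes "subdivision V E" "e \<in> E" "e' \<in> E" "v \<in> In_dirs b (open_edge e)" "v \<in> In_dirs b (open_edge e')"
  shows "e = e'"
proof (rule ccontr)
  assume "e \<noteq> e'"
  then have disj: "open_edge e \<inter> open_edge e' = {}"
    by (rule disjoint_family_onD[OF subdivisionD(4)[OF assms(1)] assms(2,3)])
  have "eventually (\<lambda>t. move b v t \<in> open_edge e \<and> move b v t \<in> open_edge e') (at_right 0)"
    using assms(4,5) by (auto simp: In_dirs_def intro: eventually_conj)
  then obtain t where "move b v t \<in> open_edge e \<and> move b v t \<in> open_edge e'"
    by (rule at_right_0_exists[OF _ zero_less_one])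
  then show False using disj by blast
qed

text \<open>An edge is connected and avoids the frontier of \<open>S\<close>, so it lies in \<open>S\<close> as soon as it meets
  \<open>S\<close>.\<close>

lemma In_dirs_union_edges:
  assumes sub: "subdivision V E" and b: "b \<in> V" and S: "frontier S \<subseteq> V"
  shows "In_dirs b S = (\<Union>e\<in>{e\<in>E. open_edge e \<subseteq> S}. In_dirs b (open_edge e))"
proof (intro equalityI subsetI)
  fix v assume v: "v \<in> In_dirs b S"
  then obtain e where e: "e \<in> E" "v \<in> In_dirs b (open_edge e)"
    using In_dirs_edge_exists[OF sub b] In_dirs_subset by blast
  have "eventually (\<lambda>t. move b v t \<in> S \<and> move b v t \<in> open_edge e) (at_right 0)"
    using v e by (auto simp: In_dirs_def intro: eventually_conj)
  then obtain t where "move b v t \<in> S \<and> move b v t \<in> open_edge e"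
    by (rule at_right_0_exists[OF _ zero_less_one])
  then have ne: "open_edge e \<inter> S \<noteq> {}" by blast
  have "open_edge e \<subseteq> S"
  proof (rule ccontr)
    assume "\<not> open_edge e \<subseteq> S"
    then have "open_edge e - S \<noteq> {}" by auto
    then have "open_edge e \<inter> frontier S \<noteq> {}"
      by (rule connected_Int_frontier[OF isom_arc_connected_inside[OF subdivisionD(5)[OF sub e(1)]] ne])
    then show False using S subdivision_inside_V[OF sub e(1)] by blast
  qed
  then show "v \<in> (\<Union>e\<in>{e\<in>E. open_edge e \<subseteq> S}. In_dirs b (open_edge e))" using e by blast
next
  fix v assume "v \<in> (\<Union>e\<in>{e\<in>E. open_edge e \<subseteq> S}. In_dirs b (open_edge e))"
  then obtain e where "open_edge e \<subseteq> S" "v \<in> In_dirs b (open_edge e)" by blast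
  then show "v \<in> In_dirs b S" using In_dirs_mono by blast
qed

text \<open>The double counting behind both Green's formula and the computation of \<^const>\<open>m_set\<close>: the
  directions at vertices pointing into \<open>S\<close> are the ends of the edges contained in \<open>S\<close>.\<close>

lemma sum_In_dirs:
  fixes G :: "'a::metrized_graph \<Rightarrow> complex \<Rightarrow> 'b::comm_monoid_add"
  assumes sub: "subdivision V E" and S: "frontier S \<subseteq> V"
  shows "(\<Sum>b\<in>V. \<Sum>v\<in>In_dirs b S. G b v) =
         (\<Sum>e\<in>{e\<in>E. open_edge e \<subseteq> S}. G (fst e 0) (start_dir e) + G (fst e (snd e)) (end_dir e))"
proof -
  note D = subdivisionD[OF sub]
  let ?E = "{e\<in>E. open_edge e \<subseteq> S}"
  have "(\<Sum>b\<in>V. \<Sum>v\<in>In_dirs b S. G b v) = (\<Sum>b\<in>V. \<Sum>e\<in>?E. \<Sum>v\<in>In_dirs b (open_edge e). G b v)"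
  proof (rule sum.cong[OF refl])
    fix b assume b: "b \<in> V"
    have "disjoint_family_on (\<lambda>e. In_dirs b (open_edge e)) ?E"
      using In_dirs_edge_unique[OF sub] unfolding disjoint_family_on_def by blast
    then show "(\<Sum>v\<in>In_dirs b S. G b v) = (\<Sum>e\<in>?E. \<Sum>v\<in>In_dirs b (open_edge e). G b v)"
      unfolding In_dirs_union_edges[OF sub b S]
      by (intro sum.UNION_disjoint) (auto simp: D(2) finite_In_dirs disjoint_family_on_def)
  qed
  also have "\<dots> = (\<Sum>e\<in>?E. \<Sum>b\<in>V. \<Sum>v\<in>In_dirs b (open_edge e). G b v)" by (rule sum.swap)
  also have "\<dots> = (\<Sum>e\<in>?E. G (fst e 0) (start_dir e) + G (fst e (snd e)) (end_dir e))"
  proof (rule sum.cong[OF refl])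
    fix e assume "e \<in> ?E"
    then have e: "e \<in> E" by simp
    have "(\<Sum>b\<in>V. \<Sum>v\<in>In_dirs b (open_edge e). G b v) =
          (\<Sum>b\<in>{fst e 0, fst e (snd e)}. \<Sum>v\<in>In_dirs b (open_edge e). G b v)"
    proof (rule sum.mono_neutral_right)
      show "\<forall>b\<in>V - {fst e 0, fst e (snd e)}. (\<Sum>v\<in>In_dirs b (open_edge e). G b v) = 0"
      proof
        fix b assume b: "b \<in> V - {fst e 0, fst e (snd e)}"
        then have "b \<notin> closure (open_edge e)"
          using subdivision_inside_V[OF sub e]
          by (auto simp: isom_arc_closure[OF D(5)[OF e]] isom_arc_closed_image[OF D(5)[OF e]])
        then show "(\<Sum>v\<in>In_dirs b (open_edge e). G b v) = 0" by (simp add: In_dirs_outside)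
      qed
    qed (use D e in auto)
    also have "\<dots> = G (fst e 0) (start_dir e) + G (fst e (snd e)) (end_dir e)"
      using isom_arc_ends_not_inside(3)[OF D(5)[OF e]] In_dirs_start[OF D(5)[OF e]] In_dirs_end[OF D(5)[OF e]]
      by (simp add: start_dir_def end_dir_def)
    finally show "(\<Sum>b\<in>V. \<Sum>v\<in>In_dirs b (open_edge e). G b v) =
        G (fst e 0) (start_dir e) + G (fst e (snd e)) (end_dir e)" .
  qed
  finally show ?thesis .
qed

lemma sum_Vec_edges:
  fixes G :: "'a::metrized_graph \<Rightarrow> complex \<Rightarrow> 'b::comm_monoid_add"
  assumes sub: "subdivision V E"
  shows "(\<Sum>b\<in>V. \<Sum>v\<in>Vec b. G b v) =
         (\<Sum>e\<in>E. G (fst e 0) (start_dir e) + G (fst e (snd e)) (end_dir e))"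
proof -
  have "In_dirs b UNIV = Vec b" for b :: 'a by (auto simp: In_dirs_def)
  then show ?thesis using sum_In_dirs[OF sub, of UNIV G] by simp
qed

text \<open>On an open arc only two points have a given small distance from \<open>\<gamma> t\<close>, so there is no room
  for a third direction.\<close>

lemma Vec_inside:
  assumes "isom_arc \<gamma> l" "open (\<gamma> ` {0<..<l})" "0 < t" "t < l"
  shows "Vec (\<gamma> t) = {init_dir (\<lambda>s. \<gamma> (t + s)), init_dir (\<lambda>s. \<gamma> (t - s))}"
    and "init_dir (\<lambda>s. \<gamma> (t + s)) \<noteq> init_dir (\<lambda>s. \<gamma> (t - s))"
proof -
  let ?f = "\<lambda>s. \<gamma> (t + s)" and ?b = "\<lambda>s. \<gamma> (t - s)"
  have f: "isom_arc ?f (l - t)" and b: "isom_arc ?b t"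
    using assms by (auto intro: isom_arc_sub isom_arc_rev_sub)
  note lf = leaves_init_dir[OF f] and lb = leaves_init_dir[OF b]
  have p: "?f 0 = \<gamma> t" "?b 0 = \<gamma> t" by auto
  have vf: "init_dir ?f \<in> Vec (\<gamma> t)" and vb: "init_dir ?b \<in> Vec (\<gamma> t)"
    using leaves_in_Vec[OF lf] leaves_in_Vec[OF lb] by auto
  have ef: "eventually (\<lambda>s. move (\<gamma> t) (init_dir ?f) s = \<gamma> (t + s)) (at_right 0)"
    using leaves_eventually[OF lf] by simp
  have eb: "eventually (\<lambda>s. move (\<gamma> t) (init_dir ?b) s = \<gamma> (t - s)) (at_right 0)"
    using leaves_eventually[OF lb] by simp
  obtain \<rho> where \<rho>: "star_radius (\<gamma> t) \<rho>" "\<rho> > 0" using star_radius_exists by blast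
  define m where "m = min \<rho> (min t (l - t))"
  have m: "m > 0" using \<rho> assms by (auto simp: m_def)
  show ne: "init_dir ?f \<noteq> init_dir ?b"
  proof
    assume eq: "init_dir ?f = init_dir ?b"
    obtain s where s: "0 < s" "s < m" "move (\<gamma> t) (init_dir ?f) s = \<gamma> (t + s) \<and> move (\<gamma> t) (init_dir ?b) s = \<gamma> (t - s)"
      using at_right_0_exists[OF eventually_conj[OF ef eb] m] by metis
    then have "\<gamma> (t + s) = \<gamma> (t - s)" unfolding eq by (elim conjE) (rule trans[OF sym])
    then show False using isom_arc_eq_iff[OF assms(1), of "t + s" "t - s"] s assms by (auto simp: m_def)
  qed
  have "v \<in> {init_dir ?f, init_dir ?b}" if v: "v \<in> Vec (\<gamma> t)" for v
  proof -
    have ev: "eventually (\<lambda>s. move (\<gamma> t) v s \<in> \<gamma> ` {0<..<l}) (at_right 0)"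
      using topological_tendstoD[OF move_tendsto[OF v] assms(2)] assms by auto
    obtain s where s: "0 < s" "s < m" "(move (\<gamma> t) (init_dir ?f) s = \<gamma> (t + s) \<and> move (\<gamma> t) (init_dir ?b) s = \<gamma> (t - s))
        \<and> move (\<gamma> t) v s \<in> \<gamma> ` {0<..<l}"
      using at_right_0_exists[OF eventually_conj[OF eventually_conj[OF ef eb] ev] m] by metis
    then obtain u where u: "0 < u" "u < l" "move (\<gamma> t) v s = \<gamma> u" by auto
    have "dist (\<gamma> t) (move (\<gamma> t) v s) = s" using star_radius_dist0[OF \<rho>(1) v, of s] s by (simp add: m_def)
    moreover have "dist (\<gamma> t) (\<gamma> u) = \<bar>t - u\<bar>" using isom_arc_dist[OF assms(1), of t u] u assms by simp
    ultimately have "u = t + s \<or> u = t - s" using u s by auto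
    then have "move (\<gamma> t) v s = move (\<gamma> t) (init_dir ?f) s \<or> move (\<gamma> t) v s = move (\<gamma> t) (init_dir ?b) s"
      using s u by auto
    then show ?thesis
      using star_radius_inj[OF \<rho>(1) v vf, of s s] star_radius_inj[OF \<rho>(1) v vb, of s s] s by (auto simp: m_def)
  qed
  then show "Vec (\<gamma> t) = {init_dir ?f, init_dir ?b}" using vf vb by blast
qed

lemma subdivision_cover:
  assumes "subdivision V E" "x \<notin> V"
  obtains e where "e \<in> E" "x \<in> open_edge e"
proof -
  have "x \<in> (\<Union>e\<in>E. open_edge e)" using assms(2) unfolding subdivisionD(3)[OF assms(1), symmetric] by simp
  then show ?thesis using that by (rule UN_E)
qed

lemma subdivision_unique:
  assumes "subdivision V E" "e \<in> E" "e' \<in> E" "x \<in> open_edge e" "x \<in> open_edge e'"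
  shows "e = e'"
proof (rule ccontr)
  assume "e \<noteq> e'"
  then have "open_edge e \<inter> open_edge e' = {}" by (rule disjoint_family_onD[OF subdivisionD(4)[OF assms(1)] assms(2,3)])
  then show False using IntI[OF assms(4,5)] by simp
qed

section \<open>Arc-length measure on the edges of a subdivision\<close>

lemma real_isometry_affine:
  fixes f :: "real \<Rightarrow> real"
  assumes iso: "\<And>s t. s \<in> A \<Longrightarrow> t \<in> A \<Longrightarrow> \<bar>f s - f t\<bar> = \<bar>s - t\<bar>"
  obtains c \<sigma> where "\<sigma> = 1 \<or> \<sigma> = -1" "\<And>s. s \<in> A \<Longrightarrow> f s = c + \<sigma> * s"
proof (cases "\<exists>a\<in>A. \<exists>b\<in>A. a \<noteq> b")
  case False
  show ?thesis
  proof (cases "A = {}")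
    case True then show ?thesis by (intro that[of 1 0]) auto
  next
    case nonempty: False
    then obtain a where "a \<in> A" by blast
    with False show ?thesis by (intro that[of 1 "f a - a"]) auto
  qed
next
  case True
  then obtain a b where ab: "a \<in> A" "b \<in> A" "a \<noteq> b" by blast
  have "f b - f a = b - a \<or> f b - f a = - (b - a)" using iso[OF ab(2,1)] by linarith
  then show ?thesis
  proof
    assume *: "f b - f a = b - a"
    have "f s = (f a - a) + 1 * s" if "s \<in> A" for s
      using iso[OF that ab(1)] iso[OF that ab(2)] * ab(3) by linarith
    then show ?thesis by (intro that[of 1 "f a - a"]) auto
  next
    assume *: "f b - f a = - (b - a)"
    have "f s = (f a + a) + (-1) * s" if "s \<in> A" for s
      using iso[OF that ab(1)] iso[OF that ab(2)] * ab(3) by linarith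
    then show ?thesis by (intro that[of "-1" "f a + a"]) auto
  qed
qed

lemma lborel_isometry_image:
  fixes A :: "real set"
  assumes "A \<in> sets borel" "\<sigma> = 1 \<or> \<sigma> = -1"
  shows "emeasure lborel ((\<lambda>s. c + \<sigma> * s) ` A) = emeasure lborel A"
proof -
  let ?g = "\<lambda>x. - (\<sigma> * c) + \<sigma> * x"
  have inv: "?g (c + \<sigma> * s) = s" "c + \<sigma> * ?g s = s" for s using assms(2) by (auto simp: algebra_simps)
  have "(\<lambda>s. c + \<sigma> * s) ` A = ?g -` A \<inter> space lborel"
    using inv by (auto intro!: image_eqI[of _ "\<lambda>s. c + \<sigma> * s"])
  then have "emeasure lborel ((\<lambda>s. c + \<sigma> * s) ` A) = emeasure (distr lborel borel ?g) A"
    using assms(1) by (subst emeasure_distr) auto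
  also have "distr lborel borel ?g = lborel"
    using assms(2) by (subst (2) lborel_real_affine[of \<sigma> "- (\<sigma> * c)"]) (auto simp: density_1 one_ennreal_def[symmetric])
  finally show ?thesis .
qed

definition isom_on :: "real set \<Rightarrow> (real \<Rightarrow> 'a::metric_space) \<Rightarrow> bool" where
  "isom_on I \<gamma> \<longleftrightarrow> (\<forall>s\<in>I. \<forall>t\<in>I. dist (\<gamma> s) (\<gamma> t) = \<bar>s - t\<bar>)"

lemma isom_onD: "isom_on I \<gamma> \<Longrightarrow> s \<in> I \<Longrightarrow> t \<in> I \<Longrightarrow> dist (\<gamma> s) (\<gamma> t) = \<bar>s - t\<bar>"
  by (simp add: isom_on_def)

lemma isom_arc_isom_on: "isom_arc \<gamma> l \<Longrightarrow> isom_on {0..l} \<gamma>"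
  by (simp add: isom_arc_def isom_on_def)

lemma isom_on_inj: "isom_on I \<gamma> \<Longrightarrow> inj_on \<gamma> I"
proof (rule inj_onI)
  fix s t assume *: "isom_on I \<gamma>" "s \<in> I" "t \<in> I" "\<gamma> s = \<gamma> t"
  have "dist (\<gamma> s) (\<gamma> t) = \<bar>s - t\<bar>" by (rule isom_onD[OF *(1-3)])
  then show "s = t" using *(4) by simp
qed

lemma isom_on_continuous: "isom_on I \<gamma> \<Longrightarrow> continuous_on I \<gamma>"
  unfolding continuous_on_iff dist_real_def using isom_onD by metis

lemma isom_on_inv_continuous:
  assumes "isom_on I \<gamma>" shows "continuous_on (\<gamma> ` I) (inv_into I \<gamma>)"
  unfolding continuous_on_iff
proof (intro ballI allI impI)
  fix x e :: real and y assume y: "y \<in> \<gamma> ` I" and e: "e > 0"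
  have "dist (inv_into I \<gamma> x') (inv_into I \<gamma> y) = dist x' y" if "x' \<in> \<gamma> ` I" for x'
    using isom_onD[OF assms inv_into_into[OF that] inv_into_into[OF y]] f_inv_into_f[OF that] f_inv_into_f[OF y]
    by (simp add: dist_real_def)
  then show "\<exists>d>0. \<forall>x'\<in>\<gamma> ` I. dist x' y < d \<longrightarrow> dist (inv_into I \<gamma> x') (inv_into I \<gamma> y) < e"
    using e by (intro exI[of _ e]) auto
qed

lemma isom_on_image_borel:
  fixes \<gamma> :: "real \<Rightarrow> 'a::metric_space"
  assumes "isom_on {a..b} \<gamma>" "A \<in> sets borel" "A \<subseteq> {a..b}"
  shows "\<gamma> ` A \<in> sets borel"
proof -
  let ?K = "\<gamma> ` {a..b}" and ?\<delta> = "inv_into {a..b} \<gamma>"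
  have "compact ?K" by (intro compact_continuous_image isom_on_continuous assms) auto
  then have K: "?K \<in> sets borel" by (simp add: borel_compact)
  have "?\<delta> \<in> borel_measurable (restrict_space borel ?K)"
    by (rule borel_measurable_continuous_on_restrict[OF isom_on_inv_continuous[OF assms(1)]])
  then have "?\<delta> -` A \<inter> space (restrict_space borel ?K) \<in> sets (restrict_space borel ?K)"
    using assms(2) by (rule measurable_sets)
  then have "?\<delta> -` A \<inter> ?K \<in> sets borel"
    using K by (subst (asm) sets_restrict_space_iff) (auto simp: space_restrict_space)
  also have "?\<delta> -` A \<inter> ?K = \<gamma> ` A"
    using assms(3) inv_into_f_f[OF isom_on_inj[OF assms(1)]] by (auto intro!: image_eqI)
  finally show ?thesis .
qed

lemma isom_on_vimage_borel:
  assumes "isom_on I \<gamma>" "I \<in> sets borel" "X \<in> sets borel"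
  shows "I \<inter> \<gamma> -` X \<in> sets (borel :: real measure)"
proof -
  have "\<gamma> \<in> borel_measurable (restrict_space borel I)"
    by (rule borel_measurable_continuous_on_restrict[OF isom_on_continuous[OF assms(1)]])
  then have "\<gamma> -` X \<inter> space (restrict_space borel I) \<in> sets (restrict_space borel I)"
    using assms(3) by (rule measurable_sets)
  then show ?thesis
    using assms(2) by (subst (asm) sets_restrict_space_iff) (auto simp: space_restrict_space Int_commute)
qed

lemma isom_on_subset: "isom_on I \<gamma> \<Longrightarrow> J \<subseteq> I \<Longrightarrow> isom_on J \<gamma>"
  by (auto simp: isom_on_def)

text \<open>The change of parameter between the two arcs is an isometry between sets of reals, hence
  affine with slope \<open>1\<close> or \<open>-1\<close>.\<close>

lemma isom_on_overlap:
  fixes \<gamma> \<gamma>' :: "real \<Rightarrow> 'a::metric_space"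
  assumes "isom_on I \<gamma>" "isom_on J \<gamma>'" "A \<in> sets borel" "A \<subseteq> I" "B \<subseteq> J" "\<gamma> ` A = \<gamma>' ` B"
  shows "emeasure lborel B = emeasure lborel A"
proof -
  define \<tau> where "\<tau> s = inv_into J \<gamma>' (\<gamma> s)" for s
  have t: "\<tau> s \<in> B \<and> \<gamma>' (\<tau> s) = \<gamma> s" if "s \<in> A" for s
  proof -
    have "\<gamma> s \<in> \<gamma>' ` B" using that assms(6) by auto
    then obtain u where u: "u \<in> B" "\<gamma> s = \<gamma>' u" by auto
    then have "\<tau> s = u" unfolding \<tau>_def u(2) using inv_into_f_f[OF isom_on_inj[OF assms(2)]] assms(5) by auto
    then show ?thesis using u by simp
  qed
  have "\<bar>\<tau> s - \<tau> s'\<bar> = \<bar>s - s'\<bar>" if "s \<in> A" "s' \<in> A" for s s'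
    using isom_onD[OF assms(1), of s s'] isom_onD[OF assms(2), of "\<tau> s" "\<tau> s'"] t[OF that(1)] t[OF that(2)] that assms(4,5)
    by (metis subsetD)
  then obtain c \<sigma> where c: "\<sigma> = 1 \<or> \<sigma> = -1" "\<And>s. s \<in> A \<Longrightarrow> \<tau> s = c + \<sigma> * s"
    using real_isometry_affine[of A \<tau>] by metis
  have "B = \<tau> ` A"
  proof (intro equalityI subsetI)
    fix u assume u: "u \<in> B"
    then have "\<gamma>' u \<in> \<gamma> ` A" using assms(6) by auto
    then obtain s where s: "s \<in> A" "\<gamma>' u = \<gamma> s" by auto
    have "u = \<tau> s" unfolding \<tau>_def s(2)[symmetric]
      using inv_into_f_f[OF isom_on_inj[OF assms(2)]] assms(5) u by auto
    then show "u \<in> \<tau> ` A" using s by auto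
  qed (use t in auto)
  also have "\<dots> = (\<lambda>s. c + \<sigma> * s) ` A" using c(2) by auto
  finally show ?thesis using lborel_isometry_image[OF assms(3) c(1)] by simp
qed

text \<open>The property by which \<^const>\<open>arc_length\<close> is defined as the unique measure having it.\<close>

definition is_arc_length :: "'a::metrized_graph measure \<Rightarrow> bool" where
  "is_arc_length m \<longleftrightarrow> sets m = sets borel \<and>
     (\<forall>\<gamma> a b. (\<forall>s\<in>{a..b}. \<forall>t\<in>{a..b}. dist (\<gamma> s) (\<gamma> t) = \<bar>s - t\<bar>) \<longrightarrow>
        (\<forall>A\<in>sets borel. A \<subseteq> {a..b} \<longrightarrow> emeasure m (\<gamma> ` A) = emeasure lborel (A :: real set)))"

lemma is_arc_lengthD:
  assumes "is_arc_length m"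
  shows "sets m = sets borel"
    "\<And>\<gamma> a b A. isom_on {a..b} \<gamma> \<Longrightarrow> A \<in> sets borel \<Longrightarrow> A \<subseteq> {a..b} \<Longrightarrow> emeasure m (\<gamma> ` A) = emeasure lborel A"
  using assms by (auto simp: is_arc_length_def isom_on_def)

lemma edge_split:
  assumes sub: "subdivision V E" and X: "X \<in> sets borel" and m: "sets m = sets borel"
    and V0: "\<And>p. p \<in> V \<Longrightarrow> emeasure m {p} = 0"
  shows "emeasure m X = (\<Sum>e\<in>E. emeasure m (X \<inter> open_edge e))"
proof -
  note D = subdivisionD[OF sub]
  have fV: "X \<inter> V \<in> sets m" using D(1) by (metis X finite_Int finite_imp_closed borel_closed sets.Int m)
  have Vm: "V \<in> sets m" using D(1) m by (simp add: finite_imp_closed borel_closed)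
  have "emeasure m V = (\<Sum>p\<in>V. emeasure m {p})"
    using D(1) Vm m by (intro emeasure_eq_sum_singleton) (auto simp: borel_closed)
  then have "emeasure m V = 0" using V0 by simp
  then have 0: "emeasure m (X \<inter> V) = 0" using emeasure_mono[OF _ Vm, of "X \<inter> V"] by (metis Int_lower2 le_zero_eq)
  have 1: "X \<inter> open_edge e \<in> sets m" if "e \<in> E" for e using D(6)[OF that] X m by (auto intro: borel_open)
  have "X = (X \<inter> V) \<union> (\<Union>e\<in>E. X \<inter> open_edge e)" using D(3) by blast
  then have "emeasure m X = emeasure m ((X \<inter> V) \<union> (\<Union>e\<in>E. X \<inter> open_edge e))" by simp
  also have "\<dots> = emeasure m (X \<inter> V) + emeasure m (\<Union>e\<in>E. X \<inter> open_edge e)"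
  proof (rule plus_emeasure[symmetric, OF fV])
    show "(\<Union>e\<in>E. X \<inter> open_edge e) \<in> sets m" using 1 D(2) by (intro sets.finite_UN) auto
    show "X \<inter> V \<inter> (\<Union>e\<in>E. X \<inter> open_edge e) = {}" using D(3) by blast
  qed
  also have "emeasure m (\<Union>e\<in>E. X \<inter> open_edge e) = (\<Sum>e\<in>E. emeasure m (X \<inter> open_edge e))"
  proof (rule sum_emeasure[symmetric, OF _ _ D(2)])
    show "disjoint_family_on (\<lambda>e. X \<inter> open_edge e) E"
      unfolding disjoint_family_on_def
    proof (intro ballI impI)
      fix e e' assume "e \<in> E" "e' \<in> E" "e \<noteq> e'"
      then have "open_edge e \<inter> open_edge e' = {}" by (rule disjoint_family_onD[OF D(4)])
      then show "(X \<inter> open_edge e) \<inter> (X \<inter> open_edge e') = {}" by blast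
    qed
  qed (use 1 in auto)
  finally show ?thesis using 0 by simp
qed

definition edge_mass :: "(real \<Rightarrow> 'a::metrized_graph) \<times> real \<Rightarrow> 'a measure" where
  "edge_mass e = distr (restrict_space lborel {0<..<snd e}) borel (fst e)"

lemma edge_measurable:
  assumes "isom_arc (fst e) (snd e)"
  shows "fst e \<in> measurable (restrict_space lborel {0<..<snd e}) borel"
proof -
  have "continuous_on {0<..<snd e} (fst e)"
    by (rule continuous_on_subset[OF isom_arc_continuous[OF assms]]) auto
  then have "fst e \<in> measurable (restrict_space borel {0<..<snd e}) borel"
    by (rule borel_measurable_continuous_on_restrict)
  also have "measurable (restrict_space borel {0<..<snd e}) borel =
      (measurable (restrict_space lborel {0<..<snd e}) borel :: (real \<Rightarrow> 'a) set)"
    by (intro measurable_cong_sets sets_restrict_space_cong) auto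
  finally show ?thesis .
qed

lemma emeasure_edge_mass:
  assumes "isom_arc (fst e) (snd e)" "X \<in> sets borel"
  shows "emeasure (edge_mass e) X = emeasure lborel ({0<..<snd e} \<inter> fst e -` X)"
  unfolding edge_mass_def
  by (subst emeasure_distr[OF edge_measurable[OF assms(1)] assms(2)], subst emeasure_restrict_space)
    (auto simp: space_restrict_space Int_commute)

lemma is_arc_length_singleton:
  assumes "is_arc_length m" shows "emeasure m {p} = 0"
proof -
  have "isom_on {0..0} (\<lambda>_::real. p)" by (simp add: isom_on_def)
  from is_arc_lengthD(2)[OF assms this, of "{0}"] show ?thesis by simp
qed

text \<open>This gives uniqueness: the right-hand side does not mention \<open>m\<close>.\<close>

lemma is_arc_length_formula:
  assumes m: "is_arc_length m" and sub: "subdivision V E" and X: "X \<in> sets borel"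
  shows "emeasure m X = (\<Sum>e\<in>E. emeasure (edge_mass e) X)"
proof -
  note D = subdivisionD[OF sub]
  have "emeasure m (X \<inter> open_edge e) = emeasure (edge_mass e) X" if e: "e \<in> E" for e
  proof -
    have i: "isom_on {0..snd e} (fst e)" by (rule isom_arc_isom_on[OF D(5)[OF e]])
    have eq: "X \<inter> open_edge e = fst e ` ({0<..<snd e} \<inter> fst e -` X)" by auto
    have "{0<..<snd e} \<inter> fst e -` X \<in> sets borel"
      by (rule isom_on_vimage_borel[OF isom_on_subset[OF i] _ X]) auto
    then show ?thesis
      unfolding emeasure_edge_mass[OF D(5)[OF e] X] eq by (intro is_arc_lengthD(2)[OF m i]) auto
  qed
  then show ?thesis
    using edge_split[OF sub X is_arc_lengthD(1)[OF m] is_arc_length_singleton[OF m]] by simp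
qed

text \<open>The sum of the Lebesgue measures of the edges of any subdivision works, because a segment
  is cut by the subdivision into finitely many points and pieces each lying in one edge, and a
  segment and an edge measure their overlap in the same way.\<close>

lemma is_arc_length_exists: "\<exists>m::'a::metrized_graph measure. is_arc_length m"
proof -
  obtain V and E :: "((real \<Rightarrow> 'a) \<times> real) set" where sub: "subdivision V E"
    using subdivision_exists[of "{}::'a set"] by blast
  note D = subdivisionD[OF sub]
  define \<mu> where "\<mu> X = (\<Sum>e\<in>E. emeasure (edge_mass e) X)" for X :: "'a set"
  define m where "m = measure_of UNIV (sets borel) \<mu>"
  have sm: "sets m = sets borel" unfolding m_def using sets.sigma_sets_eq[of "borel :: 'a measure"] by simp
  have sE: "sets (edge_mass e) = sets borel" for e :: "(real \<Rightarrow> 'a) \<times> real" by (simp add: edge_mass_def)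
  have em: "emeasure m X = \<mu> X" if "X \<in> sets borel" for X
  proof (rule emeasure_measure_of[OF m_def])
    show "positive (sets m) \<mu>" by (auto simp: positive_def \<mu>_def)
    show "countably_additive (sets m) \<mu>"
      unfolding countably_additive_def
    proof (intro allI impI)
      fix A :: "nat \<Rightarrow> 'a set" assume A: "range A \<subseteq> sets m" "disjoint_family A"
      have "(\<Sum>i. \<mu> (A i)) = (\<Sum>e\<in>E. \<Sum>i. emeasure (edge_mass e) (A i))"
        unfolding \<mu>_def by (rule suminf_sum) simp
      also have "\<dots> = (\<Sum>e\<in>E. emeasure (edge_mass e) (\<Union>i. A i))"
        using A by (intro sum.cong refl suminf_emeasure) (auto simp: sE sm)
      finally show "(\<Sum>i. \<mu> (A i)) = \<mu> (\<Union>i. A i)" by (simp add: \<mu>_def)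
    qed
  qed (use that sm in \<open>auto simp: sets.space_closed\<close>)
  have "emeasure m (\<gamma> ` A) = emeasure lborel A"
    if \<gamma>: "isom_on {a..b} \<gamma>" and A: "A \<in> sets borel" "A \<subseteq> {a..b}" for \<gamma> :: "real \<Rightarrow> 'a" and a b A
  proof -
    have g: "\<gamma> ` A \<in> sets borel" by (rule isom_on_image_borel[OF \<gamma> A])
    define Ae where "Ae e = A \<inter> ({a..b} \<inter> \<gamma> -` open_edge e)" for e
    define Av where "Av = A \<inter> ({a..b} \<inter> \<gamma> -` V)"
    have Ae: "Ae e \<in> sets borel" if "e \<in> E" for e
      unfolding Ae_def using A D(6)[OF that] by (intro sets.Int isom_on_vimage_borel[OF \<gamma>]) auto
    have "finite Av"
    proof (rule finite_imageD)
      show "finite (\<gamma> ` Av)" by (rule finite_subset[OF _ D(1)]) (auto simp: Av_def)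
      show "inj_on \<gamma> Av" by (rule inj_on_subset[OF isom_on_inj[OF \<gamma>]]) (auto simp: Av_def)
    qed
    then have Av: "emeasure lborel Av = 0" "Av \<in> sets borel"
      by (auto simp: emeasure_lborel_countable countable_finite finite_imp_closed intro: borel_closed)
    have un: "A = Av \<union> (\<Union>e\<in>E. Ae e)"
    proof -
      have *: "\<gamma> s \<in> V \<or> (\<exists>e\<in>E. \<gamma> s \<in> open_edge e)" for s using D(3) by blast
      have "s \<in> Av \<or> (\<exists>e\<in>E. s \<in> Ae e)" if "s \<in> A" for s
        using *[of s] that A(2) unfolding Ae_def Av_def by auto
      moreover have "Av \<subseteq> A" "\<And>e. Ae e \<subseteq> A" by (auto simp: Ae_def Av_def)
      ultimately show ?thesis by blast
    qed
    have disj: "disjoint_family_on Ae E"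
      unfolding disjoint_family_on_def
    proof (intro ballI impI)
      fix e e' assume "e \<in> E" "e' \<in> E" "e \<noteq> e'"
      then have "open_edge e \<inter> open_edge e' = {}" by (rule disjoint_family_onD[OF D(4)])
      then show "Ae e \<inter> Ae e' = {}" unfolding Ae_def by blast
    qed
    have "emeasure lborel A = emeasure lborel (Av \<union> (\<Union>e\<in>E. Ae e))" using un by simp
    also have "\<dots> = emeasure lborel Av + emeasure lborel (\<Union>e\<in>E. Ae e)"
    proof (rule plus_emeasure[symmetric])
      show "(\<Union>e\<in>E. Ae e) \<in> sets lborel" using Ae D(2) by (intro sets.finite_UN) auto
      show "Av \<inter> (\<Union>e\<in>E. Ae e) = {}" using D(3) unfolding Av_def Ae_def by blast
    qed (use Av in auto)
    also have "emeasure lborel (\<Union>e\<in>E. Ae e) = (\<Sum>e\<in>E. emeasure lborel (Ae e))"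
      using Ae D(2) disj by (intro sum_emeasure[symmetric]) auto
    also have "(\<Sum>e\<in>E. emeasure lborel (Ae e)) = (\<Sum>e\<in>E. emeasure (edge_mass e) (\<gamma> ` A))"
    proof (rule sum.cong[OF refl])
      fix e assume e: "e \<in> E"
      have "emeasure lborel ({0<..<snd e} \<inter> fst e -` (\<gamma> ` A)) = emeasure lborel (Ae e)"
      proof (rule isom_on_overlap[OF \<gamma> isom_arc_isom_on[OF D(5)[OF e]] Ae[OF e]])
        show "\<gamma> ` Ae e = fst e ` ({0<..<snd e} \<inter> fst e -` \<gamma> ` A)"
        proof (intro equalityI subsetI)
          fix y assume "y \<in> \<gamma> ` Ae e"
          then obtain s t where st: "y = \<gamma> s" "s \<in> A" "\<gamma> s = fst e t" "t \<in> {0<..<snd e}" by (auto simp: Ae_def)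
          then have "t \<in> fst e -` \<gamma> ` A" by force
          with st show "y \<in> fst e ` ({0<..<snd e} \<inter> fst e -` \<gamma> ` A)" by blast
        next
          fix y assume "y \<in> fst e ` ({0<..<snd e} \<inter> fst e -` \<gamma> ` A)"
          then obtain s t where st: "y = fst e t" "t \<in> {0<..<snd e}" "fst e t = \<gamma> s" "s \<in> A" by auto
          then have "\<gamma> s \<in> open_edge e" by force
          with st A(2) have "s \<in> Ae e" by (auto simp: Ae_def)
          with st show "y \<in> \<gamma> ` Ae e" by auto
        qed
      qed (auto simp: Ae_def)
      then show "emeasure lborel (Ae e) = emeasure (edge_mass e) (\<gamma> ` A)"
        by (simp add: emeasure_edge_mass[OF D(5)[OF e] g])
    qed
    finally show ?thesis using Av(1) em[OF g] by (simp add: \<mu>_def)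
  qed
  then have "is_arc_length m" unfolding is_arc_length_def using sm by (auto simp: isom_on_def)
  then show ?thesis by blast
qed

lemma is_arc_length_arc_length: "is_arc_length (arc_length :: 'a::metrized_graph measure)"
proof -
  obtain m :: "'a measure" where m: "is_arc_length m" using is_arc_length_exists by blast
  obtain V and E :: "((real \<Rightarrow> 'a) \<times> real) set" where sub: "subdivision V E"
    using subdivision_exists[of "{}::'a set"] by blast
  have "is_arc_length (THE m::'a measure. is_arc_length m)"
  proof (rule theI[of is_arc_length, OF m])
    fix m' :: "'a measure" assume m': "is_arc_length m'"
    show "m' = m"
      by (rule measure_eqI)
        (simp_all add: is_arc_lengthD(1)[OF m] is_arc_lengthD(1)[OF m'] is_arc_length_formula[OF m sub] is_arc_length_formula[OF m' sub])
  qed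
  then show ?thesis unfolding arc_length_def is_arc_length_def .
qed

lemma sets_arc_length [measurable_cong, simp]: "sets (arc_length :: 'a::metrized_graph measure) = sets borel"
  by (rule is_arc_lengthD(1)[OF is_arc_length_arc_length])

lemma space_arc_length [simp]: "space (arc_length :: 'a::metrized_graph measure) = UNIV"
  using sets_eq_imp_space_eq[OF sets_arc_length] by simp

lemma measurable_arc_length [simp]: "measurable (arc_length :: 'a::metrized_graph measure) N = measurable borel N"
  by (rule measurable_cong_sets) auto

lemmas arc_length_formula = is_arc_length_formula[OF is_arc_length_arc_length]
lemmas arc_length_singleton = is_arc_length_singleton[OF is_arc_length_arc_length]

lemma finite_measure_arc_length: "finite_measure (arc_length :: 'a::metrized_graph measure)"
proof (rule finite_measureI)
  obtain V and E :: "((real \<Rightarrow> 'a) \<times> real) set" where sub: "subdivision V E"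
    using subdivision_exists[of "{}::'a set"] by blast
  note D = subdivisionD[OF sub]
  have "emeasure (edge_mass e) UNIV < top" if "e \<in> E" for e
    using D(5)[OF that] by (subst emeasure_edge_mass) (auto dest: isom_arc_pos)
  then show "emeasure (arc_length :: 'a measure) (space arc_length) \<noteq> \<infinity>"
    using D(2) by (auto simp: arc_length_formula[OF sub] less_top[symmetric])
qed

lemma density_edge:
  assumes sub: "subdivision V E" and e: "e \<in> E"
  shows "density arc_length (\<lambda>x. ennreal (indicator (open_edge e) x)) = edge_mass e"
proof (rule measure_eqI)
  note D = subdivisionD[OF sub]
  show s: "sets (density arc_length (\<lambda>x. ennreal (indicator (open_edge e) x))) = sets (edge_mass e)"
    by (simp add: edge_mass_def)
  fix X assume "X \<in> sets (density arc_length (\<lambda>x. ennreal (indicator (open_edge e) x)))"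
  then have X: "X \<in> sets borel" by simp
  have I: "open_edge e \<in> sets borel" using D(6)[OF e] by simp
  have "emeasure (density arc_length (\<lambda>x. ennreal (indicator (open_edge e) x))) X
      = emeasure arc_length (open_edge e \<inter> X)"
    using X I by (subst emeasure_density) (auto simp: ennreal_indicator nn_integral_indicator[symmetric] indicator_inter_arith[symmetric] simp del: nn_integral_indicator)
  also have "\<dots> = (\<Sum>e'\<in>E. emeasure (edge_mass e') (open_edge e \<inter> X))"
    using X I by (intro arc_length_formula[OF sub]) auto
  also have "\<dots> = (\<Sum>e'\<in>E. if e' = e then emeasure (edge_mass e) X else 0)"
  proof (rule sum.cong[OF refl])
    fix e' assume e': "e' \<in> E"
    show "emeasure (edge_mass e') (open_edge e \<inter> X) = (if e' = e then emeasure (edge_mass e) X else 0)"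
    proof (cases "e' = e")
      case True
      have "{0<..<snd e} \<inter> fst e -` (open_edge e \<inter> X) = {0<..<snd e} \<inter> fst e -` X" by auto
      then show ?thesis using True X I by (simp add: emeasure_edge_mass[OF D(5)[OF e]])
    next
      case False
      then have "open_edge e' \<inter> open_edge e = {}" by (rule disjoint_family_onD[OF D(4) e' e])
      then have "{0<..<snd e'} \<inter> fst e' -` (open_edge e \<inter> X) = {}" by auto
      then show ?thesis using False X I by (simp add: emeasure_edge_mass[OF D(5)[OF e']])
    qed
  qed
  also have "\<dots> = emeasure (edge_mass e) X" using D(2) e by simp
  finally show "emeasure (density arc_length (\<lambda>x. ennreal (indicator (open_edge e) x))) X = emeasure (edge_mass e) X" .
qed

lemma integral_on_edge:
  fixes F :: "'a::metrized_graph \<Rightarrow> 'b::{banach, second_countable_topology}"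
  assumes sub: "subdivision V E" and e: "e \<in> E" and F: "F \<in> borel_measurable borel"
  shows "set_integrable arc_length (open_edge e) F \<longleftrightarrow> set_integrable lborel {0<..<snd e} (\<lambda>t. F (fst e t))"
    and "(LINT x:(open_edge e)|arc_length. F x) = (LINT t:{0<..<snd e}|lborel. F (fst e t))"
proof -
  note D = subdivisionD[OF sub]
  have I: "open_edge e \<in> sets borel" using D(6)[OF e] by simp
  have g: "fst e \<in> measurable (restrict_space lborel {0<..<snd e}) borel" by (rule edge_measurable[OF D(5)[OF e]])
  have "set_integrable arc_length (open_edge e) F \<longleftrightarrow> integrable (edge_mass e) F"
    unfolding density_edge[OF sub e, symmetric] set_integrable_def
    using F I by (subst integrable_density) auto
  also have "\<dots> \<longleftrightarrow> set_integrable lborel {0<..<snd e} (\<lambda>t. F (fst e t))"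
    unfolding edge_mass_def set_integrable_def
    by (subst integrable_distr_eq[OF g F], subst integrable_restrict_space) auto
  finally show "set_integrable arc_length (open_edge e) F \<longleftrightarrow> set_integrable lborel {0<..<snd e} (\<lambda>t. F (fst e t))" .
  have "(LINT x:(open_edge e)|arc_length. F x) = integral\<^sup>L (edge_mass e) F"
    unfolding density_edge[OF sub e, symmetric] set_lebesgue_integral_def
    using F I by (subst integral_density) auto
  also have "\<dots> = (LINT t:{0<..<snd e}|lborel. F (fst e t))"
    unfolding edge_mass_def set_lebesgue_integral_def
    by (subst integral_distr[OF g F], subst integral_restrict_space) auto
  finally show "(LINT x:(open_edge e)|arc_length. F x) = (LINT t:{0<..<snd e}|lborel. F (fst e t))" .
qed

lemma AE_not_in_finite:
  assumes "finite (V :: 'a::metrized_graph set)" shows "AE x in arc_length. x \<notin> V"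
proof (rule AE_I')
  have "emeasure arc_length V = (\<Sum>p\<in>V. emeasure arc_length {p})"
    using assms by (intro emeasure_eq_sum_singleton) auto
  then show "V \<in> null_sets arc_length"
    using assms by (auto simp: null_sets_def arc_length_singleton finite_imp_closed intro!: borel_closed)
qed auto

lemma arc_length_integral_edges:
  fixes F :: "'a::metrized_graph \<Rightarrow> 'b::{banach, second_countable_topology}"
  assumes sub: "subdivision V E" and F: "F \<in> borel_measurable borel"
    and int: "\<And>e. e \<in> E \<Longrightarrow> set_integrable lborel {0<..<snd e} (\<lambda>t. F (fst e t))"
  shows "integrable arc_length F"
    and "(LINT x|arc_length. F x) = (\<Sum>e\<in>E. LINT t:{0<..<snd e}|lborel. F (fst e t))"
proof -
  note D = subdivisionD[OF sub]
  let ?G = "\<lambda>x. \<Sum>e\<in>E. indicator (open_edge e) x *\<^sub>R F x"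
  have intE: "integrable arc_length (\<lambda>x. indicator (open_edge e) x *\<^sub>R F x)" if "e \<in> E" for e
    using int[OF that] integral_on_edge(1)[OF sub that F] by (simp add: set_integrable_def)
  have eq: "?G x = F x" if "x \<notin> V" for x
  proof -
    obtain e where e: "e \<in> E" "x \<in> open_edge e" by (rule subdivision_cover[OF sub \<open>x \<notin> V\<close>])
    have "?G x = (\<Sum>e'\<in>E. if e' = e then F x else 0)"
    proof (rule sum.cong[OF refl])
      fix e' assume e': "e' \<in> E"
      have "x \<notin> open_edge e'" if "e' \<noteq> e"
        using subdivision_unique[OF sub e' e(1) _ e(2)] that by auto
      then show "indicator (open_edge e') x *\<^sub>R F x = (if e' = e then F x else 0)"
        using e(2) by (cases "e' = e") (simp_all only: indicator_simps if_True if_False scaleR_one scaleR_zero_left refl not_False_eq_True)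
    qed
    also have "\<dots> = F x" using D(2) e(1) by simp
    finally show ?thesis .
  qed
  have ae: "AE x in arc_length. ?G x = F x"
    using AE_not_in_finite[OF D(1)] by eventually_elim (rule eq)
  have iG: "integrable arc_length ?G" using intE by (intro Bochner_Integration.integrable_sum) auto
  show "integrable arc_length F"
    using integrable_cong_AE_imp[OF iG _ ae] F by simp
  have "(LINT x|arc_length. F x) = (LINT x|arc_length. ?G x)"
    using ae iG F by (intro integral_cong_AE) (auto simp: borel_measurable_integrable)
  also have "\<dots> = (\<Sum>e\<in>E. LINT x:(open_edge e)|arc_length. F x)"
    unfolding set_lebesgue_integral_def using intE by (intro Bochner_Integration.integral_sum) auto
  also have "\<dots> = (\<Sum>e\<in>E. LINT t:{0<..<snd e}|lborel. F (fst e t))"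
    by (intro sum.cong refl integral_on_edge(2)[OF sub _ F])
  finally show "(LINT x|arc_length. F x) = (\<Sum>e\<in>E. LINT t:{0<..<snd e}|lborel. F (fst e t))" .
qed

lemma borel_measurable_edges:
  fixes F :: "'a::metrized_graph \<Rightarrow> 'b::topological_space"
  assumes sub: "subdivision V E"
    and F: "\<And>e. e \<in> E \<Longrightarrow> continuous_on {0<..<snd e} (\<lambda>t. F (fst e t))"
  shows "F \<in> borel_measurable borel"
proof (rule borel_measurableI)
  note D = subdivisionD[OF sub]
  fix S :: "'b set" assume S: "open S"
  have "F -` S \<inter> space borel = (F -` S \<inter> V) \<union> (\<Union>e\<in>E. fst e ` ({0<..<snd e} \<inter> (\<lambda>t. F (fst e t)) -` S))"
  proof -
    have "x \<in> V \<or> (\<exists>e\<in>E. x \<in> open_edge e)" for x using D(3) by blast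
    then show ?thesis by fastforce
  qed
  moreover have "fst e ` ({0<..<snd e} \<inter> (\<lambda>t. F (fst e t)) -` S) \<in> sets borel" if e: "e \<in> E" for e
  proof (rule isom_on_image_borel[OF isom_arc_isom_on[OF D(5)[OF e]]])
    show "{0<..<snd e} \<inter> (\<lambda>t. F (fst e t)) -` S \<in> sets borel"
      using continuous_open_preimage[OF F[OF e] _ S] by auto
  qed auto
  moreover have "F -` S \<inter> V \<in> sets borel" using D(1) by (auto intro!: borel_closed finite_imp_closed)
  ultimately show "F -` S \<inter> space borel \<in> sets borel" using D(2) by (simp only: sets.Un sets.finite_UN)
qed

section \<open>Connected open sets have finite frontier\<close>

lemma edge_interval_open:
  assumes "isom_arc \<gamma> l" "open (\<gamma> ` {0<..<l})" "0 \<le> a" "b \<le> l"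
  shows "open (\<gamma> ` {a<..<b})"
proof -
  have "continuous_on (\<gamma> ` {0..l}) (inv_into {0..l} \<gamma>)"
    by (rule isom_on_inv_continuous[OF isom_arc_isom_on[OF assms(1)]])
  then have c: "continuous_on (\<gamma> ` {0<..<l}) (inv_into {0..l} \<gamma>)"
    by (rule continuous_on_subset) auto
  have inv: "inv_into {0..l} \<gamma> (\<gamma> t) = t" if "t \<in> {0..l}" for t
    by (rule inv_into_f_f[OF isom_arc_inj[OF assms(1)] that])
  have "\<gamma> ` {a<..<b} = \<gamma> ` {0<..<l} \<inter> inv_into {0..l} \<gamma> -` {a<..<b}"
  proof (intro equalityI subsetI)
    fix x assume "x \<in> \<gamma> ` {a<..<b}"
    then obtain t where "x = \<gamma> t" "t \<in> {a<..<b}" by blast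
    with inv[of t] assms(3,4) show "x \<in> \<gamma> ` {0<..<l} \<inter> inv_into {0..l} \<gamma> -` {a<..<b}" by auto
  next
    fix x assume "x \<in> \<gamma> ` {0<..<l} \<inter> inv_into {0..l} \<gamma> -` {a<..<b}"
    then obtain t where "x = \<gamma> t" "t \<in> {0<..<l}" "inv_into {0..l} \<gamma> x \<in> {a<..<b}" by blast
    with inv[of t] show "x \<in> \<gamma> ` {a<..<b}" by auto
  qed
  then show ?thesis using continuous_open_preimage[OF c assms(2), of "{a<..<b}"] by simp
qed

text \<open>Near \<open>\<gamma> t2\<close> there are points of \<open>U\<close> between \<open>\<gamma> t1\<close> and \<open>\<gamma> t3\<close>. The points \<open>\<gamma> t1\<close> and \<open>\<gamma>
  t3\<close> are not in the open set \<open>U\<close>, so the connected set \<open>U\<close> cannot leave the open arc between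
  them.\<close>

lemma frontier_on_edge_three:
  fixes U :: "'a::metrized_graph set"
  assumes \<gamma>: "isom_arc \<gamma> l" "open (\<gamma> ` {0<..<l})" and U: "open U" "connected U"
    and t: "0 < t1" "t1 < t2" "t2 < t3" "t3 < l"
    and fr: "\<gamma> t1 \<in> frontier U" "\<gamma> t2 \<in> frontier U" "\<gamma> t3 \<in> frontier U"
    and s: "0 < s" "s < l" "\<gamma> s \<in> frontier U"
  shows "t1 \<le> s \<and> s \<le> t3"
proof -
  have nU: "x \<notin> U" if "x \<in> frontier U" for x using that U(1) frontier_disjoint_eq by blast
  have g: "isom_arc (\<lambda>t. \<gamma> (t1 + t)) (t3 - t1)" using t by (intro isom_arc_sub[OF \<gamma>(1)]) auto
  have img: "(\<lambda>t. \<gamma> (t1 + t)) ` {0<..<t3 - t1} = \<gamma> ` {t1<..<t3}"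
  proof (intro equalityI subsetI)
    fix y assume "y \<in> \<gamma> ` {t1<..<t3}"
    then obtain u where "y = \<gamma> u" "t1 < u" "u < t3" by auto
    then show "y \<in> (\<lambda>t. \<gamma> (t1 + t)) ` {0<..<t3 - t1}" by (intro image_eqI[of _ _ "u - t1"]) auto
  qed auto
  have op: "open (\<gamma> ` {t1<..<t3})" using t by (intro edge_interval_open[OF \<gamma>]) auto
  have fr13: "frontier (\<gamma> ` {t1<..<t3}) = {\<gamma> t1, \<gamma> t3}"
    using isom_arc_frontier[OF g] op by (simp add: img)
  have cl13: "closure (\<gamma> ` {t1<..<t3}) = \<gamma> ` {t1<..<t3} \<union> {\<gamma> t1, \<gamma> t3}"
    using closure_Un_frontier[of "\<gamma> ` {t1<..<t3}"] fr13 by simp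
  have "\<gamma> t2 \<in> closure U" using fr(2) by (simp add: frontier_def)
  then have "U \<inter> \<gamma> ` {t1<..<t3} \<noteq> {}"
    using open_Int_closure_eq_empty[OF op, of U] t by (metis IntI greaterThanLessThan_iff imageI Int_commute emptyE)
  moreover have "U \<inter> frontier (\<gamma> ` {t1<..<t3}) = {}" using nU[OF fr(1)] nU[OF fr(3)] by (simp add: fr13)
  ultimately have "U \<subseteq> \<gamma> ` {t1<..<t3}"
    using connected_Int_frontier[OF U(2), of "\<gamma> ` {t1<..<t3}"] by (metis Diff_eq_empty_iff)
  then have "closure U \<subseteq> \<gamma> ` {t1<..<t3} \<union> {\<gamma> t1, \<gamma> t3}" using closure_mono cl13 by metis
  moreover have "\<gamma> s \<in> closure U" using s(3) by (simp add: frontier_def)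
  ultimately have "\<gamma> s \<in> \<gamma> ` {t1<..<t3} \<union> {\<gamma> t1, \<gamma> t3}" by blast
  moreover have "\<gamma> ` {t1<..<t3} \<union> {\<gamma> t1, \<gamma> t3} \<subseteq> \<gamma> ` {t1..t3}" using t by auto
  ultimately have "\<gamma> s \<in> \<gamma> ` {t1..t3}" by (rule rev_subsetD)
  then obtain u where u: "t1 \<le> u" "u \<le> t3" "\<gamma> s = \<gamma> u" by auto
  then have "s = u" using isom_arc_eq_iff[OF \<gamma>(1), of s u] s t by simp
  then show ?thesis using u by simp
qed

text \<open>The hypothesis excludes four elements \<open>a < b < c < s\<close>.\<close>

lemma finite_reals_between:
  fixes T :: "real set"
  assumes "\<And>a b c s. a \<in> T \<Longrightarrow> b \<in> T \<Longrightarrow> c \<in> T \<Longrightarrow> s \<in> T \<Longrightarrow> a < b \<Longrightarrow> b < c \<Longrightarrow> a \<le> s \<and> s \<le> c"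
  shows "finite T"
proof (rule ccontr)
  assume "infinite T"
  then obtain B where B: "finite B" "card B = 4" "B \<subseteq> T" using infinite_arbitrarily_large by blast
  define xs where "xs = sorted_list_of_set B"
  have xs: "sorted xs" "distinct xs" "set xs = B" "length xs = 4"
    using B by (auto simp: xs_def)
  have lt: "xs ! i < xs ! j" if "i < j" "j < 4" for i j
    using xs that by (metis less_le sorted_nth_mono nth_eq_iff_index_eq order.strict_trans less_imp_le_nat not_less_iff_gr_or_eq)
  have T: "xs ! i \<in> T" if "i < 4" for i using that xs B(3) by (metis nth_mem subsetD)
  have "xs ! 3 \<le> xs ! 2" using assms[OF T[of 0] T[of 1] T[of 2] T[of 3]] lt by simp
  then show False using lt[of 2 3] by simp
qed

text \<open>An edge carries at most three frontier points. The result makes the sums defining \<^const>\<open>m_set\<close>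
  finite, and it lets the frontiers of finitely many pieces be added to the vertices of a
  subdivision.\<close>

lemma connected_open_finite_frontier:
  fixes U :: "'a::metrized_graph set"
  assumes "open U" "connected U"
  shows "finite (frontier U)"
proof -
  obtain V and E :: "((real \<Rightarrow> 'a) \<times> real) set" where sub: "subdivision V E"
    using subdivision_exists[of "{}::'a set"] by blast
  note D = subdivisionD[OF sub]
  have "finite (frontier U \<inter> open_edge e)" if e: "e \<in> E" for e
  proof -
    let ?T = "{t\<in>{0<..<snd e}. fst e t \<in> frontier U}"
    have "finite ?T"
    proof (rule finite_reals_between)
      fix a b c s assume *: "a \<in> ?T" "b \<in> ?T" "c \<in> ?T" "s \<in> ?T" "a < b" "b < c"
      show "a \<le> s \<and> s \<le> c"
        by (rule frontier_on_edge_three[OF D(5,6)[OF e] assms, of a b c s]) (use * in auto)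
    qed
    moreover have "frontier U \<inter> open_edge e \<subseteq> fst e ` ?T" by auto
    ultimately show ?thesis using finite_surj by blast
  qed
  then have "finite (V \<union> (\<Union>e\<in>E. frontier U \<inter> open_edge e))" using D(1,2) by (intro finite_UnI finite_UN_I)
  moreover have "frontier U \<subseteq> V \<union> (\<Union>e\<in>E. frontier U \<inter> open_edge e)"
  proof
    fix x assume x: "x \<in> frontier U"
    show "x \<in> V \<union> (\<Union>e\<in>E. frontier U \<inter> open_edge e)"
    proof (cases "x \<in> V")
      case False
      then obtain e where "e \<in> E" "x \<in> open_edge e" by (rule subdivision_cover[OF sub])
      then show ?thesis using x by (intro UnI2 UN_I[of e] IntI)
    qed simp
  qed
  ultimately show ?thesis by (rule finite_subset[rotated])
qed

section \<open>Piecewise conditions on the edges of a fine subdivision\<close>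

text \<open>Stability under restriction to a subinterval and under isometric changes of parameter. A
  condition with this property can be tested on the edges of every sufficiently fine subdivision.\<close>

definition reparam_closed :: "(real \<Rightarrow> real \<Rightarrow> (real \<Rightarrow> complex) \<Rightarrow> bool) \<Rightarrow> bool" where
  "reparam_closed P \<longleftrightarrow> (\<forall>a b h a' b' c \<sigma> u. P a b h \<longrightarrow> \<sigma> = 1 \<or> \<sigma> = -1 \<longrightarrow> a' < b' \<longrightarrow>
     (\<forall>t\<in>{a'<..<b'}. c + \<sigma> * t \<in> {a<..<b} \<and> u t = h (c + \<sigma> * t)) \<longrightarrow> P a' b' u)"

lemma reparam_closedD:
  assumes "reparam_closed P" "P a b h" "\<sigma> = 1 \<or> \<sigma> = -1" "a' < b'"
    "\<And>t. t \<in> {a'<..<b'} \<Longrightarrow> c + \<sigma> * t \<in> {a<..<b} \<and> u t = h (c + \<sigma> * t)"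
  shows "P a' b' u"
  using assms unfolding reparam_closed_def by blast

lemma deriv_locally_affine:
  assumes "open N" "t0 \<in> N" "\<And>t. t \<in> N \<Longrightarrow> \<tau> t = c + \<sigma> * t" "t \<in> N"
  shows "deriv \<tau> t = (\<sigma>::real)"
proof (rule DERIV_imp_deriv)
  have "((\<lambda>t. c + \<sigma> * t) has_field_derivative \<sigma>) (at t)" by (auto intro!: derivative_eq_intros)
  then show "(\<tau> has_field_derivative \<sigma>) (at t)"
    by (rule has_field_derivative_transform_within_open[OF _ assms(1,4)]) (simp add: assms(3))
qed

text \<open>As \<open>\<gamma>\<close> is isometric only locally, the change of parameter is at first only locally affine
  with slope \<open>1\<close> or \<open>-1\<close>; slope and constant term are then constant on the connected interval.\<close>

lemma interval_param_affine:
  assumes ip: "interval_param a b \<gamma> U" and g: "isom_arc g l" and sub: "g ` {0<..<l} \<subseteq> U"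
  obtains c \<sigma> where "\<sigma> = 1 \<or> \<sigma> = -1" "\<And>t. t \<in> {0<..<l} \<Longrightarrow> c + \<sigma> * t \<in> {a<..<b} \<and> g t = \<gamma> (c + \<sigma> * t)"
proof -
  obtain \<delta> where hom: "homeomorphism {a<..<b} U \<gamma> \<delta>" using ip by (auto simp: interval_param_def)
  define \<tau> where "\<tau> t = \<delta> (g t)" for t
  have \<tau>: "\<tau> t \<in> {a<..<b}" "\<gamma> (\<tau> t) = g t" if "t \<in> {0<..<l}" for t
  proof -
    have "g t \<in> U" using that sub by auto
    then show "\<tau> t \<in> {a<..<b}" "\<gamma> (\<tau> t) = g t"
      using hom unfolding homeomorphism_def \<tau>_def by auto
  qed
  have cont: "continuous_on {0<..<l} \<tau>"
  proof -
    have 1: "continuous_on {0<..<l} g" by (rule continuous_on_subset[OF isom_arc_continuous[OF g]]) auto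
    have 2: "continuous_on (g ` {0<..<l}) \<delta>"
      by (rule continuous_on_subset[OF homeomorphism_cont2[OF hom] sub])
    show ?thesis unfolding \<tau>_def by (rule continuous_on_compose2[OF 2 1 order_refl])
  qed
  have loc: "\<exists>N c \<sigma>. open N \<and> t0 \<in> N \<and> N \<subseteq> {0<..<l} \<and> (\<sigma> = 1 \<or> \<sigma> = -1) \<and> (\<forall>t\<in>N. \<tau> t = c + \<sigma> * t)"
    if t0: "t0 \<in> {0<..<l}" for t0
  proof -
    have "\<forall>t\<in>{a<..<b}. \<exists>\<epsilon>>0. \<forall>s\<in>{a<..<b}. \<forall>s'\<in>{a<..<b}.
        \<bar>s - t\<bar> < \<epsilon> \<longrightarrow> \<bar>s' - t\<bar> < \<epsilon> \<longrightarrow> dist (\<gamma> s) (\<gamma> s') = \<bar>s - s'\<bar>"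
      using ip unfolding interval_param_def by (elim conjE)
    from bspec[OF this \<tau>(1)[OF t0]] obtain \<epsilon> where e0: "\<epsilon> > 0" "\<forall>s\<in>{a<..<b}. \<forall>s'\<in>{a<..<b}.
        \<bar>s - \<tau> t0\<bar> < \<epsilon> \<longrightarrow> \<bar>s' - \<tau> t0\<bar> < \<epsilon> \<longrightarrow> dist (\<gamma> s) (\<gamma> s') = \<bar>s - s'\<bar>" by (elim exE conjE)
    have e: "\<epsilon> > 0" "dist (\<gamma> s) (\<gamma> s') = \<bar>s - s'\<bar>"
      if "s \<in> {a<..<b}" "s' \<in> {a<..<b}" "\<bar>s - \<tau> t0\<bar> < \<epsilon>" "\<bar>s' - \<tau> t0\<bar> < \<epsilon>" for s s'
      using e0(1) mp[OF mp[OF bspec[OF bspec[OF e0(2) that(1)] that(2)] that(3)] that(4)] by simp_all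
    define N where "N = {0<..<l} \<inter> \<tau> -` ball (\<tau> t0) \<epsilon>"
    have N: "open N" "t0 \<in> N" "N \<subseteq> {0<..<l}"
      using continuous_open_preimage[OF cont, of "ball (\<tau> t0) \<epsilon>"] t0 e0(1) by (auto simp: N_def)
    have "\<bar>\<tau> s - \<tau> t\<bar> = \<bar>s - t\<bar>" if "s \<in> N" "t \<in> N" for s t
    proof -
      have st: "s \<in> {0<..<l}" "t \<in> {0<..<l}" "\<bar>\<tau> s - \<tau> t0\<bar> < \<epsilon>" "\<bar>\<tau> t - \<tau> t0\<bar> < \<epsilon>"
        using that by (auto simp: N_def dist_real_def abs_minus_commute)
      have "\<bar>\<tau> s - \<tau> t\<bar> = dist (\<gamma> (\<tau> s)) (\<gamma> (\<tau> t))" using e(2)[OF \<tau>(1)[OF st(1)] \<tau>(1)[OF st(2)] st(3,4)] by simp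
      also have "\<dots> = dist (g s) (g t)" using \<tau>(2)[OF st(1)] \<tau>(2)[OF st(2)] by simp
      also have "\<dots> = \<bar>s - t\<bar>" using isom_arc_dist[OF g, of s t] st by simp
      finally show ?thesis .
    qed
    then obtain c \<sigma> where "\<sigma> = 1 \<or> \<sigma> = -1" "\<And>s. s \<in> N \<Longrightarrow> \<tau> s = c + \<sigma> * s"
      using real_isometry_affine[of N \<tau>] by metis
    then have "open N \<and> t0 \<in> N \<and> N \<subseteq> {0<..<l} \<and> (\<sigma> = 1 \<or> \<sigma> = -1) \<and> (\<forall>t\<in>N. \<tau> t = c + \<sigma> * t)"
      using N by simp
    then show ?thesis by (intro exI)
  qed
  have conn: "connected {0<..<l}" by simp
  have m: "l/2 \<in> {0<..<l}" using isom_arc_pos[OF g] by simp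
  define \<sigma> where "\<sigma> = deriv \<tau> (l/2)"
  have d: "deriv \<tau> t = \<sigma>" if "t \<in> {0<..<l}" for t
    unfolding \<sigma>_def
  proof (rule connected_local_const[OF conn that m], intro ballI)
    fix x assume x: "x \<in> {0<..<l}"
    from loc[OF x] obtain N c s where N: "open N" "x \<in> N" "\<forall>t\<in>N. \<tau> t = c + s * t" by (elim exE conjE)
    have "deriv \<tau> y = s" if "y \<in> N" for y by (rule deriv_locally_affine[OF N(1,2) bspec[OF N(3)] that])
    then have "\<forall>y\<in>N. deriv \<tau> x = deriv \<tau> y" using N(2) by simp
    then show "eventually (\<lambda>y. deriv \<tau> x = deriv \<tau> y) (at x within {0<..<l})"
      unfolding eventually_at_topological by (intro exI[of _ N]) (use N(1,2) in simp)
  qed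
  from loc[OF m] obtain N c0 s0 where N0: "open N" "l/2 \<in> N" "s0 = 1 \<or> s0 = -1" "\<forall>t\<in>N. \<tau> t = c0 + s0 * t"
    by (elim exE conjE)
  have \<sigma>: "\<sigma> = 1 \<or> \<sigma> = -1" using deriv_locally_affine[OF N0(1,2) bspec[OF N0(4)] N0(2)] N0(3) \<sigma>_def by simp
  define c where "c = \<tau> (l/2) - \<sigma> * (l/2)"
  have c: "\<tau> t - \<sigma> * t = c" if "t \<in> {0<..<l}" for t
    unfolding c_def
  proof (rule connected_local_const[OF conn that m, of "\<lambda>t. \<tau> t - \<sigma> * t"], intro ballI)
    fix x assume x: "x \<in> {0<..<l}"
    from loc[OF x] obtain N c s where N: "open N" "x \<in> N" "\<forall>t\<in>N. \<tau> t = c + s * t" by (elim exE conjE)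
    have "s = \<sigma>" using deriv_locally_affine[OF N(1,2) bspec[OF N(3)] N(2)] d[OF x] by simp
    then have "\<forall>y\<in>N. \<tau> x - \<sigma> * x = \<tau> y - \<sigma> * y" using N by simp
    then show "eventually (\<lambda>y. \<tau> x - \<sigma> * x = \<tau> y - \<sigma> * y) (at x within {0<..<l})"
      unfolding eventually_at_topological by (intro exI[of _ N]) (use N(1,2) in simp)
  qed
  have "\<tau> t = c + \<sigma> * t" if "t \<in> {0<..<l}" for t using c[OF that] by simp
  then show ?thesis using that[OF \<sigma>, of c] \<tau> by metis
qed

lemma interval_param_connected: "interval_param a b \<gamma> U \<Longrightarrow> open U \<and> connected U"
  unfolding interval_param_def homeomorphism_def
  by (metis connected_Ioo connected_continuous_image)

definition on_edges :: "((real \<Rightarrow> 'a) \<times> real) set \<Rightarrow> (real \<Rightarrow> real \<Rightarrow> (real \<Rightarrow> complex) \<Rightarrow> bool) \<Rightarrow> ('a \<Rightarrow> complex) \<Rightarrow> bool" where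
  "on_edges E P f \<longleftrightarrow> (\<forall>e\<in>E. P 0 (snd e) (f \<circ> fst e))"

text \<open>Once the exceptional points and the frontiers of the pieces are vertices, each edge lies
  in a single piece.\<close>

lemma piecewise_on_edges:
  fixes f :: "'a::metrized_graph \<Rightarrow> complex"
  assumes "piecewise P f" "reparam_closed P"
  obtains F where "finite F" "\<And>V E. subdivision V E \<Longrightarrow> F \<subseteq> V \<Longrightarrow> on_edges E P f"
proof -
  obtain X \<U> where XU: "finite X" "finite \<U>" "UNIV - X = \<Union>\<U>"
    "\<And>U. U \<in> \<U> \<Longrightarrow> \<exists>a b \<gamma>. interval_param a b \<gamma> U \<and> P a b (f \<circ> \<gamma>)"
    using assms(1) unfolding piecewise_def by (elim exE conjE) (erule that, assumption+, erule bspec)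
  have conn: "open U \<and> connected U" if U: "U \<in> \<U>" for U
    using XU(4)[OF U] by (elim exE conjE) (rule interval_param_connected)
  define F where "F = X \<union> (\<Union>U\<in>\<U>. frontier U)"
  have F: "finite F" unfolding F_def
    by (intro finite_UnI finite_UN_I XU(1,2) connected_open_finite_frontier) (use conn in auto)
  have "on_edges E P f" if sub: "subdivision V E" and FV: "F \<subseteq> V" for V E
    unfolding on_edges_def
  proof
    fix e assume e: "e \<in> E"
    note D = subdivisionD[OF sub]
    have iV: "open_edge e \<inter> V = {}" by (rule subdivision_inside_V[OF sub e])
    have pos: "0 < snd e" by (rule isom_arc_pos[OF D(5)[OF e]])
    have x: "fst e (snd e / 2) \<in> open_edge e" using pos by simp
    then have "fst e (snd e / 2) \<notin> X" using iV FV by (auto simp: F_def)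
    then have "fst e (snd e / 2) \<in> \<Union>\<U>" unfolding XU(3)[symmetric] by simp
    then obtain U where U: "U \<in> \<U>" "fst e (snd e / 2) \<in> U" by (rule UnionE)
    have "open_edge e \<subseteq> U"
    proof (rule ccontr)
      assume "\<not> open_edge e \<subseteq> U"
      then have "open_edge e - U \<noteq> {}" by auto
      moreover have "open_edge e \<inter> U \<noteq> {}" using IntI[OF x U(2)] by auto
      ultimately have "open_edge e \<inter> frontier U \<noteq> {}"
        by (intro connected_Int_frontier[OF isom_arc_connected_inside[OF D(5)[OF e]]])
      moreover have "frontier U \<subseteq> V" using FV U(1) by (auto simp: F_def)
      ultimately show False using iV by blast
    qed
    note iU = this
    from XU(4)[OF U(1)] obtain a b \<gamma> where ip: "interval_param a b \<gamma> U" "P a b (f \<circ> \<gamma>)" by (elim exE conjE)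
    obtain c \<sigma> where c: "\<sigma> = 1 \<or> \<sigma> = -1"
        "\<And>t. t \<in> {0<..<snd e} \<Longrightarrow> c + \<sigma> * t \<in> {a<..<b} \<and> fst e t = \<gamma> (c + \<sigma> * t)"
      by (rule interval_param_affine[OF ip(1) D(5)[OF e] iU]) (rule that)
    show "P 0 (snd e) (f \<circ> fst e)"
      by (rule reparam_closedD[OF assms(2) ip(2) c(1) pos, where c = c]) (use c(2) in simp)
  qed
  then show ?thesis by (rule that[OF F])
qed

lemma on_edges_piecewise:
  fixes f :: "'a::metrized_graph \<Rightarrow> complex"
  assumes sub: "subdivision V E" and "on_edges E P f"
  shows "piecewise P f"
  unfolding piecewise_def
proof (rule exI[of _ V], rule exI[of _ "open_edge ` E"], intro conjI ballI)
  note D = subdivisionD[OF sub]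
  show "finite V" "finite (open_edge ` E)" using D by auto
  show "UNIV - V = \<Union> (open_edge ` E)" using D(3) by (simp add: Compl_eq_Diff_UNIV)
  fix U assume "U \<in> open_edge ` E"
  then obtain e where e: "e \<in> E" "U = open_edge e" by (rule imageE)
  note i = isom_arc_isom_on[OF D(5)[OF e(1)]]
  have i': "isom_on {0<..<snd e} (fst e)" by (rule isom_on_subset[OF i]) auto
  have inv: "inv_into {0<..<snd e} (fst e) (fst e t) = t" if "t \<in> {0<..<snd e}" for t
    by (rule inv_into_f_f[OF isom_on_inj[OF i'] that])
  have "inv_into {0<..<snd e} (fst e) ` open_edge e = {0<..<snd e}"
    unfolding image_image using inv by simp
  then have "homeomorphism {0<..<snd e} (open_edge e) (fst e) (inv_into {0<..<snd e} (fst e))"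
    unfolding homeomorphism_def
    using isom_on_continuous[OF i'] isom_on_inv_continuous[OF i'] inv by (simp add: f_inv_into_f)
  then have h: "\<exists>\<delta>. homeomorphism {0<..<snd e} (open_edge e) (fst e) \<delta>"
    by (rule exI[of _ "inv_into {0<..<snd e} (fst e)"])
  have "\<forall>t\<in>{0<..<snd e}. \<exists>\<epsilon>>0. \<forall>s\<in>{0<..<snd e}. \<forall>s'\<in>{0<..<snd e}.
        \<bar>s - t\<bar> < \<epsilon> \<longrightarrow> \<bar>s' - t\<bar> < \<epsilon> \<longrightarrow> dist (fst e s) (fst e s') = \<bar>s - s'\<bar>"
    by (intro ballI exI[of _ 1] conjI impI isom_onD[OF i']) auto
  then have "interval_param 0 (snd e) (fst e) U"
    unfolding interval_param_def e(2) by (rule conjI[OF isom_arc_pos[OF D(5)[OF e(1)]] conjI[OF D(6)[OF e(1)] conjI[OF h]]])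
  then show "\<exists>a b \<gamma>. interval_param a b \<gamma> U \<and> P a b (f \<circ> \<gamma>)" using bspec[OF assms(2)[unfolded on_edges_def] e(1)] by (intro exI conjI)
qed

section \<open>Pieces with integrable second derivative\<close>

lemma C2_L1_reparam: "reparam_closed C2_L1"
  unfolding reparam_closed_def
proof (intro allI impI)
  fix a b :: real and h u :: "real \<Rightarrow> complex" and a' b' c \<sigma> :: real
  assume h: "C2_L1 a b h" and \<sigma>: "\<sigma> = 1 \<or> \<sigma> = -1" and ab: "a' < b'"
    and u: "\<forall>t\<in>{a'<..<b'}. c + \<sigma> * t \<in> {a<..<b} \<and> u t = h (c + \<sigma> * t)"
  obtain h' h'' where H: "\<forall>t\<in>{a<..<b}. (h has_vector_derivative h' t) (at t)"
    "\<forall>t\<in>{a<..<b}. (h' has_vector_derivative h'' t) (at t)"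
    "continuous_on {a<..<b} h''" "set_integrable lborel {a<..<b} h''"
    using h unfolding C2_L1_def by (elim exE conjE)
  have chain: "((\<lambda>t. k (c + \<sigma> * t)) has_vector_derivative \<sigma> *\<^sub>R d) (at t)"
    if "(k has_vector_derivative d) (at (c + \<sigma> * t))" for k :: "real \<Rightarrow> complex" and d t
  proof -
    have "((\<lambda>t. c + \<sigma> * t) has_vector_derivative \<sigma>) (at t)" by (auto intro!: derivative_eq_intros)
    from vector_diff_chain_at[OF this that] show ?thesis by (simp add: o_def)
  qed
  have s2: "\<sigma> * \<sigma> = 1" using \<sigma> by auto
  show "C2_L1 a' b' u"
    unfolding C2_L1_def
  proof (intro exI conjI ballI)
    fix t assume t: "t \<in> {a'<..<b'}"
    show "(u has_vector_derivative \<sigma> *\<^sub>R h' (c + \<sigma> * t)) (at t)"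
    proof (rule has_vector_derivative_transform_within_open[OF chain])
      show "(h has_vector_derivative h' (c + \<sigma> * t)) (at (c + \<sigma> * t))" using H(1) u t by blast
      show "t \<in> {a'<..<b'}" by (rule t)
    qed (use u in auto)
    have "(h' has_vector_derivative h'' (c + \<sigma> * t)) (at (c + \<sigma> * t))" using H(2) u t by blast
    from has_vector_derivative_scaleR[OF DERIV_const[of \<sigma>] chain[OF this]]
    show "((\<lambda>t. \<sigma> *\<^sub>R h' (c + \<sigma> * t)) has_vector_derivative h'' (c + \<sigma> * t)) (at t)" by (simp add: s2)
  next
    show "continuous_on {a'<..<b'} (\<lambda>t. h'' (c + \<sigma> * t))"
      by (rule continuous_on_compose2[OF H(3)]) (use u in \<open>auto intro!: continuous_intros\<close>)
    have "integrable lborel (\<lambda>t. indicator {a<..<b} (c + \<sigma> * t) *\<^sub>R h'' (c + \<sigma> * t))"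
      using H(4) \<sigma> unfolding set_integrable_def
      by (intro lborel_integrable_real_affine[of "\<lambda>t. indicator {a<..<b} t *\<^sub>R h'' t"]) auto
    then have "set_integrable lborel {a'<..<b'} (\<lambda>t. indicator {a<..<b} (c + \<sigma> * t) *\<^sub>R h'' (c + \<sigma> * t))"
      unfolding set_integrable_def by (intro integrable_mult_indicator) auto
    then show "set_integrable lborel {a'<..<b'} (\<lambda>t. h'' (c + \<sigma> * t))"
      unfolding set_integrable_def
      by (rule Bochner_Integration.integrable_cong[OF refl, THEN iffD1, rotated]) (use u in \<open>auto simp: indicator_def\<close>)
  qed
qed

lemma affine_reparam: "reparam_closed affine_piece"
  unfolding reparam_closed_def
proof (intro allI impI)
  fix a b :: real and h u :: "real \<Rightarrow> complex" and a' b' c \<sigma> :: real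
  assume "affine_piece a b h"
  then obtain p q where h: "\<forall>t\<in>{a<..<b}. h t = p + q * of_real t" unfolding affine_piece_def by (elim exE)
  assume u: "\<forall>t\<in>{a'<..<b'}. c + \<sigma> * t \<in> {a<..<b} \<and> u t = h (c + \<sigma> * t)"
  then have "\<forall>t\<in>{a'<..<b'}. u t = (p + q * of_real c) + (q * of_real \<sigma>) * of_real t"
    using h by (simp add: algebra_simps)
  then show "affine_piece a' b' u" unfolding affine_piece_def by blast
qed

lemma affine_piece_C2_L1:
  assumes "affine_piece a b h" shows "C2_L1 a b h"
proof -
  obtain p q where h: "\<forall>t\<in>{a<..<b}. h t = p + q * of_real t" using assms unfolding affine_piece_def by (elim exE)
  show ?thesis
    unfolding C2_L1_def
  proof (rule exI[of _ "\<lambda>_. q"], rule exI[of _ "\<lambda>_. 0"], intro conjI ballI)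
    fix t assume t: "t \<in> {a<..<b}"
    have "((\<lambda>t. p + q * of_real t) has_vector_derivative q) (at t)"
      by (auto intro!: derivative_eq_intros)
    then show "(h has_vector_derivative q) (at t)"
      by (rule has_vector_derivative_transform_within_open[OF _ _ t]) (use h in auto)
  qed (auto simp: set_integrable_def)
qed

lemma C2_L1_add:
  assumes "C2_L1 a b h" "C2_L1 a b k" shows "C2_L1 a b (\<lambda>t. h t + k t)"
proof -
  obtain h' h'' where H: "\<forall>t\<in>{a<..<b}. (h has_vector_derivative h' t) (at t)"
    "\<forall>t\<in>{a<..<b}. (h' has_vector_derivative h'' t) (at t)"
    "continuous_on {a<..<b} h''" "set_integrable lborel {a<..<b} h''"
    using assms(1) unfolding C2_L1_def by (elim exE conjE)
  obtain k' k'' where K: "\<forall>t\<in>{a<..<b}. (k has_vector_derivative k' t) (at t)"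
    "\<forall>t\<in>{a<..<b}. (k' has_vector_derivative k'' t) (at t)"
    "continuous_on {a<..<b} k''" "set_integrable lborel {a<..<b} k''"
    using assms(2) unfolding C2_L1_def by (elim exE conjE)
  show ?thesis unfolding C2_L1_def
    by (intro exI[of _ "\<lambda>t. h' t + k' t"] exI[of _ "\<lambda>t. h'' t + k'' t"] conjI ballI has_vector_derivative_add
        continuous_on_add set_integral_add H(3,4) K(3,4)) (use H K in auto)
qed

lemma C2_L1_cmult:
  assumes "C2_L1 a b h" shows "C2_L1 a b (\<lambda>t. c * h t)"
proof -
  obtain h' h'' where H: "\<forall>t\<in>{a<..<b}. (h has_vector_derivative h' t) (at t)"
    "\<forall>t\<in>{a<..<b}. (h' has_vector_derivative h'' t) (at t)"
    "continuous_on {a<..<b} h''" "set_integrable lborel {a<..<b} h''"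
    using assms(1) unfolding C2_L1_def by (elim exE conjE)
  show ?thesis unfolding C2_L1_def
    by (intro exI[of _ "\<lambda>t. c * h' t"] exI[of _ "\<lambda>t. c * h'' t"] conjI ballI
        has_vector_derivative_mult_right continuous_on_mult_left set_integrable_mult_right H(3,4)) (use H in auto)
qed

text \<open>The first derivative differs by a constant from an indefinite integral of the integrable
  second derivative, and so it has limits at the ends of the interval.\<close>

lemma C2_L1_extend:
  assumes "C2_L1 a b h" "a < b"
  obtains d w where "continuous_on {a..b} d" "\<And>t. t \<in> {a<..<b} \<Longrightarrow> (h has_vector_derivative d t) (at t)"
    "\<And>t. t \<in> {a<..<b} \<Longrightarrow> (d has_vector_derivative w t) (at t)" "set_integrable lborel {a<..<b} w"
proof -
  obtain h' w where H: "\<forall>t\<in>{a<..<b}. (h has_vector_derivative h' t) (at t)"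
    "\<forall>t\<in>{a<..<b}. (h' has_vector_derivative w t) (at t)"
    "continuous_on {a<..<b} w" "set_integrable lborel {a<..<b} w"
    using assms(1) unfolding C2_L1_def by (elim exE conjE)
  define m where "m = (a + b) / 2"
  have m: "m \<in> {a<..<b}" using assms(2) by (simp add: m_def)
  have "w integrable_on {a<..<b}" by (rule set_borel_integral_eq_integral(1)[OF H(4)])
  then have w: "w integrable_on {a..b}" by (simp add: integrable_on_Icc_iff_Ioo)
  define d where "d t = h' m + (integral {a..t} w - integral {a..m} w)" for t
  have dh: "d t = h' t" if t: "t \<in> {a<..<b}" for t
  proof -
    have *: "h' v - h' u = integral {a..v} w - integral {a..u} w" if "a < u" "u \<le> v" "v < b" for u v
    proof -
      have "(w has_integral (h' v - h' u)) {u..v}"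
        using that H(2) by (intro fundamental_theorem_of_calculus) (auto intro: has_vector_derivative_at_within)
      moreover have "integral {a..u} w + integral {u..v} w = integral {a..v} w"
        using that by (intro Henstock_Kurzweil_Integration.integral_combine integrable_subinterval_real[OF w]) auto
      ultimately show ?thesis by (simp add: integral_unique algebra_simps)
    qed
    show ?thesis
    proof (cases "m \<le> t")
      case True
      then show ?thesis using *[of m t] m t by (simp add: d_def algebra_simps)
    next
      case False
      then show ?thesis using *[of t m] m t by (simp add: d_def algebra_simps)
    qed
  qed
  have "continuous_on {a..b} d" unfolding d_def
    by (intro continuous_intros indefinite_integral_continuous_1 w)
  moreover have "(h has_vector_derivative d t) (at t)" if "t \<in> {a<..<b}" for t using H(1) that dh by simp
  moreover have "(d has_vector_derivative w t) (at t)" if "t \<in> {a<..<b}" for t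
    by (rule has_vector_derivative_transform_within_open[of h' _ _ "{a<..<b}"]) (use H(2) that dh in auto)
  ultimately show ?thesis using that H(4) by blast
qed

section \<open>Derivatives in the interior of an arc\<close>

lemma has_vector_derivative_iff_quotient:
  fixes h :: "real \<Rightarrow> complex"
  shows "(h has_vector_derivative d) (at x within S) \<longleftrightarrow>
         ((\<lambda>y. (h y - h x) / of_real (y - x)) \<longlongrightarrow> d) (at x within S)"
proof -
  have "(h has_vector_derivative d) (at x within S) \<longleftrightarrow>
        ((\<lambda>y. norm ((h y - h x) - (y - x) *\<^sub>R d) / norm (y - x)) \<longlongrightarrow> 0) (at x within S)"
    by (simp add: has_vector_derivative_def has_derivative_iff_norm bounded_linear_scaleR_left)
  also have "\<dots> \<longleftrightarrow> ((\<lambda>y. norm ((h y - h x) / of_real (y - x) - d)) \<longlongrightarrow> 0) (at x within S)"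
  proof (rule tendsto_cong)
    have "eventually (\<lambda>y. y \<noteq> x) (at x within S)" by (simp add: eventually_at_filter)
    then show "eventually (\<lambda>y. norm ((h y - h x) - (y - x) *\<^sub>R d) / norm (y - x) =
        norm ((h y - h x) / of_real (y - x) - d)) (at x within S)"
    proof eventually_elim
      case (elim y)
      then have "(h y - h x) / of_real (y - x) - d = ((h y - h x) - (y - x) *\<^sub>R d) / of_real (y - x)"
        by (simp add: scaleR_conv_of_real diff_divide_distrib del: of_real_diff)
      then show ?case by (simp add: norm_divide del: of_real_diff)
    qed
  qed
  also have "\<dots> \<longleftrightarrow> ((\<lambda>y. (h y - h x) / of_real (y - x)) \<longlongrightarrow> d) (at x within S)"
    by (subst tendsto_norm_zero_iff) (rule Lim_null[symmetric])
  finally show ?thesis .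
qed

lemma has_vector_derivative_at_left_right:
  fixes h :: "real \<Rightarrow> complex"
  assumes "(h has_vector_derivative d) (at_right x)" "(h has_vector_derivative d) (at_left x)"
  shows "(h has_vector_derivative d) (at x)"
  using assms unfolding has_vector_derivative_iff_quotient by (simp add: filterlim_at_split)

lemma has_vector_derivative_forward:
  fixes h :: "real \<Rightarrow> complex"
  shows "((\<lambda>s. h (t + s)) has_vector_derivative d) (at_right 0) \<longleftrightarrow> (h has_vector_derivative d) (at_right t)"
  by (simp add: has_vector_derivative_at_right_iff)

lemma has_vector_derivative_backward:
  fixes h :: "real \<Rightarrow> complex"
  shows "((\<lambda>s. h (t - s)) has_vector_derivative - d) (at_right 0) \<longleftrightarrow> (h has_vector_derivative d) (at_left t)"
proof -
  have "(h has_vector_derivative d) (at_left t) \<longleftrightarrow>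
      ((\<lambda>s. (h (t - s) - h t) / of_real (- s)) \<longlongrightarrow> d) (at_right 0)"
    unfolding has_vector_derivative_iff_quotient filterlim_at_left_to_right[of _ _ t]
    by (subst filterlim_at_right_to_0) (simp add: algebra_simps)
  also have "\<dots> \<longleftrightarrow> ((\<lambda>s. - ((h (t - s) - h t) / of_real s)) \<longlongrightarrow> d) (at_right 0)" by simp
  also have "\<dots> \<longleftrightarrow> ((\<lambda>s. (h (t - s) - h t) / of_real s) \<longlongrightarrow> - d) (at_right 0)"
    by (rule tendsto_minus_cancel_left[symmetric])
  finally show ?thesis by (simp add: has_vector_derivative_at_right_iff)
qed

lemma inside_dir_derivs:
  fixes f :: "'a::metrized_graph \<Rightarrow> complex"
  assumes \<gamma>: "isom_arc \<gamma> l" and t: "0 < t" "t < l"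
  shows "(diff_quot (init_dir (\<lambda>s. \<gamma> (t + s))) f (\<gamma> t) \<longlongrightarrow> a) (at_right 0) \<longleftrightarrow>
           (f \<circ> \<gamma> has_vector_derivative a) (at_right t)"
    and "(diff_quot (init_dir (\<lambda>s. \<gamma> (t - s))) f (\<gamma> t) \<longlongrightarrow> - a) (at_right 0) \<longleftrightarrow>
           (f \<circ> \<gamma> has_vector_derivative a) (at_left t)"
proof -
  have 1: "isom_arc (\<lambda>s. \<gamma> (t + s)) (l - t)" using t by (intro isom_arc_sub[OF \<gamma>]) auto
  have 2: "isom_arc (\<lambda>s. \<gamma> (t - s)) t" using t by (intro isom_arc_rev_sub[OF \<gamma>]) auto
  show "(diff_quot (init_dir (\<lambda>s. \<gamma> (t + s))) f (\<gamma> t) \<longlongrightarrow> a) (at_right 0) \<longleftrightarrow>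
           (f \<circ> \<gamma> has_vector_derivative a) (at_right t)"
    using dir_deriv_init[OF 1, of f a] has_vector_derivative_forward[of "f \<circ> \<gamma>" t a] by (simp add: o_def)
  show "(diff_quot (init_dir (\<lambda>s. \<gamma> (t - s))) f (\<gamma> t) \<longlongrightarrow> - a) (at_right 0) \<longleftrightarrow>
           (f \<circ> \<gamma> has_vector_derivative a) (at_left t)"
    using dir_deriv_init[OF 2, of f "- a"] has_vector_derivative_backward[of "f \<circ> \<gamma>" t a] by (simp add: o_def)
qed

lemma inside_derivative:
  fixes f :: "'a::metrized_graph \<Rightarrow> complex"
  assumes \<gamma>: "isom_arc \<gamma> l" and t: "0 < t" "t < l" and d: "(f \<circ> \<gamma> has_vector_derivative a) (at t)"
  shows "dir_deriv (init_dir (\<lambda>s. \<gamma> (t + s))) f (\<gamma> t) = a"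
    and "dir_deriv (init_dir (\<lambda>s. \<gamma> (t - s))) f (\<gamma> t) = - a"
    and "(diff_quot (init_dir (\<lambda>s. \<gamma> (t + s))) f (\<gamma> t) \<longlongrightarrow> a) (at_right 0)"
    and "(diff_quot (init_dir (\<lambda>s. \<gamma> (t - s))) f (\<gamma> t) \<longlongrightarrow> - a) (at_right 0)"
proof -
  have r: "(f \<circ> \<gamma> has_vector_derivative a) (at_right t)" and l: "(f \<circ> \<gamma> has_vector_derivative a) (at_left t)"
    using d by (auto intro: has_vector_derivative_at_within)
  show 1: "(diff_quot (init_dir (\<lambda>s. \<gamma> (t + s))) f (\<gamma> t) \<longlongrightarrow> a) (at_right 0)"
    by (rule iffD2[OF inside_dir_derivs(1)[OF \<gamma> t] r])
  show 2: "(diff_quot (init_dir (\<lambda>s. \<gamma> (t - s))) f (\<gamma> t) \<longlongrightarrow> - a) (at_right 0)"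
    by (rule iffD2[OF inside_dir_derivs(2)[OF \<gamma> t] l])
  show "dir_deriv (init_dir (\<lambda>s. \<gamma> (t + s))) f (\<gamma> t) = a" "dir_deriv (init_dir (\<lambda>s. \<gamma> (t - s))) f (\<gamma> t) = - a"
    by (rule dir_deriv_eqI[OF 1], rule dir_deriv_eqI[OF 2])
qed

text \<open>Both arcs leave the point in its two directions, possibly in the opposite order, which
  changes the sign.\<close>

lemma arc_derivative_transfer:
  fixes f :: "'a::metrized_graph \<Rightarrow> complex"
  assumes \<gamma>: "isom_arc \<gamma> l" "open (\<gamma> ` {0<..<l})" "0 < t" "t < l"
    and \<gamma>': "isom_arc \<gamma>' l'" "open (\<gamma>' ` {0<..<l'})" "0 < t'" "t' < l'"
    and eq: "\<gamma> t = \<gamma>' t'" and d: "(f \<circ> \<gamma>' has_vector_derivative a) (at t')"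
  shows "(f \<circ> \<gamma> has_vector_derivative a) (at t) \<or> (f \<circ> \<gamma> has_vector_derivative - a) (at t)"
proof -
  define p where "p = init_dir (\<lambda>s. \<gamma> (t + s))"
  define m where "m = init_dir (\<lambda>s. \<gamma> (t - s))"
  define p' where "p' = init_dir (\<lambda>s. \<gamma>' (t' + s))"
  define m' where "m' = init_dir (\<lambda>s. \<gamma>' (t' - s))"
  have V: "{p, m} = {p', m'}" "p \<noteq> m" "p' \<noteq> m'"
    using Vec_inside[OF \<gamma>] Vec_inside[OF \<gamma>'] eq unfolding p_def m_def p'_def m'_def by simp_all
  have d': "(diff_quot p' f (\<gamma> t) \<longlongrightarrow> a) (at_right 0)" "(diff_quot m' f (\<gamma> t) \<longlongrightarrow> - a) (at_right 0)"
    using inside_derivative(3,4)[OF \<gamma>'(1,3,4) d] eq unfolding p'_def m'_def by simp_all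
  note D = inside_dir_derivs[OF \<gamma>(1,3,4), of f, folded p_def m_def]
  from V consider "p = p'" "m = m'" | "p = m'" "m = p'" by (auto simp: doubleton_eq_iff)
  then show ?thesis
  proof cases
    case 1
    then have "(f \<circ> \<gamma> has_vector_derivative a) (at t)"
      using d' D(1)[of a] D(2)[of a] by (intro has_vector_derivative_at_left_right) simp_all
    then show ?thesis ..
  next
    case 2
    then have "(f \<circ> \<gamma> has_vector_derivative - a) (at t)"
      using d' D(1)[of "- a"] D(2)[of "- a"] by (intro has_vector_derivative_at_left_right) simp_all
    then show ?thesis ..
  qed
qed

section \<open>The spaces of the Dirichlet theory\<close>

lemma Zh_on_edges:
  assumes "f \<in> Zh"
  obtains F where "finite F" "\<And>V E. subdivision V E \<Longrightarrow> F \<subseteq> V \<Longrightarrow> on_edges E C2_L1 f"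
proof -
  have "piecewise C2_L1 f" using assms by (simp add: Zh_def)
  then show ?thesis by (rule piecewise_on_edges[OF _ C2_L1_reparam]) (rule that)
qed

lemma CPA_on_edges:
  assumes "f \<in> CPA"
  obtains F where "finite F" "\<And>V E. subdivision V E \<Longrightarrow> F \<subseteq> V \<Longrightarrow> on_edges E affine_piece f"
proof -
  have "piecewise affine_piece f" using assms by (simp add: CPA_def)
  then show ?thesis by (rule piecewise_on_edges[OF _ affine_reparam]) (rule that)
qed

lemma on_edges_affine_C2: "on_edges E affine_piece f \<Longrightarrow> on_edges E C2_L1 f"
  unfolding on_edges_def by (intro ballI affine_piece_C2_L1) (rule bspec)

lemma Zh_pair:
  assumes "f \<in> Zh" "g \<in> Zh" "finite F"
  obtains V E where "subdivision V E" "F \<subseteq> V" "on_edges E C2_L1 f" "on_edges E C2_L1 g"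
proof -
  obtain Ff where f: "finite Ff" "\<And>V E. subdivision V E \<Longrightarrow> Ff \<subseteq> V \<Longrightarrow> on_edges E C2_L1 f"
    by (rule Zh_on_edges[OF assms(1)]) (rule that)
  obtain Fg where g: "finite Fg" "\<And>V E. subdivision V E \<Longrightarrow> Fg \<subseteq> V \<Longrightarrow> on_edges E C2_L1 g"
    by (rule Zh_on_edges[OF assms(2)]) (rule that)
  have "finite (F \<union> (Ff \<union> Fg))" using f(1) g(1) assms(3) by simp
  then obtain V E where sub: "subdivision V E" and "F \<union> (Ff \<union> Fg) \<subseteq> V" by (rule subdivision_exists)
  then have "F \<subseteq> V" "Ff \<subseteq> V" "Fg \<subseteq> V" by auto
  then show ?thesis using f(2)[OF sub] g(2)[OF sub] by (intro that[OF sub]) simp_all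
qed

lemma CPA_pair:
  assumes "f \<in> CPA" "g \<in> CPA" "finite F"
  obtains V E where "subdivision V E" "F \<subseteq> V" "on_edges E affine_piece f" "on_edges E affine_piece g"
proof -
  obtain Ff where f: "finite Ff" "\<And>V E. subdivision V E \<Longrightarrow> Ff \<subseteq> V \<Longrightarrow> on_edges E affine_piece f"
    by (rule CPA_on_edges[OF assms(1)]) (rule that)
  obtain Fg where g: "finite Fg" "\<And>V E. subdivision V E \<Longrightarrow> Fg \<subseteq> V \<Longrightarrow> on_edges E affine_piece g"
    by (rule CPA_on_edges[OF assms(2)]) (rule that)
  have "finite (F \<union> (Ff \<union> Fg))" using f(1) g(1) assms(3) by simp
  then obtain V E where sub: "subdivision V E" and "F \<union> (Ff \<union> Fg) \<subseteq> V" by (rule subdivision_exists)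
  then have "F \<subseteq> V" "Ff \<subseteq> V" "Fg \<subseteq> V" by auto
  then show ?thesis using f(2)[OF sub] g(2)[OF sub] by (intro that[OF sub]) simp_all
qed

lemma CPA_subset_Zh: "CPA \<subseteq> Zh"
proof
  fix f :: "'a \<Rightarrow> complex" assume "f \<in> CPA"
  then have f: "continuous_on UNIV f" "piecewise affine_piece f" by (auto simp: CPA_def)
  obtain F where F: "finite F" "\<And>V E. subdivision V E \<Longrightarrow> F \<subseteq> V \<Longrightarrow> on_edges E affine_piece f"
    by (rule piecewise_on_edges[OF f(2) affine_reparam]) (rule that)
  obtain V E where "subdivision V E" "F \<subseteq> V" by (rule subdivision_exists[OF F(1)])
  then have "piecewise C2_L1 f" by (intro on_edges_piecewise on_edges_affine_C2 F(2))
  then show "f \<in> Zh" using f(1) by (simp add: Zh_def)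
qed

lemma Zh_continuous: "f \<in> Zh \<Longrightarrow> continuous_on UNIV f" by (simp add: Zh_def)
lemma CPA_continuous: "f \<in> CPA \<Longrightarrow> continuous_on UNIV f" by (simp add: CPA_def)

lemma Zh_add:
  assumes "f \<in> Zh" "g \<in> Zh" shows "(\<lambda>x. f x + g x) \<in> Zh"
proof -
  obtain V E where "subdivision V E" and fg: "on_edges E C2_L1 f" "on_edges E C2_L1 g"
    by (rule Zh_pair[OF assms finite.emptyI])
  moreover have "on_edges E C2_L1 (\<lambda>x. f x + g x)"
    unfolding on_edges_def
  proof
    fix e assume "e \<in> E"
    then have "C2_L1 0 (snd e) (f \<circ> fst e)" "C2_L1 0 (snd e) (g \<circ> fst e)" using fg by (auto simp: on_edges_def)
    from C2_L1_add[OF this] show "C2_L1 0 (snd e) ((\<lambda>x. f x + g x) \<circ> fst e)" by (simp add: o_def)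
  qed
  ultimately show ?thesis
    using on_edges_piecewise Zh_continuous[OF assms(1)] Zh_continuous[OF assms(2)] by (auto simp: Zh_def intro: continuous_on_add)
qed

lemma Zh_cmult:
  assumes "f \<in> Zh" shows "(\<lambda>x. c * f x) \<in> Zh"
proof -
  obtain V E where "subdivision V E" and f: "on_edges E C2_L1 f"
    by (rule Zh_pair[OF assms assms finite.emptyI])
  moreover have "on_edges E C2_L1 (\<lambda>x. c * f x)"
    unfolding on_edges_def
  proof
    fix e assume "e \<in> E"
    then have "C2_L1 0 (snd e) (f \<circ> fst e)" using f by (auto simp: on_edges_def)
    from C2_L1_cmult[OF this] show "C2_L1 0 (snd e) ((\<lambda>x. c * f x) \<circ> fst e)" by (simp add: o_def)
  qed
  ultimately show ?thesis
    using on_edges_piecewise Zh_continuous[OF assms(1)] by (auto simp: Zh_def intro: continuous_on_mult_left)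
qed

lemma Zh_diff: "f \<in> Zh \<Longrightarrow> g \<in> Zh \<Longrightarrow> (\<lambda>x. f x - g x) \<in> Zh"
  using Zh_add[of f "\<lambda>x. (-1) * g x"] Zh_cmult[of g "-1"] by simp

lemma affine_piece_add:
  assumes "affine_piece a b h" "affine_piece a b k" shows "affine_piece a b (\<lambda>t. h t + k t)"
proof -
  obtain p q where h: "\<forall>t\<in>{a<..<b}. h t = p + q * of_real t" using assms unfolding affine_piece_def by (elim exE)
  obtain p' q' where k: "\<forall>t\<in>{a<..<b}. k t = p' + q' * of_real t" using assms unfolding affine_piece_def by (elim exE)
  show ?thesis unfolding affine_piece_def
    by (rule exI[of _ "p + p'"], rule exI[of _ "q + q'"]) (use h k in \<open>auto simp: algebra_simps\<close>)
qed

lemma affine_piece_cmult: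
  assumes "affine_piece a b h" shows "affine_piece a b (\<lambda>t. c * h t)"
proof -
  obtain p q where h: "\<forall>t\<in>{a<..<b}. h t = p + q * of_real t" using assms unfolding affine_piece_def by (elim exE)
  show ?thesis unfolding affine_piece_def
    by (rule exI[of _ "c * p"], rule exI[of _ "c * q"]) (use h in \<open>auto simp: algebra_simps\<close>)
qed

lemma CPA_add:
  assumes "f \<in> CPA" "g \<in> CPA" shows "(\<lambda>x. f x + g x) \<in> CPA"
proof -
  obtain V E where "subdivision V E" and fg: "on_edges E affine_piece f" "on_edges E affine_piece g"
    by (rule CPA_pair[OF assms finite.emptyI])
  moreover have "on_edges E affine_piece (\<lambda>x. f x + g x)"
    unfolding on_edges_def
  proof
    fix e assume "e \<in> E"
    then have "affine_piece 0 (snd e) (f \<circ> fst e)" "affine_piece 0 (snd e) (g \<circ> fst e)" using fg by (auto simp: on_edges_def)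
    from affine_piece_add[OF this] show "affine_piece 0 (snd e) ((\<lambda>x. f x + g x) \<circ> fst e)" by (simp add: o_def)
  qed
  ultimately show ?thesis
    using on_edges_piecewise CPA_continuous[OF assms(1)] CPA_continuous[OF assms(2)] by (auto simp: CPA_def intro: continuous_on_add)
qed

lemma CPA_cmult:
  assumes "f \<in> CPA" shows "(\<lambda>x. c * f x) \<in> CPA"
proof -
  obtain V E where "subdivision V E" and f: "on_edges E affine_piece f"
    by (rule CPA_pair[OF assms assms finite.emptyI])
  moreover have "on_edges E affine_piece (\<lambda>x. c * f x)"
    unfolding on_edges_def
  proof
    fix e assume "e \<in> E"
    then have "affine_piece 0 (snd e) (f \<circ> fst e)" using f by (auto simp: on_edges_def)
    from affine_piece_cmult[OF this] show "affine_piece 0 (snd e) ((\<lambda>x. c * f x) \<circ> fst e)" by (simp add: o_def)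
  qed
  ultimately show ?thesis
    using on_edges_piecewise CPA_continuous[OF assms(1)] by (auto simp: CPA_def intro: continuous_on_mult_left)
qed

lemma CPA_diff: "f \<in> CPA \<Longrightarrow> g \<in> CPA \<Longrightarrow> (\<lambda>x. f x - g x) \<in> CPA"
  using CPA_add[of f "\<lambda>x. (-1) * g x"] CPA_cmult[of g "-1"] by simp

lemma CPA_const: "(\<lambda>x::'a::metrized_graph. c) \<in> CPA"
proof -
  obtain V and E :: "((real \<Rightarrow> 'a) \<times> real) set" where sub: "subdivision V E"
    using subdivision_exists[of "{}::'a set"] by blast
  have "on_edges E affine_piece (\<lambda>x::'a. c)"
    unfolding on_edges_def affine_piece_def by (intro ballI exI[of _ c] exI[of _ 0]) auto
  then show ?thesis using on_edges_piecewise[OF sub] by (auto simp: CPA_def)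
qed

lemma CPA_sum: "finite I \<Longrightarrow> (\<And>i. i \<in> I \<Longrightarrow> f i \<in> CPA) \<Longrightarrow> (\<lambda>x::'a::metrized_graph. \<Sum>i\<in>I. f i x) \<in> CPA"
  by (induction I rule: finite_induct) (auto intro: CPA_const CPA_add)

section \<open>The integrand of the Dirichlet form\<close>

text \<open>The integrand of \<^const>\<open>Dir_inner\<close>; in the interior of an edge it is \<open>f' * cnj g'\<close> in the
  parameter of the edge.\<close>

definition Dint :: "('a::metrized_graph \<Rightarrow> complex) \<Rightarrow> ('a \<Rightarrow> complex) \<Rightarrow> 'a \<Rightarrow> complex" where
  "Dint f g p = (\<Sum>v\<in>Vec p. dir_deriv v f p * cnj (dir_deriv v g p)) / of_nat (card (Vec p))"

lemma Dir_inner_Dint: "Dir_inner f g = (LINT p|arc_length. Dint f g p)"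
  by (simp add: Dir_inner_def Dint_def)

lemma Dint_inside:
  assumes \<gamma>: "isom_arc \<gamma> l" "open (\<gamma> ` {0<..<l})" and t: "0 < t" "t < l"
    and f: "(f \<circ> \<gamma> has_vector_derivative a) (at t)" and g: "(g \<circ> \<gamma> has_vector_derivative b) (at t)"
  shows "Dint f g (\<gamma> t) = a * cnj b"
  using Vec_inside[OF \<gamma> t]
  by (simp add: Dint_def inside_derivative(1,2)[OF \<gamma>(1) t f] inside_derivative(1,2)[OF \<gamma>(1) t g])

lemma edge_extend:
  assumes sub: "subdivision V E" and f: "on_edges E C2_L1 f" and e: "e \<in> E"
  obtains d w where "continuous_on {0..snd e} d"
    "\<And>t. t \<in> {0<..<snd e} \<Longrightarrow> (f \<circ> fst e has_vector_derivative d t) (at t)"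
    "\<And>t. t \<in> {0<..<snd e} \<Longrightarrow> (d has_vector_derivative w t) (at t)" "set_integrable lborel {0<..<snd e} w"
proof -
  have "C2_L1 0 (snd e) (f \<circ> fst e)" using f e by (auto simp: on_edges_def)
  then show ?thesis by (rule C2_L1_extend[OF _ isom_arc_pos[OF subdivisionD(5)[OF sub e]]]) (rule that)
qed

lemma edge_differentiable:
  assumes "subdivision V E" "on_edges E C2_L1 f" "e \<in> E" "t \<in> {0<..<snd e}"
  shows "\<exists>a. (f \<circ> fst e has_vector_derivative a) (at t)"
proof (rule edge_extend[OF assms(1-3)])
  fix d w assume "\<And>t. t \<in> {0<..<snd e} \<Longrightarrow> (f \<circ> fst e has_vector_derivative d t) (at t)"
  from this[OF assms(4)] show ?thesis by (rule exI)
qed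

lemma set_integrable_Ioo_continuous:
  fixes f :: "real \<Rightarrow> complex"
  assumes "continuous_on {a..b} f" shows "set_integrable lborel {a<..<b} f"
  by (rule set_integrable_subset[OF borel_integrable_atLeastAtMost'[OF assms]]) auto

lemma set_integrable_congI:
  assumes "set_integrable M A f" "\<And>x. x \<in> A \<Longrightarrow> f x = g x"
  shows "set_integrable M A g"
  using assms(1) unfolding set_integrable_def
  by (rule Bochner_Integration.integrable_cong[OF refl, THEN iffD1, rotated]) (use assms(2) in \<open>auto simp: indicator_def\<close>)

lemma Zh_Dint:
  assumes f: "f \<in> Zh" and g: "g \<in> Zh"
  shows "Dint f g \<in> borel_measurable borel" "integrable arc_length (Dint f g)"
proof -
  obtain V E where sub: "subdivision V E" and fg: "on_edges E C2_L1 f" "on_edges E C2_L1 g"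
    by (rule Zh_pair[OF f g finite.emptyI])
  note D = subdivisionD[OF sub]
  have *: "\<exists>h. continuous_on {0..snd e} h \<and> (\<forall>t\<in>{0<..<snd e}. Dint f g (fst e t) = h t)" if e: "e \<in> E" for e
  proof -
    obtain d w where d: "continuous_on {0..snd e} d"
      "\<And>t. t \<in> {0<..<snd e} \<Longrightarrow> (f \<circ> fst e has_vector_derivative d t) (at t)"
      by (rule edge_extend[OF sub fg(1) e]) (rule that)
    obtain d' w' where d': "continuous_on {0..snd e} d'"
      "\<And>t. t \<in> {0<..<snd e} \<Longrightarrow> (g \<circ> fst e has_vector_derivative d' t) (at t)"
      by (rule edge_extend[OF sub fg(2) e]) (rule that)
    have "continuous_on {0..snd e} (\<lambda>t. d t * cnj (d' t))"
      by (intro continuous_on_mult continuous_on_cnj d(1) d'(1))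
    moreover have "\<forall>t\<in>{0<..<snd e}. Dint f g (fst e t) = d t * cnj (d' t)"
      using Dint_inside[OF D(5,6)[OF e] _ _ d(2) d'(2)] by simp
    ultimately show ?thesis by (intro exI conjI)
  qed
  have c: "continuous_on {0<..<snd e} (\<lambda>t. Dint f g (fst e t))" if e: "e \<in> E" for e
  proof -
    obtain h where h: "continuous_on {0..snd e} h" "\<forall>t\<in>{0<..<snd e}. Dint f g (fst e t) = h t" using *[OF e] by (elim exE conjE)
    have "continuous_on {0<..<snd e} h" by (rule continuous_on_subset[OF h(1)]) auto
    then show ?thesis by (rule continuous_on_eq) (use h(2) in auto)
  qed
  show m: "Dint f g \<in> borel_measurable borel" by (rule borel_measurable_edges[OF sub c])
  have "set_integrable lborel {0<..<snd e} (\<lambda>t. Dint f g (fst e t))" if e: "e \<in> E" for e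
  proof -
    obtain h where h: "continuous_on {0..snd e} h" "\<forall>t\<in>{0<..<snd e}. Dint f g (fst e t) = h t" using *[OF e] by (elim exE conjE)
    show ?thesis by (rule set_integrable_congI[OF set_integrable_Ioo_continuous[OF h(1)]]) (use h(2) in auto)
  qed
  from arc_length_integral_edges(1)[OF sub m this] show "integrable arc_length (Dint f g)" by simp
qed

lemma Dir_inner_edges:
  assumes f: "f \<in> Zh" and g: "g \<in> Zh" and sub: "subdivision V E"
  shows "Dir_inner f g = (\<Sum>e\<in>E. LINT t:{0<..<snd e}|lborel. Dint f g (fst e t))"
    and "e \<in> E \<Longrightarrow> set_integrable lborel {0<..<snd e} (\<lambda>t. Dint f g (fst e t))"
proof -
  note D = subdivisionD[OF sub]
  note m = Zh_Dint[OF f g]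
  show si: "set_integrable lborel {0<..<snd e} (\<lambda>t. Dint f g (fst e t))" if e: "e \<in> E" for e
  proof -
    have "set_integrable arc_length (open_edge e) (Dint f g)"
      unfolding set_integrable_def by (intro integrable_mult_indicator m(2)) (use D(6)[OF e] in auto)
    then show ?thesis using integral_on_edge(1)[OF sub e m(1)] by simp
  qed
  show "Dir_inner f g = (\<Sum>e\<in>E. LINT t:{0<..<snd e}|lborel. Dint f g (fst e t))"
    unfolding Dir_inner_Dint by (rule arc_length_integral_edges(2)[OF sub m(1) si])
qed

section \<open>The Dirichlet form is a positive Hermitian form\<close>

lemma Dint_linear:
  assumes f: "f \<in> Zh" and f': "f' \<in> Zh" and g: "g \<in> Zh"
  shows "AE p in arc_length. Dint (\<lambda>x. f x + f' x) g p = Dint f g p + Dint f' g p"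
    and "AE p in arc_length. Dint (\<lambda>x. c * f x) g p = c * Dint f g p"
proof -
  obtain F where F: "finite F" "\<And>V E. subdivision V E \<Longrightarrow> F \<subseteq> V \<Longrightarrow> on_edges E C2_L1 f"
    by (rule Zh_on_edges[OF f]) (rule that)
  obtain V E where sub: "subdivision V E" and FV: "F \<subseteq> V" and fg: "on_edges E C2_L1 f'" "on_edges E C2_L1 g"
    by (rule Zh_pair[OF f' g F(1)])
  note D = subdivisionD[OF sub]
  have *: "Dint (\<lambda>x. f x + f' x) g p = Dint f g p + Dint f' g p \<and> Dint (\<lambda>x. c * f x) g p = c * Dint f g p"
    if pV: "p \<notin> V" for p
  proof -
    obtain e where e: "e \<in> E" "p \<in> open_edge e" by (rule subdivision_cover[OF sub pV])
    then obtain t where t: "t \<in> {0<..<snd e}" "p = fst e t" by auto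
    then have t': "0 < t" "t < snd e" by auto
    obtain a where a: "(f \<circ> fst e has_vector_derivative a) (at t)"
      using edge_differentiable[OF sub F(2)[OF sub FV] e(1) t(1)] by (elim exE)
    obtain a' where a': "(f' \<circ> fst e has_vector_derivative a') (at t)"
      using edge_differentiable[OF sub fg(1) e(1) t(1)] by (elim exE)
    obtain b where b: "(g \<circ> fst e has_vector_derivative b) (at t)"
      using edge_differentiable[OF sub fg(2) e(1) t(1)] by (elim exE)
    have s: "((\<lambda>x. f x + f' x) \<circ> fst e has_vector_derivative a + a') (at t)"
      using has_vector_derivative_add[OF a a'] by (simp add: o_def)
    have m: "((\<lambda>x. c * f x) \<circ> fst e has_vector_derivative c * a) (at t)"
      using has_vector_derivative_mult_right[OF a, of c] by (simp add: o_def)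
    note I = Dint_inside[OF D(5,6)[OF e(1)] t']
    show ?thesis unfolding t(2) I[OF a b] I[OF a' b] I[OF s b] I[OF m b] by (simp add: algebra_simps)
  qed
  show "AE p in arc_length. Dint (\<lambda>x. f x + f' x) g p = Dint f g p + Dint f' g p"
    "AE p in arc_length. Dint (\<lambda>x. c * f x) g p = c * Dint f g p"
    using AE_not_in_finite[OF D(1)] by (eventually_elim, simp add: *)+
qed

lemma Dir_inner_add_left:
  assumes f: "f \<in> Zh" and f': "f' \<in> Zh" and g: "g \<in> Zh"
  shows "Dir_inner (\<lambda>x. f x + f' x) g = Dir_inner f g + Dir_inner f' g"
proof -
  have "Dir_inner (\<lambda>x. f x + f' x) g = (LINT p|arc_length. Dint f g p + Dint f' g p)"
    unfolding Dir_inner_Dint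
    using Zh_Dint(1)[OF Zh_add[OF f f'] g] Zh_Dint(1)[OF f g] Zh_Dint(1)[OF f' g]
    by (intro integral_cong_AE Dint_linear(1) f f' g) auto
  also have "\<dots> = Dir_inner f g + Dir_inner f' g"
    unfolding Dir_inner_Dint by (intro Bochner_Integration.integral_add Zh_Dint(2) f f' g)
  finally show ?thesis .
qed

lemma Dir_inner_cmult_left:
  assumes f: "f \<in> Zh" and g: "g \<in> Zh"
  shows "Dir_inner (\<lambda>x. c * f x) g = c * Dir_inner f g"
proof -
  have "Dir_inner (\<lambda>x. c * f x) g = (LINT p|arc_length. c * Dint f g p)"
    unfolding Dir_inner_Dint
    using Zh_Dint(1)[OF Zh_cmult[OF f] g] Zh_Dint(1)[OF f g]
    by (intro integral_cong_AE Dint_linear(2)[OF f f g]) auto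
  also have "\<dots> = c * Dir_inner f g"
    unfolding Dir_inner_Dint by simp
  finally show ?thesis .
qed

lemma Dir_inner_commute: "Dir_inner g f = cnj (Dir_inner f g)"
proof -
  have "Dint g f = (\<lambda>p. cnj (Dint f g p))" by (rule ext) (simp add: Dint_def mult.commute)
  then show ?thesis unfolding Dir_inner_Dint by simp
qed

lemma Dir_inner_add_right:
  assumes "f \<in> Zh" "f' \<in> Zh" "g \<in> Zh"
  shows "Dir_inner g (\<lambda>x. f x + f' x) = Dir_inner g f + Dir_inner g f'"
  by (subst (1 2 3) Dir_inner_commute) (simp add: Dir_inner_add_left[OF assms])

lemma Dir_inner_cmult_right:
  assumes "f \<in> Zh" "g \<in> Zh"
  shows "Dir_inner g (\<lambda>x. c * f x) = cnj c * Dir_inner g f"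
  by (subst (1 2) Dir_inner_commute) (simp add: Dir_inner_cmult_left[OF assms])

lemma Dir_inner_diff_left:
  assumes "f \<in> Zh" "f' \<in> Zh" "g \<in> Zh"
  shows "Dir_inner (\<lambda>x. f x - f' x) g = Dir_inner f g - Dir_inner f' g"
  using Dir_inner_add_left[OF assms(1) Zh_cmult[OF assms(2), of "-1"] assms(3)]
    Dir_inner_cmult_left[OF assms(2,3), of "-1"] by simp

lemma Dir_inner_diff_right:
  assumes "f \<in> Zh" "f' \<in> Zh" "g \<in> Zh"
  shows "Dir_inner g (\<lambda>x. f x - f' x) = Dir_inner g f - Dir_inner g f'"
  by (subst (1 2 3) Dir_inner_commute) (simp add: Dir_inner_diff_left[OF assms])

lemma Dir_inner_sum_left:
  assumes "finite I" "\<And>i. i \<in> I \<Longrightarrow> f i \<in> CPA" "g \<in> Zh"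
  shows "Dir_inner (\<lambda>x::'a::metrized_graph. \<Sum>i\<in>I. c i * f i x) g = (\<Sum>i\<in>I. c i * Dir_inner (f i) g)"
  using assms(1,2)
proof (induction I rule: finite_induct)
  case empty
  have "(\<lambda>x::'a. 0::complex) \<in> Zh" by (rule subsetD[OF CPA_subset_Zh CPA_const])
  from Dir_inner_cmult_left[OF this assms(3), of 0] show ?case by simp
next
  case (insert i I)
  have 3: "f i \<in> Zh" by (rule subsetD[OF CPA_subset_Zh]) (simp add: insert.prems)
  have 1: "(\<lambda>x. c i * f i x) \<in> Zh" by (rule Zh_cmult[OF 3])
  have "(\<lambda>x. \<Sum>i\<in>I. c i * f i x) \<in> CPA" by (intro CPA_sum insert.hyps CPA_cmult insert.prems) simp
  then have 2: "(\<lambda>x. \<Sum>i\<in>I. c i * f i x) \<in> Zh" by (rule subsetD[OF CPA_subset_Zh])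
  have "Dir_inner (\<lambda>x. \<Sum>i\<in>insert i I. c i * f i x) g = Dir_inner (\<lambda>x. c i * f i x + (\<Sum>i\<in>I. c i * f i x)) g"
    using insert.hyps by simp
  also have "\<dots> = c i * Dir_inner (f i) g + Dir_inner (\<lambda>x. \<Sum>i\<in>I. c i * f i x) g"
    unfolding Dir_inner_add_left[OF 1 2 assms(3)] Dir_inner_cmult_left[OF 3 assms(3)] ..
  also have "Dir_inner (\<lambda>x. \<Sum>i\<in>I. c i * f i x) g = (\<Sum>i\<in>I. c i * Dir_inner (f i) g)"
    by (rule insert.IH) (simp add: insert.prems)
  finally show ?case using insert.hyps by simp
qed

lemma Dir_inner_self:
  shows "Dir_inner f f = of_real (Re (Dir_inner f f))" "0 \<le> Re (Dir_inner f f)"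
proof -
  let ?r = "\<lambda>p. (\<Sum>v\<in>Vec p. (cmod (dir_deriv v f p))\<^sup>2) / real (card (Vec p))"
  have "Dint f f = (\<lambda>p. of_real (?r p))"
    by (rule ext) (simp add: Dint_def complex_norm_square[symmetric])
  then have "Dir_inner f f = of_real (LINT p|arc_length. ?r p)"
    unfolding Dir_inner_Dint by (simp only: integral_complex_of_real)
  moreover have "0 \<le> (LINT p|arc_length. ?r p)"
    by (intro integral_nonneg_AE) (auto intro!: divide_nonneg_nonneg sum_nonneg)
  ultimately show "Dir_inner f f = of_real (Re (Dir_inner f f))" "0 \<le> Re (Dir_inner f f)" by simp_all
qed

lemma Dir_norm_nonneg: "0 \<le> Dir_norm f" by (simp add: Dir_norm_def Dir_inner_self(2))

lemma Dir_norm_sq: "(Dir_norm f)\<^sup>2 = Re (Dir_inner f f)" by (simp add: Dir_norm_def Dir_inner_self(2))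

lemma Dir_Cauchy_Schwarz:
  assumes f: "f \<in> Zh" and g: "g \<in> Zh"
  shows "cmod (Dir_inner f g) \<le> Dir_norm f * Dir_norm g"
proof -
  define z where "z = Dir_inner f g"
  define A where "A = Re (Dir_inner f f)"
  define B where "B = Re (Dir_inner g g)"
  have AB: "0 \<le> A" "0 \<le> B" using Dir_inner_self(2) by (auto simp: A_def B_def)
  have AA: "Dir_inner f f = of_real A" and BB: "Dir_inner g g = of_real B"
    unfolding A_def B_def by (rule Dir_inner_self(1))+
  \<comment> \<open>Positivity at \<open>f - t * z * g\<close>.\<close>
  have q: "0 \<le> A - 2 * t * (cmod z)\<^sup>2 + t\<^sup>2 * (cmod z)\<^sup>2 * B" for t :: real
  proof -
    define c where "c = - (of_real t * z)"
    have cg: "(\<lambda>x. c * g x) \<in> Zh" by (rule Zh_cmult[OF g])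
    have s: "(\<lambda>x. f x + c * g x) \<in> Zh" by (rule Zh_add[OF f cg])
    have "Dir_inner (\<lambda>x. f x + c * g x) (\<lambda>x. f x + c * g x) =
        Dir_inner f f + cnj c * z + c * cnj z + c * cnj c * Dir_inner g g"
      unfolding Dir_inner_add_left[OF f cg s] Dir_inner_add_right[OF f cg f] Dir_inner_cmult_left[OF g s]
        Dir_inner_add_right[OF f cg g] Dir_inner_cmult_right[OF g f] Dir_inner_cmult_right[OF g g]
      by (simp add: z_def Dir_inner_commute[of f g] algebra_simps)
    also have "\<dots> = of_real A - 2 * of_real t * (z * cnj z) + of_real t * of_real t * (z * cnj z) * of_real B"
      unfolding AA BB by (simp add: c_def algebra_simps)
    also have "\<dots> = of_real (A - 2 * t * (cmod z)\<^sup>2 + t\<^sup>2 * (cmod z)\<^sup>2 * B)"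
      unfolding complex_norm_square[symmetric] by (simp add: power2_eq_square)
    finally show ?thesis using Dir_inner_self(2)[of "\<lambda>x. f x + c * g x"] by simp
  qed
  have "(cmod z)\<^sup>2 \<le> A * B"
  proof (cases "B = 0")
    case True
    have "z = 0"
    proof (rule ccontr)
      assume "z \<noteq> 0"
      then have p: "(cmod z)\<^sup>2 > 0" by simp
      \<comment> \<open>For \<open>B = 0\<close> the quadratic polynomial is affine in \<open>t\<close>, and this \<open>t\<close> makes it negative.\<close>
      have *: "0 \<le> A - 2 * ((A + 1) / (cmod z)\<^sup>2) * (cmod z)\<^sup>2" using q[of "(A + 1) / (cmod z)\<^sup>2"] True by simp
      have "2 * ((A + 1) / (cmod z)\<^sup>2) * (cmod z)\<^sup>2 = 2 * (A + 1)" using p by simp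
      with * have "0 \<le> A - 2 * (A + 1)" by (simp only:)
      then show False using AB(1) by simp
    qed
    then show ?thesis using True by simp
  next
    case False
    then have B: "B > 0" using AB by simp
    have "0 \<le> A - 2 * (1 / B) * (cmod z)\<^sup>2 + (1 / B)\<^sup>2 * (cmod z)\<^sup>2 * B" by (rule q)
    also have "\<dots> = A - (cmod z)\<^sup>2 / B" using B by (simp add: power2_eq_square field_simps)
    finally show ?thesis using B by (simp add: field_simps)
  qed
  also have "\<dots> = (Dir_norm f * Dir_norm g)\<^sup>2" by (simp add: power_mult_distrib Dir_norm_sq A_def B_def)
  finally show ?thesis unfolding z_def by (rule power2_le_imp_le) (simp add: Dir_norm_nonneg)
qed

lemma Dir_norm_triangle:
  assumes f: "f \<in> Zh" and g: "g \<in> Zh"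
  shows "Dir_norm (\<lambda>x. f x + g x) \<le> Dir_norm f + Dir_norm g"
proof (rule power2_le_imp_le)
  have s: "(\<lambda>x. f x + g x) \<in> Zh" by (rule Zh_add[OF f g])
  have "Dir_inner (\<lambda>x. f x + g x) (\<lambda>x. f x + g x) = Dir_inner f f + Dir_inner f g + (cnj (Dir_inner f g) + Dir_inner g g)"
    unfolding Dir_inner_add_left[OF f g s] Dir_inner_add_right[OF f g f] Dir_inner_add_right[OF f g g]
    by (simp add: Dir_inner_commute[of f g])
  then have "(Dir_norm (\<lambda>x. f x + g x))\<^sup>2 = (Dir_norm f)\<^sup>2 + 2 * Re (Dir_inner f g) + (Dir_norm g)\<^sup>2"
    by (simp add: Dir_norm_sq)
  also have "\<dots> \<le> (Dir_norm f)\<^sup>2 + 2 * (Dir_norm f * Dir_norm g) + (Dir_norm g)\<^sup>2"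
    using Dir_Cauchy_Schwarz[OF f g] complex_Re_le_cmod[of "Dir_inner f g"] by simp
  also have "\<dots> = (Dir_norm f + Dir_norm g)\<^sup>2" by (simp add: power2_sum)
  finally show "(Dir_norm (\<lambda>x. f x + g x))\<^sup>2 \<le> (Dir_norm f + Dir_norm g)\<^sup>2" .
  show "0 \<le> Dir_norm f + Dir_norm g" by (simp add: Dir_norm_nonneg)
qed

section \<open>Piecewise affine functions on edges\<close>

text \<open>The slope along the edge of the function that is affine there with the given values at
  both ends.\<close>

definition edge_slope :: "('a \<Rightarrow> complex) \<Rightarrow> (real \<Rightarrow> 'a) \<times> real \<Rightarrow> complex" where
  "edge_slope k e = (k (fst e (snd e)) - k (fst e 0)) / of_real (snd e)"

lemma affine_on_edge:
  assumes k: "continuous_on UNIV k" and sub: "subdivision V E" and aff: "on_edges E affine_piece k" and e: "e \<in> E"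
    and t: "t \<in> {0..snd e}"
  shows "k (fst e t) = k (fst e 0) + edge_slope k e * of_real t"
proof -
  note arc = subdivisionD(5)[OF sub e]
  have pos: "0 < snd e" by (rule isom_arc_pos[OF arc])
  have "affine_piece 0 (snd e) (k \<circ> fst e)" using aff e by (auto simp: on_edges_def)
  then obtain p q where pq: "\<forall>t\<in>{0<..<snd e}. (k \<circ> fst e) t = p + q * of_real t" unfolding affine_piece_def by (elim exE)
  have c: "continuous_on {0..snd e} (\<lambda>t. k (fst e t) - q * of_real t)"
    by (intro continuous_intros continuous_on_compose2[OF k isom_arc_continuous[OF arc]]) auto
  have cl: "closure {0<..<snd e} = {0..snd e}" using pos by simp
  have *: "k (fst e t) - q * of_real t = p" if "t \<in> {0..snd e}" for t
    by (rule continuous_constant_on_closure[of "{0<..<snd e}" "\<lambda>t. k (fst e t) - q * of_real t"])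
      (use c pq that cl in \<open>auto simp: closure_greaterThanLessThan\<close>)
  have p: "k (fst e 0) = p" using *[of 0] pos by simp
  have "k (fst e (snd e)) = p + q * of_real (snd e)" using *[of "snd e"] pos by (simp add: algebra_simps)
  then have "q = edge_slope k e" using p pos by (simp add: edge_slope_def)
  then show ?thesis using *[OF t] p by (simp add: algebra_simps)
qed

lemma arc_affine_start:
  assumes arc: "isom_arc \<gamma> l" and k: "\<And>t. 0 \<le> t \<Longrightarrow> t \<le> l \<Longrightarrow> k (\<gamma> t) = k (\<gamma> 0) + q * of_real t"
  shows "(diff_quot (init_dir \<gamma>) k (\<gamma> 0) \<longlongrightarrow> q) (at_right 0)"
proof -
  have "eventually (\<lambda>t. (k (\<gamma> t) - k (\<gamma> 0)) / of_real t = q) (at_right 0)"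
    using eventually_at_right_real[OF isom_arc_pos[OF arc]]
  proof eventually_elim
    case (elim t)
    then show ?case using k[of t] by simp
  qed
  then have "((\<lambda>t. (k (\<gamma> t) - k (\<gamma> 0)) / of_real t) \<longlongrightarrow> q) (at_right 0)"
    by (rule tendsto_eventually)
  then show ?thesis by (rule iffD2[OF diff_quot_along[OF leaves_init_dir[OF arc]]])
qed

lemma edge_end_slopes:
  assumes k: "continuous_on UNIV k" and sub: "subdivision V E" and aff: "on_edges E affine_piece k" and e: "e \<in> E"
  shows "(diff_quot (start_dir e) k (fst e 0) \<longlongrightarrow> edge_slope k e) (at_right 0)"
    and "(diff_quot (end_dir e) k (fst e (snd e)) \<longlongrightarrow> - edge_slope k e) (at_right 0)"
proof -
  note arc = subdivisionD(5)[OF sub e]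
  have pos: "0 < snd e" by (rule isom_arc_pos[OF arc])
  note A = affine_on_edge[OF k sub aff e]
  show "(diff_quot (start_dir e) k (fst e 0) \<longlongrightarrow> edge_slope k e) (at_right 0)"
    unfolding start_dir_def by (rule arc_affine_start[OF arc]) (rule A, simp)
  have "(diff_quot (init_dir (\<lambda>t. fst e (snd e - t))) k (fst e (snd e - 0)) \<longlongrightarrow> - edge_slope k e) (at_right 0)"
  proof (rule arc_affine_start[OF isom_arc_rev[OF arc]])
    fix t assume t: "0 \<le> t" "t \<le> snd e"
    show "k (fst e (snd e - t)) = k (fst e (snd e - 0)) + - edge_slope k e * of_real t"
      using A[of "snd e - t"] A[of "snd e"] t pos by (simp add: algebra_simps)
  qed
  then show "(diff_quot (end_dir e) k (fst e (snd e)) \<longlongrightarrow> - edge_slope k e) (at_right 0)"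
    by (simp add: end_dir_def)
qed

lemma edge_slope_deriv:
  assumes k: "continuous_on UNIV k" and sub: "subdivision V E" and aff: "on_edges E affine_piece k" and e: "e \<in> E"
    and t: "t \<in> {0<..<snd e}"
  shows "(k \<circ> fst e has_vector_derivative edge_slope k e) (at t)"
proof -
  have "((\<lambda>t. k (fst e 0) + edge_slope k e * of_real t) has_vector_derivative edge_slope k e) (at t)"
    by (auto intro!: derivative_eq_intros)
  then show ?thesis
  proof (rule has_vector_derivative_transform_within_open[OF _ open_greaterThanLessThan t])
    fix s assume "s \<in> {0<..<snd e}"
    then have "s \<in> {0..snd e}" by simp
    from affine_on_edge[OF k sub aff e this]
    show "k (fst e 0) + edge_slope k e * of_real s = (k \<circ> fst e) s" unfolding o_def by (rule sym)
  qed
qed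

lemma slope_sum_inside:
  assumes \<gamma>: "isom_arc \<gamma> l" "open (\<gamma> ` {0<..<l})" and t: "0 < t" "t < l"
    and f: "(f \<circ> \<gamma> has_vector_derivative a) (at t)"
  shows "slope_sum f (\<gamma> t) = 0"
  using Vec_inside[OF \<gamma> t] by (simp add: slope_sum_def inside_derivative(1,2)[OF \<gamma>(1) t f])

lemma slope_sum_off_vertices:
  assumes k: "continuous_on UNIV k" and sub: "subdivision V E" and aff: "on_edges E affine_piece k" and x: "x \<notin> V"
  shows "slope_sum k x = 0"
proof -
  obtain e where e: "e \<in> E" "x \<in> open_edge e" by (rule subdivision_cover[OF sub x])
  then obtain t where t: "t \<in> {0<..<snd e}" "x = fst e t" by auto
  show ?thesis
    unfolding t(2) by (rule slope_sum_inside[OF subdivisionD(5,6)[OF sub e(1)] _ _ edge_slope_deriv[OF k sub aff e(1) t(1)]])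
      (use t in auto)
qed

section \<open>Green's formula\<close>

lemma ftc_Ioo:
  fixes u :: "real \<Rightarrow> complex"
  assumes "0 \<le> l" "continuous_on {0..l} u" "continuous_on {0..l} d"
    and "\<And>t. t \<in> {0<..<l} \<Longrightarrow> (u has_vector_derivative d t) (at t)"
  shows "(LINT t:{0<..<l}|lborel. d t * c) = (u l - u 0) * c"
proof -
  have si: "set_integrable lborel {0<..<l} (\<lambda>t. d t * c)"
    by (intro set_integrable_Ioo_continuous continuous_intros assms)
  have "(d has_integral (u l - u 0)) {0..l}"
    by (rule fundamental_theorem_of_calculus_interior_strong[OF finite.emptyI assms(1) _ assms(2)]) (use assms(4) in auto)
  then have "((\<lambda>t. d t * c) has_integral (u l - u 0) * c) {0<..<l}"
    unfolding has_integral_Icc_iff_Ioo[symmetric] by (rule has_integral_mult_left)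
  then show ?thesis unfolding set_borel_integral_eq_integral(2)[OF si] by (rule integral_unique)
qed

lemma set_lebesgue_integral_congI:
  "(\<And>x. x \<in> A \<Longrightarrow> f x = g x) \<Longrightarrow> (LINT x:A|M. f x) = (LINT x:A|M. g x)"
  unfolding set_lebesgue_integral_def by (intro Bochner_Integration.integral_cong refl) (auto simp: indicator_def)

text \<open>On each edge the integrand is \<open>\<phi>'\<close> times a constant slope, so the integral is an increment
  of \<open>\<phi>\<close> times this slope; the increments are then collected at the vertices.\<close>

lemma Green_formula:
  assumes \<phi>: "\<phi> \<in> Zh" and k: "continuous_on UNIV k" and sub: "subdivision V E"
    and \<phi>2: "on_edges E C2_L1 \<phi>" and aff: "on_edges E affine_piece k"
  shows "Dir_inner \<phi> k = - (\<Sum>b\<in>V. \<phi> b * cnj (slope_sum k b))"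
proof -
  note D = subdivisionD[OF sub]
  have kZ: "k \<in> Zh"
    using k on_edges_piecewise[OF sub on_edges_affine_C2[OF aff]] by (simp add: Zh_def)
  have "(LINT t:{0<..<snd e}|lborel. Dint \<phi> k (fst e t)) = (\<phi> (fst e (snd e)) - \<phi> (fst e 0)) * cnj (edge_slope k e)"
    if e: "e \<in> E" for e
  proof -
    obtain d w where d: "continuous_on {0..snd e} d"
      "\<And>t. t \<in> {0<..<snd e} \<Longrightarrow> (\<phi> \<circ> fst e has_vector_derivative d t) (at t)"
      by (rule edge_extend[OF sub \<phi>2 e]) (rule that)
    have "(LINT t:{0<..<snd e}|lborel. Dint \<phi> k (fst e t)) = (LINT t:{0<..<snd e}|lborel. d t * cnj (edge_slope k e))"
      by (rule set_lebesgue_integral_congI)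
        (rule Dint_inside[OF D(5,6)[OF e] _ _ d(2) edge_slope_deriv[OF k sub aff e]], auto)
    also have "\<dots> = ((\<phi> \<circ> fst e) (snd e) - (\<phi> \<circ> fst e) 0) * cnj (edge_slope k e)"
    proof (rule ftc_Ioo[OF _ _ d(1) d(2)])
      show "0 \<le> snd e" using isom_arc_pos[OF D(5)[OF e]] by simp
      show "continuous_on {0..snd e} (\<phi> \<circ> fst e)" unfolding o_def
        by (rule continuous_on_compose2[OF Zh_continuous[OF \<phi>] isom_arc_continuous[OF D(5)[OF e]]]) auto
    qed
    finally show ?thesis by simp
  qed
  then have "Dir_inner \<phi> k = (\<Sum>e\<in>E. (\<phi> (fst e (snd e)) - \<phi> (fst e 0)) * cnj (edge_slope k e))"
    unfolding Dir_inner_edges(1)[OF \<phi> kZ sub] by (intro sum.cong refl)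
  moreover have "(\<Sum>b\<in>V. \<phi> b * cnj (slope_sum k b)) = (\<Sum>b\<in>V. \<Sum>v\<in>Vec b. \<phi> b * cnj (dir_deriv v k b))"
    by (simp add: slope_sum_def sum_distrib_left)
  moreover have "\<dots> = (\<Sum>e\<in>E. \<phi> (fst e 0) * cnj (dir_deriv (start_dir e) k (fst e 0)) +
      \<phi> (fst e (snd e)) * cnj (dir_deriv (end_dir e) k (fst e (snd e))))"
    by (rule sum_Vec_edges[OF sub, of "\<lambda>b v. \<phi> b * cnj (dir_deriv v k b)"])
  moreover have "\<dots> = (\<Sum>e\<in>E. - ((\<phi> (fst e (snd e)) - \<phi> (fst e 0)) * cnj (edge_slope k e)))"
  proof (rule sum.cong[OF refl])
    fix e assume e: "e \<in> E"
    show "\<phi> (fst e 0) * cnj (dir_deriv (start_dir e) k (fst e 0)) +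
      \<phi> (fst e (snd e)) * cnj (dir_deriv (end_dir e) k (fst e (snd e))) =
      - ((\<phi> (fst e (snd e)) - \<phi> (fst e 0)) * cnj (edge_slope k e))"
      unfolding dir_deriv_eqI[OF edge_end_slopes(1)[OF k sub aff e]] dir_deriv_eqI[OF edge_end_slopes(2)[OF k sub aff e]]
      by (simp add: algebra_simps)
  qed
  ultimately show ?thesis by (simp add: sum_negf)
qed

text \<open>The edge alone contributes the squared slope times its length to the energy.\<close>

lemma energy_edge_le:
  assumes k: "continuous_on UNIV k" and sub: "subdivision V E" and aff: "on_edges E affine_piece k" and e: "e \<in> E"
  shows "(cmod (k (fst e (snd e)) - k (fst e 0)))\<^sup>2 \<le> Re (Dir_inner k k) * snd e"
proof -
  note D = subdivisionD[OF sub]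
  have kZ: "k \<in> Zh"
    using k on_edges_piecewise[OF sub on_edges_affine_C2[OF aff]] by (simp add: Zh_def)
  have *: "(LINT t:{0<..<snd e}|lborel. Dint k k (fst e t)) = of_real ((cmod (edge_slope k e))\<^sup>2 * snd e)"
    if e: "e \<in> E" for e
  proof -
    have pos: "0 < snd e" by (rule isom_arc_pos[OF D(5)[OF e]])
    note sd = edge_slope_deriv[OF k sub aff e]
    have "(LINT t:{0<..<snd e}|lborel. Dint k k (fst e t)) = (LINT t:{0<..<snd e}|lborel. complex_of_real ((cmod (edge_slope k e))\<^sup>2))"
      unfolding complex_norm_square
      by (rule set_lebesgue_integral_congI) (rule Dint_inside[OF D(5,6)[OF e] _ _ sd sd], auto)
    also have "\<dots> = of_real ((cmod (edge_slope k e))\<^sup>2 * snd e)"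
      using pos by (simp add: set_lebesgue_integral_def scaleR_conv_of_real mult.commute)
    finally show ?thesis .
  qed
  have pos: "0 < snd e" by (rule isom_arc_pos[OF D(5)[OF e]])
  have "Dir_inner k k = of_real (\<Sum>e\<in>E. (cmod (edge_slope k e))\<^sup>2 * snd e)"
    unfolding Dir_inner_edges(1)[OF kZ kZ sub] of_real_sum by (intro sum.cong refl *)
  then have "Re (Dir_inner k k) = (\<Sum>e\<in>E. (cmod (edge_slope k e))\<^sup>2 * snd e)" by simp
  also have "\<dots> \<ge> (cmod (edge_slope k e))\<^sup>2 * snd e"
  proof (rule member_le_sum[OF e _ D(2)])
    fix e' assume "e' \<in> E - {e}"
    then have "0 < snd e'" using isom_arc_pos[OF D(5)] by blast
    then show "0 \<le> (cmod (edge_slope k e'))\<^sup>2 * snd e'" by simp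
  qed
  finally have "(cmod (edge_slope k e))\<^sup>2 * snd e * snd e \<le> Re (Dir_inner k k) * snd e" using pos by simp
  moreover have "(cmod (edge_slope k e))\<^sup>2 * snd e * snd e = (cmod (k (fst e (snd e)) - k (fst e 0)))\<^sup>2"
    using pos by (simp add: edge_slope_def norm_divide power_divide power2_eq_square)
  ultimately show ?thesis by simp
qed

section \<open>Closability of the Dirichlet form\<close>

lemma edge_differentiable_off_vertices:
  assumes sub: "subdivision V E" and e: "e \<in> E" and sub': "subdivision V' E'" and f: "on_edges E' C2_L1 f"
    and t: "t \<in> {0<..<snd e}" "fst e t \<notin> V'"
  shows "\<exists>a. (f \<circ> fst e has_vector_derivative a) (at t)"
proof -
  obtain e' where e': "e' \<in> E'" "fst e t \<in> open_edge e'" by (rule subdivision_cover[OF sub' t(2)])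
  then obtain t' where t': "t' \<in> {0<..<snd e'}" "fst e t = fst e' t'" by auto
  from edge_differentiable[OF sub' f e'(1) t'(1)] obtain a where a: "(f \<circ> fst e' has_vector_derivative a) (at t')" by (elim exE)
  have "(f \<circ> fst e has_vector_derivative a) (at t) \<or> (f \<circ> fst e has_vector_derivative - a) (at t)"
    by (rule arc_derivative_transfer[OF subdivisionD(5,6)[OF sub e] _ _ subdivisionD(5,6)[OF sub' e'(1)] _ _ t'(2) a])
      (use t t' in auto)
  then show ?thesis by (elim disjE) (rule exI, assumption)+
qed

lemma edge_vertices_finite:
  assumes sub: "subdivision V E" and e: "e \<in> E" and F: "finite F"
  shows "finite {t\<in>{0<..<snd e}. fst e t \<in> F}"
proof (rule finite_imageD)
  show "finite (fst e ` {t\<in>{0<..<snd e}. fst e t \<in> F})" by (rule finite_subset[OF _ F]) auto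
  show "inj_on (fst e) {t\<in>{0<..<snd e}. fst e t \<in> F}"
    by (rule inj_on_subset[OF isom_arc_inj[OF subdivisionD(5)[OF sub e]]]) auto
qed

text \<open>Integration by parts on the edges moves the derivative from \<open>u\<close> to \<open>\<phi>\<close>, whose second
  derivative is integrable and whose first derivative is bounded. Hence uniformly convergent null
  sequences are weakly null for the Dirichlet form, which is why a Dirichlet-Cauchy sequence is
  determined by its uniform limit.\<close>

lemma Dir_inner_bound_uniform:
  assumes \<phi>: "\<phi> \<in> Zh"
  obtains C where "\<And>u B. u \<in> Zh \<Longrightarrow> (\<And>x. cmod (u x) \<le> B) \<Longrightarrow> cmod (Dir_inner u \<phi>) \<le> C * B"
proof -
  obtain V E where sub: "subdivision V E" and \<phi>2: "on_edges E C2_L1 \<phi>"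
    by (rule Zh_pair[OF \<phi> \<phi> finite.emptyI])
  note D = subdivisionD[OF sub]
  have "\<exists>d w. continuous_on {0..snd e} d \<and> (\<forall>t\<in>{0<..<snd e}. (\<phi> \<circ> fst e has_vector_derivative d t) (at t)) \<and>
      (\<forall>t\<in>{0<..<snd e}. (d has_vector_derivative w t) (at t)) \<and> set_integrable lborel {0<..<snd e} w" if "e \<in> E" for e
    by (rule edge_extend[OF sub \<phi>2 that], rule exI, rule exI, intro conjI ballI)
  then obtain d w where dw: "\<And>e. e \<in> E \<Longrightarrow> continuous_on {0..snd e} (d e)"
    "\<And>e t. e \<in> E \<Longrightarrow> t \<in> {0<..<snd e} \<Longrightarrow> (\<phi> \<circ> fst e has_vector_derivative d e t) (at t)"
    "\<And>e t. e \<in> E \<Longrightarrow> t \<in> {0<..<snd e} \<Longrightarrow> (d e has_vector_derivative w e t) (at t)"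
    "\<And>e. e \<in> E \<Longrightarrow> set_integrable lborel {0<..<snd e} (w e)"
    by metis
  define C where "C = (\<Sum>e\<in>E. cmod (d e (snd e)) + cmod (d e 0) + (LINT t:{0<..<snd e}|lborel. cmod (w e t)))"
  have "cmod (Dir_inner u \<phi>) \<le> C * B" if u: "u \<in> Zh" and B: "\<And>x. cmod (u x) \<le> B" for u B
  proof -
    obtain V' E' where sub': "subdivision V' E'" and u2: "on_edges E' C2_L1 u"
      by (rule Zh_pair[OF u u finite.emptyI])
    have "0 \<le> B" using order_trans[OF norm_ge_zero B] .
    have *: "cmod (LINT t:{0<..<snd e}|lborel. Dint u \<phi> (fst e t)) \<le>
        (cmod (d e (snd e)) + cmod (d e 0) + (LINT t:{0<..<snd e}|lborel. cmod (w e t))) * B" if e: "e \<in> E" for e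
    proof -
      \<comment> \<open>The edge comes from a subdivision adapted to \<open>\<phi>\<close>; \<open>u\<close> may have kinks on it at the
        vertices of a subdivision adapted to \<open>u\<close>.\<close>
      define S where "S = {t\<in>{0<..<snd e}. fst e t \<in> V'}"
      have fS: "finite S" unfolding S_def by (rule edge_vertices_finite[OF sub e subdivisionD(1)[OF sub']])
      have pos: "0 < snd e" by (rule isom_arc_pos[OF D(5)[OF e]])
      have uc: "continuous_on {0..snd e} (u \<circ> fst e)" unfolding o_def
        by (rule continuous_on_compose2[OF Zh_continuous[OF u] isom_arc_continuous[OF D(5)[OF e]]]) auto
      have uc': "continuous_on {0<..<snd e} (u \<circ> fst e)" by (rule continuous_on_subset[OF uc]) auto
      have ud: "(u \<circ> fst e has_vector_derivative vector_derivative (u \<circ> fst e) (at t)) (at t)" if "t \<in> {0<..<snd e} - S" for t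
        using edge_differentiable_off_vertices[OF sub e sub' u2, of t] that
        by (auto simp: S_def intro: vector_derivative_works[THEN iffD1] differentiableI_vector)
      have bm: "(\<lambda>t. indicator {0<..<snd e} t *\<^sub>R (u \<circ> fst e) t) \<in> borel_measurable borel"
        by (rule borel_measurable_continuous_on_indicator[OF _ uc']) auto
      have wm: "(\<lambda>t. indicator {0<..<snd e} t *\<^sub>R w e t) \<in> borel_measurable borel"
        using borel_measurable_integrable[OF dw(4)[OF e, unfolded set_integrable_def]] by simp
      have cwm: "(\<lambda>t. cnj (indicator {0<..<snd e} t *\<^sub>R w e t)) \<in> borel_measurable borel"
        by (rule measurable_compose[OF wm]) (intro borel_measurable_continuous_onI continuous_on_cnj continuous_on_id)
      have absw: "set_integrable lborel {0<..<snd e} (\<lambda>t. cmod (w e t))"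
        by (rule set_integrable_norm[OF dw(4)[OF e]])
      have uw: "set_integrable lborel {0<..<snd e} (\<lambda>t. (u \<circ> fst e) t * cnj (w e t))"
        unfolding set_integrable_def
      proof (rule Bochner_Integration.integrable_bound)
        show "integrable lborel (\<lambda>t. B *\<^sub>R (indicator {0<..<snd e} t *\<^sub>R cmod (w e t)))"
          using absw unfolding set_integrable_def by (intro integrable_scaleR_right) simp
        have "(\<lambda>t. (indicator {0<..<snd e} t *\<^sub>R (u \<circ> fst e) t) * cnj (indicator {0<..<snd e} t *\<^sub>R w e t)) \<in> borel_measurable lborel"
          using bm cwm by (intro borel_measurable_times) simp_all
        also have "(\<lambda>t. (indicator {0<..<snd e} t *\<^sub>R (u \<circ> fst e) t) * cnj (indicator {0<..<snd e} t *\<^sub>R w e t)) =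
           (\<lambda>t. indicator {0<..<snd e} t *\<^sub>R ((u \<circ> fst e) t * cnj (w e t)))"
          by (auto simp: indicator_def)
        finally show "(\<lambda>t. indicator {0<..<snd e} t *\<^sub>R ((u \<circ> fst e) t * cnj (w e t))) \<in> borel_measurable lborel" .
        show "AE t in lborel. norm (indicator {0<..<snd e} t *\<^sub>R ((u \<circ> fst e) t * cnj (w e t)))
            \<le> norm (B *\<^sub>R (indicator {0<..<snd e} t *\<^sub>R cmod (w e t)))"
          using B \<open>0 \<le> B\<close> by (auto simp: indicator_def norm_mult intro!: mult_right_mono)
      qed
      define I where "I = (LINT t:{0<..<snd e}|lborel. (u \<circ> fst e) t * cnj (w e t))"
      define y where "y = (u \<circ> fst e) (snd e) * cnj (d e (snd e)) - (u \<circ> fst e) 0 * cnj (d e 0) - I"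
      have hasI: "((\<lambda>t. (u \<circ> fst e) t * cnj (w e t)) has_integral I) {0..snd e}"
        unfolding has_integral_Icc_iff_Ioo I_def set_borel_integral_eq_integral(2)[OF uw]
        by (rule integrable_integral[OF set_borel_integral_eq_integral(1)[OF uw]])
      have "((\<lambda>t. vector_derivative (u \<circ> fst e) (at t) * cnj (d e t)) has_integral y) {0..snd e}"
      proof (rule integration_by_parts_interior_strong[OF bounded_bilinear_mult fS, where f = "u \<circ> fst e" and g = "\<lambda>t. cnj (d e t)"
            and g' = "\<lambda>t. cnj (w e t)"])
        show "0 \<le> snd e" using pos by simp
        show "continuous_on {0..snd e} (\<lambda>t. cnj (d e t))" by (intro continuous_on_cnj dw(1)[OF e])
        show "((\<lambda>t. (u \<circ> fst e) t * cnj (w e t)) has_integral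
          (u \<circ> fst e) (snd e) * cnj (d e (snd e)) - (u \<circ> fst e) 0 * cnj (d e 0) - y) {0..snd e}"
          using hasI by (simp add: y_def)
        show "((\<lambda>t. cnj (d e t)) has_vector_derivative cnj (w e t)) (at t)" if "t \<in> {0<..<snd e} - S" for t
          using dw(3)[OF e, of t] that by (intro has_vector_derivative_cnj) auto
      qed (fact uc ud)+
      then have "((\<lambda>t. vector_derivative (u \<circ> fst e) (at t) * cnj (d e t)) has_integral y) {0<..<snd e}"
        by (simp only: has_integral_Icc_iff_Ioo)
      then have "((\<lambda>t. Dint u \<phi> (fst e t)) has_integral y) {0<..<snd e}"
      proof (rule has_integral_spike_finite[OF fS, rotated])
        fix t assume t: "t \<in> {0<..<snd e} - S"
        then have t': "t \<in> {0<..<snd e}" "0 < t" "t < snd e" by auto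
        show "Dint u \<phi> (fst e t) = vector_derivative (u \<circ> fst e) (at t) * cnj (d e t)"
          by (rule Dint_inside[OF D(5,6)[OF e] t'(2,3) ud[OF t] dw(2)[OF e t'(1)]])
      qed
      then have "(LINT t:{0<..<snd e}|lborel. Dint u \<phi> (fst e t)) = y"
        unfolding set_borel_integral_eq_integral(2)[OF Dir_inner_edges(2)[OF u \<phi> sub e]] by (rule integral_unique)
      moreover have "cmod I \<le> (LINT t:{0<..<snd e}|lborel. cmod ((u \<circ> fst e) t * cnj (w e t)))"
        unfolding I_def by (rule set_integral_norm_bound[OF uw])
      moreover have "\<dots> \<le> (LINT t:{0<..<snd e}|lborel. B * cmod (w e t))"
        by (rule set_integral_mono[OF set_integrable_norm[OF uw]])
          (use absw B in \<open>auto simp: norm_mult intro!: mult_right_mono\<close>)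
      moreover have "\<dots> = B * (LINT t:{0<..<snd e}|lborel. cmod (w e t))" by simp
      moreover have "cmod y \<le> cmod ((u \<circ> fst e) (snd e) * cnj (d e (snd e))) + cmod ((u \<circ> fst e) 0 * cnj (d e 0)) + cmod I"
        unfolding y_def by (intro order_trans[OF norm_triangle_ineq4] add_right_mono norm_triangle_ineq4)
      moreover have "cmod ((u \<circ> fst e) (snd e) * cnj (d e (snd e))) \<le> B * cmod (d e (snd e))"
        "cmod ((u \<circ> fst e) 0 * cnj (d e 0)) \<le> B * cmod (d e 0)"
        using B by (auto simp: norm_mult intro!: mult_right_mono)
      ultimately show ?thesis by (simp add: algebra_simps)
    qed
    have "cmod (Dir_inner u \<phi>) \<le> (\<Sum>e\<in>E. cmod (LINT t:{0<..<snd e}|lborel. Dint u \<phi> (fst e t)))"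
      unfolding Dir_inner_edges(1)[OF u \<phi> sub] by (rule norm_sum)
    also have "\<dots> \<le> C * B" unfolding C_def sum_distrib_right by (rule sum_mono) (rule *)
    finally show ?thesis .
  qed
  then show ?thesis by (rule that)
qed

section \<open>Linear systems\<close>

text \<open>Gaussian elimination: if \<open>a i j0 \<noteq> 0\<close>, equation \<open>i\<close> eliminates the unknown \<open>x j0\<close>.\<close>

lemma underdetermined_system:
  fixes a :: "'i \<Rightarrow> 'j \<Rightarrow> complex"
  assumes "finite I" "finite J" "card I < card J"
  shows "\<exists>x. (\<exists>j\<in>J. x j \<noteq> 0) \<and> (\<forall>i\<in>I. (\<Sum>j\<in>J. a i j * x j) = 0)"
  using assms
proof (induction I arbitrary: J a rule: finite_induct)
  case empty
  then have "J \<noteq> {}" by auto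
  then show ?case by (intro exI[of _ "\<lambda>_. 1"]) auto
next
  case (insert i I)
  show ?case
  proof (cases "\<forall>j\<in>J. a i j = 0")
    case True
    have "card I < card J" using insert by simp
    from insert.IH[OF insert.prems(1) this, of a] obtain x where "\<exists>j\<in>J. x j \<noteq> 0" "\<forall>i\<in>I. (\<Sum>j\<in>J. a i j * x j) = 0"
      by (elim exE conjE)
    then show ?thesis using True by (intro exI[of _ x]) simp
  next
    case False
    then obtain j0 where j0: "j0 \<in> J" "a i j0 \<noteq> 0" by blast
    define J' where "J' = J - {j0}"
    have J': "finite J'" "card I < card J'" using insert j0 by (auto simp: J'_def)
    from insert.IH[OF J', of "\<lambda>i' j. a i' j - a i' j0 * a i j / a i j0"]
    obtain x where x: "\<exists>j\<in>J'. x j \<noteq> 0" "\<forall>i'\<in>I. (\<Sum>j\<in>J'. (a i' j - a i' j0 * a i j / a i j0) * x j) = 0"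
      by (elim exE conjE)
    define s where "s = (\<Sum>j\<in>J'. a i j * x j)"
    define y where "y j = (if j = j0 then - s / a i j0 else x j)" for j
    have sum: "(\<Sum>j\<in>J. c j * y j) = c j0 * (- s / a i j0) + (\<Sum>j\<in>J'. c j * x j)" for c :: "'j \<Rightarrow> complex"
    proof -
      have "(\<Sum>j\<in>J. c j * y j) = c j0 * y j0 + (\<Sum>j\<in>J'. c j * y j)"
        unfolding J'_def using insert.prems(1) j0(1) by (rule sum.remove)
      moreover have "(\<Sum>j\<in>J'. c j * y j) = (\<Sum>j\<in>J'. c j * x j)" by (rule sum.cong) (auto simp: J'_def y_def)
      ultimately show ?thesis by (simp add: y_def)
    qed
    have "(\<Sum>j\<in>J. a i j * y j) = 0" using j0(2) unfolding sum by (simp add: s_def)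
    moreover have "(\<Sum>j\<in>J. a i' j * y j) = 0" if "i' \<in> I" for i'
    proof -
      have "0 = (\<Sum>j\<in>J'. (a i' j - a i' j0 * a i j / a i j0) * x j)" using x(2) that by simp
      also have "\<dots> = (\<Sum>j\<in>J'. a i' j * x j) - (\<Sum>j\<in>J'. (a i' j0 / a i j0) * (a i j * x j))"
        unfolding sum_subtractf[symmetric] by (rule sum.cong) (auto simp: algebra_simps)
      also have "\<dots> = (\<Sum>j\<in>J'. a i' j * x j) - (a i' j0 / a i j0) * s"
        unfolding s_def sum_distrib_left ..
      finally show ?thesis unfolding sum by simp
    qed
    moreover have "\<exists>j\<in>J. y j \<noteq> 0" using x(1) by (auto simp: J'_def y_def)
    ultimately show ?thesis by (intro exI[of _ y]) auto
  qed
qed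

text \<open>The right-hand side becomes a further column, so that a nontrivial solution of the
  enlarged homogeneous system exists. By injectivity its entry at the new column does not vanish,
  and dividing by it solves the system.\<close>

lemma injective_system_solvable:
  fixes a :: "'i \<Rightarrow> 'i \<Rightarrow> complex"
  assumes fin: "finite I" and inj: "\<And>x. (\<And>i. i \<in> I \<Longrightarrow> (\<Sum>j\<in>I. a i j * x j) = 0) \<Longrightarrow> (\<And>j. j \<in> I \<Longrightarrow> x j = 0)"
  obtains x where "\<And>i. i \<in> I \<Longrightarrow> (\<Sum>j\<in>I. a i j * x j) = b i"
proof -
  define J where "J = insert None (Some ` I)"
  have J: "finite J" "card I < card J" using fin by (auto simp: J_def card_image)
  from underdetermined_system[OF fin J, of "\<lambda>i j. case j of None \<Rightarrow> - b i | Some j \<Rightarrow> a i j"]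
  obtain x where x: "\<exists>j\<in>J. x j \<noteq> 0" "\<forall>i\<in>I. (\<Sum>j\<in>J. (case j of None \<Rightarrow> - b i | Some j \<Rightarrow> a i j) * x j) = 0"
    by (elim exE conjE)
  have eq: "(\<Sum>j\<in>I. a i j * x (Some j)) = b i * x None" if "i \<in> I" for i
  proof -
    have "(\<Sum>j\<in>J. (case j of None \<Rightarrow> - b i | Some j \<Rightarrow> a i j) * x j) = - b i * x None + (\<Sum>j\<in>I. a i j * x (Some j))"
      using fin unfolding J_def by (subst sum.insert) (auto simp: sum.reindex)
    then show ?thesis using x(2) that by simp
  qed
  have n0: "x None \<noteq> 0"
  proof
    assume 0: "x None = 0"
    have "x (Some j) = 0" if "j \<in> I" for j
      by (rule inj[of "\<lambda>j. x (Some j)", OF _ that]) (use eq 0 in simp)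
    then show False using x(1) 0 by (auto simp: J_def)
  qed
  show ?thesis
  proof (rule that[of "\<lambda>j. x (Some j) / x None"])
    fix i assume i: "i \<in> I"
    have "(\<Sum>j\<in>I. a i j * (x (Some j) / x None)) = (\<Sum>j\<in>I. a i j * x (Some j)) / x None"
      by (simp add: sum_divide_distrib)
    then show "(\<Sum>j\<in>I. a i j * (x (Some j) / x None)) = b i" using eq[OF i] n0 by simp
  qed
qed

section \<open>The maximum principle\<close>

text \<open>Weaker in appearance than being in \<^const>\<open>CPA\<close>, as no subdivision is given. It is what the
  vanishing of the Laplacian of a function in \<^const>\<open>D_fun\<close> yields directly, and it suffices for the
  maximum principle.\<close>

definition locally_affine :: "('a::metrized_graph \<Rightarrow> complex) \<Rightarrow> bool" where
  "locally_affine w \<longleftrightarrow> (\<forall>p. \<forall>v\<in>Vec p. \<exists>c. eventually (\<lambda>t. w (move p v t) = w p + c * of_real t) (at_right 0))"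

lemma locally_affineD:
  assumes "locally_affine w" "v \<in> Vec p"
  shows "eventually (\<lambda>t. w (move p v t) = w p + dir_deriv v w p * of_real t) (at_right 0)"
    "(diff_quot v w p \<longlongrightarrow> dir_deriv v w p) (at_right 0)"
proof -
  obtain c where c: "eventually (\<lambda>t. w (move p v t) = w p + c * of_real t) (at_right 0)"
    using assms unfolding locally_affine_def by blast
  have "eventually (\<lambda>t. diff_quot v w p t = c) (at_right 0)"
    using c eventually_at_right_less[of 0] by eventually_elim (simp add: diff_quot_def)
  then have l: "(diff_quot v w p \<longlongrightarrow> c) (at_right 0)" by (rule tendsto_eventually)
  then have "dir_deriv v w p = c" by (rule dir_deriv_eqI)
  then show "eventually (\<lambda>t. w (move p v t) = w p + dir_deriv v w p * of_real t) (at_right 0)"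
    "(diff_quot v w p \<longlongrightarrow> dir_deriv v w p) (at_right 0)" using c l by simp_all
qed

lemma eventually_star_ball:
  fixes p :: "'a::metrized_graph"
  assumes "P p" "\<And>v. v \<in> Vec p \<Longrightarrow> eventually (\<lambda>t. P (move p v t)) (at_right 0)"
  obtains \<epsilon> where "\<epsilon> > 0" "\<And>x. x \<in> ball p \<epsilon> \<Longrightarrow> P x"
proof -
  have "eventually (\<lambda>t. \<forall>v\<in>Vec p. P (move p v t)) (at_right 0)"
    by (rule eventually_ball_finite[OF finite_Vec]) (use assms(2) in blast)
  then obtain \<delta> where \<delta>: "\<delta> > 0" "\<And>t. 0 < t \<Longrightarrow> t < \<delta> \<Longrightarrow> \<forall>v\<in>Vec p. P (move p v t)"
    unfolding eventually_at_right_field by blast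
  obtain \<rho> where \<rho>: "star_radius p \<rho>" "\<rho> > 0" using star_radius_exists by blast
  define \<epsilon> where "\<epsilon> = min \<delta> \<rho>"
  have e: "\<epsilon> > 0" using \<delta> \<rho> by (simp add: \<epsilon>_def)
  have sr: "star_radius p \<epsilon>" by (rule star_radius_mono[OF \<rho>(1) e]) (simp add: \<epsilon>_def)
  have "P x" if "x \<in> ball p \<epsilon>" for x
  proof (rule star_radius_ball[OF sr that])
    fix v t assume vt: "v \<in> Vec p" "0 \<le> t" "t < \<epsilon>" "x = move p v t"
    show "P x"
    proof (cases "t = 0")
      case True then show ?thesis using vt assms(1) by simp
    next
      case False
      then have "\<forall>v\<in>Vec p. P (move p v t)" using vt by (intro \<delta>(2)) (auto simp: \<epsilon>_def)
      then show ?thesis using vt by simp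
    qed
  qed
  then show ?thesis using e by (intro that[of \<epsilon>])
qed

text \<open>At a maximum point other than \<open>a\<close> all slopes have real part at most \<open>0\<close> while their sum
  has real part at least \<open>0\<close>. So these real parts vanish and the real part of \<open>w\<close> is locally
  constant there: if \<open>a\<close> were not a maximum point, the closed set of maximum points would be open,
  hence everything.\<close>

lemma maximum_principle:
  fixes w :: "'a::metrized_graph \<Rightarrow> complex"
  assumes cont: "continuous_on UNIV w" and la: "locally_affine w"
    and pos: "\<And>p. p \<noteq> a \<Longrightarrow> 0 \<le> Re (slope_sum w p)"
  shows "Re (w x) \<le> Re (w a)"
proof -
  have cR: "continuous_on UNIV (\<lambda>x. Re (w x))" by (intro continuous_intros cont)
  obtain m where m: "\<And>x. Re (w x) \<le> Re (w m)"
    using continuous_attains_sup[OF graph_compact UNIV_not_empty cR] by blast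
  define A where "A = {x. Re (w x) = Re (w m)}"
  have cl: "closed A"
    unfolding A_def by (intro closed_Collect_eq cR continuous_on_const)
  have "a \<in> A"
  proof (rule ccontr)
    assume a: "a \<notin> A"
    have "open A"
      unfolding open_contains_ball
    proof
      fix p assume p: "p \<in> A"
      have pa: "p \<noteq> a" using p a by auto
      have le: "Re (dir_deriv v w p) \<le> 0" if v: "v \<in> Vec p" for v
      proof -
        obtain t where t: "0 < t" "w (move p v t) = w p + dir_deriv v w p * of_real t"
          by (rule at_right_0_exists[OF locally_affineD(1)[OF la v] zero_less_one])
        have "Re (w (move p v t)) \<le> Re (w p)" using m[of "move p v t"] p by (simp add: A_def)
        then show ?thesis using t by (simp add: mult_le_0_iff)
      qed
      have "0 \<le> (\<Sum>v\<in>Vec p. Re (dir_deriv v w p))" using pos[OF pa] by (simp add: slope_sum_def Re_sum)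
      moreover have "(\<Sum>v\<in>Vec p. Re (dir_deriv v w p)) \<le> 0" by (rule sum_nonpos) (rule le)
      ultimately have "(\<Sum>v\<in>Vec p. - Re (dir_deriv v w p)) = 0" by (simp add: sum_negf)
      then have z: "Re (dir_deriv v w p) = 0" if "v \<in> Vec p" for v
        using sum_nonneg_eq_0_iff[OF finite_Vec, of p "\<lambda>v. - Re (dir_deriv v w p)"] le that by simp
      have ev: "eventually (\<lambda>t. Re (w (move p v t)) = Re (w m)) (at_right 0)" if v: "v \<in> Vec p" for v
        using locally_affineD(1)[OF la v]
      proof eventually_elim
        case (elim t)
        then show ?case using z[OF v] p by (simp add: A_def)
      qed
      obtain \<epsilon> where e: "\<epsilon> > 0" "\<And>x. x \<in> ball p \<epsilon> \<Longrightarrow> Re (w x) = Re (w m)"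
        by (rule eventually_star_ball[of "\<lambda>x. Re (w x) = Re (w m)" p]) (use ev p in \<open>auto simp: A_def\<close>)
      then show "\<exists>e>0. ball p e \<subseteq> A" by (intro exI[of _ \<epsilon>]) (auto simp: A_def)
    qed
    moreover have "m \<in> A" by (simp add: A_def)
    ultimately have "A = UNIV"
      using connected_clopen[of "UNIV::'a set"] graph_connected cl by (auto simp: open_openin[symmetric] closed_closedin[symmetric])
    then show False using a by simp
  qed
  then show ?thesis using m[of x] by (simp add: A_def)
qed

lemma diff_quot_tendsto_cmult:
  assumes "(diff_quot v f p \<longlongrightarrow> d) (at_right 0)"
  shows "(diff_quot v (\<lambda>x. c * f x) p \<longlongrightarrow> c * d) (at_right 0)"
proof -
  have "diff_quot v (\<lambda>x. c * f x) p = (\<lambda>t. c * diff_quot v f p t)"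
    by (rule ext) (simp add: diff_quot_def right_diff_distrib)
  then show ?thesis using tendsto_mult_left[OF assms, of c] by simp
qed

lemma diff_quot_tendsto_diff:
  assumes "(diff_quot v f p \<longlongrightarrow> d) (at_right 0)" "(diff_quot v g p \<longlongrightarrow> d') (at_right 0)"
  shows "(diff_quot v (\<lambda>x. f x - g x) p \<longlongrightarrow> d - d') (at_right 0)"
proof -
  have "diff_quot v (\<lambda>x. f x - g x) p = (\<lambda>t. diff_quot v f p t - diff_quot v g p t)"
    by (rule ext) (simp add: diff_quot_def diff_divide_distrib)
  then show ?thesis using tendsto_diff[OF assms] by simp
qed

lemma D_funD: "f \<in> D_fun \<Longrightarrow> v \<in> Vec p \<Longrightarrow> (diff_quot v f p \<longlongrightarrow> dir_deriv v f p) (at_right 0)"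
proof -
  assume "f \<in> D_fun" "v \<in> Vec p"
  then obtain d where d: "(diff_quot v f p \<longlongrightarrow> d) (at_right 0)" unfolding D_fun_def by blast
  with dir_deriv_eqI[OF d] show ?thesis by simp
qed

lemma slope_sum_cmult: "f \<in> D_fun \<Longrightarrow> slope_sum (\<lambda>x. c * f x) p = c * slope_sum f p"
  unfolding slope_sum_def sum_distrib_left
  by (intro sum.cong refl dir_deriv_eqI diff_quot_tendsto_cmult D_funD)

lemma slope_sum_diff: "f \<in> D_fun \<Longrightarrow> g \<in> D_fun \<Longrightarrow> slope_sum (\<lambda>x. f x - g x) p = slope_sum f p - slope_sum g p"
  unfolding slope_sum_def sum_subtractf[symmetric]
  by (intro sum.cong refl dir_deriv_eqI diff_quot_tendsto_diff D_funD)

lemma edge_of_direction: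
  assumes sub: "subdivision V E" and p: "p \<in> V" and v: "v \<in> Vec p"
  obtains e where "e \<in> E" "(p = fst e 0 \<and> v = start_dir e) \<or> (p = fst e (snd e) \<and> v = end_dir e)"
proof -
  from In_dirs_edge_exists[OF sub p v] obtain e where e: "e \<in> E" "v \<in> In_dirs p (open_edge e)" by (elim bexE)
  note arc = subdivisionD(5)[OF sub e(1)]
  have "p \<in> closure (open_edge e)"
  proof (rule ccontr)
    assume "p \<notin> closure (open_edge e)"
    then have "In_dirs p (open_edge e) = {}" by (rule In_dirs_outside)
    then show False using e(2) by simp
  qed
  then have "p \<in> fst e ` {0..snd e}" by (simp add: isom_arc_closure[OF arc])
  moreover have "p \<notin> open_edge e" using subdivision_inside_V[OF sub e(1)] p by auto
  ultimately have "p = fst e 0 \<or> p = fst e (snd e)" by (simp add: isom_arc_closed_image[OF arc])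
  then have "(p = fst e 0 \<and> v = start_dir e) \<or> (p = fst e (snd e) \<and> v = end_dir e)"
    using e(2) In_dirs_start[OF arc] In_dirs_end[OF arc] by (auto simp: start_dir_def end_dir_def)
  then show ?thesis by (rule that[OF e(1)])
qed

lemma CPA_locally_affine:
  fixes k :: "'a::metrized_graph \<Rightarrow> complex"
  assumes k: "k \<in> CPA" shows "locally_affine k"
  unfolding locally_affine_def
proof (intro allI ballI)
  fix p :: 'a and v assume v: "v \<in> Vec p"
  obtain V E where sub: "subdivision V E" "{p} \<subseteq> V" and aff: "on_edges E affine_piece k"
    by (rule CPA_pair[OF k k, of "{p}"]) auto
  note kc = CPA_continuous[OF k]
  have pV: "p \<in> V" using sub(2) by simp
  obtain e where e: "e \<in> E" "(p = fst e 0 \<and> v = start_dir e) \<or> (p = fst e (snd e) \<and> v = end_dir e)"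
    by (rule edge_of_direction[OF sub(1) pV v])
  note arc = subdivisionD(5)[OF sub(1) e(1)]
  note A = affine_on_edge[OF kc sub(1) aff e(1)]
  have small: "eventually (\<lambda>t. t \<in> {0<..<snd e}) (at_right 0)" by (rule eventually_at_right_real[OF isom_arc_pos[OF arc]])
  show "\<exists>c. eventually (\<lambda>t. k (move p v t) = k p + c * of_real t) (at_right 0)"
    using e(2)
  proof
    assume p: "p = fst e 0 \<and> v = start_dir e"
    have "eventually (\<lambda>t. move (fst e 0) (start_dir e) t = fst e t) (at_right 0)"
      unfolding start_dir_def by (rule leaves_eventually[OF leaves_init_dir[OF arc]])
    with small have "eventually (\<lambda>t. k (move p v t) = k p + edge_slope k e * of_real t) (at_right 0)"
    proof eventually_elim
      case (elim t)
      then show ?case using A[of t] p by simp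
    qed
    then show ?thesis by (rule exI)
  next
    assume p: "p = fst e (snd e) \<and> v = end_dir e"
    have "eventually (\<lambda>t. move (fst e (snd e - 0)) (end_dir e) t = fst e (snd e - t)) (at_right 0)"
      unfolding end_dir_def by (rule leaves_eventually[OF leaves_init_dir[OF isom_arc_rev[OF arc]]])
    with small have "eventually (\<lambda>t. k (move p v t) = k p + (- edge_slope k e) * of_real t) (at_right 0)"
    proof eventually_elim
      case (elim t)
      then have "k (move p v t) = k (fst e (snd e - t))" using p by simp
      also have "\<dots> = k (fst e 0) + edge_slope k e * of_real (snd e - t)" by (rule A) (use elim in auto)
      also have "\<dots> = (k (fst e 0) + edge_slope k e * of_real (snd e)) - edge_slope k e * of_real t"
        by (simp add: algebra_simps)
      also have "k (fst e 0) + edge_slope k e * of_real (snd e) = k p"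
        using A[of "snd e"] isom_arc_pos[OF arc] p by simp
      finally show ?case by simp
    qed
    then show ?thesis by (rule exI)
  qed
qed

lemma CPA_D_fun: "k \<in> CPA \<Longrightarrow> k \<in> D_fun"
  unfolding D_fun_def
  by (intro CollectI allI ballI exI) (rule locally_affineD(2)[OF CPA_locally_affine])

text \<open>The maximum principle with pole \<open>z\<close> for the multiples of \<open>k\<close> by \<open>1\<close>, \<open>-1\<close>, \<open>\<i>\<close> and \<open>-\<i>\<close>.\<close>

lemma CPA_harmonic_off_zero:
  assumes k: "k \<in> CPA" and s: "\<And>p. p \<noteq> z \<Longrightarrow> slope_sum k p = 0" and z: "k z = 0"
  shows "k x = 0"
proof -
  have le: "Re (u * k x) \<le> 0" for u
  proof -
    have uk: "(\<lambda>x. u * k x) \<in> CPA" by (rule CPA_cmult[OF k])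
    have "Re (u * k x) \<le> Re (u * k z)"
      by (rule maximum_principle[OF CPA_continuous[OF uk] CPA_locally_affine[OF uk]])
        (simp add: slope_sum_cmult[OF CPA_D_fun[OF k]] s)
    then show ?thesis using z by simp
  qed
  show ?thesis
    using le[of 1] le[of "-1"] le[of "\<i>"] le[of "-\<i>"] by (simp add: complex_eq_iff)
qed

lemma CPA_unique:
  assumes k: "k \<in> CPA" "k' \<in> CPA" and s: "\<And>p. slope_sum k p = slope_sum k' p" and z: "k z = k' z"
  shows "k = k'"
proof
  fix x
  have "(\<lambda>x. k x - k' x) x = 0"
    by (rule CPA_harmonic_off_zero[OF CPA_diff[OF k], of z])
      (simp_all add: slope_sum_diff[OF CPA_D_fun[OF k(1)] CPA_D_fun[OF k(2)]] s z)
  then show "k x = k' x" by simp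
qed

section \<open>Affine interpolation of vertex values\<close>

definition interp :: "'a::metrized_graph set \<Rightarrow> ((real \<Rightarrow> 'a) \<times> real) set \<Rightarrow> ('a \<Rightarrow> complex) \<Rightarrow> 'a \<Rightarrow> complex" where
  "interp V E c x = (if x \<in> V then c x else
     let e = (SOME e. e \<in> E \<and> x \<in> open_edge e) in
       c (fst e 0) + edge_slope c e * of_real (inv_into {0..snd e} (fst e) x))"

lemma interp_vertex: "x \<in> V \<Longrightarrow> interp V E c x = c x"
  by (simp add: interp_def)

lemma interp_edge:
  assumes sub: "subdivision V E" and e: "e \<in> E" and t: "t \<in> {0..snd e}"
  shows "interp V E c (fst e t) = c (fst e 0) + edge_slope c e * of_real t"
proof -
  note D = subdivisionD[OF sub]
  note arc = D(5)[OF e]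
  have pos: "0 < snd e" by (rule isom_arc_pos[OF arc])
  consider "t = 0" | "t = snd e" | "t \<in> {0<..<snd e}" using t by force
  then show ?thesis
  proof cases
    case 1
    then show ?thesis using interp_vertex[OF D(7)[OF e]] by simp
  next
    case 2
    then show ?thesis using interp_vertex[OF D(8)[OF e]] pos by (simp add: edge_slope_def)
  next
    case 3
    then have x: "fst e t \<in> open_edge e" by simp
    then have nV: "fst e t \<notin> V" using subdivision_inside_V[OF sub e] by blast
    have s: "(SOME e'. e' \<in> E \<and> fst e t \<in> open_edge e') = e"
    proof (rule some_equality)
      show "e \<in> E \<and> fst e t \<in> open_edge e" using e x by simp
      show "e' = e" if "e' \<in> E \<and> fst e t \<in> open_edge e'" for e'
        by (rule subdivision_unique[OF sub _ e _ x]) (use that in auto)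
    qed
    have "inv_into {0..snd e} (fst e) (fst e t) = t" by (rule inv_into_f_f[OF isom_arc_inj[OF arc] t])
    then show ?thesis using nV by (simp add: interp_def s)
  qed
qed

lemma edge_slope_interp:
  assumes sub: "subdivision V E" and e: "e \<in> E"
  shows "edge_slope (interp V E c) e = edge_slope c e"
  unfolding edge_slope_def
  using interp_vertex[OF subdivisionD(7)[OF sub e]] interp_vertex[OF subdivisionD(8)[OF sub e]] by simp

lemma interp_CPA:
  assumes sub: "subdivision V E"
  shows "interp V E c \<in> CPA" "on_edges E affine_piece (interp V E c)"
proof -
  note D = subdivisionD[OF sub]
  show aff: "on_edges E affine_piece (interp V E c)"
    unfolding on_edges_def affine_piece_def
  proof
    fix e assume e: "e \<in> E"
    show "\<exists>p q. \<forall>t\<in>{0<..<snd e}. (interp V E c \<circ> fst e) t = p + q * of_real t"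
      by (rule exI[of _ "c (fst e 0)"], rule exI[of _ "edge_slope c e"]) (simp add: interp_edge[OF sub e])
  qed
  have ce: "continuous_on (fst e ` {0..snd e}) (interp V E c)" if e: "e \<in> E" for e
  proof -
    note i = isom_arc_isom_on[OF D(5)[OF e]]
    have "continuous_on (fst e ` {0..snd e}) (\<lambda>x. c (fst e 0) + edge_slope c e * of_real (inv_into {0..snd e} (fst e) x))"
      by (intro continuous_intros isom_on_inv_continuous[OF i])
    then show ?thesis
    proof (rule continuous_on_eq)
      fix x assume "x \<in> fst e ` {0..snd e}"
      then obtain t where t: "t \<in> {0..snd e}" "x = fst e t" by auto
      show "c (fst e 0) + edge_slope c e * of_real (inv_into {0..snd e} (fst e) x) = interp V E c x"
        unfolding t(2) inv_into_f_f[OF isom_arc_inj[OF D(5)[OF e]] t(1)] interp_edge[OF sub e t(1)] ..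
    qed
  qed
  have "continuous_on (\<Union>e\<in>E. fst e ` {0..snd e}) (interp V E c)"
    by (rule continuous_on_closed_Union[OF D(2) _ ce]) (intro compact_imp_closed isom_arc_compact D(5))
  moreover have "continuous_on V (interp V E c)" by (rule continuous_on_finite[OF D(1)])
  moreover have "closed (\<Union>e\<in>E. fst e ` {0..snd e})"
    using D(2) by (intro closed_UN ballI compact_imp_closed isom_arc_compact D(5))
  ultimately have "continuous_on ((\<Union>e\<in>E. fst e ` {0..snd e}) \<union> V) (interp V E c)"
    using finite_imp_closed[OF D(1)] by (intro continuous_on_closed_Un)
  moreover have "(\<Union>e\<in>E. fst e ` {0..snd e}) \<union> V = UNIV"
  proof -
    have "x \<in> (\<Union>e\<in>E. fst e ` {0..snd e}) \<union> V" for x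
    proof (cases "x \<in> V")
      case False
      then obtain e where e: "e \<in> E" "x \<in> open_edge e" by (rule subdivision_cover[OF sub])
      have "open_edge e \<subseteq> fst e ` {0..snd e}" by (rule image_mono) auto
      then show ?thesis using e by blast
    qed simp
    then show ?thesis by blast
  qed
  ultimately have "continuous_on UNIV (interp V E c)" by simp
  then show "interp V E c \<in> CPA" using on_edges_piecewise[OF sub aff] by (simp add: CPA_def)
qed

lemma slope_sum_vertex:
  assumes k: "continuous_on UNIV k" and sub: "subdivision V E" and aff: "on_edges E affine_piece k" and b: "b \<in> V"
  shows "slope_sum k b = (\<Sum>e\<in>E. ((if fst e 0 = b then 1 else 0) - (if fst e (snd e) = b then 1 else 0)) * edge_slope k e)"
proof -
  have "slope_sum k b = (\<Sum>b'\<in>V. if b' = b then slope_sum k b' else 0)"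
    using subdivisionD(1)[OF sub] b by simp
  also have "\<dots> = (\<Sum>b'\<in>V. \<Sum>v\<in>Vec b'. if b' = b then dir_deriv v k b' else 0)"
    by (rule sum.cong) (auto simp: slope_sum_def)
  also have "\<dots> = (\<Sum>e\<in>E. (if fst e 0 = b then dir_deriv (start_dir e) k (fst e 0) else 0) +
      (if fst e (snd e) = b then dir_deriv (end_dir e) k (fst e (snd e)) else 0))"
    by (rule sum_Vec_edges[OF sub])
  also have "\<dots> = (\<Sum>e\<in>E. ((if fst e 0 = b then 1 else 0) - (if fst e (snd e) = b then 1 else 0)) * edge_slope k e)"
  proof (rule sum.cong[OF refl])
    fix e assume e: "e \<in> E"
    show "(if fst e 0 = b then dir_deriv (start_dir e) k (fst e 0) else 0) +
      (if fst e (snd e) = b then dir_deriv (end_dir e) k (fst e (snd e)) else 0) =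
      ((if fst e 0 = b then 1 else 0) - (if fst e (snd e) = b then 1 else 0)) * edge_slope k e"
      unfolding dir_deriv_eqI[OF edge_end_slopes(1)[OF k sub aff e]] dir_deriv_eqI[OF edge_end_slopes(2)[OF k sub aff e]]
      by simp
  qed
  finally show ?thesis .
qed

section \<open>The Green kernel based at a point\<close>

text \<open>For functions affine on the edges, prescribing the value at \<open>z\<close> and the slope sums at all
  other vertices is a square linear system for the vertex values. It is injective by the maximum
  principle, hence solvable. The slope sum at \<open>z\<close> is then forced, because the slope sums over all
  vertices add up to \<open>0\<close>: each edge contributes its slope twice, with opposite signs.\<close>

lemma kernel_exists:
  fixes z y :: "'a::metrized_graph"
  assumes sub: "subdivision V E" and z: "z \<in> V" and y: "y \<in> V"
  shows "\<exists>k. k \<in> CPA \<and> on_edges E affine_piece k \<and> k z = 0 \<and>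
    (\<forall>p. slope_sum k p = (if p = z then 1 else 0) - (if p = y then 1 else 0))"
proof -
  note D = subdivisionD[OF sub]
  define s where "s b e = ((if fst e 0 = b then 1 else 0) - (if fst e (snd e) = b then 1 else 0) :: complex)"
    for b :: 'a and e :: "(real \<Rightarrow> 'a) \<times> real"
  define L where "L b b' = (\<Sum>e\<in>E. s b e * (- s b' e) / of_real (snd e))" for b b'
  have L: "(\<Sum>b'\<in>V. L b b' * c b') = slope_sum (interp V E c) b" if b: "b \<in> V" for b and c :: "'a \<Rightarrow> complex"
  proof -
    have cs: "(\<Sum>b'\<in>V. - s b' e * c b') = c (fst e (snd e)) - c (fst e 0)" if e: "e \<in> E" for e
    proof -
      have "(\<Sum>b'\<in>V. - s b' e * c b') = (\<Sum>b'\<in>V. (if fst e (snd e) = b' then c b' else 0) - (if fst e 0 = b' then c b' else 0))"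
        by (rule sum.cong) (auto simp: s_def)
      also have "\<dots> = c (fst e (snd e)) - c (fst e 0)"
        unfolding sum_subtractf using D(1) D(7,8)[OF e] by simp
      finally show ?thesis .
    qed
    have "(\<Sum>b'\<in>V. L b b' * c b') = (\<Sum>b'\<in>V. \<Sum>e\<in>E. s b e / of_real (snd e) * (- s b' e * c b'))"
      unfolding L_def sum_distrib_right by (intro sum.cong refl) simp
    also have "\<dots> = (\<Sum>e\<in>E. s b e / of_real (snd e) * (\<Sum>b'\<in>V. - s b' e * c b'))"
      unfolding sum_distrib_left by (rule sum.swap)
    also have "\<dots> = (\<Sum>e\<in>E. s b e * edge_slope c e)"
    proof (rule sum.cong[OF refl])
      fix e assume e: "e \<in> E"
      show "s b e / of_real (snd e) * (\<Sum>b'\<in>V. - s b' e * c b') = s b e * edge_slope c e"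
        unfolding cs[OF e] by (simp add: edge_slope_def)
    qed
    also have "\<dots> = slope_sum (interp V E c) b"
      unfolding slope_sum_vertex[OF CPA_continuous[OF interp_CPA(1)[OF sub]] sub interp_CPA(2)[OF sub] b] s_def
      by (rule sum.cong[OF refl]) (simp add: edge_slope_interp[OF sub])
    finally show ?thesis .
  qed
  \<comment> \<open>The equation at \<open>z\<close> is replaced by prescribing the value there.\<close>
  define a where "a b b' = (if b = z then (if b' = z then 1 else 0) else L b b')" for b b'
  have a: "(\<Sum>b'\<in>V. a b b' * c b') = (if b = z then c z else slope_sum (interp V E c) b)" if b: "b \<in> V" for b and c :: "'a \<Rightarrow> complex"
  proof (cases "b = z")
    case True
    have "(\<Sum>b'\<in>V. a b b' * c b') = (\<Sum>b'\<in>V. if b' = z then c b' else 0)" by (rule sum.cong) (auto simp: a_def True)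
    then show ?thesis using True D(1) z by simp
  next
    case False
    then show ?thesis using L[OF b] by (simp add: a_def)
  qed
  have off: "slope_sum (interp V E c) p = 0" if "p \<notin> V" for p c
    by (rule slope_sum_off_vertices[OF CPA_continuous[OF interp_CPA(1)[OF sub]] sub interp_CPA(2)[OF sub] that])
  have inj: "c b = 0" if c: "\<And>b. b \<in> V \<Longrightarrow> (\<Sum>b'\<in>V. a b b' * c b') = 0" and b: "b \<in> V" for c :: "'a \<Rightarrow> complex" and b
  proof -
    let ?k = "interp V E c"
    have k: "?k \<in> CPA" by (rule interp_CPA(1)[OF sub])
    have s0: "slope_sum ?k p = 0" if "p \<noteq> z" for p
      using c[of p] a[of p c] off[of p c] that by (cases "p \<in> V") auto
    have cz: "c z = 0" using c[OF z] a[OF z, of c] by simp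
    have "?k b = 0" by (rule CPA_harmonic_off_zero[OF k, where z = z]) (rule s0, assumption, simp only: interp_vertex[OF z] cz)
    then show ?thesis by (simp add: interp_vertex[OF b])
  qed
  obtain c where c: "\<And>b. b \<in> V \<Longrightarrow> (\<Sum>b'\<in>V. a b b' * c b') = (if b = z then 0 else - (if b = y then 1 else 0))"
    by (rule injective_system_solvable[OF D(1), of a "\<lambda>b. if b = z then 0 else - (if b = y then 1 else 0)"])
      (use inj in blast)+
  let ?k = "interp V E c"
  have kz: "?k z = 0" using c[OF z] a[OF z, of c] by (simp add: interp_vertex[OF z])
  have kb: "slope_sum ?k b = - (if b = y then 1 else 0)" if "b \<in> V" "b \<noteq> z" for b
    using c[OF that(1)] a[OF that(1), of c] that(2) by simp
  have "(\<Sum>b\<in>V. slope_sum ?k b) = (\<Sum>b\<in>V. \<Sum>v\<in>Vec b. dir_deriv v ?k b)" by (simp add: slope_sum_def)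
  also have "\<dots> = (\<Sum>e\<in>E. dir_deriv (start_dir e) ?k (fst e 0) + dir_deriv (end_dir e) ?k (fst e (snd e)))"
    by (rule sum_Vec_edges[OF sub])
  also have "\<dots> = (\<Sum>e\<in>E. 0)"
  proof (rule sum.cong[OF refl])
    fix e assume e: "e \<in> E"
    show "dir_deriv (start_dir e) ?k (fst e 0) + dir_deriv (end_dir e) ?k (fst e (snd e)) = 0"
      unfolding dir_deriv_eqI[OF edge_end_slopes(1)[OF CPA_continuous[OF interp_CPA(1)[OF sub]] sub interp_CPA(2)[OF sub] e]]
        dir_deriv_eqI[OF edge_end_slopes(2)[OF CPA_continuous[OF interp_CPA(1)[OF sub]] sub interp_CPA(2)[OF sub] e]] by simp
  qed
  finally have tot: "(\<Sum>b\<in>V. slope_sum ?k b) = 0" by simp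
  have "(\<Sum>b\<in>V. slope_sum ?k b) = slope_sum ?k z + (\<Sum>b\<in>V - {z}. slope_sum ?k b)"
    by (rule sum.remove[OF D(1) z])
  also have "(\<Sum>b\<in>V - {z}. slope_sum ?k b) = (\<Sum>b\<in>V - {z}. if b = y then - 1 else 0)"
    by (rule sum.cong) (simp_all add: kb)
  also have "\<dots> = (if y = z then 0 else - 1)" using D(1) y by auto
  finally have sz: "slope_sum ?k z = (if y = z then 0 else 1)" using tot by (simp split: if_splits)
  have "slope_sum ?k p = (if p = z then 1 else 0) - (if p = y then 1 else 0)" for p
    using sz kb[of p] off[of p c] z y by (cases "p \<in> V") auto
  then show ?thesis using interp_CPA[OF sub, of c] kz by blast
qed

text \<open>This is \<open>x \<mapsto> j_fun z x y\<close> (\<open>j_fun_ker\<close>), characterized by slope sums at points instead of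
  by the values of its Laplacian on Borel sets.\<close>

definition ker :: "'a::metrized_graph \<Rightarrow> 'a \<Rightarrow> 'a \<Rightarrow> complex" where
  "ker z y = (THE k. k \<in> CPA \<and> k z = 0 \<and> (\<forall>p. slope_sum k p = (if p = z then 1 else 0) - (if p = y then 1 else 0)))"

lemma kernel_unique_ex:
  fixes z y :: "'a::metrized_graph"
  shows "\<exists>!k. k \<in> CPA \<and> k z = 0 \<and> (\<forall>p. slope_sum k p = (if p = z then 1 else 0) - (if p = y then 1 else 0))"
proof -
  obtain V and E :: "((real \<Rightarrow> 'a) \<times> real) set" where sub: "subdivision V E" "{z, y} \<subseteq> V"
    by (rule subdivision_exists[of "{z, y}"]) auto
  have zy: "z \<in> V" "y \<in> V" using sub(2) by auto
  from kernel_exists[OF sub(1) zy] obtain k where k: "k \<in> CPA" "k z = 0"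
    "\<forall>p. slope_sum k p = (if p = z then 1 else 0) - (if p = y then 1 else 0)" by (elim exE conjE)
  show ?thesis
  proof (rule ex1I[of _ k])
    show "k \<in> CPA \<and> k z = 0 \<and> (\<forall>p. slope_sum k p = (if p = z then 1 else 0) - (if p = y then 1 else 0))"
      using k by blast
    fix k' assume k': "k' \<in> CPA \<and> k' z = 0 \<and> (\<forall>p. slope_sum k' p = (if p = z then 1 else 0) - (if p = y then 1 else 0))"
    show "k' = k" by (rule CPA_unique[where z = z]) (use k k' in simp_all)
  qed
qed

lemma ker:
  shows ker_CPA: "ker z y \<in> CPA" and ker_base: "ker z y z = 0"
    and ker_slope: "slope_sum (ker z y) p = (if p = z then 1 else 0) - (if p = y then 1 else 0)"
  using theI'[OF kernel_unique_ex[of z y]] unfolding ker_def[symmetric] by blast+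

lemma ker_eqI:
  assumes "k \<in> CPA" "k z = 0" "\<And>p. slope_sum k p = (if p = z then 1 else 0) - (if p = y then 1 else 0)"
  shows "ker z y = k"
proof (rule CPA_unique[where z = z, OF ker_CPA assms(1)])
  show "slope_sum (ker z y) p = slope_sum k p" for p unfolding assms(3) by (rule ker_slope)
  show "ker z y z = k z" by (simp only: assms(2) ker_base)
qed

lemma ker_on_edges:
  assumes "subdivision V E" "z \<in> V" "y \<in> V"
  shows "on_edges E affine_piece (ker z y)"
proof -
  from kernel_exists[OF assms] obtain k where k: "k \<in> CPA" "on_edges E affine_piece k" "k z = 0"
    "\<forall>p. slope_sum k p = (if p = z then 1 else 0) - (if p = y then 1 else 0)" by (elim exE conjE)
  have "ker z y = k" by (rule ker_eqI) (use k in auto)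
  then show ?thesis using k(2) by simp
qed

lemma ker_Zh: "ker z y \<in> Zh" using ker_CPA CPA_subset_Zh by blast

lemma ker_continuous: "continuous_on UNIV (ker z y)" by (rule CPA_continuous[OF ker_CPA])

text \<open>In Green's formula only the slope sums at \<open>z\<close> and \<open>y\<close> survive. So point evaluation, up to
  the value at \<open>z\<close>, is the Dirichlet product with the kernel; symmetry, the Lipschitz bound and
  the weak form of the eigenvalue equation all come from this.\<close>

lemma ker_reproducing:
  assumes \<phi>: "\<phi> \<in> Zh"
  shows "Dir_inner \<phi> (ker z y) = \<phi> y - \<phi> z"
proof -
  obtain V E where sub: "subdivision V E" "{z, y} \<subseteq> V" and \<phi>2: "on_edges E C2_L1 \<phi>"
    by (rule Zh_pair[OF \<phi> \<phi>, of "{z, y}"]) auto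
  have zy: "z \<in> V" "y \<in> V" using sub(2) by auto
  have "Dir_inner \<phi> (ker z y) = - (\<Sum>b\<in>V. \<phi> b * cnj (slope_sum (ker z y) b))"
    by (rule Green_formula[OF \<phi> ker_continuous sub(1) \<phi>2 ker_on_edges[OF sub(1) zy]])
  also have "\<dots> = - (\<Sum>b\<in>V. (if b = z then \<phi> b else 0) - (if b = y then \<phi> b else 0))"
    by (intro arg_cong[of _ _ uminus] sum.cong) (auto simp: ker_slope)
  also have "\<dots> = \<phi> y - \<phi> z" unfolding sum_subtractf using subdivisionD(1)[OF sub(1)] zy by simp
  finally show ?thesis .
qed

lemma ker_real: "Im (ker z y x) = 0"
proof -
  have le: "Re (u * ker z y x) \<le> 0" if "Re u = 0" for u
  proof -
    have uk: "(\<lambda>x. u * ker z y x) \<in> CPA" by (rule CPA_cmult[OF ker_CPA])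
    have "Re (u * ker z y x) \<le> Re (u * ker z y z)"
      by (rule maximum_principle[OF CPA_continuous[OF uk] CPA_locally_affine[OF uk]])
        (simp add: slope_sum_cmult[OF CPA_D_fun[OF ker_CPA]] ker_slope that)
    then show ?thesis by (simp add: ker_base)
  qed
  show ?thesis using le[of "\<i>"] le[of "-\<i>"] by simp
qed

text \<open>Up to complex conjugation both values are the Dirichlet product of \<open>ker z x\<close> and \<open>ker z
  y\<close>, and they are real.\<close>

lemma ker_symmetric: "ker z y x = ker z x y"
proof -
  have "ker z x y = Dir_inner (ker z x) (ker z y)" using ker_reproducing[OF ker_Zh, of z x z y] ker_base by simp
  moreover have "ker z y x = Dir_inner (ker z y) (ker z x)" using ker_reproducing[OF ker_Zh, of z y z x] ker_base by simp
  ultimately have "ker z y x = cnj (ker z x y)" using Dir_inner_commute by metis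
  then show ?thesis using ker_real[of z x y] by (simp add: complex_eq_iff)
qed

lemma slope_sum_const: "slope_sum (\<lambda>x. c) p = 0"
proof -
  have "dir_deriv v (\<lambda>x. c) p = 0" for v
  proof (rule dir_deriv_eqI)
    have "diff_quot v (\<lambda>x. c) p = (\<lambda>t. 0)" by (rule ext) (simp add: diff_quot_def)
    then show "(diff_quot v (\<lambda>x. c) p \<longlongrightarrow> 0) (at_right 0)" by simp
  qed
  then show ?thesis by (simp add: slope_sum_def)
qed

lemma ker_change_base: "ker \<zeta> y x = ker z y x - ker z \<zeta> x - (ker z y \<zeta> - ker z \<zeta> \<zeta>)"
proof -
  let ?c = "ker z y \<zeta> - ker z \<zeta> \<zeta>"
  have d: "(\<lambda>x. ker z y x - ker z \<zeta> x) \<in> CPA" by (rule CPA_diff[OF ker_CPA ker_CPA])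
  have c0: "(\<lambda>x::'a. ?c) \<in> CPA" by (rule CPA_const)
  have "ker \<zeta> y = (\<lambda>x. (ker z y x - ker z \<zeta> x) - ?c)"
  proof (rule ker_eqI)
    show "(\<lambda>x. (ker z y x - ker z \<zeta> x) - ?c) \<in> CPA" by (rule CPA_diff[OF d c0])
    show "slope_sum (\<lambda>x. (ker z y x - ker z \<zeta> x) - ?c) p = (if p = \<zeta> then 1 else 0) - (if p = y then 1 else 0)" for p
      unfolding slope_sum_diff[OF CPA_D_fun[OF d] CPA_D_fun[OF c0]]
        slope_sum_diff[OF CPA_D_fun[OF ker_CPA] CPA_D_fun[OF ker_CPA]] slope_sum_const ker_slope by simp
  qed simp
  then show ?thesis by (simp add: fun_eq_iff)
qed

lemma j_fun_ker: "j_fun \<zeta> x y = ker \<zeta> y x"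
proof -
  have "(\<forall>E\<in>sets borel. CPA_laplacian h E = indicator E y - indicator E \<zeta>) \<longleftrightarrow>
      (\<forall>p. slope_sum h p = (if p = \<zeta> then 1 else 0) - (if p = y then 1 else 0))" for h :: "'a \<Rightarrow> complex"
  proof
    assume *: "\<forall>E\<in>sets borel. CPA_laplacian h E = indicator E y - indicator E \<zeta>"
    show "\<forall>p. slope_sum h p = (if p = \<zeta> then 1 else 0) - (if p = y then 1 else 0)"
    proof
      fix p
      have e: "{q \<in> {p}. slope_sum h q \<noteq> 0} = (if slope_sum h p = 0 then {} else {p})" by auto
      have "{p} \<in> sets borel" by simp
      with * have "CPA_laplacian h {p} = indicator {p} y - indicator {p} \<zeta>" by blast
      moreover have "CPA_laplacian h {p} = - slope_sum h p" unfolding CPA_laplacian_def e by simp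
      ultimately have "- slope_sum h p = indicator {p} y - indicator {p} \<zeta>" by simp
      from arg_cong[OF this, of uminus]
      show "slope_sum h p = (if p = \<zeta> then 1 else 0) - (if p = y then 1 else 0)"
        by (simp add: indicator_def eq_commute)
    qed
  next
    assume *: "\<forall>p. slope_sum h p = (if p = \<zeta> then 1 else 0) - (if p = y then 1 else 0)"
    show "\<forall>E\<in>sets borel. CPA_laplacian h E = indicator E y - indicator E \<zeta>"
    proof
      fix E :: "'a set"
      have "(\<Sum>p\<in>{p\<in>E. slope_sum h p \<noteq> 0}. slope_sum h p) = (\<Sum>p\<in>{\<zeta>, y} \<inter> E. slope_sum h p)"
        by (rule sum.mono_neutral_left) (auto simp: * split: if_splits)
      also have "\<dots> = indicator E \<zeta> - indicator E y"
        by (cases "\<zeta> = y"; cases "\<zeta> \<in> E"; cases "y \<in> E") (auto simp: * Int_insert_left)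
      finally show "CPA_laplacian h E = indicator E y - indicator E \<zeta>" by (simp add: CPA_laplacian_def)
    qed
  qed
  then show ?thesis unfolding j_fun_def ker_def by (simp add: conj_commute)
qed

section \<open>The Green kernel is Lipschitz with constant 1\<close>

text \<open>For the end points \<open>a\<close> and \<open>b\<close> of the edge let \<open>w = ker b a\<close>. Its values lie between \<open>0\<close>
  and \<open>R = w a\<close> by the maximum principle, and its energy is also \<open>R\<close> by the reproducing property.
  The part of the energy on the edge itself gives \<open>R\<^sup>2 \<le> R l\<close> for the length \<open>l\<close>, so \<open>R \<le> l\<close>: the
  effective resistance is at most the resistance of the edge. The increment of \<open>ker z x\<close> along the
  edge is a difference of two values of \<open>w\<close>, again by the reproducing property.\<close>

lemma ker_edge_slope:
  assumes sub: "subdivision V E" and zx: "z \<in> V" "x \<in> V" and e: "e \<in> E"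
  shows "cmod (edge_slope (ker z x) e) \<le> 1"
proof -
  define a where "a = fst e 0"
  define b where "b = fst e (snd e)"
  have ab: "a \<in> V" "b \<in> V" using subdivisionD(7,8)[OF sub e] by (auto simp: a_def b_def)
  have pos: "0 < snd e" by (rule isom_arc_pos[OF subdivisionD(5)[OF sub e]])
  define w where "w = ker b a"
  have wZ: "w \<in> Zh" and wC: "w \<in> CPA" by (simp_all add: w_def ker_Zh ker_CPA)
  have wb: "w b = 0" by (simp add: w_def ker_base)
  have up: "Re (w q) \<le> Re (w a)" for q
    by (rule maximum_principle[OF CPA_continuous[OF wC] CPA_locally_affine[OF wC]]) (simp add: w_def ker_slope)
  have lo: "Re (w b) \<le> Re (w q)" for q
  proof -
    have nC: "(\<lambda>q. (-1) * w q) \<in> CPA" by (rule CPA_cmult[OF wC])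
    have "Re ((-1) * w q) \<le> Re ((-1) * w b)"
    proof (rule maximum_principle[OF CPA_continuous[OF nC] CPA_locally_affine[OF nC]])
      fix p assume "p \<noteq> b"
      then show "0 \<le> Re (slope_sum (\<lambda>q. (-1) * w q) p)"
        unfolding slope_sum_cmult[OF CPA_D_fun[OF wC]] by (simp add: w_def ker_slope)
    qed
    then show ?thesis by simp
  qed
  define R where "R = Re (w a)"
  have R0: "0 \<le> R" using lo[of a] wb by (simp add: R_def)
  have ww: "Dir_inner w w = w a"
    using ker_reproducing[OF wZ, of b a] wb by (simp add: w_def[symmetric])
  have wa: "w a = of_real R" using ker_real[of b a a] by (simp add: w_def R_def complex_eq_iff)
  have aff: "on_edges E affine_piece w" unfolding w_def by (rule ker_on_edges[OF sub ab(2,1)])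
  have "(cmod (w b - w a))\<^sup>2 \<le> Re (Dir_inner w w) * snd e"
    using energy_edge_le[OF CPA_continuous[OF wC] sub aff e] by (simp add: a_def b_def)
  then have "R * R \<le> R * snd e" using R0 by (simp add: wb wa ww power2_eq_square)
  then have Rl: "R \<le> snd e" using R0 pos by (cases "R = 0") auto
  have "ker z x a - ker z x b = Dir_inner (ker z x) w"
    unfolding w_def by (rule ker_reproducing[OF ker_Zh, symmetric])
  also have "\<dots> = cnj (Dir_inner w (ker z x))" by (rule Dir_inner_commute)
  also have "\<dots> = cnj (w x - w z)" unfolding ker_reproducing[OF wZ] ..
  finally have "cmod (ker z x a - ker z x b) = cmod (w x - w z)" by (simp only: complex_mod_cnj)
  also have "\<dots> = \<bar>Re (w x) - Re (w z)\<bar>"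
    using ker_real[of b a x] ker_real[of b a z] by (simp add: w_def cmod_def)
  also have "\<dots> \<le> R" using up[of x] up[of z] lo[of x] lo[of z] wb by (simp add: R_def)
  finally have "cmod (ker z x b - ker z x a) \<le> snd e" using Rl by (simp add: norm_minus_commute)
  then show ?thesis using pos by (simp add: edge_slope_def a_def b_def norm_divide)
qed

text \<open>Apart from finitely many parameters the derivative along the arc is, up to sign, an edge
  slope.\<close>

lemma ker_lipschitz_arc:
  assumes \<gamma>: "isom_arc \<gamma> l" "open (\<gamma> ` {0<..<l})" and t: "0 \<le> t" "t \<le> l"
  shows "cmod (ker z x (\<gamma> t) - ker z x (\<gamma> 0)) \<le> t"
proof -
  obtain V and E :: "((real \<Rightarrow> 'a) \<times> real) set" where sub: "subdivision V E" "{z, x} \<subseteq> V"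
    by (rule subdivision_exists[of "{z, x}"]) auto
  have zx: "z \<in> V" "x \<in> V" using sub(2) by auto
  note D = subdivisionD[OF sub(1)]
  note aff = ker_on_edges[OF sub(1) zx]
  let ?k = "ker z x"
  define S where "S = {s\<in>{0..l}. \<gamma> s \<in> V}"
  have fS: "finite S"
  proof (rule finite_imageD)
    show "finite (\<gamma> ` S)" by (rule finite_subset[OF _ D(1)]) (auto simp: S_def)
    show "inj_on \<gamma> S" by (rule inj_on_subset[OF isom_arc_inj[OF \<gamma>(1)]]) (auto simp: S_def)
  qed
  have "\<exists>a. cmod a \<le> 1 \<and> (s \<in> {0<..<l} - S \<longrightarrow> (?k \<circ> \<gamma> has_vector_derivative a) (at s))" for s
  proof (cases "s \<in> {0<..<l} - S")
    case True
    then have s: "0 < s" "s < l" "\<gamma> s \<notin> V" by (auto simp: S_def)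
    obtain e where e: "e \<in> E" "\<gamma> s \<in> open_edge e" by (rule subdivision_cover[OF sub(1) s(3)])
    then obtain u where u: "0 < u" "u < snd e" "\<gamma> s = fst e u" by auto
    have sl: "cmod (edge_slope ?k e) \<le> 1" by (rule ker_edge_slope[OF sub(1) zx e(1)])
    have "(?k \<circ> fst e has_vector_derivative edge_slope ?k e) (at u)"
      by (rule edge_slope_deriv[OF ker_continuous sub(1) aff e(1)]) (use u in auto)
    from arc_derivative_transfer[OF \<gamma> s(1,2) D(5,6)[OF e(1)] u this]
    show ?thesis
    proof
      assume "(?k \<circ> \<gamma> has_vector_derivative edge_slope ?k e) (at s)"
      then show ?thesis using sl by (intro exI[of _ "edge_slope ?k e"]) simp
    next
      assume "(?k \<circ> \<gamma> has_vector_derivative - edge_slope ?k e) (at s)"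
      then show ?thesis using sl by (intro exI[of _ "- edge_slope ?k e"]) simp
    qed
  next
    case False
    show ?thesis by (rule exI[of _ 0]) (simp only: False, simp)
  qed
  then obtain d where d: "\<And>s. cmod (d s) \<le> 1" "\<And>s. s \<in> {0<..<l} - S \<Longrightarrow> (?k \<circ> \<gamma> has_vector_derivative d s) (at s)"
    by metis
  have "(d has_integral ((?k \<circ> \<gamma>) t - (?k \<circ> \<gamma>) 0)) {0..t}"
  proof (rule fundamental_theorem_of_calculus_interior_strong[OF fS t(1)])
    show "(?k \<circ> \<gamma> has_vector_derivative d s) (at s)" if "s \<in> {0<..<t} - S" for s
      by (rule d(2)) (use that t in auto)
    show "continuous_on {0..t} (?k \<circ> \<gamma>)" unfolding o_def
      by (rule continuous_on_compose2[OF ker_continuous continuous_on_subset[OF isom_arc_continuous[OF \<gamma>(1)]]])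
        (use t in auto)
  qed
  then have "(d has_integral ((?k \<circ> \<gamma>) t - (?k \<circ> \<gamma>) 0)) (cbox 0 t)" by simp
  from has_integral_bound[OF zero_le_one this d(1)] show ?thesis using t by simp
qed

lemma ker_lipschitz_star:
  assumes \<rho>: "star_radius p \<rho>" and v: "v \<in> Vec p" and t: "0 \<le> t" "t < \<rho>"
  shows "cmod (ker z x (move p v t) - ker z x p) \<le> t"
proof (cases "t = 0")
  case False
  then have "0 < t" using t by simp
  then have "isom_arc (move p v) t" by (rule star_radius_isom_arc[OF \<rho> v _ t(2)])
  moreover have "open (move p v ` {0<..<t})" by (rule star_radius_open_ray[OF \<rho> v]) (use t in auto)
  ultimately show ?thesis using ker_lipschitz_arc[of "move p v" t t z x] t by simp
qed simp

section \<open>The algebra generated by the connected open sets\<close>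

lemma conn_algebra_minimal:
  assumes "algebra UNIV M" "\<And>U. open U \<Longrightarrow> connected U \<Longrightarrow> U \<in> M" "S \<in> conn_algebra"
  shows "S \<in> M"
proof -
  have "M \<in> {M. algebra UNIV M \<and> {U. open U \<and> connected U} \<subseteq> M}" using assms(1,2) by auto
  then show ?thesis using assms(3) unfolding conn_algebra_def by (rule InterD[rotated])
qed

lemma conn_algebra_I:
  assumes "\<And>M. algebra UNIV M \<Longrightarrow> (\<And>U. open U \<Longrightarrow> connected U \<Longrightarrow> U \<in> M) \<Longrightarrow> S \<in> M"
  shows "S \<in> conn_algebra"
  unfolding conn_algebra_def
proof (rule InterI)
  fix M assume "M \<in> {M. algebra UNIV M \<and> {U::'a set. open U \<and> connected U} \<subseteq> M}"
  then show "S \<in> M" by (intro assms) auto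
qed

lemma conn_algebra_is_algebra: "algebra UNIV conn_algebra"
  unfolding algebra_iff_Un
proof (intro conjI ballI)
  show "{} \<in> conn_algebra" by (rule conn_algebra_I) (simp add: algebra_iff_Un)
  show "UNIV - A \<in> conn_algebra" if A: "A \<in> conn_algebra" for A :: "'a set"
  proof (rule conn_algebra_I)
    fix M :: "'a set set" assume M: "algebra UNIV M" "\<And>U. open U \<Longrightarrow> connected U \<Longrightarrow> U \<in> M"
    have "A \<in> M" by (rule conn_algebra_minimal[OF M A])
    then show "UNIV - A \<in> M" using M(1) unfolding algebra_iff_Un by (elim conjE) (erule bspec)
  qed
  show "A \<union> B \<in> conn_algebra" if A: "A \<in> conn_algebra" and B: "B \<in> conn_algebra" for A B :: "'a set"
  proof (rule conn_algebra_I)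
    fix M :: "'a set set" assume M: "algebra UNIV M" "\<And>U. open U \<Longrightarrow> connected U \<Longrightarrow> U \<in> M"
    interpret M: algebra UNIV M by (rule M(1))
    show "A \<union> B \<in> M" by (rule M.Un[OF conn_algebra_minimal[OF M A] conn_algebra_minimal[OF M B]])
  qed
qed simp

lemma conn_algebra_open: "open U \<Longrightarrow> connected U \<Longrightarrow> U \<in> conn_algebra"
  by (rule conn_algebra_I)

lemma conn_algebra_finite_frontier:
  fixes S :: "'a::metrized_graph set"
  assumes "S \<in> conn_algebra" shows "finite (frontier S)" "S \<in> sets borel"
proof -
  have "S \<in> {S. finite (frontier S) \<and> S \<in> sets borel}"
  proof (rule conn_algebra_minimal[OF _ _ assms])
    show "algebra UNIV {S::'a set. finite (frontier S) \<and> S \<in> sets borel}"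
      unfolding algebra_iff_Un
    proof (intro conjI ballI)
      fix A B :: "'a set" assume "A \<in> {S. finite (frontier S) \<and> S \<in> sets borel}" "B \<in> {S. finite (frontier S) \<and> S \<in> sets borel}"
      then show "A \<union> B \<in> {S. finite (frontier S) \<and> S \<in> sets borel}"
        using finite_subset[OF frontier_Un_subset[of A B]] by auto
    next
      fix A :: "'a set" assume "A \<in> {S. finite (frontier S) \<and> S \<in> sets borel}"
      then show "UNIV - A \<in> {S. finite (frontier S) \<and> S \<in> sets borel}"
        by (auto simp: frontier_complement Compl_eq_Diff_UNIV[symmetric])
    qed auto
    show "U \<in> {S. finite (frontier S) \<and> S \<in> sets borel}" if "open U" "connected U" for U :: "'a set"
      using connected_open_finite_frontier[OF that] that(1) by auto
  qed
  then show "finite (frontier S)" "S \<in> sets borel" by auto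
qed

section \<open>The set function of a function with directional derivatives\<close>

text \<open>Outside the closure of \<open>S\<close> no direction points into \<open>S\<close>, in the interior all of them do.
  So the sums over the frontier may be extended to any finite set containing it.\<close>

lemma m_set_vertices:
  fixes S V :: "'a::metrized_graph set"
  assumes V: "finite V" "frontier S \<subseteq> V"
  shows "m_set f S = (\<Sum>b\<in>V. \<Sum>v\<in>In_dirs b S. dir_deriv v f b) - (\<Sum>b\<in>V \<inter> S. slope_sum f b)"
proof -
  let ?I = "\<lambda>b. \<Sum>v\<in>In_dirs b S. dir_deriv v f b"
  have out: "(\<Sum>v\<in>Out_dirs b S. dir_deriv v f b) = slope_sum f b - ?I b" for b
    unfolding Out_dirs_def slope_sum_def
    by (rule sum_diff[OF finite_Vec In_dirs_subset])
  have "(\<Sum>b\<in>frontier S - S. ?I b) = (\<Sum>b\<in>V - S. ?I b)"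
  proof (rule sum.mono_neutral_left)
    show "\<forall>b\<in>V - S - (frontier S - S). ?I b = 0"
    proof
      fix b assume b: "b \<in> V - S - (frontier S - S)"
      then have "b \<notin> closure S" using closure_Un_frontier[of S] by blast
      then show "?I b = 0" by (simp add: In_dirs_outside)
    qed
  qed (use V in auto)
  moreover have "(\<Sum>b\<in>frontier S \<inter> S. slope_sum f b - ?I b) = (\<Sum>b\<in>V \<inter> S. slope_sum f b - ?I b)"
  proof (rule sum.mono_neutral_left)
    show "\<forall>b\<in>V \<inter> S - frontier S \<inter> S. slope_sum f b - ?I b = 0"
    proof
      fix b assume b: "b \<in> V \<inter> S - frontier S \<inter> S"
      then have "b \<in> interior S" using closure_subset[of S] by (auto simp: frontier_def)
      then have "In_dirs b (interior S) = Vec b" by (intro In_dirs_open) auto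
      then have "In_dirs b S = Vec b" using In_dirs_mono[OF interior_subset, of b S] In_dirs_subset[of b S] by blast
      then show "slope_sum f b - ?I b = 0" by (simp add: slope_sum_def)
    qed
  qed (use V in auto)
  ultimately have "m_set f S = (\<Sum>b\<in>V - S. ?I b) - (\<Sum>b\<in>V \<inter> S. slope_sum f b - ?I b)"
    unfolding m_set_def out by simp
  also have "\<dots> = ((\<Sum>b\<in>V - S. ?I b) + (\<Sum>b\<in>V \<inter> S. ?I b)) - (\<Sum>b\<in>V \<inter> S. slope_sum f b)"
    by (simp add: sum_subtractf)
  also have "(\<Sum>b\<in>V - S. ?I b) + (\<Sum>b\<in>V \<inter> S. ?I b) = (\<Sum>b\<in>V. ?I b)"
    using sum.Int_Diff[OF V(1), of ?I S] by (simp add: add.commute)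
  finally show ?thesis .
qed

text \<open>The two ends of an edge contribute opposite slopes, so only the slope sums at the vertices
  in \<open>S\<close> remain.\<close>

lemma m_set_ker:
  fixes S :: "'a::metrized_graph set"
  assumes S: "finite (frontier S)"
  shows "m_set (ker z y) S = indicator S y - indicator S z"
proof -
  obtain V and E :: "((real \<Rightarrow> 'a) \<times> real) set" where sub: "subdivision V E" "{z, y} \<union> frontier S \<subseteq> V"
    by (rule subdivision_exists[of "{z, y} \<union> frontier S"]) (use S in auto)
  have zy: "z \<in> V" "y \<in> V" and F: "frontier S \<subseteq> V" using sub(2) by auto
  note aff = ker_on_edges[OF sub(1) zy]
  have "(\<Sum>b\<in>V. \<Sum>v\<in>In_dirs b S. dir_deriv v (ker z y) b) =
      (\<Sum>e\<in>{e\<in>E. open_edge e \<subseteq> S}. dir_deriv (start_dir e) (ker z y) (fst e 0) + dir_deriv (end_dir e) (ker z y) (fst e (snd e)))"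
    by (rule sum_In_dirs[OF sub(1) F])
  also have "\<dots> = (\<Sum>e\<in>{e\<in>E. open_edge e \<subseteq> S}. 0)"
  proof (rule sum.cong[OF refl])
    fix e assume "e \<in> {e\<in>E. open_edge e \<subseteq> S}"
    then have e: "e \<in> E" by simp
    show "dir_deriv (start_dir e) (ker z y) (fst e 0) + dir_deriv (end_dir e) (ker z y) (fst e (snd e)) = 0"
      unfolding dir_deriv_eqI[OF edge_end_slopes(1)[OF ker_continuous sub(1) aff e]]
        dir_deriv_eqI[OF edge_end_slopes(2)[OF ker_continuous sub(1) aff e]] by simp
  qed
  finally have "m_set (ker z y) S = - (\<Sum>b\<in>V \<inter> S. slope_sum (ker z y) b)"
    unfolding m_set_vertices[OF subdivisionD(1)[OF sub(1)] F] by simp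
  also have "\<dots> = - (\<Sum>b\<in>V \<inter> S. (if b = z then 1 else 0) - (if b = y then 1 else 0))" by (simp add: ker_slope)
  also have "\<dots> = indicator S y - indicator S z"
    unfolding sum_subtractf using subdivisionD(1)[OF sub(1)] zy by (simp add: indicator_def)
  finally show ?thesis .
qed

section \<open>Functions with vanishing Laplacian are constant\<close>

lemma D_fun_continuous:
  assumes f: "f \<in> D_fun" shows "continuous_on UNIV f"
  unfolding continuous_on_iff
proof (intro ballI allI impI)
  fix p :: 'a and e :: real assume e: "e > 0"
  have "eventually (\<lambda>t. dist (f (move p v t)) (f p) < e) (at_right 0)" if v: "v \<in> Vec p" for v
  proof -
    have "((\<lambda>t. f p + diff_quot v f p t * of_real t) \<longlongrightarrow> f p + dir_deriv v f p * of_real 0) (at_right 0)"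
      by (intro tendsto_intros D_funD[OF f v])
    then have "eventually (\<lambda>t. dist (f p + diff_quot v f p t * of_real t) (f p) < e) (at_right 0)"
      using e by (simp add: tendsto_iff)
    then show ?thesis using eventually_at_right_less[of "0::real"]
    proof eventually_elim
      case (elim t)
      then show ?case by (simp add: diff_quot_def)
    qed
  qed
  then obtain \<epsilon> where "\<epsilon> > 0" "\<And>x. x \<in> ball p \<epsilon> \<Longrightarrow> dist (f x) (f p) < e"
    by (rule eventually_star_ball[of "\<lambda>x. dist (f x) (f p) < e" p, rotated]) (use e in auto)
  then show "\<exists>d>0. \<forall>x'\<in>UNIV. dist x' p < d \<longrightarrow> dist (f x') (f p) < e"
    by (intro exI[of _ \<epsilon>]) (auto simp: dist_commute)
qed

lemma star_arc:
  assumes \<rho>: "star_radius p \<rho>" and v: "v \<in> Vec p" and st: "0 \<le> s" "s < t" "t < \<rho>"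
  shows "isom_arc (\<lambda>u. move p v (s + u)) (t - s)" "open ((\<lambda>u. move p v (s + u)) ` {0<..<t - s})"
proof -
  have "isom_arc (move p v) t" by (rule star_radius_isom_arc[OF \<rho> v]) (use st in auto)
  then show "isom_arc (\<lambda>u. move p v (s + u)) (t - s)" by (rule isom_arc_sub) (use st in auto)
  have "(\<lambda>u. move p v (s + u)) ` {0<..<t - s} = move p v ` {s<..<t}"
  proof (intro equalityI subsetI)
    fix y assume "y \<in> move p v ` {s<..<t}"
    then obtain u where "y = move p v u" "s < u" "u < t" by auto
    then show "y \<in> (\<lambda>u. move p v (s + u)) ` {0<..<t - s}" by (intro image_eqI[of _ _ "u - s"]) auto
  qed auto
  then show "open ((\<lambda>u. move p v (s + u)) ` {0<..<t - s})"
    using star_radius_open_ray[OF \<rho> v st(1), of t] st by simp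
qed

text \<open>An open subarc of a ray, between parameters \<open>s < t\<close>, has \<open>m_set w\<close> equal to the forward
  derivative at \<open>s\<close> plus the backward derivative at \<open>t\<close>. As this vanishes for all \<open>s < t\<close>, the
  forward derivative is a constant and the backward derivative its negative.\<close>

lemma harmonic_locally_affine:
  fixes w :: "'a::metrized_graph \<Rightarrow> complex"
  assumes w: "w \<in> D_fun" and m: "\<And>S. open S \<Longrightarrow> connected S \<Longrightarrow> m_set w S = 0"
  shows "locally_affine w"
  unfolding locally_affine_def
proof (intro allI ballI)
  fix p :: 'a and v assume v: "v \<in> Vec p"
  obtain \<rho> where \<rho>: "star_radius p \<rho>" "\<rho> > 0" using star_radius_exists by blast
  \<comment> \<open>The forward and the backward derivative.\<close>
  define P where "P s = dir_deriv (init_dir (\<lambda>u. move p v (s + u))) w (move p v s)" for s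
  define M where "M s = dir_deriv (init_dir (\<lambda>u. move p v (s - u))) w (move p v s)" for s
  have PM: "P s + M t = 0" if st: "0 \<le> s" "s < t" "t < \<rho>" for s t
  proof -
    let ?g = "\<lambda>u. move p v (s + u)" and ?l = "t - s"
    note g = star_arc[OF \<rho>(1) v st]
    let ?S = "?g ` {0<..<?l}"
    have fr: "frontier ?S = {?g 0, ?g ?l}" by (rule isom_arc_frontier[OF g])
    have V: "finite {?g 0, ?g ?l}" "frontier ?S \<subseteq> {?g 0, ?g ?l}" using fr by auto
    have e: "{?g 0, ?g ?l} \<inter> ?S = {}" using isom_arc_ends_not_inside(1,2)[OF g(1)] by blast
    have "0 = m_set w ?S" by (rule m[symmetric, OF g(2) isom_arc_connected_inside[OF g(1)]])
    also have "\<dots> = (\<Sum>b\<in>{?g 0, ?g ?l}. \<Sum>v\<in>In_dirs b ?S. dir_deriv v w b)"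
      unfolding m_set_vertices[OF V] e by simp
    also have "\<dots> = (\<Sum>v\<in>In_dirs (?g 0) ?S. dir_deriv v w (?g 0)) + (\<Sum>v\<in>In_dirs (?g ?l) ?S. dir_deriv v w (?g ?l))"
      using isom_arc_ends_not_inside(3)[OF g(1)] by (subst sum.insert) auto
    also have "\<dots> = P s + M t"
      unfolding In_dirs_start[OF g(1)] In_dirs_end[OF g(1)] by (simp add: P_def M_def)
    finally show ?thesis by simp
  qed
  define c where "c = P 0"
  have M: "M t = - c" if "0 < t" "t < \<rho>" for t using PM[of 0 t] that by (simp add: c_def add_eq_0_iff)
  have P: "P s = c" if "0 \<le> s" "s < \<rho>" for s
  proof -
    obtain t where "s < t" "t < \<rho>" using dense \<open>s < \<rho>\<close> by blast
    then show ?thesis using PM[of s t] M[of t] that by (simp add: add_eq_0_iff)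
  qed
  have der: "(w \<circ> move p v has_vector_derivative c) (at s)" if s: "0 < s" "s < \<rho>" for s
  proof -
    obtain t where t: "s < t" "t < \<rho>" using dense s by blast
    have arc: "isom_arc (move p v) t" by (rule star_radius_isom_arc[OF \<rho>(1) v]) (use s t in auto)
    have a1: "isom_arc (\<lambda>u. move p v (s + u)) (t - s)" by (rule isom_arc_sub[OF arc]) (use s t in auto)
    have a2: "isom_arc (\<lambda>u. move p v (s - u)) s" by (rule isom_arc_rev_sub[OF arc]) (use s t in auto)
    have 1: "init_dir (\<lambda>u. move p v (s + u)) \<in> Vec (move p v s)" using init_dir_in_Vec[OF a1] by simp
    have 2: "init_dir (\<lambda>u. move p v (s - u)) \<in> Vec (move p v s)" using init_dir_in_Vec[OF a2] by simp
    have "(diff_quot (init_dir (\<lambda>u. move p v (s + u))) w (move p v s) \<longlongrightarrow> c) (at_right 0)"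
      using D_funD[OF w 1] P[of s] s by (simp add: P_def)
    moreover have "(diff_quot (init_dir (\<lambda>u. move p v (s - u))) w (move p v s) \<longlongrightarrow> - c) (at_right 0)"
      using D_funD[OF w 2] M[of s] s by (simp add: M_def)
    ultimately show ?thesis
      using inside_dir_derivs[OF arc s(1) t(1), of w c] by (intro has_vector_derivative_at_left_right) simp_all
  qed
  have "w (move p v t) = w p + c * of_real t" if t: "0 < t" "t < \<rho>" for t
  proof -
    have arc: "isom_arc (move p v) t" by (rule star_radius_isom_arc[OF \<rho>(1) v t])
    have "((\<lambda>_. c) has_integral ((w \<circ> move p v) t - (w \<circ> move p v) 0)) {0..t}"
    proof (rule fundamental_theorem_of_calculus_interior_strong[OF finite.emptyI])
      show "continuous_on {0..t} (w \<circ> move p v)" unfolding o_def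
        by (rule continuous_on_compose2[OF D_fun_continuous[OF w] isom_arc_continuous[OF arc]]) auto
      show "(w \<circ> move p v has_vector_derivative c) (at s)" if "s \<in> {0<..<t} - {}" for s
        by (rule der) (use that t in auto)
    qed (use t in simp)
    moreover have "((\<lambda>_. c) has_integral t *\<^sub>R c) {0..t}"
      using has_integral_const_real[of c 0 t] t by simp
    ultimately have "(w \<circ> move p v) t - (w \<circ> move p v) 0 = t *\<^sub>R c" by (rule has_integral_unique)
    then show ?thesis by (simp add: scaleR_conv_of_real algebra_simps)
  qed
  moreover have "eventually (\<lambda>t. t \<in> {0<..<\<rho>}) (at_right 0)" by (rule eventually_at_right_real[OF \<rho>(2)])
  ultimately have "eventually (\<lambda>t. w (move p v t) = w p + c * of_real t) (at_right 0)"
    by (auto elim: eventually_mono)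
  then show "\<exists>c. eventually (\<lambda>t. w (move p v t) = w p + c * of_real t) (at_right 0)" by (rule exI)
qed

text \<open>A point is a small star without its open rays.\<close>

lemma singleton_conn_algebra: "{p::'a::metrized_graph} \<in> conn_algebra"
proof -
  interpret algebra UNIV "conn_algebra :: 'a set set" by (rule conn_algebra_is_algebra)
  obtain \<rho> where \<rho>: "star_radius p \<rho>" "\<rho> > 0" using star_radius_exists by blast
  define \<sigma> where "\<sigma> = \<rho> / 2"
  have \<sigma>: "0 < \<sigma>" "\<sigma> < \<rho>" using \<rho>(2) by (auto simp: \<sigma>_def)
  have sr: "star_radius p \<sigma>" by (rule star_radius_mono[OF \<rho>(1)]) (use \<sigma> in auto)
  have arc: "isom_arc (move p v) \<sigma>" if "v \<in> Vec p" for v by (rule star_radius_isom_arc[OF \<rho>(1) that \<sigma>])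
  have ray: "move p v ` {0<..<\<sigma>} \<in> conn_algebra" if v: "v \<in> Vec p" for v
    by (rule conn_algebra_open[OF star_radius_open_ray[OF sr v] isom_arc_connected_inside[OF arc[OF v]]]) auto
  have b: "ball p \<sigma> = (\<Union>v\<in>Vec p. move p v ` {0..<\<sigma>})"
  proof (intro equalityI subsetI)
    fix y assume "y \<in> ball p \<sigma>"
    then obtain v t where "v \<in> Vec p" "0 \<le> t" "t < \<sigma>" "y = move p v t" by (rule star_radius_ball[OF sr])
    then show "y \<in> (\<Union>v\<in>Vec p. move p v ` {0..<\<sigma>})" by (intro UN_I[of v] image_eqI[of _ _ t]) auto
  next
    fix y assume "y \<in> (\<Union>v\<in>Vec p. move p v ` {0..<\<sigma>})"
    then obtain v t where "v \<in> Vec p" "0 \<le> t" "t < \<sigma>" "y = move p v t" by auto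
    then show "y \<in> ball p \<sigma>" using star_radius_dist0[OF sr, of v t] by simp
  qed
  have "connected (\<Union>v\<in>Vec p. move p v ` {0..<\<sigma>})"
  proof (rule connected_Union)
    show "connected s" if "s \<in> (\<lambda>v. move p v ` {0..<\<sigma>}) ` Vec p" for s
      using that by (auto intro!: connected_continuous_image continuous_on_subset[OF isom_arc_continuous[OF arc]])
    have "p \<in> move p v ` {0..<\<sigma>}" for v by (rule image_eqI[of _ _ 0]) (use \<sigma> in auto)
    then show "\<Inter> ((\<lambda>v. move p v ` {0..<\<sigma>}) ` Vec p) \<noteq> {}" by blast
  qed
  then have ball: "ball p \<sigma> \<in> conn_algebra" unfolding b[symmetric] by (intro conn_algebra_open) auto
  have rays: "(\<Union>v\<in>Vec p. move p v ` {0<..<\<sigma>}) \<in> conn_algebra"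
    by (rule finite_UN[OF finite_Vec]) (rule ray)
  have "{p} = ball p \<sigma> - (\<Union>v\<in>Vec p. move p v ` {0<..<\<sigma>})"
  proof (intro equalityI subsetI)
    fix y assume "y \<in> {p}"
    moreover have "p \<noteq> move p v t" if "v \<in> Vec p" "0 < t" "t < \<sigma>" for v t
      using star_radius_dist0[OF sr that(1), of t] that by auto
    ultimately show "y \<in> ball p \<sigma> - (\<Union>v\<in>Vec p. move p v ` {0<..<\<sigma>})" using \<sigma> by auto
  next
    fix y assume y: "y \<in> ball p \<sigma> - (\<Union>v\<in>Vec p. move p v ` {0<..<\<sigma>})"
    then have "y \<in> ball p \<sigma>" by simp
    then obtain v t where vt: "v \<in> Vec p" "0 \<le> t" "t < \<sigma>" "y = move p v t" by (rule star_radius_ball[OF sr])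
    then have "t = 0" using y by force
    then show "y \<in> {p}" using vt by simp
  qed
  then show ?thesis using Diff[OF ball rays] by simp
qed

lemma m_set_singleton: "m_set w {p::'a::metrized_graph} = - slope_sum w p"
proof -
  have "In_dirs p {p} = {}"
  proof (rule ccontr)
    assume "In_dirs p {p} \<noteq> {}"
    then obtain v where v: "v \<in> Vec p" "eventually (\<lambda>t. move p v t \<in> {p}) (at_right 0)" by (auto simp: In_dirs_def)
    obtain \<rho> where \<rho>: "star_radius p \<rho>" "\<rho> > 0" using star_radius_exists by blast
    obtain t where t: "0 < t" "t < \<rho>" "move p v t \<in> {p}" by (rule at_right_0_exists[OF v(2) \<rho>(2)])
    then show False using star_radius_dist0[OF \<rho>(1) v(1), of t] by simp
  qed
  then show ?thesis using m_set_vertices[of "{p}" "{p}" w] frontier_subset_closed[of "{p}"] by simp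
qed

text \<open>Open arcs show that \<open>w\<close> is affine along rays, singletons that its slopes at every point
  sum to \<open>0\<close>. So the maximum principle holds with any point as pole.\<close>

lemma harmonic_constant:
  fixes w :: "'a::metrized_graph \<Rightarrow> complex"
  assumes w: "w \<in> D_fun" and m: "\<And>S. S \<in> conn_algebra \<Longrightarrow> m_set w S = 0"
  shows "w x = w y"
proof -
  have la: "locally_affine w" by (rule harmonic_locally_affine[OF w m[OF conn_algebra_open]])
  have s: "slope_sum w p = 0" for p using m[OF singleton_conn_algebra, of p] m_set_singleton[of w p] by simp
  have le: "Re (u * w x) \<le> Re (u * w y)" for u x y
  proof (rule maximum_principle)
    show "continuous_on UNIV (\<lambda>x. u * w x)" by (intro continuous_on_mult_left D_fun_continuous w)
    show "locally_affine (\<lambda>x. u * w x)"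
      unfolding locally_affine_def
    proof (intro allI ballI)
      fix p :: 'a and v assume v: "v \<in> Vec p"
      have "eventually (\<lambda>t. u * w (move p v t) = u * w p + (u * dir_deriv v w p) * of_real t) (at_right 0)"
        using locally_affineD(1)[OF la v] by eventually_elim (simp add: algebra_simps)
      then show "\<exists>c. eventually (\<lambda>t. u * w (move p v t) = u * w p + c * of_real t) (at_right 0)" by (rule exI)
    qed
  qed (simp add: slope_sum_cmult[OF w] s)
  show ?thesis
    using le[of 1 x y] le[of 1 y x] le[of "\<i>" x y] le[of "\<i>" y x] by (simp add: complex_eq_iff)
qed

section \<open>The Jordan decomposition of a real measure\<close>

lemma vbm_empty:
  assumes "vector_borel_measure (m :: 'a::topological_space set \<Rightarrow> 'b::real_normed_vector)" shows "m {} = 0"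
proof -
  have "(\<lambda>i::nat. m {}) sums m (\<Union>i::nat. {})"
    using assms[unfolded vector_borel_measure_def, rule_format, of "\<lambda>_. {}"] by (simp add: disjoint_family_on_def)
  then have "summable (\<lambda>i::nat. m {})" by (rule sums_summable)
  then have "(\<lambda>i::nat. m {}) \<longlonglongrightarrow> 0" by (rule summable_LIMSEQ_zero)
  then show ?thesis by (simp add: LIMSEQ_const_iff)
qed

lemma vbm_sums:
  assumes "vector_borel_measure m" "range A \<subseteq> sets borel" "disjoint_family A"
  shows "(\<lambda>i. m (A i)) sums m (\<Union>i. A i)"
  using assms unfolding vector_borel_measure_def by simp

lemma vbm_Un:
  assumes m: "vector_borel_measure m" and AB: "A \<in> sets borel" "B \<in> sets borel" "A \<inter> B = {}"
  shows "m (A \<union> B) = m A + m B"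
proof -
  have "range (binaryset A B) \<subseteq> sets borel" using AB by (auto simp: binaryset_def)
  moreover have "disjoint_family (binaryset A B)"
    using AB(3) by (auto simp: disjoint_family_on_def binaryset_def)
  ultimately have "(\<lambda>i. m (binaryset A B i)) sums m (\<Union>i. binaryset A B i)" by (rule vbm_sums[OF m])
  then have "(\<lambda>i. m (binaryset A B i)) sums m (A \<union> B)" by (simp add: UN_binaryset_eq)
  moreover have "(\<lambda>i. m (binaryset A B i)) sums (m A + m B)"
    by (rule binaryset_sums[of m, OF vbm_empty[OF m]])
  ultimately show ?thesis by (rule sums_unique2)
qed

lemma vbm_uminus:
  assumes "vector_borel_measure (\<mu> :: 'a::topological_space set \<Rightarrow> real)" shows "vector_borel_measure (\<lambda>A. - \<mu> A)"
  unfolding vector_borel_measure_def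
proof (intro allI impI)
  fix A :: "nat \<Rightarrow> 'a set" assume "range A \<subseteq> sets borel" "disjoint_family A"
  then show "(\<lambda>i. - \<mu> (A i)) sums - \<mu> (\<Union>i. A i)" by (intro sums_minus vbm_sums[OF assms])
qed

lemma vbm_bounded:
  fixes \<mu> :: "'a::topological_space set \<Rightarrow> real"
  assumes m: "vector_borel_measure \<mu>" and tv: "total_variation \<mu> UNIV < \<infinity>"
  obtains K where "0 \<le> K" "\<And>E. E \<in> sets borel \<Longrightarrow> \<bar>\<mu> E\<bar> \<le> K"
proof -
  let ?T = "total_variation \<mu> UNIV"
  have "ennreal \<bar>\<mu> E\<bar> \<le> ?T" if E: "E \<in> sets borel" for E
  proof -
    let ?A = "binaryset E (- E)"
    have A: "range ?A \<subseteq> sets borel" "disjoint_family ?A" "(\<Union>i. ?A i) = UNIV"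
      using E by (auto simp: binaryset_def disjoint_family_on_def UN_binaryset_eq)
    have "ennreal \<bar>\<mu> E\<bar> = (\<Sum>i\<in>{0::nat}. ennreal (norm (\<mu> (?A i))))" by (simp add: binaryset_def)
    also have "\<dots> \<le> (\<Sum>i. ennreal (norm (\<mu> (?A i))))" by (rule sum_le_suminf) auto
    also have "\<dots> \<le> ?T"
      unfolding total_variation_def by (rule SUP_upper) (use A in simp)
    finally show ?thesis .
  qed
  then have "\<bar>\<mu> E\<bar> \<le> enn2real ?T" if "E \<in> sets borel" for E
    using that tv by (metis abs_ge_zero enn2real_ennreal enn2real_mono infinity_ennreal_def)
  then show ?thesis using that[of "enn2real ?T"] by simp
qed

lemma ennreal_add_le: "ennreal (a + b) \<le> ennreal a + ennreal b"
proof -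
  have "ennreal (a + b) \<le> ennreal (max 0 a + max 0 b)" by (rule ennreal_leI) simp
  also have "\<dots> = ennreal (max 0 a) + ennreal (max 0 b)" by (rule ennreal_plus) auto
  also have "\<dots> = ennreal a + ennreal b" by (simp add: ennreal_max_0)
  finally show ?thesis .
qed

lemma ennreal_sum_le: "ennreal (\<Sum>i<n::nat. f i) \<le> (\<Sum>i<n. ennreal (f i))"
proof (induction n)
  case (Suc n)
  have "ennreal (\<Sum>i<Suc n. f i) \<le> ennreal (\<Sum>i<n. f i) + ennreal (f n)"
    unfolding sum.lessThan_Suc by (rule ennreal_add_le)
  also have "\<dots> \<le> (\<Sum>i<n. ennreal (f i)) + ennreal (f n)" by (rule add_right_mono[OF Suc.IH])
  finally show ?case by simp
qed simp

lemma ennreal_sums_le: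
  assumes "f sums s" shows "ennreal s \<le> (\<Sum>i. ennreal (f i))"
proof (rule LIMSEQ_le_const2)
  show "(\<lambda>n. ennreal (\<Sum>i<n. f i)) \<longlonglongrightarrow> ennreal s"
    using assms unfolding sums_def by (rule tendsto_ennrealI)
  have "ennreal (\<Sum>i<n. f i) \<le> (\<Sum>i. ennreal (f i))" for n
    by (rule order_trans[OF ennreal_sum_le]) (rule sum_le_suminf, auto)
  then show "\<exists>N. \<forall>n\<ge>N. ennreal (\<Sum>i<n. f i) \<le> (\<Sum>i. ennreal (f i))" by blast
qed

text \<open>The bound \<open>K\<close> comes from the finite total variation. The locale is applied to a measure
  and to its negative.\<close>

locale real_charge =
  fixes \<mu> :: "'a::topological_space set \<Rightarrow> real" and K :: real
  assumes vbm: "vector_borel_measure \<mu>" and bounded: "\<And>E. E \<in> sets borel \<Longrightarrow> \<bar>\<mu> E\<bar> \<le> K"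
begin

text \<open>The set function from which \<^const>\<open>positive_part\<close> is built.\<close>

definition pos_var :: "'a set \<Rightarrow> ennreal" where
  "pos_var E = (SUP A \<in> {A \<in> sets borel. A \<subseteq> E}. ennreal (\<mu> A))"

lemma pos_var_upper: "A \<in> sets borel \<Longrightarrow> A \<subseteq> E \<Longrightarrow> ennreal (\<mu> A) \<le> pos_var E"
  unfolding pos_var_def by (rule SUP_upper) simp

lemma pos_var_mono: "E \<subseteq> F \<Longrightarrow> pos_var E \<le> pos_var F"
  unfolding pos_var_def by (rule SUP_subset_mono) auto

lemma pos_var_super:
  assumes "X \<inter> Y = {}" shows "pos_var X + pos_var Y \<le> pos_var (X \<union> Y)"
proof -
  have ne: "{A \<in> sets borel. A \<subseteq> X} \<noteq> {}" "{A \<in> sets borel. A \<subseteq> Y} \<noteq> {}" by auto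
  have *: "ennreal (\<mu> B) + ennreal (\<mu> C) \<le> pos_var (X \<union> Y)"
    if B: "B \<in> sets borel" "B \<subseteq> X" and C: "C \<in> sets borel" "C \<subseteq> Y" for B C
  proof (cases "0 \<le> \<mu> B \<and> 0 \<le> \<mu> C")
    case True
    have "B \<inter> C = {}" using B C assms by blast
    then have "ennreal (\<mu> B) + ennreal (\<mu> C) = ennreal (\<mu> (B \<union> C))"
      using True by (simp add: vbm_Un[OF vbm B(1) C(1)])
    also have "\<dots> \<le> pos_var (X \<union> Y)" using B C by (intro pos_var_upper) auto
    finally show ?thesis .
  next
    case False
    have "ennreal (\<mu> B) \<le> pos_var (X \<union> Y)" "ennreal (\<mu> C) \<le> pos_var (X \<union> Y)" using B C by (auto intro!: pos_var_upper)
    then show ?thesis using False by (auto simp: not_le ennreal_neg)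
  qed
  have "pos_var X + pos_var Y = (SUP B\<in>{A \<in> sets borel. A \<subseteq> X}. ennreal (\<mu> B) + pos_var Y)"
    unfolding pos_var_def[of X] by (rule ennreal_SUP_add_left[symmetric, OF ne(1)])
  also have "\<dots> \<le> pos_var (X \<union> Y)"
  proof (rule SUP_least)
    fix B assume B: "B \<in> {A \<in> sets borel. A \<subseteq> X}"
    have "ennreal (\<mu> B) + pos_var Y = (SUP C\<in>{A \<in> sets borel. A \<subseteq> Y}. ennreal (\<mu> C) + ennreal (\<mu> B))"
      unfolding pos_var_def[of Y] by (subst ennreal_SUP_add_left[OF ne(2)]) (simp add: add.commute)
    also have "\<dots> \<le> pos_var (X \<union> Y)"
    proof (rule SUP_least)
      fix C assume "C \<in> {A \<in> sets borel. A \<subseteq> Y}"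
      then show "ennreal (\<mu> C) + ennreal (\<mu> B) \<le> pos_var (X \<union> Y)" using *[of B C] B by (simp add: add.commute)
    qed
    finally show "ennreal (\<mu> B) + pos_var Y \<le> pos_var (X \<union> Y)" .
  qed
  finally show ?thesis .
qed

lemma pos_var_countably_additive: "countably_additive (sets borel) pos_var"
  unfolding countably_additive_def
proof (intro allI impI)
  fix A :: "nat \<Rightarrow> 'a set" assume A: "range A \<subseteq> sets borel" "disjoint_family A"
  show "(\<Sum>i. pos_var (A i)) = pos_var (\<Union>i. A i)"
  proof (rule antisym)
    have part: "(\<Sum>i<n. pos_var (A i)) \<le> pos_var (\<Union>i<n. A i)" for n
    proof (induction n)
      case (Suc n)
      have "A i \<inter> A n = {}" if "i < n" for i
        by (rule disjoint_family_onD[OF A(2)]) (use that in auto)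
      then have "(\<Union>i<n. A i) \<inter> A n = {}" by blast
      from pos_var_super[OF this] have "pos_var (\<Union>i<n. A i) + pos_var (A n) \<le> pos_var (\<Union>i<Suc n. A i)"
        by (simp add: lessThan_Suc Un_commute)
      moreover have "(\<Sum>i<n. pos_var (A i)) + pos_var (A n) \<le> pos_var (\<Union>i<n. A i) + pos_var (A n)" by (rule add_right_mono[OF Suc.IH])
      ultimately show ?case unfolding sum.lessThan_Suc by (rule order_trans[rotated])
    qed simp
    have "(\<Sum>i<n. pos_var (A i)) \<le> pos_var (\<Union>i. A i)" for n
      by (rule order_trans[OF part]) (rule pos_var_mono, auto)
    then show "(\<Sum>i. pos_var (A i)) \<le> pos_var (\<Union>i. A i)" by (intro suminf_le_const) auto
    show "pos_var (\<Union>i. A i) \<le> (\<Sum>i. pos_var (A i))"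
      unfolding pos_var_def[of "\<Union>i. A i"]
    proof (rule SUP_least)
      fix B assume B: "B \<in> {B \<in> sets borel. B \<subseteq> (\<Union>i. A i)}"
      have BA: "range (\<lambda>i. B \<inter> A i) \<subseteq> sets borel" using A(1) B by auto
      have dis: "disjoint_family (\<lambda>i. B \<inter> A i)" using A(2) by (auto simp: disjoint_family_on_def)
      have "(\<Union>i. B \<inter> A i) = B" using B by auto
      then have "(\<lambda>i. \<mu> (B \<inter> A i)) sums \<mu> B" using vbm_sums[OF vbm BA dis] by simp
      then have "ennreal (\<mu> B) \<le> (\<Sum>i. ennreal (\<mu> (B \<inter> A i)))" by (rule ennreal_sums_le)
      also have "\<dots> \<le> (\<Sum>i. pos_var (A i))"
        using BA by (intro suminf_le pos_var_upper) auto
      finally show "ennreal (\<mu> B) \<le> (\<Sum>i. pos_var (A i))" .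
    qed
  qed
qed

lemma sets_positive_part: "sets (positive_part \<mu>) = sets borel"
  unfolding positive_part_def using sets.sigma_sets_eq[of "borel :: 'a measure"] by simp

lemma emeasure_positive_part:
  assumes "E \<in> sets borel" shows "emeasure (positive_part \<mu>) E = pos_var E"
proof (rule emeasure_measure_of[of "positive_part \<mu>" UNIV "sets borel" pos_var])
  show "positive_part \<mu> = measure_of UNIV (sets borel) pos_var"
    by (simp add: positive_part_def pos_var_def[abs_def])
  have "ennreal (\<mu> {}) = 0" using vbm_empty[OF vbm] by simp
  then have "pos_var {} = 0" unfolding pos_var_def by (auto simp: SUP_eq_iff)
  then show "positive (sets (positive_part \<mu>)) pos_var" by (simp add: positive_def)
  show "countably_additive (sets (positive_part \<mu>)) pos_var" unfolding sets_positive_part by (rule pos_var_countably_additive)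
qed (use assms in \<open>auto simp: sets_positive_part\<close>)

lemma pos_var_le: "(\<And>A. A \<in> sets borel \<Longrightarrow> A \<subseteq> E \<Longrightarrow> \<mu> A \<le> c) \<Longrightarrow> pos_var E \<le> ennreal c"
  unfolding pos_var_def by (intro SUP_least ennreal_leI) auto

lemma finite_measure_positive_part: "finite_measure (positive_part \<mu>)"
proof (rule finite_measureI)
  have "space (positive_part \<mu>) = UNIV" using sets_eq_imp_space_eq[OF sets_positive_part] by simp
  moreover have "pos_var UNIV \<le> ennreal K" by (rule pos_var_le) (use bounded in \<open>auto dest: abs_le_D1\<close>)
  ultimately show "emeasure (positive_part \<mu>) (space (positive_part \<mu>)) \<noteq> \<infinity>"
    by (auto simp: emeasure_positive_part top_unique)
qed

lemma measure_positive_part_upper: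
  assumes "A \<in> sets borel" "A \<subseteq> E" "E \<in> sets borel"
  shows "\<mu> A \<le> measure (positive_part \<mu>) E"
proof -
  interpret finite_measure "positive_part \<mu>" by (rule finite_measure_positive_part)
  have "ennreal (\<mu> A) \<le> ennreal (measure (positive_part \<mu>) E)"
    using pos_var_upper[OF assms(1,2)] emeasure_positive_part[OF assms(3)] by (simp add: emeasure_eq_measure)
  then have "\<mu> A \<le> measure (positive_part \<mu>) E \<or> \<mu> A \<le> 0 \<and> measure (positive_part \<mu>) E = 0"
    using measure_nonneg[of "positive_part \<mu>" E] by (simp add: ennreal_le_iff2)
  then show ?thesis by auto
qed

lemma measure_positive_part_le:
  assumes "E \<in> sets borel" "0 \<le> c" "\<And>A. A \<in> sets borel \<Longrightarrow> A \<subseteq> E \<Longrightarrow> \<mu> A \<le> c"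
  shows "measure (positive_part \<mu>) E \<le> c"
proof -
  interpret finite_measure "positive_part \<mu>" by (rule finite_measure_positive_part)
  have "ennreal (measure (positive_part \<mu>) E) \<le> ennreal c"
    using pos_var_le[OF assms(3)] emeasure_positive_part[OF assms(1)] by (simp add: emeasure_eq_measure)
  then show ?thesis using assms(2) by simp
qed

end

text \<open>For \<open>A \<subseteq> E\<close> one has \<open>\<mu> A = \<mu> E + (- \<mu>) (E - A)\<close>, which is at most \<open>\<mu> E\<close> plus the negative
  part of \<open>E\<close>; the supremum over \<open>A\<close> gives one inequality, and the same for \<open>- \<mu>\<close> the other.\<close>

lemma Jordan_decomposition:
  fixes \<mu> :: "'a::topological_space set \<Rightarrow> real"
  assumes m: "vector_borel_measure \<mu>" and tv: "total_variation \<mu> UNIV < \<infinity>"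
  shows "sets (positive_part \<mu>) = sets borel" "sets (positive_part (\<lambda>A. - \<mu> A)) = sets borel"
    "finite_measure (positive_part \<mu>)" "finite_measure (positive_part (\<lambda>A. - \<mu> A))"
    "\<And>E. E \<in> sets borel \<Longrightarrow> \<mu> E = measure (positive_part \<mu>) E - measure (positive_part (\<lambda>A. - \<mu> A)) E"
proof -
  obtain K where K: "0 \<le> K" "\<And>E. E \<in> sets borel \<Longrightarrow> \<bar>\<mu> E\<bar> \<le> K" by (rule vbm_bounded[OF m tv]) (rule that)
  interpret p: real_charge \<mu> K by unfold_locales (use m K in auto)
  interpret n: real_charge "\<lambda>A. - \<mu> A" K by unfold_locales (use vbm_uminus[OF m] K in auto)
  show "sets (positive_part \<mu>) = sets borel" "sets (positive_part (\<lambda>A. - \<mu> A)) = sets borel"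
    "finite_measure (positive_part \<mu>)" "finite_measure (positive_part (\<lambda>A. - \<mu> A))"
    by (rule p.sets_positive_part n.sets_positive_part p.finite_measure_positive_part n.finite_measure_positive_part)+
  fix E :: "'a set" assume E: "E \<in> sets borel"
  have split: "\<mu> E = \<mu> A + \<mu> (E - A)" if A: "A \<in> sets borel" "A \<subseteq> E" for A
  proof -
    have "E = A \<union> (E - A)" using A by auto
    then show ?thesis using vbm_Un[OF m A(1), of "E - A"] E A by auto
  qed
  let ?P = "measure (positive_part \<mu>) E" and ?N = "measure (positive_part (\<lambda>A. - \<mu> A)) E"
  have "?P \<le> \<mu> E + ?N"
  proof (rule p.measure_positive_part_le[OF E])
    show "0 \<le> \<mu> E + ?N" using n.measure_positive_part_upper[OF E subset_refl E] by simp
    show "\<mu> A \<le> \<mu> E + ?N" if A: "A \<in> sets borel" "A \<subseteq> E" for A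
      using split[OF A] n.measure_positive_part_upper[of "E - A" E] E A by simp
  qed
  moreover have "?N \<le> ?P - \<mu> E"
  proof (rule n.measure_positive_part_le[OF E])
    show "0 \<le> ?P - \<mu> E" using p.measure_positive_part_upper[OF E subset_refl E] by simp
    show "- \<mu> A \<le> ?P - \<mu> E" if A: "A \<in> sets borel" "A \<subseteq> E" for A
      using split[OF A] p.measure_positive_part_upper[of "E - A" E] E A by simp
  qed
  ultimately show "\<mu> E = ?P - ?N" by simp
qed

section \<open>Complex measures as functionals on bounded Borel functions\<close>

definition bounded_borel :: "('a::topological_space \<Rightarrow> complex) \<Rightarrow> bool" where
  "bounded_borel \<phi> \<longleftrightarrow> \<phi> \<in> borel_measurable borel \<and> (\<exists>B. \<forall>x. cmod (\<phi> x) \<le> B)"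

text \<open>A complex measure of bounded variation, seen as the functional that integrates bounded
  Borel functions: linear, bounded for the sup norm, and satisfying bounded convergence. In this
  form \<open>\<mu>\<close>, \<open>f dx\<close> and their linear combinations are treated alike.\<close>

definition charge :: "(('a::topological_space \<Rightarrow> complex) \<Rightarrow> complex) \<Rightarrow> bool" where
  "charge J \<longleftrightarrow>
     (\<forall>\<phi> \<psi>. bounded_borel \<phi> \<longrightarrow> bounded_borel \<psi> \<longrightarrow> J (\<lambda>x. \<phi> x + \<psi> x) = J \<phi> + J \<psi>) \<and>
     (\<forall>c \<phi>. bounded_borel \<phi> \<longrightarrow> J (\<lambda>x. c * \<phi> x) = c * J \<phi>) \<and>
     (\<exists>K. \<forall>\<phi> B. \<phi> \<in> borel_measurable borel \<longrightarrow> (\<forall>x. cmod (\<phi> x) \<le> B) \<longrightarrow> cmod (J \<phi>) \<le> K * B) \<and>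
     (\<forall>s \<phi> B. (\<forall>n. s n \<in> borel_measurable borel) \<longrightarrow> (\<forall>n x. cmod (s n x) \<le> B) \<longrightarrow>
        (\<forall>x. (\<lambda>n. s n x) \<longlonglongrightarrow> \<phi> x) \<longrightarrow> (\<lambda>n. J (s n)) \<longlonglongrightarrow> J \<phi>)"

lemma charge_add: "charge J \<Longrightarrow> bounded_borel \<phi> \<Longrightarrow> bounded_borel \<psi> \<Longrightarrow> J (\<lambda>x. \<phi> x + \<psi> x) = J \<phi> + J \<psi>"
  by (simp add: charge_def)

lemma charge_cmult: "charge J \<Longrightarrow> bounded_borel \<phi> \<Longrightarrow> J (\<lambda>x. c * \<phi> x) = c * J \<phi>"
  by (simp add: charge_def)

text \<open>Some admissible constant in the bound, not necessarily the least one.\<close>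

definition charge_norm :: "(('a::topological_space \<Rightarrow> complex) \<Rightarrow> complex) \<Rightarrow> real" where
  "charge_norm J = (SOME K. \<forall>\<phi> B. \<phi> \<in> borel_measurable borel \<longrightarrow> (\<forall>x. cmod (\<phi> x) \<le> B) \<longrightarrow> cmod (J \<phi>) \<le> K * B)"

lemma charge_bound:
  assumes "charge J" "\<phi> \<in> borel_measurable borel" "\<And>x. cmod (\<phi> x) \<le> B"
  shows "cmod (J \<phi>) \<le> charge_norm J * B"
proof -
  have "\<exists>K. \<forall>\<phi> B. \<phi> \<in> borel_measurable borel \<longrightarrow> (\<forall>x. cmod (\<phi> x) \<le> B) \<longrightarrow> cmod (J \<phi>) \<le> K * B"
    using assms(1) unfolding charge_def by (elim conjE)
  from someI_ex[OF this, folded charge_norm_def] show ?thesis using assms(2,3) by simp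
qed

lemma charge_norm_nonneg: "charge J \<Longrightarrow> 0 \<le> charge_norm J"
proof -
  assume "charge J"
  then have "cmod (J (\<lambda>x. 1)) \<le> charge_norm J * 1" by (rule charge_bound) auto
  then show ?thesis using norm_ge_zero[of "J (\<lambda>x. 1)"] by linarith
qed

lemma charge_dominated:
  assumes "charge J" "\<And>n. s n \<in> borel_measurable borel" "\<And>n x. cmod (s n x) \<le> B" "\<And>x. (\<lambda>n. s n x) \<longlonglongrightarrow> \<phi> x"
  shows "(\<lambda>n. J (s n)) \<longlonglongrightarrow> J \<phi>"
proof -
  have "\<forall>s \<phi> B. (\<forall>n. s n \<in> borel_measurable borel) \<longrightarrow> (\<forall>n x. cmod (s n x) \<le> B) \<longrightarrow>
        (\<forall>x. (\<lambda>n. s n x) \<longlonglongrightarrow> \<phi> x) \<longrightarrow> (\<lambda>n. J (s n)) \<longlonglongrightarrow> J \<phi>"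
    using assms(1) unfolding charge_def by (elim conjE)
  from this[rule_format, of s B \<phi>, OF assms(2-4)] show ?thesis .
qed

lemma bounded_borelI: "\<phi> \<in> borel_measurable borel \<Longrightarrow> (\<And>x. cmod (\<phi> x) \<le> B) \<Longrightarrow> bounded_borel \<phi>"
  by (auto simp: bounded_borel_def)

lemma bounded_borel_add: "bounded_borel \<phi> \<Longrightarrow> bounded_borel \<psi> \<Longrightarrow> bounded_borel (\<lambda>x. \<phi> x + \<psi> x)"
proof -
  assume "bounded_borel \<phi>" "bounded_borel \<psi>"
  then obtain B C where m: "\<phi> \<in> borel_measurable borel" "\<psi> \<in> borel_measurable borel"
    and b: "\<And>x. cmod (\<phi> x) \<le> B" "\<And>x. cmod (\<psi> x) \<le> C"
    by (auto simp: bounded_borel_def)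
  show ?thesis
    by (rule bounded_borelI[of _ "B + C"]) (use m in simp, rule norm_triangle_le, rule add_mono, rule b, rule b)
qed

lemma bounded_borel_cmult: "bounded_borel \<phi> \<Longrightarrow> bounded_borel (\<lambda>x. c * \<phi> x)"
proof -
  assume "bounded_borel \<phi>"
  then obtain B where m: "\<phi> \<in> borel_measurable borel" and b: "\<And>x. cmod (\<phi> x) \<le> B" by (auto simp: bounded_borel_def)
  show ?thesis
    by (rule bounded_borelI[of _ "cmod c * B"]) (use m b in \<open>auto simp: norm_mult intro: mult_left_mono\<close>)
qed

lemma bounded_borel_const: "bounded_borel (\<lambda>x. c)"
  by (rule bounded_borelI[of _ "cmod c"]) auto

lemma bounded_borel_indicator: "S \<in> sets borel \<Longrightarrow> bounded_borel (indicator S)"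
  by (rule bounded_borelI[of _ 1]) (auto simp: indicator_def)

lemma bounded_borel_continuous:
  fixes \<phi> :: "'a::metrized_graph \<Rightarrow> complex"
  assumes "continuous_on UNIV \<phi>" shows "bounded_borel \<phi>"
proof -
  have "compact (\<phi> ` UNIV)" by (rule compact_continuous_image[OF assms graph_compact])
  then have "bounded (\<phi> ` UNIV)" by (rule compact_imp_bounded)
  then obtain B where "\<And>x. cmod (\<phi> x) \<le> B" unfolding bounded_iff by auto
  then show ?thesis using borel_measurable_continuous_onI[OF assms] by (intro bounded_borelI)
qed

lemma bounded_borel_sum:
  "finite I \<Longrightarrow> (\<And>i. i \<in> I \<Longrightarrow> bounded_borel (f i)) \<Longrightarrow> bounded_borel (\<lambda>x. \<Sum>i\<in>I. f i x)"
  by (induction I rule: finite_induct) (auto intro: bounded_borel_const bounded_borel_add)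

lemma charge_diff: "charge J \<Longrightarrow> bounded_borel \<phi> \<Longrightarrow> bounded_borel \<psi> \<Longrightarrow> J (\<lambda>x. \<phi> x - \<psi> x) = J \<phi> - J \<psi>"
  using charge_add[of J \<phi> "\<lambda>x. (-1) * \<psi> x"] charge_cmult[of J \<psi> "-1"] bounded_borel_cmult[of \<psi> "-1"] by simp

lemma charge_sum:
  assumes J: "charge J"
  shows "finite I \<Longrightarrow> (\<And>i. i \<in> I \<Longrightarrow> bounded_borel (f i)) \<Longrightarrow> J (\<lambda>x. \<Sum>i\<in>I. f i x) = (\<Sum>i\<in>I. J (f i))"
proof (induction I rule: finite_induct)
  case empty
  then show ?case using charge_cmult[OF J bounded_borel_const, of 0 0] by simp
next
  case (insert i I)
  then have "J (\<lambda>x. f i x + (\<Sum>i\<in>I. f i x)) = J (f i) + J (\<lambda>x. \<Sum>i\<in>I. f i x)"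
    by (intro charge_add[OF J] bounded_borel_sum) auto
  then show ?case using insert by simp
qed

lemma charge_density:
  fixes M :: "'a::topological_space measure"
  assumes s: "sets M = sets borel" and \<rho>: "integrable M \<rho>"
  shows "charge (\<lambda>\<phi>. LINT x|M. \<phi> x * \<rho> x)"
proof -
  have mM: "f \<in> borel_measurable M \<longleftrightarrow> f \<in> borel_measurable borel" for f :: "'a \<Rightarrow> complex"
  proof -
    have "borel_measurable M = (borel_measurable borel :: ('a \<Rightarrow> complex) set)" by (rule measurable_cong_sets[OF s refl])
    then show ?thesis by simp
  qed
  have \<rho>m: "\<rho> \<in> borel_measurable M" by (rule borel_measurable_integrable[OF \<rho>])
  have dom: "integrable M (\<lambda>x. B * cmod (\<rho> x))" for B using \<rho> by simp
  have int: "integrable M (\<lambda>x. \<phi> x * \<rho> x)" if "\<phi> \<in> borel_measurable borel" "\<And>x. cmod (\<phi> x) \<le> B" for \<phi> B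
  proof (rule Bochner_Integration.integrable_bound[OF dom[of B]])
    show "(\<lambda>x. \<phi> x * \<rho> x) \<in> borel_measurable M" using that(1) \<rho>m mM[of \<phi>] by simp
    have "0 \<le> B" using order_trans[OF norm_ge_zero that(2)] .
    then show "AE x in M. cmod (\<phi> x * \<rho> x) \<le> norm (B * cmod (\<rho> x))"
      using that(2) by (auto simp: norm_mult intro!: mult_right_mono)
  qed
  have int': "integrable M (\<lambda>x. \<phi> x * \<rho> x)" if bb: "bounded_borel \<phi>" for \<phi>
  proof -
    obtain B where "\<phi> \<in> borel_measurable borel" "\<forall>x. cmod (\<phi> x) \<le> B" using bb unfolding bounded_borel_def by (elim conjE exE)
    then show ?thesis by (intro int[of \<phi> B]) auto
  qed
  show ?thesis
    unfolding charge_def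
  proof (intro conjI allI impI)
    fix \<phi> \<psi> :: "'a \<Rightarrow> complex" assume "bounded_borel \<phi>" "bounded_borel \<psi>"
    then show "(LINT x|M. (\<phi> x + \<psi> x) * \<rho> x) = (LINT x|M. \<phi> x * \<rho> x) + (LINT x|M. \<psi> x * \<rho> x)"
      using int' by (simp add: distrib_right)
  next
    fix c and \<phi> :: "'a \<Rightarrow> complex" assume "bounded_borel \<phi>"
    show "(LINT x|M. c * \<phi> x * \<rho> x) = c * (LINT x|M. \<phi> x * \<rho> x)" by (simp add: mult.assoc)
  next
    have "cmod (LINT x|M. \<phi> x * \<rho> x) \<le> (LINT x|M. cmod (\<rho> x)) * B"
      if \<phi>: "\<phi> \<in> borel_measurable borel" "\<And>x. cmod (\<phi> x) \<le> B" for \<phi> B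
    proof -
      have "cmod (LINT x|M. \<phi> x * \<rho> x) \<le> (LINT x|M. cmod (\<phi> x * \<rho> x))" by (rule integral_norm_bound)
      also have "\<dots> \<le> (LINT x|M. B * cmod (\<rho> x))"
        by (rule integral_mono[OF integrable_norm[OF int[OF \<phi>]] dom[of B]])
          (simp add: norm_mult mult_right_mono \<phi>(2))
      finally show ?thesis by (simp add: mult.commute)
    qed
    then show "\<exists>K. \<forall>\<phi> B. \<phi> \<in> borel_measurable borel \<longrightarrow> (\<forall>x. cmod (\<phi> x) \<le> B) \<longrightarrow> cmod (LINT x|M. \<phi> x * \<rho> x) \<le> K * B"
      by (intro exI[of _ "LINT x|M. cmod (\<rho> x)"] allI impI) simp
  next
    fix s :: "nat \<Rightarrow> 'a \<Rightarrow> complex" and \<phi> B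
    assume s: "\<forall>n. s n \<in> borel_measurable borel" "\<forall>n x. cmod (s n x) \<le> B" "\<forall>x. (\<lambda>n. s n x) \<longlonglongrightarrow> \<phi> x"
    have \<phi>m: "\<phi> \<in> borel_measurable borel" by (rule borel_measurable_LIMSEQ_metric[of s]) (use s in auto)
    show "(\<lambda>n. LINT x|M. s n x * \<rho> x) \<longlonglongrightarrow> (LINT x|M. \<phi> x * \<rho> x)"
    proof (rule integral_dominated_convergence[OF _ _ dom[of B]])
      show "(\<lambda>x. \<phi> x * \<rho> x) \<in> borel_measurable M"
        by (rule borel_measurable_times[OF mM[THEN iffD2, OF \<phi>m] \<rho>m])
      show "(\<lambda>x. s n x * \<rho> x) \<in> borel_measurable M" for n
        by (rule borel_measurable_times[OF mM[THEN iffD2] \<rho>m]) (use s(1) in simp)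
      show "AE x in M. (\<lambda>n. s n x * \<rho> x) \<longlonglongrightarrow> \<phi> x * \<rho> x"
        by (intro AE_I2 tendsto_mult_right) (use s(3) in simp)
      show "AE x in M. norm (s n x * \<rho> x) \<le> B * cmod (\<rho> x)" for n
        by (intro AE_I2) (use s(2) in \<open>simp add: norm_mult mult_right_mono\<close>)
    qed
  qed
qed

lemma charge_lin:
  assumes J: "charge J1" "charge J2" shows "charge (\<lambda>\<phi>. a * J1 \<phi> + b * J2 \<phi>)"
  unfolding charge_def
proof (intro conjI allI impI)
  fix \<phi> \<psi> :: "'a \<Rightarrow> complex" assume "bounded_borel \<phi>" "bounded_borel \<psi>"
  then show "a * J1 (\<lambda>x. \<phi> x + \<psi> x) + b * J2 (\<lambda>x. \<phi> x + \<psi> x) = a * J1 \<phi> + b * J2 \<phi> + (a * J1 \<psi> + b * J2 \<psi>)"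
    by (simp add: charge_add J algebra_simps)
next
  fix c and \<phi> :: "'a \<Rightarrow> complex" assume "bounded_borel \<phi>"
  then show "a * J1 (\<lambda>x. c * \<phi> x) + b * J2 (\<lambda>x. c * \<phi> x) = c * (a * J1 \<phi> + b * J2 \<phi>)"
    by (simp add: charge_cmult J algebra_simps)
next
  have "cmod (a * J1 \<phi> + b * J2 \<phi>) \<le> (cmod a * charge_norm J1 + cmod b * charge_norm J2) * B"
    if \<phi>: "\<phi> \<in> borel_measurable borel" "\<And>x. cmod (\<phi> x) \<le> B" for \<phi> B
  proof -
    have "cmod (a * J1 \<phi> + b * J2 \<phi>) \<le> cmod a * cmod (J1 \<phi>) + cmod b * cmod (J2 \<phi>)"
      using norm_triangle_ineq[of "a * J1 \<phi>" "b * J2 \<phi>"] by (simp add: norm_mult)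
    also have "\<dots> \<le> cmod a * (charge_norm J1 * B) + cmod b * (charge_norm J2 * B)"
      by (intro add_mono mult_left_mono charge_bound J \<phi>) auto
    finally show ?thesis by (simp add: algebra_simps)
  qed
  then show "\<exists>K. \<forall>\<phi> B. \<phi> \<in> borel_measurable borel \<longrightarrow> (\<forall>x. cmod (\<phi> x) \<le> B) \<longrightarrow> cmod (a * J1 \<phi> + b * J2 \<phi>) \<le> K * B"
    by (intro exI[of _ "cmod a * charge_norm J1 + cmod b * charge_norm J2"] allI impI) simp
next
  fix s :: "nat \<Rightarrow> 'a \<Rightarrow> complex" and \<phi> B
  assume s: "\<forall>n. s n \<in> borel_measurable borel" "\<forall>n x. cmod (s n x) \<le> B" "\<forall>x. (\<lambda>n. s n x) \<longlonglongrightarrow> \<phi> x"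
  show "(\<lambda>n. a * J1 (s n) + b * J2 (s n)) \<longlonglongrightarrow> a * J1 \<phi> + b * J2 \<phi>"
    by (intro tendsto_add tendsto_mult_left charge_dominated[OF J(1), of s B] charge_dominated[OF J(2), of s B])
      (use s in simp_all)
qed

lemma charge_finite_measure:
  assumes "sets M = sets borel" "finite_measure M"
  shows "charge (\<lambda>\<phi>. LINT x|M. \<phi> x)"
proof -
  interpret finite_measure M by (rule assms(2))
  have "integrable M (\<lambda>x. 1::complex)" by simp
  from charge_density[OF assms(1) this] show ?thesis by simp
qed

lemma charge_signed_integral:
  fixes \<mu> :: "'a::topological_space set \<Rightarrow> real"
  assumes "vector_borel_measure \<mu>" "total_variation \<mu> UNIV < \<infinity>"
  shows "charge (signed_integral \<mu>)"
proof -
  note J = Jordan_decomposition[OF assms]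
  have "signed_integral \<mu> = (\<lambda>\<phi>. 1 * (LINT x|positive_part \<mu>. \<phi> x) + (-1) * (LINT x|positive_part (\<lambda>A. - \<mu> A). \<phi> x))"
    by (rule ext) (simp add: signed_integral_def)
  then show ?thesis
    using charge_lin[OF charge_finite_measure[OF J(1,3)] charge_finite_measure[OF J(2,4)], of 1 "-1"] by simp
qed

lemma signed_integral_indicator:
  fixes \<mu> :: "'a::topological_space set \<Rightarrow> real"
  assumes "vector_borel_measure \<mu>" "total_variation \<mu> UNIV < \<infinity>" "E \<in> sets borel"
  shows "signed_integral \<mu> (indicator E) = of_real (\<mu> E)"
proof -
  note J = Jordan_decomposition[OF assms(1,2)]
  have *: "(LINT x|M. indicator E x :: complex) = of_real (measure M E)" if s: "sets M = sets borel" for M :: "'a measure"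
  proof -
    have sp: "space M = UNIV" using sets_eq_imp_space_eq[OF s] by simp
    have "(LINT x|M. indicator E x :: complex) = (LINT x|M. of_real (indicator E x))"
      by (rule Bochner_Integration.integral_cong) (auto simp: indicator_def)
    also have "\<dots> = of_real (measure M E)" by (simp add: sp)
    finally show ?thesis .
  qed
  show ?thesis unfolding signed_integral_def *[OF J(1)] *[OF J(2)] using J(5)[OF assms(3)] by simp
qed

section \<open>Discretising the pole of the Green kernel\<close>

lemma finite_borel_partition:
  assumes "finite C" "\<And>c. c \<in> C \<Longrightarrow> B c \<in> sets borel"
  shows "\<exists>\<pi>. (\<forall>y\<in>(\<Union>c\<in>C. B c). \<pi> y \<in> C \<and> y \<in> B (\<pi> y)) \<and> (\<forall>c. {y. \<pi> y = c} \<in> sets borel)"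
  using assms
proof (induction C rule: finite_induct)
  case empty
  have "{y. undefined = c} \<in> sets borel" for c :: 'a by (cases "undefined = c") auto
  then show ?case by (intro exI[of _ "\<lambda>_. undefined"]) auto
next
  case (insert a C)
  then obtain \<pi> where \<pi>: "\<forall>y\<in>(\<Union>c\<in>C. B c). \<pi> y \<in> C \<and> y \<in> B (\<pi> y)" "\<forall>c. {y. \<pi> y = c} \<in> sets borel" by auto
  define \<pi>' where "\<pi>' y = (if y \<in> B a then a else \<pi> y)" for y
  have "{y. \<pi>' y = c} = (if c = a then B a else {}) \<union> ({y. \<pi> y = c} - B a)" for c
    by (auto simp: \<pi>'_def)
  then have "{y. \<pi>' y = c} \<in> sets borel" for c using \<pi>(2) insert.prems by auto
  moreover have "\<forall>y\<in>(\<Union>c\<in>insert a C. B c). \<pi>' y \<in> insert a C \<and> y \<in> B (\<pi>' y)"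
    using \<pi>(1) by (auto simp: \<pi>'_def)
  ultimately show ?case by (intro exI[of _ \<pi>'] conjI allI)
qed

text \<open>Moving the pole of the kernel to one of finitely many points changes the kernel little,
  uniformly in the other variable, by its symmetry and its Lipschitz bound. Integrals over the
  pole thereby become uniform limits of finite sums.\<close>

lemma ker_discretize:
  fixes z :: "'a::metrized_graph"
  assumes e: "e > 0"
  shows "\<exists>\<pi>. finite (range \<pi>) \<and> (\<forall>c. {y. \<pi> y = c} \<in> sets borel) \<and> (\<forall>y::'a. dist y (\<pi> y) < e) \<and>
    (\<forall>x y. cmod (ker z (\<pi> y) x - ker z y x) \<le> e)"
proof -
  have "\<exists>\<delta>. star_radius p \<delta> \<and> 0 < \<delta> \<and> \<delta> \<le> e" for p :: 'a
  proof -
    obtain \<rho> where "star_radius p \<rho>" "\<rho> > 0" using star_radius_exists by blast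
    then show ?thesis using e by (intro exI[of _ "min \<rho> e"]) (auto intro: star_radius_mono)
  qed
  then obtain \<delta> where \<delta>: "\<And>p::'a. star_radius p (\<delta> p)" "\<And>p. 0 < \<delta> p" "\<And>p. \<delta> p \<le> e" by metis
  have "\<exists>D. D \<subseteq> (UNIV::'a set) \<and> finite D \<and> UNIV \<subseteq> (\<Union>c\<in>D. ball c (\<delta> c))"
    by (rule compactE_image[OF graph_compact, of UNIV "\<lambda>c. ball c (\<delta> c)"]) (use \<delta>(2) in auto)
  then obtain D where D: "finite D" "(UNIV::'a set) \<subseteq> (\<Union>c\<in>D. ball c (\<delta> c))" by blast
  have "\<exists>\<pi>. (\<forall>y\<in>(\<Union>c\<in>D. ball c (\<delta> c)). \<pi> y \<in> D \<and> y \<in> ball (\<pi> y) (\<delta> (\<pi> y))) \<and> (\<forall>c. {y. \<pi> y = c} \<in> sets borel)"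
    by (rule finite_borel_partition[OF D(1)]) simp
  then obtain \<pi> where \<pi>: "\<And>y. \<pi> y \<in> D" "\<And>y. y \<in> ball (\<pi> y) (\<delta> (\<pi> y))" "\<And>c. {y. \<pi> y = c} \<in> sets borel"
    using D(2) by (metis UNIV_I subsetD)
  have "finite (range \<pi>)" by (rule finite_subset[OF _ D(1)]) (use \<pi>(1) in auto)
  moreover have "dist y (\<pi> y) < e" for y using \<pi>(2)[of y] \<delta>(3)[of "\<pi> y"] by (simp add: dist_commute)
  moreover have "cmod (ker z (\<pi> y) x - ker z y x) \<le> e" for x y
  proof -
    obtain v t where vt: "v \<in> Vec (\<pi> y)" "0 \<le> t" "t < \<delta> (\<pi> y)" "y = move (\<pi> y) v t"
      by (rule star_radius_ball[OF \<delta>(1) \<pi>(2)])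
    have "cmod (ker z x y - ker z x (\<pi> y)) \<le> t"
      using ker_lipschitz_star[OF \<delta>(1) vt(1-3), of z x] vt(4) by simp
    also have "t \<le> e" using vt(3) \<delta>(3)[of "\<pi> y"] by simp
    finally show ?thesis by (simp add: ker_symmetric[of z x] norm_minus_commute)
  qed
  ultimately show ?thesis using \<pi>(3) by blast
qed

lemma continuous_bound:
  fixes f :: "'a::metrized_graph \<Rightarrow> complex"
  assumes "continuous_on UNIV f" obtains B where "0 \<le> B" "\<And>x. cmod (f x) \<le> B"
proof -
  obtain B where B: "\<forall>x. cmod (f x) \<le> B" using bounded_borel_continuous[OF assms] unfolding bounded_borel_def by (elim conjE exE)
  have "0 \<le> B" using order_trans[OF norm_ge_zero B[rule_format]] .
  then show ?thesis using B by (intro that[of B]) auto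
qed

lemma ker_bounded:
  fixes z :: "'a::metrized_graph"
  obtains B where "0 \<le> B" "\<And>x y. cmod (ker z y x) \<le> B"
proof -
  from ker_discretize[OF zero_less_one, of z] obtain \<pi> where \<pi>: "finite (range \<pi>)"
    "\<forall>x y. cmod (ker z (\<pi> y) x - ker z y x) \<le> 1" by (elim exE conjE)
  have "\<exists>B. 0 \<le> B \<and> (\<forall>x. cmod (ker z c x) \<le> B)" for c
    by (rule continuous_bound[OF ker_continuous[of z c]]) blast
  then obtain b where b: "\<And>c. 0 \<le> b c" "\<And>c x. cmod (ker z c x) \<le> b c" by metis
  define B where "B = (\<Sum>c\<in>range \<pi>. b c) + 1"
  have "cmod (ker z y x) \<le> B" for x y
  proof -
    have "cmod (ker z y x) \<le> cmod (ker z (\<pi> y) x) + cmod (ker z (\<pi> y) x - ker z y x)"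
      using norm_triangle_ineq4[of "ker z (\<pi> y) x" "ker z (\<pi> y) x - ker z y x"] by simp
    also have "\<dots> \<le> b (\<pi> y) + 1" using b(2) \<pi>(2) by (intro add_mono) auto
    also have "b (\<pi> y) \<le> (\<Sum>c\<in>range \<pi>. b c)" by (rule member_le_sum) (use b(1) \<pi>(1) in auto)
    finally show ?thesis by (simp add: B_def)
  qed
  moreover have "0 \<le> B" unfolding B_def by (intro add_nonneg_nonneg sum_nonneg b(1)) auto
  ultimately show ?thesis by (intro that[of B])
qed

section \<open>Potentials\<close>

text \<open>The Green potential of the measure \<open>J\<close>.\<close>

definition pot :: "'a::metrized_graph \<Rightarrow> (('a \<Rightarrow> complex) \<Rightarrow> complex) \<Rightarrow> 'a \<Rightarrow> complex" where
  "pot z J x = J (\<lambda>y. ker z y x)"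

lemma ker_pole_continuous: "continuous_on UNIV (\<lambda>y. ker z y x)"
  unfolding ker_symmetric[of z _ x] by (rule ker_continuous)

lemma ker_pole_borel: "(\<lambda>y. ker z y x) \<in> borel_measurable borel"
  by (rule borel_measurable_continuous_onI[OF ker_pole_continuous])

lemma ker_pole_bounded_borel: "bounded_borel (\<lambda>y. ker z y x)"
  by (rule bounded_borel_continuous[OF ker_pole_continuous])

lemma diff_quot_ker_bound:
  assumes "star_radius p \<rho>" "v \<in> Vec p" "0 < t" "t < \<rho>"
  shows "cmod (diff_quot v (ker z y) p t) \<le> 1"
  using ker_lipschitz_star[OF assms(1,2) _ assms(4), of z y] assms(3)
  by (simp add: diff_quot_def norm_divide)

lemma filterlim_at_right_0I:
  fixes S :: "nat \<Rightarrow> real"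
  assumes "\<And>n. 0 < S n" "S \<longlonglongrightarrow> 0" shows "filterlim S (at_right 0) sequentially"
proof -
  have "S n \<noteq> 0" for n using assms(1)[of n] by simp
  then have "eventually (\<lambda>n. S n \<in> {0<..} \<and> S n \<noteq> 0) sequentially"
    using assms(1) by (intro always_eventually) simp
  then show ?thesis using assms(2) by (simp add: filterlim_at)
qed

text \<open>Differentiation under the integral: the difference quotients of the kernel are bounded by
  \<open>1\<close>.\<close>

lemma pot_dir_deriv:
  assumes J: "charge J" and v: "v \<in> Vec p"
  shows "(diff_quot v (pot z J) p \<longlongrightarrow> J (\<lambda>y. dir_deriv v (ker z y) p)) (at_right 0)"
    and "bounded_borel (\<lambda>y. dir_deriv v (ker z y) p)"
proof -
  obtain \<rho> where \<rho>: "star_radius p \<rho>" "\<rho> > 0" using star_radius_exists by blast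
  have dq: "diff_quot v (pot z J) p t = J (\<lambda>y. diff_quot v (ker z y) p t)" for t
  proof -
    have "J (\<lambda>y. diff_quot v (ker z y) p t) = J (\<lambda>y. (1 / of_real t) * (ker z y (move p v t) - ker z y p))"
      by (simp add: diff_quot_def)
    also have "\<dots> = (1 / of_real t) * (J (\<lambda>y. ker z y (move p v t)) - J (\<lambda>y. ker z y p))"
    proof -
      have "bounded_borel (\<lambda>y. ker z y (move p v t) - ker z y p)"
        by (rule bounded_borel_continuous) (intro continuous_on_diff ker_pole_continuous)
      then show ?thesis
        by (simp only: charge_cmult[OF J] charge_diff[OF J ker_pole_bounded_borel ker_pole_bounded_borel])
    qed
    finally show ?thesis by (simp add: diff_quot_def pot_def)
  qed
  have m: "(\<lambda>y. diff_quot v (ker z y) p t) \<in> borel_measurable borel" for t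
    unfolding diff_quot_def divide_inverse
    by (intro borel_measurable_times borel_measurable_diff ker_pole_borel borel_measurable_const)
  have lim: "(diff_quot v (ker z y) p \<longlongrightarrow> dir_deriv v (ker z y) p) (at_right 0)" for y
    by (rule D_funD[OF CPA_D_fun[OF ker_CPA] v])
  show "(diff_quot v (pot z J) p \<longlongrightarrow> J (\<lambda>y. dir_deriv v (ker z y) p)) (at_right 0)"
  proof (rule tendsto_at_right_sequentially[OF \<rho>(2)])
    fix S :: "nat \<Rightarrow> real" assume S: "\<And>n. 0 < S n" "\<And>n. S n < \<rho>" "S \<longlonglongrightarrow> 0"
    have "filterlim S (at_right 0) sequentially"
      by (rule filterlim_at_right_0I[OF S(1,3)])
    then have "(\<lambda>n. diff_quot v (ker z y) p (S n)) \<longlonglongrightarrow> dir_deriv v (ker z y) p" for y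
      by (rule filterlim_compose[OF lim])
    then show "(\<lambda>n. diff_quot v (pot z J) p (S n)) \<longlonglongrightarrow> J (\<lambda>y. dir_deriv v (ker z y) p)"
      unfolding dq by (intro charge_dominated[OF J m, of _ 1] diff_quot_ker_bound[OF \<rho>(1) v S(1,2)])
  qed
  \<comment> \<open>A sequence of admissible parameters exhibits the derivative as a pointwise limit of Borel
    functions.\<close>
  define S where "S n = \<rho> / (real n + 2)" for n
  have S: "0 < S n" "S n < \<rho>" for n using \<rho>(2) by (auto simp: S_def field_simps intro!: add_pos_nonneg)
  have "S \<longlonglongrightarrow> 0" unfolding S_def by real_asymp
  then have "filterlim S (at_right 0) sequentially" by (rule filterlim_at_right_0I[OF S(1)])
  then have limS: "(\<lambda>n. diff_quot v (ker z y) p (S n)) \<longlonglongrightarrow> dir_deriv v (ker z y) p" for y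
    by (rule filterlim_compose[OF lim])
  show "bounded_borel (\<lambda>y. dir_deriv v (ker z y) p)"
  proof (rule bounded_borelI)
    show "(\<lambda>y. dir_deriv v (ker z y) p) \<in> borel_measurable borel"
      by (rule borel_measurable_LIMSEQ_metric[OF m limS])
    show "cmod (dir_deriv v (ker z y) p) \<le> 1" for y
      by (rule LIMSEQ_le_const2[OF tendsto_norm[OF limS]])
        (intro exI[of _ 0] allI impI diff_quot_ker_bound[OF \<rho>(1) v S])
  qed
qed

lemma pot_D_fun: "charge J \<Longrightarrow> pot z J \<in> D_fun"
  unfolding D_fun_def by (auto intro: exI pot_dir_deriv(1))

lemma pot_continuous: "charge J \<Longrightarrow> continuous_on UNIV (pot z J)"
  by (rule D_fun_continuous[OF pot_D_fun])

lemma finite_Out_dirs: "finite (Out_dirs b S)"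
  unfolding Out_dirs_def by (rule finite_Diff[OF finite_Vec])

text \<open>As \<open>m_set\<close> is a finite combination of directional derivatives, it may be taken under the
  integral, where \<open>m_set_ker\<close> applies.\<close>

lemma pot_m_set:
  assumes J: "charge J" and S: "finite (frontier S)" "S \<in> sets borel"
  shows "m_set (pot z J) S = J (indicator S) - indicator S z * J (\<lambda>_. 1)"
proof -
  have In: "v \<in> Vec b" if "v \<in> In_dirs b S" for v b using that In_dirs_subset by blast
  have Out: "v \<in> Vec b" if "v \<in> Out_dirs b S" for v b using that by (simp add: Out_dirs_def)
  have dd: "dir_deriv v (pot z J) b = J (\<lambda>y. dir_deriv v (ker z y) b)" if "v \<in> Vec b" for v b
    by (rule dir_deriv_eqI[OF pot_dir_deriv(1)[OF J that]])
  have bb: "bounded_borel (\<lambda>y. dir_deriv v (ker z y) b)" if "v \<in> Vec b" for v b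
    by (rule pot_dir_deriv(2)[OF J that])
  have I: "(\<Sum>b\<in>frontier S - S. \<Sum>v\<in>In_dirs b S. dir_deriv v (pot z J) b) =
      J (\<lambda>y. \<Sum>b\<in>frontier S - S. \<Sum>v\<in>In_dirs b S. dir_deriv v (ker z y) b)"
    using S(1) by (simp add: charge_sum[OF J] bounded_borel_sum finite_In_dirs bb In dd)
  have O: "(\<Sum>b\<in>frontier S \<inter> S. \<Sum>v\<in>Out_dirs b S. dir_deriv v (pot z J) b) =
      J (\<lambda>y. \<Sum>b\<in>frontier S \<inter> S. \<Sum>v\<in>Out_dirs b S. dir_deriv v (ker z y) b)"
    using S(1) by (simp add: charge_sum[OF J] bounded_borel_sum finite_Out_dirs bb Out dd)
  have "m_set (pot z J) S = J (\<lambda>y. m_set (ker z y) S)"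
    unfolding m_set_def I O using S(1)
    by (intro charge_diff[OF J, symmetric] bounded_borel_sum finite_In_dirs finite_Out_dirs bb In Out) auto
  also have "\<dots> = J (\<lambda>y. indicator S y - indicator S z * 1)" by (simp add: m_set_ker[OF S(1)])
  also have "\<dots> = J (indicator S) - indicator S z * J (\<lambda>_. 1)"
    using charge_diff[OF J bounded_borel_indicator[OF S(2)] bounded_borel_cmult[OF bounded_borel_const[of 1], of "indicator S z"]]
      charge_cmult[OF J bounded_borel_const[of 1], of "indicator S z"] by simp
  finally show ?thesis .
qed

section \<open>Potentials as Dirichlet limits\<close>

text \<open>The potential of the image of the measure \<open>J\<close> under \<open>\<pi>\<close>, a sum of point masses if \<open>\<pi>\<close> has
  finite range.\<close>

definition simple_pot :: "'a::metrized_graph \<Rightarrow> (('a \<Rightarrow> complex) \<Rightarrow> complex) \<Rightarrow> ('a \<Rightarrow> 'a) \<Rightarrow> 'a \<Rightarrow> complex" where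
  "simple_pot z J \<pi> x = (\<Sum>c\<in>range \<pi>. J (indicator {y. \<pi> y = c}) * ker z c x)"

lemma charge_simple:
  assumes J: "charge J" and \<pi>: "finite (range \<pi>)" "\<And>c. {y. \<pi> y = c} \<in> sets borel"
  shows "J (\<lambda>y. h (\<pi> y)) = (\<Sum>c\<in>range \<pi>. J (indicator {y. \<pi> y = c}) * h c)"
    and "(\<lambda>y. h (\<pi> y)) \<in> borel_measurable borel"
proof -
  have eq: "h (\<pi> y) = (\<Sum>c\<in>range \<pi>. h c * indicator {y. \<pi> y = c} y)" for y
  proof -
    have "(\<Sum>c\<in>range \<pi>. h c * indicator {y. \<pi> y = c} y) = (\<Sum>c\<in>range \<pi>. if \<pi> y = c then h c else 0)"
      by (rule sum.cong) (auto simp: indicator_def)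
    then show ?thesis using \<pi>(1) by simp
  qed
  have bb: "bounded_borel (\<lambda>y. h c * indicator {y. \<pi> y = c} y)" for c
    by (rule bounded_borel_cmult[OF bounded_borel_indicator[OF \<pi>(2)]])
  have "bounded_borel (\<lambda>y. \<Sum>c\<in>range \<pi>. h c * indicator {y. \<pi> y = c} y)"
    by (rule bounded_borel_sum[OF \<pi>(1) bb])
  then show "(\<lambda>y. h (\<pi> y)) \<in> borel_measurable borel" unfolding eq bounded_borel_def by (rule conjunct1)
  have "J (\<lambda>y. h (\<pi> y)) = (\<Sum>c\<in>range \<pi>. J (\<lambda>y. h c * indicator {y. \<pi> y = c} y))"
    unfolding eq by (rule charge_sum[OF J \<pi>(1) bb])
  also have "\<dots> = (\<Sum>c\<in>range \<pi>. J (indicator {y. \<pi> y = c}) * h c)"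
    by (rule sum.cong) (simp_all add: charge_cmult[OF J bounded_borel_indicator[OF \<pi>(2)]] mult.commute)
  finally show "J (\<lambda>y. h (\<pi> y)) = (\<Sum>c\<in>range \<pi>. J (indicator {y. \<pi> y = c}) * h c)" .
qed

lemma simple_pot_CPA: "finite (range \<pi>) \<Longrightarrow> simple_pot z J \<pi> \<in> CPA"
  unfolding simple_pot_def[abs_def] by (intro CPA_sum CPA_cmult ker_CPA)

lemma simple_pot_eq:
  assumes J: "charge J" and \<pi>: "finite (range \<pi>)" "\<And>c. {y. \<pi> y = c} \<in> sets borel"
  shows "simple_pot z J \<pi> x = J (\<lambda>y. ker z (\<pi> y) x)"
  unfolding simple_pot_def by (rule charge_simple(1)[OF J \<pi>, symmetric])

lemma simple_pot_close:
  assumes J: "charge J" and \<pi>: "finite (range \<pi>)" "\<And>c. {y. \<pi> y = c} \<in> sets borel"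
    and e: "\<And>x y. cmod (ker z (\<pi> y) x - ker z y x) \<le> e"
  shows "cmod (simple_pot z J \<pi> x - pot z J x) \<le> charge_norm J * e"
proof -
  have m: "(\<lambda>y. ker z (\<pi> y) x) \<in> borel_measurable borel" by (rule charge_simple(2)[OF J \<pi>])
  obtain B where "\<And>x y. cmod (ker z y x) \<le> B" by (rule ker_bounded) blast
  then have bb: "bounded_borel (\<lambda>y. ker z (\<pi> y) x)" by (intro bounded_borelI[OF m])
  have "simple_pot z J \<pi> x - pot z J x = J (\<lambda>y. ker z (\<pi> y) x - ker z y x)"
    unfolding simple_pot_eq[OF J \<pi>] pot_def by (rule charge_diff[OF J bb ker_pole_bounded_borel, symmetric])
  then show ?thesis
    using charge_bound[OF J borel_measurable_diff[OF m ker_pole_borel] e] by simp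
qed

lemma simple_pot_Dir_inner:
  assumes J: "charge J" and \<pi>: "finite (range \<pi>)" "\<And>c. {y. \<pi> y = c} \<in> sets borel" and g: "g \<in> Zh"
  shows "Dir_inner (simple_pot z J \<pi>) g = J (\<lambda>y. cnj (g (\<pi> y) - g z))"
proof -
  have "Dir_inner (ker z c) g = cnj (g c - g z)" for c
    using ker_reproducing[OF g, of z c] Dir_inner_commute[of "ker z c" g] by simp
  then show ?thesis
    unfolding simple_pot_def[abs_def] charge_simple(1)[OF J \<pi>, of "\<lambda>c. cnj (g c - g z)"]
    by (subst Dir_inner_sum_left[OF \<pi>(1) ker_CPA g]) simp
qed

text \<open>The approximants are potentials of discretized measures. By the reproducing property their
  Dirichlet product with \<open>g\<close> is \<open>J\<close> applied to \<open>g\<close>, composed with the discretization, minus \<open>g z\<close>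
  (with complex conjugation). Applied to differences of approximants, this bounds their energy by
  their sup norm; applied to a uniformly convergent sequence, it gives the weak equation satisfied
  by the potential.\<close>

lemma pot_approx:
  fixes z :: "'a::metrized_graph"
  assumes J: "charge J"
  obtains q where "\<And>n. q n \<in> CPA" "uniform_limit UNIV q (pot z J) sequentially"
    "\<And>e. e > 0 \<Longrightarrow> \<exists>N. \<forall>m\<ge>N. \<forall>n\<ge>N. Dir_norm (\<lambda>x. q m x - q n x) < e"
    "\<And>G g. (\<And>n. G n \<in> Zh) \<Longrightarrow> uniform_limit UNIV G g sequentially \<Longrightarrow>
       (\<lambda>n. Dir_inner (q n) (G n)) \<longlonglongrightarrow> J (\<lambda>y. cnj (g y - g z))"
    "\<And>J'. charge J' \<Longrightarrow> (\<lambda>n. J' (q n)) \<longlonglongrightarrow> J (pot z J')"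
proof -
  have pos: "0 < 1 / (real n + 1)" for n by simp
  have "\<forall>n. \<exists>\<pi>. finite (range \<pi>) \<and> (\<forall>c. {y. \<pi> y = c} \<in> sets borel) \<and> (\<forall>y::'a. dist y (\<pi> y) < 1 / (real n + 1)) \<and>
    (\<forall>x y. cmod (ker z (\<pi> y) x - ker z y x) \<le> 1 / (real n + 1))"
    by (intro allI ker_discretize pos)
  from choice[OF this] obtain \<pi> where "\<forall>n. finite (range (\<pi> n)) \<and> (\<forall>c. {y. \<pi> n y = c} \<in> sets borel) \<and> (\<forall>y::'a. dist y (\<pi> n y) < 1 / (real n + 1)) \<and>
    (\<forall>x y. cmod (ker z (\<pi> n y) x - ker z y x) \<le> 1 / (real n + 1))" by (elim exE)
  then have \<pi>: "\<And>n. finite (range (\<pi> n))" "\<And>n c. {y. \<pi> n y = c} \<in> sets borel"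
    "\<And>n y. dist y (\<pi> n y) < 1 / (real n + 1)" "\<And>n x y. cmod (ker z (\<pi> n y) x - ker z y x) \<le> 1 / (real n + 1)"
    by auto
  have to0: "(\<lambda>n. C * (1 / (real n + 1))) \<longlonglongrightarrow> 0" for C :: real by real_asymp
  have \<pi>lim: "(\<lambda>n. \<pi> n y) \<longlonglongrightarrow> y" for y
  proof -
    have "(\<lambda>n. dist (\<pi> n y) y) \<longlonglongrightarrow> 0"
      by (rule tendsto_sandwich[OF _ _ tendsto_const to0[of 1]])
        (use \<pi>(3) in \<open>auto intro!: always_eventually less_imp_le simp: dist_commute\<close>)
    then show ?thesis by (rule iffD2[OF tendsto_dist_iff])
  qed
  define q where "q n = simple_pot z J (\<pi> n)" for n
  have qC: "q n \<in> CPA" for n unfolding q_def by (rule simple_pot_CPA[OF \<pi>(1)])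
  have qZ: "q n \<in> Zh" for n using qC CPA_subset_Zh by blast
  define K where "K = charge_norm J"
  have K: "0 \<le> K" unfolding K_def by (rule charge_norm_nonneg[OF J])
  have close: "cmod (q n x - pot z J x) \<le> K * (1 / (real n + 1))" for n x
    unfolding q_def K_def by (rule simple_pot_close[OF J \<pi>(1,2,4)])
  have ul: "uniform_limit UNIV q (pot z J) sequentially"
  proof (rule uniform_limitI)
    fix e :: real assume "e > 0"
    then have "eventually (\<lambda>n. K * (1 / (real n + 1)) < e) sequentially"
      using to0[of K] by (intro order_tendstoD(2)) auto
    then show "eventually (\<lambda>n. \<forall>x\<in>UNIV. dist (q n x) (pot z J x) < e) sequentially"
    proof eventually_elim
      case (elim n)
      then show ?case using close[of n] by (auto simp: dist_norm intro: order_le_less_trans)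
    qed
  qed
  have inner: "Dir_inner (q n) g = J (\<lambda>y. cnj (g (\<pi> n y) - g z))" if "g \<in> Zh" for n g
    unfolding q_def by (rule simple_pot_Dir_inner[OF J \<pi>(1,2) that])
  have cauchy: "\<exists>N. \<forall>m\<ge>N. \<forall>n\<ge>N. Dir_norm (\<lambda>x. q m x - q n x) < e" if e: "e > 0" for e
  proof -
    have "eventually (\<lambda>n. (8 * K * K) * (1 / (real n + 1)) < e\<^sup>2) sequentially"
      using to0[of "8 * K * K"] e by (intro order_tendstoD(2)) auto
    then obtain N where N: "\<And>n. n \<ge> N \<Longrightarrow> (8 * K * K) * (1 / (real n + 1)) < e\<^sup>2" unfolding eventually_sequentially by blast
    have "Dir_norm (\<lambda>x. q m x - q n x) < e" if mn: "m \<ge> N" "n \<ge> N" for m n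
    proof -
      \<comment> \<open>The energy of \<open>h\<close> is the product of \<open>q m\<close> with \<open>h\<close> minus that of \<open>q n\<close> with \<open>h\<close>; each
        is bounded through the sup norm of \<open>h\<close>.\<close>
      define h where "h x = q m x - q n x" for x
      have hZ: "h \<in> Zh" unfolding h_def by (rule Zh_diff[OF qZ qZ])
      define B where "B = 2 * K * (1 / (real N + 1))"
      have le: "K * (1 / (real i + 1)) \<le> K * (1 / (real N + 1))" if "i \<ge> N" for i
        using that K by (intro mult_left_mono) (auto simp: field_simps)
      have hB: "cmod (h x) \<le> B" for x
      proof -
        have "cmod (h x) \<le> cmod (q m x - pot z J x) + cmod (q n x - pot z J x)"
          using norm_triangle_ineq4[of "q m x - pot z J x" "q n x - pot z J x"] by (simp add: h_def)
        then show ?thesis using close[of m x] close[of n x] le[OF mn(1)] le[OF mn(2)] by (simp add: B_def)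
      qed
      have bd: "cmod (J (\<lambda>y. cnj (h (\<pi> i y) - h z))) \<le> K * (2 * B)" for i
        unfolding K_def
      proof (rule charge_bound[OF J])
        show "(\<lambda>y. cnj (h (\<pi> i y) - h z)) \<in> borel_measurable borel" by (rule charge_simple(2)[OF J \<pi>(1,2)])
        show "cmod (cnj (h (\<pi> i y) - h z)) \<le> 2 * B" for y
          using norm_triangle_ineq4[of "h (\<pi> i y)" "h z"] hB[of "\<pi> i y"] hB[of z] unfolding complex_mod_cnj by linarith
      qed
      have "Dir_inner h h = Dir_inner (q m) h - Dir_inner (q n) h"
        using Dir_inner_diff_left[OF qZ qZ hZ, of m n] by (simp only: h_def[abs_def, symmetric])
      then have "cmod (Dir_inner h h) \<le> cmod (Dir_inner (q m) h) + cmod (Dir_inner (q n) h)"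
        by (simp only: norm_triangle_ineq4)
      also have "\<dots> \<le> K * (2 * B) + K * (2 * B)" unfolding inner[OF hZ] by (rule add_mono[OF bd bd])
      finally have "(Dir_norm h)\<^sup>2 \<le> K * (2 * B) + K * (2 * B)"
        unfolding Dir_norm_sq using complex_Re_le_cmod[of "Dir_inner h h"] by linarith
      also have "\<dots> = (8 * K * K) * (1 / (real N + 1))" by (simp add: B_def)
      also have "\<dots> < e\<^sup>2" using N[of N] by simp
      finally have "Dir_norm h < e" using e by (intro power_less_imp_less_base[of _ 2 e]) auto
      then show ?thesis by (simp add: h_def[abs_def])
    qed
    then show ?thesis by blast
  qed
  have lim: "(\<lambda>n. Dir_inner (q n) (G n)) \<longlonglongrightarrow> J (\<lambda>y. cnj (g y - g z))"
    if G: "\<And>n. G n \<in> Zh" and u: "uniform_limit UNIV G g sequentially" for G g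
  proof -
    have gc: "continuous_on UNIV g"
      by (rule uniform_limit_theorem[OF _ u]) (use Zh_continuous[OF G] in auto)
    obtain B where B: "0 \<le> B" "\<And>x. cmod (g x) \<le> B" by (rule continuous_bound[OF gc]) (rule that)
    from uniform_limitD[OF u zero_less_one] obtain N0 where N0: "\<And>n x. n \<ge> N0 \<Longrightarrow> dist (G n x) (g x) < 1"
      unfolding eventually_sequentially by blast
    have GB: "cmod (G (n + N0) x) \<le> B + 1" for n x
      using N0[of "n + N0" x] B(2)[of x] norm_triangle_ineq4[of "g x" "g x - G (n + N0) x"]
      by (simp add: dist_norm norm_minus_commute)
    have pt: "(\<lambda>n. G n (\<pi> n y)) \<longlonglongrightarrow> g y" for y
    proof -
      have 1: "(\<lambda>n. g (\<pi> n y)) \<longlonglongrightarrow> g y"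
        using continuous_on_tendsto_compose[OF gc \<pi>lim[of y]] by simp
      have 2: "(\<lambda>n. G n (\<pi> n y) - g (\<pi> n y)) \<longlonglongrightarrow> 0"
        unfolding tendsto_iff
      proof (intro allI impI)
        fix e :: real assume "e > 0"
        from uniform_limitD[OF u this] show "eventually (\<lambda>n. dist (G n (\<pi> n y) - g (\<pi> n y)) 0 < e) sequentially"
          by eventually_elim (simp add: dist_norm)
      qed
      from tendsto_add[OF 2 1] show ?thesis by simp
    qed
    have ptz: "(\<lambda>n. G n z) \<longlonglongrightarrow> g z" by (rule tendsto_uniform_limitI[OF u]) simp
    have "(\<lambda>n. J (\<lambda>y. cnj (G (n + N0) (\<pi> (n + N0) y) - G (n + N0) z))) \<longlonglongrightarrow> J (\<lambda>y. cnj (g y - g z))"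
    proof (rule charge_dominated[OF J])
      show "(\<lambda>y. cnj (G (n + N0) (\<pi> (n + N0) y) - G (n + N0) z)) \<in> borel_measurable borel" for n
        by (rule charge_simple(2)[OF J \<pi>(1,2)])
      show "cmod (cnj (G (n + N0) (\<pi> (n + N0) y) - G (n + N0) z)) \<le> (B + 1) + (B + 1)" for n y
        unfolding complex_mod_cnj by (rule order_trans[OF norm_triangle_ineq4 add_mono[OF GB GB]])
      show "(\<lambda>n. cnj (G (n + N0) (\<pi> (n + N0) y) - G (n + N0) z)) \<longlonglongrightarrow> cnj (g y - g z)" for y
        by (intro tendsto_cnj tendsto_diff LIMSEQ_ignore_initial_segment[OF pt] LIMSEQ_ignore_initial_segment[OF ptz])
    qed
    then have "(\<lambda>n. Dir_inner (q (n + N0)) (G (n + N0))) \<longlonglongrightarrow> J (\<lambda>y. cnj (g y - g z))"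
      unfolding inner[OF G] .
    then show ?thesis by (rule LIMSEQ_offset)
  qed
  have sym: "(\<lambda>n. J' (q n)) \<longlonglongrightarrow> J (pot z J')" if J': "charge J'" for J'
  proof -
    have "J' (q n) = J (\<lambda>y. pot z J' (\<pi> n y))" for n
    proof -
      have "J' (q n) = (\<Sum>c\<in>range (\<pi> n). J' (\<lambda>x. J (indicator {y. \<pi> n y = c}) * ker z c x))"
        unfolding q_def simple_pot_def[abs_def]
        by (rule charge_sum[OF J' \<pi>(1)]) (intro bounded_borel_cmult bounded_borel_continuous ker_continuous)
      also have "\<dots> = (\<Sum>c\<in>range (\<pi> n). J (indicator {y. \<pi> n y = c}) * pot z J' c)"
      proof (rule sum.cong[OF refl])
        fix c
        have "J' (\<lambda>x. J (indicator {y. \<pi> n y = c}) * ker z c x) = J (indicator {y. \<pi> n y = c}) * J' (ker z c)"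
          by (rule charge_cmult[OF J' bounded_borel_continuous[OF ker_continuous]])
        also have "J' (ker z c) = pot z J' c" unfolding pot_def ker_symmetric[of z _ c] ..
        finally show "J' (\<lambda>x. J (indicator {y. \<pi> n y = c}) * ker z c x) = J (indicator {y. \<pi> n y = c}) * pot z J' c" .
      qed
      also have "\<dots> = J (\<lambda>y. pot z J' (\<pi> n y))" by (rule charge_simple(1)[OF J \<pi>(1,2), symmetric])
      finally show ?thesis .
    qed
    moreover have "(\<lambda>n. J (\<lambda>y. pot z J' (\<pi> n y))) \<longlonglongrightarrow> J (pot z J')"
    proof -
      obtain B where B: "0 \<le> B" "\<And>x. cmod (pot z J' x) \<le> B" by (rule continuous_bound[OF pot_continuous[OF J']]) (rule that)
      show ?thesis
      proof (rule charge_dominated[OF J])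
        show "(\<lambda>y. pot z J' (\<pi> n y)) \<in> borel_measurable borel" for n by (rule charge_simple(2)[OF J \<pi>(1,2)])
        show "cmod (pot z J' (\<pi> n y)) \<le> B" for n y by (rule B(2))
        show "(\<lambda>n. pot z J' (\<pi> n y)) \<longlonglongrightarrow> pot z J' y" for y
          using continuous_on_tendsto_compose[OF pot_continuous[OF J'] \<pi>lim[of y]] by simp
      qed
    qed
    ultimately show ?thesis by simp
  qed
  show ?thesis by (rule that[of q, OF qC ul cauchy lim sym])
qed

lemma charge_uniform_limit:
  assumes J: "charge J" and s: "\<And>n. s n \<in> borel_measurable borel" and u: "uniform_limit UNIV s \<phi> sequentially"
    and \<phi>: "bounded_borel \<phi>"
  shows "(\<lambda>n. J (s n)) \<longlonglongrightarrow> J \<phi>"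
proof -
  obtain B where B: "\<forall>x. cmod (\<phi> x) \<le> B" using \<phi> unfolding bounded_borel_def by (elim conjE exE)
  from uniform_limitD[OF u zero_less_one] obtain N0 where N0: "\<And>n x. n \<ge> N0 \<Longrightarrow> dist (s n x) (\<phi> x) < 1"
    unfolding eventually_sequentially by blast
  have "(\<lambda>n. J (s (n + N0))) \<longlonglongrightarrow> J \<phi>"
  proof (rule charge_dominated[OF J])
    show "s (n + N0) \<in> borel_measurable borel" for n by (rule s)
    show "cmod (s (n + N0) x) \<le> B + 1" for n x
      using N0[of "n + N0" x] B[rule_format, of x] norm_triangle_ineq4[of "\<phi> x" "\<phi> x - s (n + N0) x"]
      by (simp add: dist_norm norm_minus_commute)
    show "(\<lambda>n. s (n + N0) x) \<longlonglongrightarrow> \<phi> x" for x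
      by (rule LIMSEQ_ignore_initial_segment[OF tendsto_uniform_limitI[OF u]]) simp
  qed
  then show ?thesis by (rule LIMSEQ_offset)
qed

text \<open>The exchange of the order of integration of the symmetric kernel.\<close>

lemma pot_symmetric:
  assumes J: "charge J" and J': "charge J'"
  shows "J' (pot z J) = J (pot z J')"
proof (rule pot_approx[OF J, of z])
  fix q assume q: "\<And>n. q n \<in> CPA" "uniform_limit UNIV q (pot z J) sequentially"
    "\<And>J'. charge J' \<Longrightarrow> (\<lambda>n. J' (q n)) \<longlonglongrightarrow> J (pot z J')"
  have "(\<lambda>n. J' (q n)) \<longlonglongrightarrow> J' (pot z J)"
    by (rule charge_uniform_limit[OF J' borel_measurable_continuous_onI[OF CPA_continuous[OF q(1)]] q(2)
          bounded_borel_continuous[OF pot_continuous[OF J]]])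
  then show ?thesis using q(3)[OF J'] by (rule LIMSEQ_unique)
qed

section \<open>Charges and countable additivity\<close>

text \<open>Test \<open>J\<close> on the sum of the indicators of the \<open>A i\<close>, weighted by unimodular or zero factors
  that make the terms \<open>cmod (J (indicator (A i)))\<close>; disjointness keeps the sup norm at most \<open>1\<close>.\<close>

lemma charge_countable_bound:
  assumes J: "charge J" and A: "range A \<subseteq> sets borel" "disjoint_family (A :: nat \<Rightarrow> 'a::topological_space set)"
  shows "(\<Sum>i. ennreal (cmod (J (indicator (A i))))) \<le> ennreal (charge_norm J)"
proof (rule suminf_le_const)
  fix n
  define \<theta> where "\<theta> i = cnj (sgn (J (indicator (A i))))" for i
  have \<theta>: "\<theta> i * J (indicator (A i)) = of_real (cmod (J (indicator (A i))))" for i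
  proof (cases "J (indicator (A i)) = 0")
    case False
    then show ?thesis
      by (simp add: \<theta>_def sgn_eq complex_norm_square[symmetric] power2_eq_square mult.commute[of "cnj _"])
  qed simp
  have \<theta>1: "cmod (\<theta> i) \<le> 1" for i by (simp add: \<theta>_def norm_sgn)
  have bb: "bounded_borel (\<lambda>x. \<theta> i * indicator (A i) x)" for i
    by (rule bounded_borel_cmult[OF bounded_borel_indicator]) (use A(1) in auto)
  have le: "cmod (\<Sum>i<n. \<theta> i * indicator (A i) x) \<le> 1" for x
  proof (cases "\<exists>i<n. x \<in> A i")
    case True
    then obtain i where i: "i < n" "x \<in> A i" by blast
    have "(\<Sum>j<n. \<theta> j * indicator (A j) x) = (\<Sum>j<n. if j = i then \<theta> i else 0)"
    proof (rule sum.cong[OF refl])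
      fix j
      have "x \<notin> A j" if "j \<noteq> i" using disjoint_family_onD[OF A(2) UNIV_I UNIV_I that] i(2) by blast
      then show "\<theta> j * indicator (A j) x = (if j = i then \<theta> i else 0)" using i(2) by (auto simp: indicator_def)
    qed
    then show ?thesis using i(1) \<theta>1 by simp
  next
    case False
    then have "(\<Sum>j<n. \<theta> j * indicator (A j) x) = 0" by (intro sum.neutral) (auto simp: indicator_def)
    then show ?thesis by simp
  qed
  have "bounded_borel (\<lambda>x. \<Sum>i<n. \<theta> i * indicator (A i) x)" by (rule bounded_borel_sum[OF _ bb]) simp
  then have m: "(\<lambda>x. \<Sum>i<n. \<theta> i * indicator (A i) x) \<in> borel_measurable borel" by (simp add: bounded_borel_def)
  have "J (\<lambda>x. \<Sum>i<n. \<theta> i * indicator (A i) x) = (\<Sum>i<n. J (\<lambda>x. \<theta> i * indicator (A i) x))"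
    by (rule charge_sum[OF J _ bb]) simp
  also have "\<dots> = (\<Sum>i<n. of_real (cmod (J (indicator (A i)))))"
  proof (rule sum.cong[OF refl])
    fix i
    have "A i \<in> sets borel" using A(1) by auto
    then show "J (\<lambda>x. \<theta> i * indicator (A i) x) = of_real (cmod (J (indicator (A i))))"
      by (simp add: charge_cmult[OF J bounded_borel_indicator] \<theta>)
  qed
  also have "\<dots> = of_real (\<Sum>i<n. cmod (J (indicator (A i))))" by (rule of_real_sum[symmetric])
  finally have eq: "J (\<lambda>x. \<Sum>i<n. \<theta> i * indicator (A i) x) = of_real (\<Sum>i<n. cmod (J (indicator (A i))))" .
  have "cmod (of_real (\<Sum>i<n. cmod (J (indicator (A i))))) \<le> charge_norm J * 1"
    unfolding eq[symmetric] by (rule charge_bound[OF J m le])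
  then have "(\<Sum>i<n. cmod (J (indicator (A i)))) \<le> charge_norm J"
    unfolding norm_of_real using abs_ge_self[of "\<Sum>i<n. cmod (J (indicator (A i)))"] by simp
  then have "ennreal (\<Sum>i<n. cmod (J (indicator (A i)))) \<le> ennreal (charge_norm J)" by (rule ennreal_leI)
  then show "(\<Sum>i<n. ennreal (cmod (J (indicator (A i))))) \<le> ennreal (charge_norm J)" by simp
qed simp

lemma charge_sums:
  assumes J: "charge J" and A: "range A \<subseteq> sets borel" "disjoint_family (A :: nat \<Rightarrow> 'a::topological_space set)"
  shows "(\<lambda>i. J (indicator (A i))) sums J (indicator (\<Union>i. A i))"
proof -
  have Ai: "A i \<in> sets borel" for i using A(1) by auto
  have ind: "(\<Sum>i<n. indicator (A i) x :: complex) = indicator (\<Union>i<n. A i) x" for n x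
  proof (induction n)
    case (Suc n)
    have "A i \<inter> A n = {}" if "i < n" for i by (rule disjoint_family_onD[OF A(2)]) (use that in auto)
    then have "indicator (\<Union>i<Suc n. A i) x = indicator (\<Union>i<n. A i) x + (indicator (A n) x :: complex)"
      by (cases "x \<in> A n") (auto simp: indicator_def lessThan_Suc)
    then show ?case using Suc.IH by simp
  qed simp
  have "(\<Sum>i<n. J (indicator (A i))) = J (indicator (\<Union>i<n. A i))" for n
    using charge_sum[OF J, of "{..<n}" "\<lambda>i. indicator (A i)"] bounded_borel_indicator[OF Ai] by (simp add: ind)
  moreover have "(\<lambda>n. J (indicator (\<Union>i<n. A i))) \<longlonglongrightarrow> J (indicator (\<Union>i. A i))"
  proof (rule charge_dominated[OF J])
    show "indicator (\<Union>i<n. A i) \<in> borel_measurable borel" for n using Ai by (intro borel_measurable_indicator) auto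
    show "cmod (indicator (\<Union>i<n. A i) x) \<le> 1" for n x by (simp add: indicator_def)
    show "(\<lambda>n. indicator (\<Union>i<n. A i) x :: complex) \<longlonglongrightarrow> indicator (\<Union>i. A i) x" for x
      by (rule LIMSEQ_indicator_UN)
  qed
  ultimately show ?thesis unfolding sums_def by simp
qed

lemma charge_vector_borel_measure:
  assumes J: "charge J" and \<nu>: "\<And>E. E \<in> sets borel \<Longrightarrow> \<nu> E = J (indicator E)"
  shows "vector_borel_measure \<nu>" "total_variation \<nu> UNIV < \<infinity>"
proof -
  show "vector_borel_measure \<nu>"
    unfolding vector_borel_measure_def
  proof (intro allI impI)
    fix A :: "nat \<Rightarrow> 'a set" assume A: "range A \<subseteq> sets borel" "disjoint_family A"
    have "A i \<in> sets borel" for i using A(1) by auto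
    then show "(\<lambda>i. \<nu> (A i)) sums \<nu> (\<Union>i. A i)" using charge_sums[OF J A] by (simp add: \<nu>)
  qed
  have "total_variation \<nu> UNIV \<le> ennreal (charge_norm J)"
    unfolding total_variation_def
  proof (rule SUP_least)
    fix A :: "nat \<Rightarrow> 'a set" assume "A \<in> {A. range A \<subseteq> sets borel \<and> disjoint_family A \<and> (\<Union>i. A i) = UNIV}"
    then have A: "range A \<subseteq> sets borel" "disjoint_family A" by simp_all
    have "A i \<in> sets borel" for i using A(1) by auto
    then have "(\<Sum>i. ennreal (norm (\<nu> (A i)))) = (\<Sum>i. ennreal (cmod (J (indicator (A i)))))" by (simp only: \<nu>)
    also have "\<dots> \<le> ennreal (charge_norm J)" by (rule charge_countable_bound[OF J A])
    finally show "(\<Sum>i. ennreal (norm (\<nu> (A i)))) \<le> ennreal (charge_norm J)" .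
  qed
  then show "total_variation \<nu> UNIV < \<infinity>" by (simp add: order_le_less_trans)
qed

section \<open>Adding constants and subtracting\<close>

lemma dir_deriv_add_const: "dir_deriv v (\<lambda>x. f x + c) p = dir_deriv v f p"
proof -
  have "diff_quot v (\<lambda>x. f x + c) p = diff_quot v f p" by (rule ext) (simp add: diff_quot_def)
  then show ?thesis by (simp add: dir_deriv_def)
qed

lemma m_set_add_const: "m_set (\<lambda>x. f x + c) S = m_set f S"
  by (simp add: m_set_def dir_deriv_add_const)

lemma D_fun_add_const: "f \<in> D_fun \<Longrightarrow> (\<lambda>x. f x + c) \<in> D_fun"
proof -
  have "diff_quot v (\<lambda>x. f x + c) p = diff_quot v f p" for v p by (rule ext) (simp add: diff_quot_def)
  then show "f \<in> D_fun \<Longrightarrow> (\<lambda>x. f x + c) \<in> D_fun" by (simp add: D_fun_def)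
qed

lemma Dir_inner_add_const: "Dir_inner (\<lambda>x. f x + c) g = Dir_inner f g"
  by (simp add: Dir_inner_def dir_deriv_add_const)

lemma Dir_norm_add_const: "Dir_norm (\<lambda>x. f x + c) = Dir_norm f"
  by (simp add: Dir_norm_def Dir_inner_def dir_deriv_add_const)

lemma D_fun_diff: "f \<in> D_fun \<Longrightarrow> g \<in> D_fun \<Longrightarrow> (\<lambda>x. f x - g x) \<in> D_fun"
proof -
  assume fg: "f \<in> D_fun" "g \<in> D_fun"
  have "(diff_quot v (\<lambda>x. f x - g x) p \<longlongrightarrow> dir_deriv v f p - dir_deriv v g p) (at_right 0)" if "v \<in> Vec p" for v p
    by (rule diff_quot_tendsto_diff[OF D_funD[OF fg(1) that] D_funD[OF fg(2) that]])
  then show ?thesis unfolding D_fun_def by (auto intro: exI)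
qed

lemma m_set_diff:
  assumes "f \<in> D_fun" "g \<in> D_fun"
  shows "m_set (\<lambda>x. f x - g x) S = m_set f S - m_set g S"
proof -
  have d: "dir_deriv v (\<lambda>x. f x - g x) p = dir_deriv v f p - dir_deriv v g p" if "v \<in> Vec p" for v p
    by (rule dir_deriv_eqI[OF diff_quot_tendsto_diff[OF D_funD[OF assms(1) that] D_funD[OF assms(2) that]]])
  have I: "(\<Sum>b\<in>F. \<Sum>v\<in>In_dirs b S. dir_deriv v (\<lambda>x. f x - g x) b) =
     (\<Sum>b\<in>F. \<Sum>v\<in>In_dirs b S. dir_deriv v f b - dir_deriv v g b)" for F
    by (intro sum.cong refl d) (auto simp: In_dirs_def)
  have O: "(\<Sum>b\<in>F. \<Sum>v\<in>Out_dirs b S. dir_deriv v (\<lambda>x. f x - g x) b) =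
     (\<Sum>b\<in>F. \<Sum>v\<in>Out_dirs b S. dir_deriv v f b - dir_deriv v g b)" for F
    by (intro sum.cong refl d) (auto simp: Out_dirs_def)
  show ?thesis unfolding m_set_def I O by (simp add: sum_subtractf)
qed

section \<open>The completed Dirichlet space\<close>

lemma Dir_approxD:
  assumes "Dir_approx \<mu> s f"
  shows "s n \<in> Zh" "signed_integral \<mu> (s n) = 0" "uniform_limit UNIV s f sequentially"
    "e > 0 \<Longrightarrow> \<exists>N. \<forall>m\<ge>N. \<forall>n\<ge>N. Dir_norm (\<lambda>x. s m x - s n x) < e"
  using assms by (auto simp: Dir_approx_def Zh_mu_def)

lemma Dir_approx_bounded:
  assumes s: "Dir_approx \<mu> s f"
  obtains M N where "0 < M" "\<And>n. n \<ge> N \<Longrightarrow> Dir_norm (s n) \<le> M"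
proof -
  obtain N where N: "\<And>m n. m \<ge> N \<Longrightarrow> n \<ge> N \<Longrightarrow> Dir_norm (\<lambda>x. s m x - s n x) < 1"
    using Dir_approxD(4)[OF s zero_less_one] by blast
  have "Dir_norm (s n) \<le> Dir_norm (s N) + 1" if "n \<ge> N" for n
  proof -
    have "Dir_norm (\<lambda>x. s N x + (s n x - s N x)) \<le> Dir_norm (s N) + Dir_norm (\<lambda>x. s n x - s N x)"
      by (rule Dir_norm_triangle) (intro Dir_approxD(1)[OF s] Zh_diff)+
    then show ?thesis using N[of n N] that by simp
  qed
  then show ?thesis using Dir_norm_nonneg[of "s N"] by (intro that[of "Dir_norm (s N) + 1" N]) auto
qed

lemma Dir_approx_diff:
  assumes J: "charge (signed_integral \<mu>)" and s: "Dir_approx \<mu> s f" and u: "Dir_approx \<mu> u g"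
  shows "Dir_approx \<mu> (\<lambda>n x. s n x - u n x) (\<lambda>x. f x - g x)"
  unfolding Dir_approx_def
proof (intro conjI allI impI)
  note S = Dir_approxD[OF s] and U = Dir_approxD[OF u]
  show "(\<lambda>x. s n x - u n x) \<in> Zh_mu \<mu>" for n
    using charge_diff[OF J bounded_borel_continuous[OF Zh_continuous[OF S(1)]] bounded_borel_continuous[OF Zh_continuous[OF U(1)]]]
      S(2) U(2) Zh_diff[OF S(1) U(1)] by (simp add: Zh_mu_def)
  show "uniform_limit UNIV (\<lambda>n x. s n x - u n x) (\<lambda>x. f x - g x) sequentially"
    by (intro uniform_limit_minus S(3) U(3))
  fix e :: real assume "e > 0"
  then have e2: "e / 2 > 0" by simp
  obtain N where N: "\<And>m n. m \<ge> N \<Longrightarrow> n \<ge> N \<Longrightarrow> Dir_norm (\<lambda>x. s m x - s n x) < e / 2" using S(4)[OF e2] by blast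
  obtain N' where N': "\<And>m n. m \<ge> N' \<Longrightarrow> n \<ge> N' \<Longrightarrow> Dir_norm (\<lambda>x. u m x - u n x) < e / 2" using U(4)[OF e2] by blast
  have "Dir_norm (\<lambda>x. (s m x - u m x) - (s n x - u n x)) < e" if "m \<ge> max N N'" "n \<ge> max N N'" for m n
  proof -
    have "Dir_norm (\<lambda>x. (s m x - s n x) + (u n x - u m x)) \<le> Dir_norm (\<lambda>x. s m x - s n x) + Dir_norm (\<lambda>x. u n x - u m x)"
      by (rule Dir_norm_triangle) (intro Zh_diff S(1) U(1))+
    also have "(\<lambda>x. (s m x - s n x) + (u n x - u m x)) = (\<lambda>x. (s m x - u m x) - (s n x - u n x))" by auto
    finally show ?thesis using N[of m n] N'[of n m] that by simp
  qed
  then show "\<exists>N. \<forall>m\<ge>N. \<forall>n\<ge>N. Dir_norm (\<lambda>x. (s m x - u m x) - (s n x - u n x)) < e" by blast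
qed

text \<open>Closability. Split the energy of \<open>t n\<close> into the products of \<open>t n\<close> with \<open>t n - t m\<close> and
  with \<open>t m\<close>. The first is small for large \<open>m\<close> and \<open>n\<close>, the second, for fixed \<open>m\<close>, because \<open>t n\<close>
  tends uniformly to \<open>0\<close>.\<close>

lemma Dir_approx_null:
  assumes t: "Dir_approx \<mu> t (\<lambda>x. 0)"
  shows "(\<lambda>n. Dir_norm (t n)) \<longlonglongrightarrow> 0"
proof (rule LIMSEQ_I)
  note T = Dir_approxD[OF t]
  fix e :: real assume e: "e > 0"
  obtain M N0 where M: "0 < M" "\<And>n. n \<ge> N0 \<Longrightarrow> Dir_norm (t n) \<le> M" by (rule Dir_approx_bounded[OF t]) blast
  have "e\<^sup>2 / (2 * M) > 0" using e M by simp
  from T(4)[OF this] obtain N1 where N1: "\<And>m n. m \<ge> N1 \<Longrightarrow> n \<ge> N1 \<Longrightarrow> Dir_norm (\<lambda>x. t m x - t n x) < e\<^sup>2 / (2 * M)" by blast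
  define m where "m = max N0 N1"
  obtain C0 where C0: "\<And>u B. u \<in> Zh \<Longrightarrow> (\<And>x. cmod (u x) \<le> B) \<Longrightarrow> cmod (Dir_inner u (t m)) \<le> C0 * B"
    by (rule Dir_inner_bound_uniform[OF T(1)[of m]]) blast
  define C where "C = \<bar>C0\<bar> + 1"
  have C: "0 < C" by (simp add: C_def)
  have "e\<^sup>2 / (2 * C) > 0" using e C by simp
  from uniform_limitD[OF T(3) this] obtain N2 where N2: "\<And>n x. n \<ge> N2 \<Longrightarrow> cmod (t n x) < e\<^sup>2 / (2 * C)"
    unfolding eventually_sequentially by auto
  have "Dir_norm (t n) < e" if n: "n \<ge> max m N2" for n
  proof -
    have nn: "n \<ge> N0" "n \<ge> N1" "n \<ge> N2" "m \<ge> N0" "m \<ge> N1" using n by (auto simp: m_def)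
    have d: "(\<lambda>x. t n x - t m x) \<in> Zh" by (intro Zh_diff T(1))
    have "Dir_inner (t n) (t n) = Dir_inner (t n) (\<lambda>x. t n x - t m x) + Dir_inner (t n) (t m)"
      by (simp add: Dir_inner_diff_right[OF T(1) T(1) T(1)])
    then have "(Dir_norm (t n))\<^sup>2 \<le> cmod (Dir_inner (t n) (\<lambda>x. t n x - t m x)) + cmod (Dir_inner (t n) (t m))"
      using complex_Re_le_cmod[of "Dir_inner (t n) (t n)"] norm_triangle_ineq[of "Dir_inner (t n) (\<lambda>x. t n x - t m x)" "Dir_inner (t n) (t m)"]
      unfolding Dir_norm_sq by simp
    also have "cmod (Dir_inner (t n) (\<lambda>x. t n x - t m x)) \<le> Dir_norm (t n) * Dir_norm (\<lambda>x. t n x - t m x)"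
      by (rule Dir_Cauchy_Schwarz[OF T(1) d])
    also have "\<dots> \<le> M * Dir_norm (\<lambda>x. t n x - t m x)" by (rule mult_right_mono[OF M(2)[OF nn(1)] Dir_norm_nonneg])
    also have "\<dots> < M * (e\<^sup>2 / (2 * M))" by (rule mult_strict_left_mono[OF N1[OF nn(2,5)] M(1)])
    also have "\<dots> = e\<^sup>2 / 2" using M(1) by simp
    also have "cmod (Dir_inner (t n) (t m)) \<le> C0 * (e\<^sup>2 / (2 * C))"
      by (rule C0[OF T(1)]) (rule less_imp_le[OF N2[OF nn(3)]])
    also have "\<dots> \<le> C * (e\<^sup>2 / (2 * C))" using C by (intro mult_right_mono) (auto simp: C_def)
    also have "\<dots> = e\<^sup>2 / 2" using C by simp
    finally have "(Dir_norm (t n))\<^sup>2 < e\<^sup>2" by simp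
    then show ?thesis using e by (intro power_less_imp_less_base[of _ 2 e]) auto
  qed
  then show "\<exists>N. \<forall>n\<ge>N. norm (Dir_norm (t n) - 0) < e" by (intro exI[of _ "max m N2"]) (simp add: abs_of_nonneg[OF Dir_norm_nonneg])
qed

text \<open>The limit of the inner products does not depend on the approximating sequences, which is
  what the definite description in \<^const>\<open>Dir_mu_inner\<close> requires.\<close>

lemma Dir_approx_inner_unique:
  assumes J: "charge (signed_integral \<mu>)"
    and s: "Dir_approx \<mu> s f" "Dir_approx \<mu> s' f" and u: "Dir_approx \<mu> u g" "Dir_approx \<mu> u' g"
    and lim: "(\<lambda>n. Dir_inner (s n) (u n)) \<longlonglongrightarrow> c"
  shows "(\<lambda>n. Dir_inner (s' n) (u' n)) \<longlonglongrightarrow> c"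
proof -
  note S = Dir_approxD[OF s(1)] and S' = Dir_approxD[OF s(2)] and U = Dir_approxD[OF u(1)] and U' = Dir_approxD[OF u(2)]
  have t: "(\<lambda>n. Dir_norm (\<lambda>x. s' n x - s n x)) \<longlonglongrightarrow> 0"
    by (rule Dir_approx_null) (use Dir_approx_diff[OF J s(2,1)] in simp)
  have t': "(\<lambda>n. Dir_norm (\<lambda>x. u' n x - u n x)) \<longlonglongrightarrow> 0"
    by (rule Dir_approx_null) (use Dir_approx_diff[OF J u(2,1)] in simp)
  obtain M N where M: "0 < M" "\<And>n. n \<ge> N \<Longrightarrow> Dir_norm (s n) \<le> M" by (rule Dir_approx_bounded[OF s(1)]) blast
  obtain M' N' where M': "0 < M'" "\<And>n. n \<ge> N' \<Longrightarrow> Dir_norm (u' n) \<le> M'" by (rule Dir_approx_bounded[OF u(2)]) blast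
  have eq: "Dir_inner (s' n) (u' n) - Dir_inner (s n) (u n) =
      Dir_inner (\<lambda>x. s' n x - s n x) (u' n) + Dir_inner (s n) (\<lambda>x. u' n x - u n x)" for n
    by (simp add: Dir_inner_diff_left[OF S'(1) S(1) U'(1)] Dir_inner_diff_right[OF U'(1) U(1) S(1)])
  have "(\<lambda>n. Dir_inner (s' n) (u' n) - Dir_inner (s n) (u n)) \<longlonglongrightarrow> 0"
  proof (rule Lim_null_comparison)
    show "(\<lambda>n. Dir_norm (\<lambda>x. s' n x - s n x) * M' + M * Dir_norm (\<lambda>x. u' n x - u n x)) \<longlonglongrightarrow> 0"
      using tendsto_add[OF tendsto_mult_left_zero[OF t, of M'] tendsto_mult_right_zero[OF t', of M]] by simp
    show "eventually (\<lambda>n. norm (Dir_inner (s' n) (u' n) - Dir_inner (s n) (u n)) \<le>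
       Dir_norm (\<lambda>x. s' n x - s n x) * M' + M * Dir_norm (\<lambda>x. u' n x - u n x)) sequentially"
      using eventually_ge_at_top[of "max N N'"]
    proof eventually_elim
      case (elim n)
      have "cmod (Dir_inner (\<lambda>x. s' n x - s n x) (u' n)) \<le> Dir_norm (\<lambda>x. s' n x - s n x) * Dir_norm (u' n)"
        by (intro Dir_Cauchy_Schwarz Zh_diff S(1) S'(1) U'(1))
      also have "\<dots> \<le> Dir_norm (\<lambda>x. s' n x - s n x) * M'"
        by (rule mult_left_mono[OF M'(2) Dir_norm_nonneg]) (use elim in simp)
      finally have 1: "cmod (Dir_inner (\<lambda>x. s' n x - s n x) (u' n)) \<le> Dir_norm (\<lambda>x. s' n x - s n x) * M'" .
      have "cmod (Dir_inner (s n) (\<lambda>x. u' n x - u n x)) \<le> Dir_norm (s n) * Dir_norm (\<lambda>x. u' n x - u n x)"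
        by (intro Dir_Cauchy_Schwarz Zh_diff S(1) U(1) U'(1))
      also have "\<dots> \<le> M * Dir_norm (\<lambda>x. u' n x - u n x)"
        by (rule mult_right_mono[OF M(2) Dir_norm_nonneg]) (use elim in simp)
      finally show ?case unfolding eq
        by (intro order_trans[OF norm_triangle_ineq] add_mono 1)
    qed
  qed
  from tendsto_add[OF this lim] show ?thesis by simp
qed

lemma Dir_mu_inner_eqI:
  assumes J: "charge (signed_integral \<mu>)"
    and s: "Dir_approx \<mu> s f" and u: "Dir_approx \<mu> u g" and lim: "(\<lambda>n. Dir_inner (s n) (u n)) \<longlonglongrightarrow> c"
  shows "Dir_mu_inner \<mu> f g = c"
  unfolding Dir_mu_inner_def
proof (rule the_equality)
  show "\<forall>s u. Dir_approx \<mu> s f \<longrightarrow> Dir_approx \<mu> u g \<longrightarrow> (\<lambda>n. Dir_inner (s n) (u n)) \<longlonglongrightarrow> c"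
    using Dir_approx_inner_unique[OF J s _ u _ lim] by simp
  fix c' assume "\<forall>s u. Dir_approx \<mu> s f \<longrightarrow> Dir_approx \<mu> u g \<longrightarrow> (\<lambda>n. Dir_inner (s n) (u n)) \<longlonglongrightarrow> c'"
  then have "(\<lambda>n. Dir_inner (s n) (u n)) \<longlonglongrightarrow> c'" using s u by simp
  then show "c' = c" using lim by (rule LIMSEQ_unique)
qed

lemma Dir_mu_inner_lim:
  assumes J: "charge (signed_integral \<mu>)" and s: "Dir_approx \<mu> s f" and u: "Dir_approx \<mu> u g"
  shows "(\<lambda>n. Dir_inner (s n) (u n)) \<longlonglongrightarrow> Dir_mu_inner \<mu> f g"
proof -
  note S = Dir_approxD[OF s] and U = Dir_approxD[OF u]
  obtain M N where M: "0 < M" "\<And>n. n \<ge> N \<Longrightarrow> Dir_norm (s n) \<le> M" by (rule Dir_approx_bounded[OF s]) blast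
  obtain M' N' where M': "0 < M'" "\<And>n. n \<ge> N' \<Longrightarrow> Dir_norm (u n) \<le> M'" by (rule Dir_approx_bounded[OF u]) blast
  have "Cauchy (\<lambda>n. Dir_inner (s n) (u n))"
  proof (rule metric_CauchyI)
    fix e :: real assume e: "e > 0"
    have pos: "e / (2 * M') > 0" "e / (2 * M) > 0" using e M M' by auto
    obtain N1 where N1: "\<And>m n. m \<ge> N1 \<Longrightarrow> n \<ge> N1 \<Longrightarrow> Dir_norm (\<lambda>x. s m x - s n x) < e / (2 * M')"
      using S(4)[OF pos(1)] by blast
    obtain N2 where N2: "\<And>m n. m \<ge> N2 \<Longrightarrow> n \<ge> N2 \<Longrightarrow> Dir_norm (\<lambda>x. u m x - u n x) < e / (2 * M)"
      using U(4)[OF pos(2)] by blast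
    have "dist (Dir_inner (s m) (u m)) (Dir_inner (s n) (u n)) < e"
      if "m \<ge> max (max N N') (max N1 N2)" "n \<ge> max (max N N') (max N1 N2)" for m n
    proof -
      have mn: "m \<ge> N" "m \<ge> N'" "m \<ge> N1" "m \<ge> N2" "n \<ge> N" "n \<ge> N'" "n \<ge> N1" "n \<ge> N2" using that by auto
      have eq: "Dir_inner (s m) (u m) - Dir_inner (s n) (u n) =
        Dir_inner (\<lambda>x. s m x - s n x) (u m) + Dir_inner (s n) (\<lambda>x. u m x - u n x)"
        by (simp add: Dir_inner_diff_left[OF S(1) S(1) U(1)] Dir_inner_diff_right[OF U(1) U(1) S(1)])
      have "cmod (Dir_inner (\<lambda>x. s m x - s n x) (u m)) \<le> Dir_norm (\<lambda>x. s m x - s n x) * Dir_norm (u m)"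
        by (intro Dir_Cauchy_Schwarz Zh_diff S(1) U(1))
      also have "\<dots> \<le> Dir_norm (\<lambda>x. s m x - s n x) * M'" by (rule mult_left_mono[OF M'(2)[OF mn(2)] Dir_norm_nonneg])
      also have "\<dots> < e / (2 * M') * M'" by (rule mult_strict_right_mono[OF N1[OF mn(3,7)] M'(1)])
      finally have 1: "cmod (Dir_inner (\<lambda>x. s m x - s n x) (u m)) < e / 2" using M'(1) by simp
      have "cmod (Dir_inner (s n) (\<lambda>x. u m x - u n x)) \<le> Dir_norm (s n) * Dir_norm (\<lambda>x. u m x - u n x)"
        by (intro Dir_Cauchy_Schwarz Zh_diff S(1) U(1))
      also have "\<dots> \<le> M * Dir_norm (\<lambda>x. u m x - u n x)" by (rule mult_right_mono[OF M(2)[OF mn(5)] Dir_norm_nonneg])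
      also have "\<dots> < M * (e / (2 * M))" by (rule mult_strict_left_mono[OF N2[OF mn(4,8)] M(1)])
      finally have 2: "cmod (Dir_inner (s n) (\<lambda>x. u m x - u n x)) < e / 2" using M(1) by simp
      show ?thesis unfolding dist_norm eq
        using norm_triangle_ineq[of "Dir_inner (\<lambda>x. s m x - s n x) (u m)" "Dir_inner (s n) (\<lambda>x. u m x - u n x)"] 1 2 by linarith
    qed
    then show "\<exists>N. \<forall>m\<ge>N. \<forall>n\<ge>N. dist (Dir_inner (s m) (u m)) (Dir_inner (s n) (u n)) < e" by blast
  qed
  then obtain c where c: "(\<lambda>n. Dir_inner (s n) (u n)) \<longlonglongrightarrow> c" using Cauchy_convergent_iff convergent_def by blast
  then show ?thesis using Dir_mu_inner_eqI[OF J s u c] by simp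
qed

lemma Dir_mu_continuous: "Dir_approx \<mu> s f \<Longrightarrow> continuous_on UNIV f"
proof -
  assume s: "Dir_approx \<mu> s f"
  show ?thesis
    by (rule uniform_limit_theorem[OF _ Dir_approxD(3)[OF s]])
      (intro always_eventually allI Zh_continuous Dir_approxD(1)[OF s], simp)
qed

lemma Dir_mu_integral_zero:
  assumes J: "charge (signed_integral \<mu>)" and s: "Dir_approx \<mu> s f"
  shows "signed_integral \<mu> f = 0"
proof -
  have "(\<lambda>n. signed_integral \<mu> (s n)) \<longlonglongrightarrow> signed_integral \<mu> f"
    by (rule charge_uniform_limit[OF J borel_measurable_continuous_onI[OF Zh_continuous[OF Dir_approxD(1)[OF s]]] Dir_approxD(3)[OF s]
          bounded_borel_continuous[OF Dir_mu_continuous[OF s]]])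
  then show ?thesis by (simp add: Dir_approxD(2)[OF s] LIMSEQ_const_iff)
qed

text \<open>By the reproducing property and the Cauchy-Schwarz inequality, the oscillation of \<open>s n\<close>
  between two points is bounded by its energy norm; so \<open>f\<close> is constant, and its integral against
  \<open>\<mu>\<close> vanishes.\<close>

lemma Dir_approx_energy_zero:
  assumes J: "charge (signed_integral \<mu>)" and J1: "signed_integral \<mu> (\<lambda>_. 1) = 1"
    and s: "Dir_approx \<mu> s f" and lim: "(\<lambda>n. Dir_inner (s n) (s n)) \<longlonglongrightarrow> 0"
  shows "f x = 0"
proof -
  note S = Dir_approxD[OF s]
  have "(\<lambda>n. Dir_norm (s n)) \<longlonglongrightarrow> 0"
    unfolding Dir_norm_def using tendsto_real_sqrt[OF tendsto_Re[OF lim]] by simp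
  then have n0: "(\<lambda>n. Dir_norm (s n) * Dir_norm (ker x y)) \<longlonglongrightarrow> 0" for y by (rule tendsto_mult_left_zero)
  have const: "f y = f x" for y
  proof -
    have "(\<lambda>n. s n y - s n x) \<longlonglongrightarrow> 0"
    proof (rule Lim_null_comparison[OF _ n0[of y]])
      show "eventually (\<lambda>n. norm (s n y - s n x) \<le> Dir_norm (s n) * Dir_norm (ker x y)) sequentially"
        using Dir_Cauchy_Schwarz[OF S(1) ker_Zh, of _ x y] ker_reproducing[OF S(1), of _ x y] by (intro always_eventually) simp
    qed
    moreover have "(\<lambda>n. s n y - s n x) \<longlonglongrightarrow> f y - f x"
      by (intro tendsto_diff tendsto_uniform_limitI[OF S(3)]) auto
    ultimately have "0 = f y - f x" by (rule LIMSEQ_unique)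
    then show ?thesis by simp
  qed
  have "f = (\<lambda>y. f x * 1)" using const by auto
  then have "signed_integral \<mu> f = f x * signed_integral \<mu> (\<lambda>_. 1)"
    using charge_cmult[OF J bounded_borel_const[of 1], of "f x"] by simp
  then show ?thesis using Dir_mu_integral_zero[OF J s] J1 by simp
qed

section \<open>The kernel of the operator\<close>

lemma ker_diagonal_continuous:
  fixes z :: "'a::metrized_graph"
  shows "continuous_on UNIV (\<lambda>\<zeta>. ker z \<zeta> \<zeta>)"
  unfolding continuous_on_iff
proof (intro ballI allI impI)
  fix p :: 'a and e :: real assume e: "e > 0"
  obtain \<rho> where \<rho>: "star_radius p \<rho>" "\<rho> > 0" using star_radius_exists by blast
  have "dist (ker z x x) (ker z p p) < e" if x: "dist x p < min \<rho> (e / 2)" for x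
  proof -
    have "x \<in> ball p \<rho>" using x by (simp add: dist_commute)
    then obtain v t where vt: "v \<in> Vec p" "0 \<le> t" "t < \<rho>" "x = move p v t" by (rule star_radius_ball[OF \<rho>(1)])
    have t: "t < e / 2" using star_radius_dist0[OF \<rho>(1) vt(1-3)] x vt(4) by (simp add: dist_commute)
    have 1: "cmod (ker z x x - ker z x p) \<le> t" using ker_lipschitz_star[OF \<rho>(1) vt(1-3), of z x] vt(4) by simp
    have "cmod (ker z p x - ker z p p) \<le> t" using ker_lipschitz_star[OF \<rho>(1) vt(1-3), of z p] vt(4) by simp
    then have 2: "cmod (ker z x p - ker z p p) \<le> t" by (simp add: ker_symmetric[of z x p])
    have "cmod (ker z x x - ker z p p) \<le> cmod (ker z x x - ker z x p) + cmod (ker z x p - ker z p p)"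
      using norm_triangle_ineq[of "ker z x x - ker z x p" "ker z x p - ker z p p"] by simp
    then show ?thesis using 1 2 t by (simp add: dist_norm)
  qed
  then show "\<exists>d>0. \<forall>x'\<in>UNIV. dist x' p < d \<longrightarrow> dist (ker z x' x') (ker z p p) < e"
    using \<rho>(2) e by (intro exI[of _ "min \<rho> (e / 2)"]) auto
qed

context
  fixes \<mu> :: "'a::metrized_graph set \<Rightarrow> real" and z :: 'a
  assumes J: "charge (signed_integral \<mu>)" and J1: "signed_integral \<mu> (\<lambda>_. 1) = 1"
begin

lemma signed_integral_const: "signed_integral \<mu> (\<lambda>_. c) = c"
  using charge_cmult[OF J bounded_borel_const[of 1], of c] J1 by simp

text \<open>Every base point \<open>\<zeta>\<close> is replaced by the fixed base point \<open>z\<close>.\<close>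

lemma j_mu_formula:
  "j_mu \<mu> x y = ker z y x - pot z (signed_integral \<mu>) x - pot z (signed_integral \<mu>) y + signed_integral \<mu> (\<lambda>\<zeta>. ker z \<zeta> \<zeta>)"
proof -
  let ?I = "signed_integral \<mu>"
  have c: "bounded_borel (\<lambda>\<zeta>. ker z y x)" by (rule bounded_borel_const)
  have d: "bounded_borel (\<lambda>\<zeta>. ker z \<zeta> \<zeta>)" by (rule bounded_borel_continuous[OF ker_diagonal_continuous])
  have s: "(\<lambda>\<zeta>. ker z y \<zeta>) = (\<lambda>\<zeta>. ker z \<zeta> y)" by (rule ext) (rule ker_symmetric)
  have py: "bounded_borel (\<lambda>\<zeta>. ker z y \<zeta>)" by (rule bounded_borel_continuous[OF ker_continuous])
  have 1: "bounded_borel (\<lambda>\<zeta>. ker z y x - ker z \<zeta> x)"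
    by (rule bounded_borel_continuous) (intro continuous_on_diff continuous_on_const ker_pole_continuous)
  have 2: "bounded_borel (\<lambda>\<zeta>. ker z y \<zeta> - ker z \<zeta> \<zeta>)"
    by (rule bounded_borel_continuous) (intro continuous_on_diff ker_continuous ker_diagonal_continuous)
  have j: "j_fun \<zeta> x y = (ker z y x - ker z \<zeta> x) - (ker z y \<zeta> - ker z \<zeta> \<zeta>)" for \<zeta>
    unfolding j_fun_ker by (rule ker_change_base)
  have "j_mu \<mu> x y = ?I (\<lambda>\<zeta>. (ker z y x - ker z \<zeta> x) - (ker z y \<zeta> - ker z \<zeta> \<zeta>))"
    unfolding j_mu_def j ..
  also have "\<dots> = (?I (\<lambda>\<zeta>. ker z y x) - ?I (\<lambda>\<zeta>. ker z \<zeta> x)) - (?I (\<lambda>\<zeta>. ker z y \<zeta>) - ?I (\<lambda>\<zeta>. ker z \<zeta> \<zeta>))"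
    by (simp only: charge_diff[OF J 1 2] charge_diff[OF J c ker_pole_bounded_borel] charge_diff[OF J py d])
  finally have "j_mu \<mu> x y = (ker z y x - pot z ?I x) - (pot z ?I y - ?I (\<lambda>\<zeta>. ker z \<zeta> \<zeta>))"
    by (simp only: signed_integral_const pot_def s)
  then show ?thesis by (simp add: algebra_simps)
qed

text \<open>The diagonal terms of \<open>j_mu\<close> cancel against \<open>c_mu\<close>; what remains is the kernel corrected
  so that its integral against \<open>\<mu>\<close> vanishes in either variable.\<close>

lemma g_mu_formula:
  "g_mu \<mu> x y = ker z y x - pot z (signed_integral \<mu>) x - pot z (signed_integral \<mu>) y
     + signed_integral \<mu> (pot z (signed_integral \<mu>))"
proof -
  let ?I = "signed_integral \<mu>"
  let ?u = "pot z ?I"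
  let ?\<kappa> = "?I (\<lambda>\<zeta>. ker z \<zeta> \<zeta>)"
  have u: "bounded_borel ?u" by (rule bounded_borel_continuous[OF pot_continuous[OF J]])
  have "?I (\<lambda>x. j_mu \<mu> x y) = ?\<kappa> - ?I ?u" for y
  proof -
    have ky: "bounded_borel (\<lambda>x. ker z y x)" by (rule bounded_borel_continuous[OF ker_continuous])
    have d: "bounded_borel (\<lambda>x. ker z y x - ?u x)"
      by (rule bounded_borel_continuous) (intro continuous_on_diff ker_continuous pot_continuous J)
    have "?I (\<lambda>x. j_mu \<mu> x y) = ?I (\<lambda>x. (ker z y x - ?u x) + (?\<kappa> - ?u y))"
      unfolding j_mu_formula by (simp add: algebra_simps)
    also have "\<dots> = ?I (\<lambda>x. ker z y x) - ?I ?u + (?\<kappa> - ?u y)"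
      by (simp only: charge_add[OF J d bounded_borel_const] charge_diff[OF J ky u] signed_integral_const)
    also have "?I (\<lambda>x. ker z y x) = ?u y" unfolding pot_def ker_symmetric[of z _ y] ..
    finally show ?thesis by simp
  qed
  then have "c_mu \<mu> = ?\<kappa> - ?I ?u" unfolding c_mu_def by (intro the_equality) auto
  then show ?thesis unfolding g_mu_def j_mu_formula by simp
qed

end

lemma L2_integrable:
  assumes "f \<in> L2" shows "integrable arc_length f"
proof -
  interpret finite_measure "arc_length :: 'a measure" by (rule finite_measure_arc_length)
  have f: "f \<in> borel_measurable borel" "integrable arc_length (\<lambda>x. (cmod (f x))\<^sup>2)" using assms by (auto simp: L2_def)
  have "integrable arc_length (\<lambda>x. 1 + (cmod (f x))\<^sup>2)" using f(2) by simp
  then show ?thesis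
  proof (rule Bochner_Integration.integrable_bound)
    show "f \<in> borel_measurable arc_length" using f(1) by simp
    have "cmod (f x) \<le> 1 + (cmod (f x))\<^sup>2" for x
    proof (cases "cmod (f x) \<le> 1")
      case True then show ?thesis by (simp add: add_increasing2)
    next
      case False
      then have "cmod (f x) * 1 \<le> cmod (f x) * cmod (f x)" by (intro mult_left_mono) auto
      then show ?thesis by (simp add: power2_eq_square)
    qed
    then show "AE x in arc_length. norm (f x) \<le> norm (1 + (cmod (f x))\<^sup>2)" by simp
  qed
qed

section \<open>The image of the operator\<close>

text \<open>With \<open>\<nu> = \<lambda> (f dx - (\<integral>f dx) \<mu>)\<close>, a measure of total mass \<open>0\<close>, the function \<open>h = \<lambda> \<phi>\<^sub>\<mu>(f)\<close>
  is the potential of \<open>\<nu>\<close> normalized to have integral \<open>0\<close> against \<open>\<mu>\<close>. The functionals \<open>I\<mu>\<close>, \<open>Jf\<close>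
  and \<open>I\<nu>\<close> are integration against \<open>\<mu>\<close>, \<open>f dx\<close> and \<open>\<nu>\<close>.\<close>

locale phi_image =
  fixes \<mu> :: "'a::metrized_graph set \<Rightarrow> real" and f :: "'a \<Rightarrow> complex" and lam :: real
  assumes vbm: "vector_borel_measure \<mu>" and \<mu>1: "\<mu> UNIV = 1" and tv: "total_variation \<mu> UNIV < \<infinity>"
    and f: "integrable arc_length f"
begin

text \<open>An arbitrary pole for the kernel. Since \<open>\<nu>\<close> has mass \<open>0\<close>, another choice changes the
  potential of \<open>\<nu>\<close> by a constant.\<close>

definition base :: 'a where "base = undefined"
definition I\<mu> :: "('a \<Rightarrow> complex) \<Rightarrow> complex" where "I\<mu> = signed_integral \<mu>"
definition Jf :: "('a \<Rightarrow> complex) \<Rightarrow> complex" where "Jf \<phi> = (LINT y|arc_length. \<phi> y * f y)"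
definition mass :: complex where "mass = Jf (\<lambda>_. 1)"
definition I\<nu> :: "('a \<Rightarrow> complex) \<Rightarrow> complex" where "I\<nu> \<phi> = of_real lam * Jf \<phi> + (- of_real lam * mass) * I\<mu> \<phi>"
definition h :: "'a \<Rightarrow> complex" where "h x = of_real lam * phi_mu \<mu> f x"

lemma charge_I\<mu>: "charge I\<mu>" unfolding I\<mu>_def by (rule charge_signed_integral[OF vbm tv])

lemma charge_Jf: "charge Jf" unfolding Jf_def[abs_def] by (rule charge_density[OF sets_arc_length f])

lemma charge_I\<nu>: "charge I\<nu>" unfolding I\<nu>_def[abs_def] by (rule charge_lin[OF charge_Jf charge_I\<mu>])

lemma I\<mu>_indicator: "E \<in> sets borel \<Longrightarrow> I\<mu> (indicator E) = of_real (\<mu> E)"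
  unfolding I\<mu>_def by (rule signed_integral_indicator[OF vbm tv])

lemma I\<mu>_1: "I\<mu> (\<lambda>_. 1) = 1"
proof -
  have "I\<mu> (indicator UNIV) = 1" using I\<mu>_indicator[of UNIV] \<mu>1 by simp
  moreover have "(indicator UNIV :: 'a \<Rightarrow> complex) = (\<lambda>_. 1)" by auto
  ultimately show ?thesis by simp
qed

lemma I\<mu>_const: "I\<mu> (\<lambda>_. c) = c"
  using charge_cmult[OF charge_I\<mu> bounded_borel_const[of 1], of c] I\<mu>_1 by simp

lemma Jf_const: "Jf (\<lambda>_. c) = c * mass"
  using charge_cmult[OF charge_Jf bounded_borel_const[of 1], of c] by (simp add: mass_def)

lemma I\<nu>_1: "I\<nu> (\<lambda>_. 1) = 0"
  by (simp add: I\<nu>_def I\<mu>_1 mass_def)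

lemma h_pot: "h x = pot base I\<nu> x + of_real lam * (mass * I\<mu> (pot base I\<mu>) - Jf (pot base I\<mu>))"
proof -
  let ?u = "pot base I\<mu>"
  have u: "bounded_borel ?u" by (rule bounded_borel_continuous[OF pot_continuous[OF charge_I\<mu>]])
  have d: "bounded_borel (\<lambda>y. ker base y x - ?u y)"
    by (rule bounded_borel_continuous) (intro continuous_on_diff ker_pole_continuous pot_continuous charge_I\<mu>)
  have "phi_mu \<mu> f x = Jf (\<lambda>y. (ker base y x - ?u y) + (I\<mu> ?u - ?u x))"
    unfolding phi_mu_def Jf_def g_mu_formula[OF charge_I\<mu>[unfolded I\<mu>_def] I\<mu>_1[unfolded I\<mu>_def], of _ _ base] I\<mu>_def
    by (simp add: algebra_simps)
  also have "\<dots> = Jf (\<lambda>y. ker base y x) - Jf ?u + (I\<mu> ?u - ?u x) * mass"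
    by (simp only: charge_add[OF charge_Jf d bounded_borel_const] charge_diff[OF charge_Jf ker_pole_bounded_borel u] Jf_const)
  finally have phi: "phi_mu \<mu> f x = Jf (\<lambda>y. ker base y x) - Jf ?u + (I\<mu> ?u - ?u x) * mass" .
  have "pot base I\<nu> x = of_real lam * Jf (\<lambda>y. ker base y x) + (- of_real lam * mass) * ?u x"
    by (simp only: pot_def I\<nu>_def)
  then show ?thesis unfolding h_def phi by (simp only: ring_distribs right_diff_distrib left_diff_distrib) (simp add: algebra_simps)
qed

text \<open>The constants in the formula for \<open>h\<close> cancel the integral of the potential of \<open>\<nu>\<close>, by
  symmetry of the kernel.\<close>

lemma I\<mu>_h: "I\<mu> h = 0"
proof -
  let ?u = "pot base I\<mu>" and ?p = "pot base Jf"
  have bu: "bounded_borel ?u" by (rule bounded_borel_continuous[OF pot_continuous[OF charge_I\<mu>]])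
  have bp: "bounded_borel ?p" by (rule bounded_borel_continuous[OF pot_continuous[OF charge_Jf]])
  have "pot base I\<nu> x = of_real lam * ?p x + (- of_real lam * mass) * ?u x" for x
    by (simp add: pot_def I\<nu>_def)
  then have p: "I\<mu> (pot base I\<nu>) = of_real lam * I\<mu> ?p + (- of_real lam * mass) * I\<mu> ?u"
    using charge_add[OF charge_I\<mu> bounded_borel_cmult[OF bp] bounded_borel_cmult[OF bu]]
      charge_cmult[OF charge_I\<mu> bp] charge_cmult[OF charge_I\<mu> bu] by presburger
  have s: "I\<mu> ?p = Jf ?u" by (rule pot_symmetric[OF charge_Jf charge_I\<mu>])
  have bn: "bounded_borel (pot base I\<nu>)" by (rule bounded_borel_continuous[OF pot_continuous[OF charge_I\<nu>]])
  have "h = (\<lambda>x. pot base I\<nu> x + of_real lam * (mass * I\<mu> ?u - Jf ?u))" by (rule ext) (rule h_pot)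
  then have "I\<mu> h = I\<mu> (pot base I\<nu>) + of_real lam * (mass * I\<mu> ?u - Jf ?u)"
    using charge_add[OF charge_I\<mu> bn bounded_borel_const] I\<mu>_const by simp
  then show ?thesis by (simp add: p s algebra_simps)
qed

text \<open>The constant in \<open>h_pot\<close> is identified by \<open>\<integral>h d\<mu> = 0\<close>.\<close>

lemma h_pot': "h x = pot base I\<nu> x - I\<mu> (pot base I\<nu>)"
proof -
  let ?c = "of_real lam * (mass * I\<mu> (pot base I\<mu>) - Jf (pot base I\<mu>))"
  have bn: "bounded_borel (pot base I\<nu>)" by (rule bounded_borel_continuous[OF pot_continuous[OF charge_I\<nu>]])
  have "h = (\<lambda>x. pot base I\<nu> x + ?c)" by (rule ext) (rule h_pot)
  then have "I\<mu> h = I\<mu> (pot base I\<nu>) + ?c"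
    using charge_add[OF charge_I\<mu> bn bounded_borel_const] I\<mu>_const by simp
  then have "?c = - I\<mu> (pot base I\<nu>)" using I\<mu>_h by (simp add: eq_neg_iff_add_eq_0 add.commute)
  then show ?thesis unfolding h_pot by simp
qed

lemma h_D_fun: "h \<in> D_fun"
proof -
  have "h = (\<lambda>x. pot base I\<nu> x + (- I\<mu> (pot base I\<nu>)))" by (rule ext) (simp add: h_pot')
  then show ?thesis by (simp only: D_fun_add_const[OF pot_D_fun[OF charge_I\<nu>]])
qed

lemma h_continuous: "continuous_on UNIV h" by (rule D_fun_continuous[OF h_D_fun])

lemma I\<nu>_indicator:
  assumes "E \<in> sets borel"
  shows "I\<nu> (indicator E) = of_real lam * ((LINT x:E|arc_length. f x) - mass * of_real (\<mu> E))"
proof -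
  have "Jf (indicator E) = (LINT x:E|arc_length. f x)"
    unfolding Jf_def set_lebesgue_integral_def
    by (rule Bochner_Integration.integral_cong) (auto simp: indicator_def)
  then show ?thesis by (simp add: I\<nu>_def I\<mu>_indicator[OF assms] algebra_simps)
qed

text \<open>The Laplacian of \<open>h\<close> is \<open>\<nu>\<close>, because \<open>\<nu>\<close> has mass \<open>0\<close>.\<close>

lemma h_m_set:
  assumes "S \<in> conn_algebra"
  shows "m_set h S = I\<nu> (indicator S)"
proof -
  have "h = (\<lambda>x. pot base I\<nu> x + (- I\<mu> (pot base I\<nu>)))" by (rule ext) (simp add: h_pot')
  then have "m_set h S = m_set (pot base I\<nu>) S" by (simp only: m_set_add_const)
  then show ?thesis using pot_m_set[OF charge_I\<nu> conn_algebra_finite_frontier[OF assms], of base] I\<nu>_1 by simp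
qed

lemma h_BDV: "h \<in> BDV"
  unfolding BDV_def
proof (intro CollectI conjI h_D_fun exI[of _ "charge_norm I\<nu> + 1"] allI impI)
  show "0 < charge_norm I\<nu> + 1" using charge_norm_nonneg[OF charge_I\<nu>] by simp
  fix S :: "nat \<Rightarrow> 'a set" assume S: "range S \<subseteq> conn_algebra" "disjoint_family S"
  have Sc: "S i \<in> conn_algebra" for i using S(1) by auto
  have Sb: "range S \<subseteq> sets borel" using conn_algebra_finite_frontier(2)[OF Sc] by auto
  have "(\<Sum>i. ennreal (cmod (m_set h (S i)))) = (\<Sum>i. ennreal (cmod (I\<nu> (indicator (S i)))))"
    by (simp only: h_m_set[OF Sc])
  also have "\<dots> \<le> ennreal (charge_norm I\<nu>)" by (rule charge_countable_bound[OF charge_I\<nu> Sb S(2)])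
  also have "\<dots> \<le> ennreal (charge_norm I\<nu> + 1)" by (rule ennreal_leI) simp
  finally show "(\<Sum>i. ennreal (cmod (m_set h (S i)))) \<le> ennreal (charge_norm I\<nu> + 1)" .
qed

text \<open>The weak form \<open>\<langle>h, g\<rangle> = \<lambda> \<langle>f, g\<rangle>\<close> in the Dirichlet space. The term of \<open>\<nu>\<close> in \<open>\<mu>\<close> does not
  contribute, as \<open>g\<close> has integral \<open>0\<close> against \<open>\<mu>\<close>.\<close>

lemma h_approx:
  obtains s where "Dir_approx \<mu> s h"
    "\<And>u g. Dir_approx \<mu> u g \<Longrightarrow> (\<lambda>n. Dir_inner (s n) (u n)) \<longlonglongrightarrow> of_real lam * L2_inner f g"
proof (rule pot_approx[OF charge_I\<nu>, of base])
  fix q assume q: "\<And>n. q n \<in> CPA" "uniform_limit UNIV q (pot base I\<nu>) sequentially"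
    "\<And>e. e > 0 \<Longrightarrow> \<exists>N. \<forall>m\<ge>N. \<forall>n\<ge>N. Dir_norm (\<lambda>x. q m x - q n x) < e"
    "\<And>G g. (\<And>n. G n \<in> Zh) \<Longrightarrow> uniform_limit UNIV G g sequentially \<Longrightarrow>
       (\<lambda>n. Dir_inner (q n) (G n)) \<longlonglongrightarrow> I\<nu> (\<lambda>y. cnj (g y - g base))"
  define s where "s n x = q n x + (- I\<mu> (q n))" for n x
  have qc: "bounded_borel (q n)" for n by (rule bounded_borel_continuous[OF CPA_continuous[OF q(1)]])
  have sC: "s n \<in> CPA" for n unfolding s_def[abs_def] by (intro CPA_add q(1) CPA_const)
  have "Dir_approx \<mu> s h"
    unfolding Dir_approx_def
  proof (intro conjI allI impI)
    fix n
    have "signed_integral \<mu> (s n) = 0"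
      using charge_add[OF charge_I\<mu> qc bounded_borel_const, of n "- I\<mu> (q n)"] I\<mu>_const[of "- I\<mu> (q n)"]
      by (simp add: s_def[abs_def] I\<mu>_def)
    then show "s n \<in> Zh_mu \<mu>" using sC CPA_subset_Zh by (auto simp: Zh_mu_def)
  next
    fix e :: real assume e: "e > 0"
    have "(\<lambda>x. s m x - s n x) = (\<lambda>x. (q m x - q n x) + (I\<mu> (q n) - I\<mu> (q m)))" for m n by (auto simp: s_def)
    then have "Dir_norm (\<lambda>x. s m x - s n x) = Dir_norm (\<lambda>x. q m x - q n x)" for m n by (simp only: Dir_norm_add_const)
    then show "\<exists>N. \<forall>m\<ge>N. \<forall>n\<ge>N. Dir_norm (\<lambda>x. s m x - s n x) < e" using q(3)[OF e] by simp
  next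
    have "(\<lambda>n. I\<mu> (q n)) \<longlonglongrightarrow> I\<mu> (pot base I\<nu>)"
      by (rule charge_uniform_limit[OF charge_I\<mu> borel_measurable_continuous_onI[OF CPA_continuous[OF q(1)]] q(2)
          bounded_borel_continuous[OF pot_continuous[OF charge_I\<nu>]]])
    then have "uniform_limit UNIV (\<lambda>n x::'a. I\<mu> (q n)) (\<lambda>x. I\<mu> (pot base I\<nu>)) sequentially"
      unfolding uniform_limit_iff by (auto dest: tendstoD)
    from uniform_limit_minus[OF q(2) this]
    show "uniform_limit UNIV s h sequentially" by (simp add: s_def[abs_def] h_pot'[abs_def])
  qed
  moreover have "(\<lambda>n. Dir_inner (s n) (u n)) \<longlonglongrightarrow> of_real lam * L2_inner f g" if u: "Dir_approx \<mu> u g" for u g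
  proof -
    have gc: "continuous_on UNIV g" by (rule Dir_mu_continuous[OF u])
    have bg: "bounded_borel (\<lambda>y. cnj (g y))" by (rule bounded_borel_continuous) (intro continuous_on_cnj gc)
    have "I\<nu> (\<lambda>y. cnj (g y - g base)) = I\<nu> (\<lambda>y. cnj (g y)) - cnj (g base) * I\<nu> (\<lambda>_. 1)"
      using charge_diff[OF charge_I\<nu> bg bounded_borel_cmult[OF bounded_borel_const[of 1], of "cnj (g base)"]]
        charge_cmult[OF charge_I\<nu> bounded_borel_const[of 1], of "cnj (g base)"] by simp
    also have "\<dots> = I\<nu> (\<lambda>y. cnj (g y))" by (simp add: I\<nu>_1)
    also have "I\<mu> (\<lambda>y. cnj (g y)) = cnj (I\<mu> g)" by (simp add: I\<mu>_def signed_integral_def)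
    then have "I\<nu> (\<lambda>y. cnj (g y)) = of_real lam * L2_inner f g"
      using Dir_mu_integral_zero[OF charge_I\<mu>[unfolded I\<mu>_def] u]
      by (simp add: I\<nu>_def Jf_def L2_inner_def I\<mu>_def mult.commute)
    finally have "(\<lambda>n. Dir_inner (q n) (u n)) \<longlonglongrightarrow> of_real lam * L2_inner f g"
      using q(4)[OF Dir_approxD(1,3)[OF u]] by simp
    then show ?thesis by (simp add: s_def[abs_def] Dir_inner_add_const del: add_uminus_conv_diff)
  qed
  ultimately show ?thesis by (rule that)
qed

end

section \<open>Eigenfunctions\<close>

lemma L2_inner_cong_AE:
  assumes "f \<in> borel_measurable borel" "f' \<in> borel_measurable borel" "continuous_on UNIV g" "AE x in arc_length. f x = f' x"
  shows "L2_inner f g = L2_inner f' g"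
  unfolding L2_inner_def
proof (rule integral_cong_AE)
  have g: "(\<lambda>x. cnj (g x)) \<in> borel_measurable borel"
    by (rule borel_measurable_continuous_onI) (intro continuous_on_cnj assms(3))
  show "(\<lambda>x. f x * cnj (g x)) \<in> borel_measurable arc_length" "(\<lambda>x. f' x * cnj (g x)) \<in> borel_measurable arc_length"
    using borel_measurable_times[OF assms(1) g] borel_measurable_times[OF assms(2) g] by simp_all
  show "AE x in arc_length. f x * cnj (g x) = f' x * cnj (g x)" using assms(4) by eventually_elim simp
qed

theorem theorem12p1:
  fixes \<mu> :: "'a::metrized_graph set \<Rightarrow> real"
    and f :: "'a \<Rightarrow> complex"
    and lam :: real
  assumes "vector_borel_measure \<mu>"
    and "\<mu> UNIV = 1"
    and "total_variation \<mu> UNIV < \<infinity>"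
    and "f \<in> L2"
    and "\<not> (AE x in arc_length. f x = 0)"
    and "lam > 0"
  shows "((\<exists>h. (AE x in arc_length. h x = f x) \<and> Dir_eigenfunction \<mu> h lam) \<longleftrightarrow>
            phi_eigenfunction \<mu> f (1 / lam)) \<and>
         (phi_eigenfunction \<mu> f (1 / lam) \<longleftrightarrow>
            (\<exists>h. (AE x in arc_length. h x = f x) \<and> BDV_eigenfunction \<mu> h lam))"
proof -
  interpret P: phi_image \<mu> f lam
    by unfold_locales (use assms(1-3) L2_integrable[OF assms(4)] in auto)
  note J = P.charge_I\<mu>[unfolded P.I\<mu>_def] and J1 = P.I\<mu>_1[unfolded P.I\<mu>_def]
  have fm: "f \<in> borel_measurable borel" using assms(4) by (simp add: L2_def)
  have hm: "P.h \<in> borel_measurable borel" by (rule borel_measurable_continuous_onI[OF P.h_continuous])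
  obtain s where s: "Dir_approx \<mu> s P.h"
    "\<And>u g. Dir_approx \<mu> u g \<Longrightarrow> (\<lambda>n. Dir_inner (s n) (u n)) \<longlonglongrightarrow> of_real lam * L2_inner f g"
    by (rule P.h_approx) (rule that)
  \<comment> \<open>All three conditions amount to \<open>h = f\<close> almost everywhere.\<close>
  have phi: "phi_eigenfunction \<mu> f (1 / lam) \<longleftrightarrow> (AE x in arc_length. P.h x = f x)"
  proof -
    have "phi_mu \<mu> f x = of_real (1 / lam) * f x \<longleftrightarrow> P.h x = f x" for x
      using assms(6) by (simp add: P.h_def field_simps)
    then show ?thesis using assms(4,5) by (simp add: phi_eigenfunction_def)
  qed
  have ne: "h \<noteq> (\<lambda>x. 0)" if "AE x in arc_length. h x = f x" for h
    using assms(5) that by auto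
  have A1: "Dir_eigenfunction \<mu> P.h lam" if ae: "AE x in arc_length. P.h x = f x"
    unfolding Dir_eigenfunction_def
  proof (intro conjI ballI ne[OF ae])
    show "P.h \<in> Dir_mu \<mu>" using s(1) by (auto simp: Dir_mu_def)
    fix g assume "g \<in> Dir_mu \<mu>"
    then obtain u where u: "Dir_approx \<mu> u g" by (auto simp: Dir_mu_def)
    have "Dir_mu_inner \<mu> P.h g = of_real lam * L2_inner f g" by (rule Dir_mu_inner_eqI[OF J s(1) u s(2)[OF u]])
    also have "L2_inner f g = L2_inner P.h g"
      by (rule L2_inner_cong_AE[OF hm fm Dir_mu_continuous[OF u] ae, symmetric])
    finally show "Dir_mu_inner \<mu> P.h g = of_real lam * L2_inner P.h g" .
  qed
  \<comment> \<open>Both functions satisfy the same weak equation, so their difference is orthogonal to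
    itself.\<close>
  have A2: "P.h = h" if ae: "AE x in arc_length. h x = f x" and eig: "Dir_eigenfunction \<mu> h lam" for h
  proof
    fix x
    obtain t where t: "Dir_approx \<mu> t h" using eig by (auto simp: Dir_eigenfunction_def Dir_mu_def)
    have w: "Dir_approx \<mu> (\<lambda>n x. s n x - t n x) (\<lambda>x. P.h x - h x)" by (rule Dir_approx_diff[OF J s(1) t])
    let ?w = "\<lambda>n x. s n x - t n x" and ?W = "\<lambda>x. P.h x - h x"
    have "?W \<in> Dir_mu \<mu>" using w by (auto simp: Dir_mu_def)
    then have "Dir_mu_inner \<mu> h ?W = of_real lam * L2_inner h ?W" using eig by (simp add: Dir_eigenfunction_def)
    also have "L2_inner h ?W = L2_inner f ?W"
      by (rule L2_inner_cong_AE[OF borel_measurable_continuous_onI[OF Dir_mu_continuous[OF t]] fm Dir_mu_continuous[OF w] ae])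
    finally have "(\<lambda>n. Dir_inner (t n) (?w n)) \<longlonglongrightarrow> of_real lam * L2_inner f ?W"
      using Dir_mu_inner_lim[OF J t w] by simp
    from tendsto_diff[OF s(2)[OF w] this]
    have "(\<lambda>n. Dir_inner (s n) (?w n) - Dir_inner (t n) (?w n)) \<longlonglongrightarrow> 0" by simp
    moreover have "Dir_inner (?w n) (?w n) = Dir_inner (s n) (?w n) - Dir_inner (t n) (?w n)" for n
      by (rule Dir_inner_diff_left[OF Dir_approxD(1)[OF s(1)] Dir_approxD(1)[OF t] Dir_approxD(1)[OF w]])
    ultimately have "(\<lambda>n. Dir_inner (?w n) (?w n)) \<longlonglongrightarrow> 0" by simp
    from Dir_approx_energy_zero[OF J J1 w this, of x] show "P.h x = h x" by simp
  qed
  have C1: "BDV_eigenfunction \<mu> P.h lam" if ae: "AE x in arc_length. P.h x = f x"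
    unfolding BDV_eigenfunction_def
  proof (intro conjI ne[OF ae] P.h_BDV exI[of _ P.mass])
    show "signed_integral \<mu> P.h = 0" using P.I\<mu>_h by (simp add: P.I\<mu>_def)
    have "(LINT x:E|arc_length. P.h x) = (LINT x:E|arc_length. f x)" if "E \<in> sets borel" for E
      using ae that hm fm unfolding set_lebesgue_integral_def
      by (intro integral_cong_AE) (auto elim!: eventually_mono)
    then have eq: "of_real lam * ((LINT x:E|arc_length. P.h x) - P.mass * of_real (\<mu> E)) = P.I\<nu> (indicator E)"
      if "E \<in> sets borel" for E using P.I\<nu>_indicator[OF that] that by simp
    show "has_BDV_laplacian P.h (\<lambda>E. of_real lam * ((LINT x:E|arc_length. P.h x) - P.mass * of_real (\<mu> E)))"
      unfolding has_BDV_laplacian_def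
      using charge_vector_borel_measure[OF P.charge_I\<nu> eq] eq[OF conn_algebra_finite_frontier(2)] P.h_m_set by simp
  qed
  \<comment> \<open>The constant \<open>C\<close> is determined by the total mass, so both Laplacians agree and the
    difference of the two functions is harmonic, hence constant.\<close>
  have C2: "P.h = h" if ae: "AE x in arc_length. h x = f x" and eig: "BDV_eigenfunction \<mu> h lam" for h
  proof -
    have hD: "h \<in> D_fun" and h0: "signed_integral \<mu> h = 0" using eig by (auto simp: BDV_eigenfunction_def BDV_def)
    obtain C where C: "has_BDV_laplacian h (\<lambda>E. of_real lam * ((LINT x:E|arc_length. h x) - C * of_real (\<mu> E)))"
      using eig by (auto simp: BDV_eigenfunction_def)
    have hc: "continuous_on UNIV h" by (rule D_fun_continuous[OF hD])
    have hbm: "h \<in> borel_measurable borel" by (rule borel_measurable_continuous_onI[OF hc])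
    have int: "(LINT x:E|arc_length. h x) = (LINT x:E|arc_length. f x)" if "E \<in> sets borel" for E
      using ae that hbm fm unfolding set_lebesgue_integral_def
      by (intro integral_cong_AE) (auto elim!: eventually_mono)
    have m: "m_set h S = of_real lam * ((LINT x:S|arc_length. f x) - C * of_real (\<mu> S))" if "S \<in> conn_algebra" for S
    proof -
      have "m_set h S = of_real lam * ((LINT x:S|arc_length. h x) - C * of_real (\<mu> S))"
        using C that unfolding has_BDV_laplacian_def by metis
      then show ?thesis unfolding int[OF conn_algebra_finite_frontier(2)[OF that]] .
    qed
    have U: "(UNIV :: 'a set) \<in> conn_algebra" by (rule conn_algebra_open) (use graph_connected in auto)
    have "m_set h UNIV = 0" by (simp add: m_set_def)
    then have "(LINT x:UNIV|arc_length. f x) = C" using m[OF U] assms(2,6) by simp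
    then have "C = P.mass" by (simp add: P.mass_def P.Jf_def set_lebesgue_integral_def)
    then have mh: "m_set h S = m_set P.h S" if "S \<in> conn_algebra" for S
      using m[OF that] P.h_m_set[OF that] P.I\<nu>_indicator[OF conn_algebra_finite_frontier(2)[OF that]] by simp
    have wD: "(\<lambda>x. P.h x - h x) \<in> D_fun" by (rule D_fun_diff[OF P.h_D_fun hD])
    have w0: "m_set (\<lambda>x. P.h x - h x) S = 0" if "S \<in> conn_algebra" for S
      using m_set_diff[OF P.h_D_fun hD, of S] mh[OF that] by simp
    have const: "P.h x - h x = P.h y - h y" for x y by (rule harmonic_constant[OF wD w0])
    show ?thesis
    proof
      fix x
      have "(\<lambda>y. P.h y - h y) = (\<lambda>y. P.h x - h x)" using const by auto
      then have "signed_integral \<mu> (\<lambda>y. P.h y - h y) = P.h x - h x" using signed_integral_const[OF J J1] by simp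
      moreover have "signed_integral \<mu> (\<lambda>y. P.h y - h y) = 0"
        using charge_diff[OF J bounded_borel_continuous[OF P.h_continuous] bounded_borel_continuous[OF hc]] P.I\<mu>_h h0
        by (simp add: P.I\<mu>_def)
      ultimately show "P.h x = h x" by simp
    qed
  qed
  have A: "(\<exists>h. (AE x in arc_length. h x = f x) \<and> Dir_eigenfunction \<mu> h lam) \<longleftrightarrow> (AE x in arc_length. P.h x = f x)"
    using A1 A2 by metis
  have C: "(\<exists>h. (AE x in arc_length. h x = f x) \<and> BDV_eigenfunction \<mu> h lam) \<longleftrightarrow> (AE x in arc_length. P.h x = f x)"
    using C1 C2 by metis
  show ?thesis unfolding phi A C by simp
qed

end
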